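(* Let $k$ be a field complete with respect to a nontrivial discrete absolute value, with residue field $\tilde k_1$ of characteristic $p>0$, and let $k\subseteq\ell$ be a finite wildly ramified extension which is totally ramified, with $p^n=[\tilde\ell_\bullet:\tilde k_\bullet]=[\ell:k]$. Let $r\in\sqrt{|k^\times|}$ and let $A$ be a form of $k\{r^{-1}T\}$ with respect to $\ell/k$ which has geometrically reduced graded reduction. Put $\tilde B:=\tilde A_\bullet\otimes_{\tilde k_\bullet}\tilde\ell_\bullet$, with a fixed identification $\tilde B=\tilde\ell_1[t^{\pm1},T]$ as in the context. Suppose $\deg_T(\partial_L(T))=1$. Then $\mathcal L_{\tilde B}/\mathcal L'_{\tilde B}$ is a finite cyclic group of exponent $p^n$ generated by the class of $\frac{\partial_L(T)}{T}$.
   Context: A group is said here to have exponent $N$ if every element is annihilated by $N$. $\sqrt{|k^\times|}=\{\alpha>0:\alpha^j\in|k^\times|\text{ for some }j\ge1\}$. $k\{r^{-1}T\}$ is the algebra of power series $\sum a_jT^j$ over $k$ with $|a_j|r^j\to0$. A form of it with respect to $\ell/k$ is a $k$-affinoid algebra $A$ with $\ell\otimes_kA\cong\ell\{r^{-1}T\}$ as $\ell$-algebras. For a ring $A$ with nonarchimedean seminorm (for affinoid algebras: the spectral seminorm), the graded reduction is $\tilde A_\bullet=\bigoplus_{\gamma>0}A_{\le\gamma}/A_{<\gamma}$, where $A_{\le\gamma}=\{|a|\le\gamma\}$, $A_{<\gamma}=\{|a|<\gamma\}$; its degree $1$ part is denoted $\tilde A_1$. The extension $\ell/k$ is wildly ramified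 if $\tilde k_1\subseteq\tilde\ell_1$ is purely inseparable and $(|\ell^\times|:|k^\times|)$ is a power of $p$; totally ramified means $\tilde\ell_1=\tilde k_1$. $A$ has geometrically reduced graded reduction if $\tilde k_\bullet^{\mathrm{alg}}\otimes_{\tilde k_\bullet}\tilde A_\bullet$ is reduced, where $\tilde k_\bullet^{\mathrm{alg}}$ is a graded algebraic closure of the graded field $\tilde k_\bullet$. Gradings are forgotten from here on. Choosing a uniformizer $\varpi$ of $\ell$ and sending its principal symbol (its class in $\ell_{\le|\varpi|}/\ell_{<|\varpi|}$) to $t$ identifies $\tilde\ell_\bullet=\tilde\ell_1[t^{\pm1}]$ and $\tilde k_\bullet=\tilde k_1[t^{\pm p^n}]$. Under the hypotheses there is an isomorphism of $\tilde\ell_\bullet$-algebras $\tilde A_\bullet\otimes_{\tilde k_\bullet}\tilde\ell_\bullet\cong\tilde\ell_\bullet[T]=\tilde\ell_1[t^{\pm1},T]$, which is fixed and used as an identification. Let $m=p^n-1$ and, for a ring $R$, $R[S]_m=R[S]/(S^{m+1})$. Let $K=\mathrm{Frac}(\tilde\ell_\bullet)$, $K'=\mathrm{Frac}(\tilde k_\bullet)$, and let $\partial:K\to K[S]_m$ be the $K'$-algebra homomorphism with $t\mapsto t+S$ (the standard higher derivation of exponent $n$). Let $L'=\mathrm{Frac}(\tilde A_\bullet)$, $L=\mathrm{Frac}(\tilde B)=L'\otimes_{K'}K$, and $\partial_L=\mathrm{id}_{L'}\otimes_{K'}\partial:L\to L[S]_m$; it maps $\tilde B$ into $\tilde B[S]_m$.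 $\deg_T$ denotes the degree in the variable $T$ of an element of $\tilde B$ or of $\tilde B[S]_m=\tilde\ell_\bullet[S]_m[T]$. Define subgroups of $(L[S]_m)^\times$: $$\mathcal L=\Big\{\tfrac{\partial_L(z)}{z}: z\in L^\times\Big\},\quad \mathcal L_{\tilde B}=\mathcal L\cap(\tilde B[S]_m)^\times,\quad \mathcal L'_{\tilde B}=\Big\{\tfrac{\partial_L(u)}{u}:u\in\tilde B^\times\Big\}\subseteq\mathcal L_{\tilde B}.$$
   Formalization: For some identifications with deg_T(∂_L(T))=1, ∂_L(T)/T is not in L_B (e.g. T=τ+t, τ invariant), so its class is undefined; the generator claim is stated when ∂_L(T)/T lies in L_B, and unconditionally for T−c with some c in the graded reduction of ℓ. *)

theory Defs
  imports Complex_Main "HOL-Library.Poly_Mapping" "HOL-Algebra.UnivPoly" "HOL-Algebra.QuotRing"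
    "HOL-Algebra.IntRing" "HOL-Algebra.Elementary_Groups" "HOL-Algebra.Embedded_Algebras"
begin

definition single :: "('a, 'm) ring_scheme \<Rightarrow> 'i \<Rightarrow> 'a \<Rightarrow> 'i \<Rightarrow> 'a" where
  "single R i a = (\<lambda>j. if j = i then a else \<zero>\<^bsub>R\<^esub>)"

definition conv :: "('a, 'm) ring_scheme \<Rightarrow> ('i \<Rightarrow> 'i \<Rightarrow> 'i) \<Rightarrow> ('i \<Rightarrow> 'a) \<Rightarrow> ('i \<Rightarrow> 'a) \<Rightarrow> 'i \<Rightarrow> 'a" where
  "conv R op f g = (\<lambda>x. finsum R (\<lambda>(i, j). f i \<otimes>\<^bsub>R\<^esub> g j)
     {(i, j). f i \<noteq> \<zero>\<^bsub>R\<^esub> \<and> g j \<noteq> \<zero>\<^bsub>R\<^esub> \<and> op i j = x})"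

text \<open>The elements of \<open>C\<close> are read as (possibly infinite) formal sums of elements of a monoid with
  operation \<open>op\<close> and unit \<open>e\<close>. In every use below the sums in \<^const>\<open>conv\<close> are finite.\<close>

definition conv_ring :: "('a, 'm) ring_scheme \<Rightarrow> ('i \<Rightarrow> 'i \<Rightarrow> 'i) \<Rightarrow> 'i \<Rightarrow> ('i \<Rightarrow> 'a) set \<Rightarrow> ('i \<Rightarrow> 'a) ring" where
  "conv_ring R op e C =
     \<lparr>carrier = C, mult = conv R op, one = single R e \<one>\<^bsub>R\<^esub>,
      zero = (\<lambda>_. \<zero>\<^bsub>R\<^esub>), add = (\<lambda>f g x. f x \<oplus>\<^bsub>R\<^esub> g x)\<rparr>"

text \<open>For commutative rings \<open>S\<close>, \<open>T\<close> that are algebras over \<open>C\<close> through \<open>i\<close> and \<open>j\<close>, the tensor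
  product is the free abelian group on \<open>S \<times> T\<close>, made a ring by
  \<open>(x, y) (x', y') = (x x', y y')\<close>, modulo the bilinearity relations. The subgroup
  generated by the relations is already an ideal.\<close>

definition free_pairs :: "('s, 'm) ring_scheme \<Rightarrow> ('t, 'n) ring_scheme \<Rightarrow> ('s \<times> 't \<Rightarrow> int) ring" where
  "free_pairs S T =
     conv_ring \<Z> (\<lambda>z w. (fst z \<otimes>\<^bsub>S\<^esub> fst w, snd z \<otimes>\<^bsub>T\<^esub> snd w)) (\<one>\<^bsub>S\<^esub>, \<one>\<^bsub>T\<^esub>)
       {f. finite {z. f z \<noteq> 0} \<and> {z. f z \<noteq> 0} \<subseteq> carrier S \<times> carrier T}"

definition pair_gen :: "'s \<Rightarrow> 't \<Rightarrow> 's \<times> 't \<Rightarrow> int" where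
  "pair_gen x y = single \<Z> (x, y) 1"

definition tensor_rels ::
  "('c, 'k) ring_scheme \<Rightarrow> ('s, 'm) ring_scheme \<Rightarrow> ('t, 'n) ring_scheme \<Rightarrow> ('c \<Rightarrow> 's) \<Rightarrow> ('c \<Rightarrow> 't)
    \<Rightarrow> ('s \<times> 't \<Rightarrow> int) set" where
  "tensor_rels C S T i j = (let P = free_pairs S T in
     {pair_gen (x \<oplus>\<^bsub>S\<^esub> x') y \<ominus>\<^bsub>P\<^esub> (pair_gen x y \<oplus>\<^bsub>P\<^esub> pair_gen x' y) | x x' y.
        x \<in> carrier S \<and> x' \<in> carrier S \<and> y \<in> carrier T}
   \<union> {pair_gen x (y \<oplus>\<^bsub>T\<^esub> y') \<ominus>\<^bsub>P\<^esub> (pair_gen x y \<oplus>\<^bsub>P\<^esub> pair_gen x y') | x y y'.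
        x \<in> carrier S \<and> y \<in> carrier T \<and> y' \<in> carrier T}
   \<union> {pair_gen (x \<otimes>\<^bsub>S\<^esub> i c) y \<ominus>\<^bsub>P\<^esub> pair_gen x (j c \<otimes>\<^bsub>T\<^esub> y) | x c y.
        x \<in> carrier S \<and> c \<in> carrier C \<and> y \<in> carrier T})"

definition tensor ::
  "('c, 'k) ring_scheme \<Rightarrow> ('s, 'm) ring_scheme \<Rightarrow> ('t, 'n) ring_scheme \<Rightarrow> ('c \<Rightarrow> 's) \<Rightarrow> ('c \<Rightarrow> 't)
    \<Rightarrow> ('s \<times> 't \<Rightarrow> int) set ring" where
  "tensor C S T i j = free_pairs S T Quot (Idl\<^bsub>free_pairs S T\<^esub> (tensor_rels C S T i j))"

definition tens ::
  "('c, 'k) ring_scheme \<Rightarrow> ('s, 'm) ring_scheme \<Rightarrow> ('t, 'n) ring_scheme \<Rightarrow> ('c \<Rightarrow> 's) \<Rightarrow> ('c \<Rightarrow> 't)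
    \<Rightarrow> 's \<Rightarrow> 't \<Rightarrow> ('s \<times> 't \<Rightarrow> int) set" where
  "tens C S T i j x y =
     (Idl\<^bsub>free_pairs S T\<^esub> (tensor_rels C S T i j)) +>\<^bsub>free_pairs S T\<^esub> pair_gen x y"

definition reduced_ring :: "('a, 'm) ring_scheme \<Rightarrow> bool" where
  "reduced_ring R \<longleftrightarrow> (\<forall>x\<in>carrier R. \<forall>j::nat. x [^]\<^bsub>R\<^esub> j = \<zero>\<^bsub>R\<^esub> \<longrightarrow> x = \<zero>\<^bsub>R\<^esub>)"

definition nonarch_abs :: "('a, 'm) ring_scheme \<Rightarrow> ('a \<Rightarrow> real) \<Rightarrow> bool" where
  "nonarch_abs R v \<longleftrightarrow>
     (\<forall>x\<in>carrier R. 0 \<le> v x \<and> (v x = 0 \<longleftrightarrow> x = \<zero>\<^bsub>R\<^esub>)) \<and>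
     (\<forall>x\<in>carrier R. \<forall>y\<in>carrier R. v (x \<otimes>\<^bsub>R\<^esub> y) = v x * v y \<and> v (x \<oplus>\<^bsub>R\<^esub> y) \<le> max (v x) (v y))"

definition nonarch_norm :: "('a, 'm) ring_scheme \<Rightarrow> ('a \<Rightarrow> real) \<Rightarrow> bool" where
  "nonarch_norm R N \<longleftrightarrow>
     (\<forall>x\<in>carrier R. 0 \<le> N x \<and> (N x = 0 \<longleftrightarrow> x = \<zero>\<^bsub>R\<^esub>)) \<and> N \<one>\<^bsub>R\<^esub> \<le> 1 \<and>
     (\<forall>x\<in>carrier R. \<forall>y\<in>carrier R. N (x \<otimes>\<^bsub>R\<^esub> y) \<le> N x * N y \<and> N (x \<ominus>\<^bsub>R\<^esub> y) \<le> max (N x) (N y))"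

definition norm_complete :: "('a, 'm) ring_scheme \<Rightarrow> ('a \<Rightarrow> real) \<Rightarrow> bool" where
  "norm_complete R N \<longleftrightarrow>
     (\<forall>s::nat \<Rightarrow> 'a. (\<forall>i. s i \<in> carrier R) \<and>
        (\<forall>\<epsilon>>0. \<exists>M. \<forall>i\<ge>M. \<forall>j\<ge>M. N (s i \<ominus>\<^bsub>R\<^esub> s j) < \<epsilon>) \<longrightarrow>
        (\<exists>a\<in>carrier R. (\<lambda>i. N (s i \<ominus>\<^bsub>R\<^esub> a)) \<longlonglongrightarrow> 0))"

definition value_set :: "('a, 'm) ring_scheme \<Rightarrow> ('a \<Rightarrow> real) \<Rightarrow> real set" where
  "value_set R v = v ` (carrier R - {\<zero>\<^bsub>R\<^esub>})"

definition nontrivial_discrete :: "('a, 'm) ring_scheme \<Rightarrow> ('a \<Rightarrow> real) \<Rightarrow> bool" where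
  "nontrivial_discrete R v \<longleftrightarrow> (\<exists>\<gamma>\<in>value_set R v. 0 < \<gamma> \<and> \<gamma> < 1 \<and> value_set R v = range (\<lambda>i::int. \<gamma> powi i))"

text \<open>For a subgroup \<open>H\<close> of a group \<open>G\<close> of positive reals. The value is \<open>0\<close> if the index is
  infinite.\<close>

definition value_index :: "real set \<Rightarrow> real set \<Rightarrow> nat" where
  "value_index G H = card (rcosets\<^bsub>\<lparr>carrier = G, mult = (*), one = 1\<rparr>\<^esub> H)"

definition sqrt_value_group :: "('a, 'm) ring_scheme \<Rightarrow> ('a \<Rightarrow> real) \<Rightarrow> real set" where
  "sqrt_value_group R v = {\<alpha>. \<alpha> > 0 \<and> (\<exists>j\<ge>1. \<alpha> ^ j \<in> value_set R v)}"

definition uniformizer :: "('a, 'm) ring_scheme \<Rightarrow> ('a \<Rightarrow> real) \<Rightarrow> 'a \<Rightarrow> bool" where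
  "uniformizer R v w \<longleftrightarrow>
     w \<in> carrier R \<and> 0 < v w \<and> v w < 1 \<and> (\<forall>x\<in>carrier R. v x < 1 \<longrightarrow> v x \<le> v w)"

text \<open>A subfield is passed around as a ring of its own, sharing the operations of the big field.\<close>

definition field_extension :: "'a ring \<Rightarrow> 'a ring \<Rightarrow> bool" where
  "field_extension k l \<longleftrightarrow> field l \<and> subfield (carrier k) l \<and> k = l\<lparr>carrier := carrier k\<rparr>"

definition radius_power :: "nat \<Rightarrow> (nat \<Rightarrow> real) \<Rightarrow> (nat \<Rightarrow>\<^sub>0 nat) \<Rightarrow> real" where
  "radius_power d \<rho> \<nu> = (\<Prod>i<d. \<rho> i ^ Poly_Mapping.lookup \<nu> i)"

text \<open>The algebra of power series in the variables \<open>T\<^sub>0, \<dots>, T\<^sub>d\<^sub>-\<^sub>1\<close> over \<open>R\<close> whose coefficients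
  \<open>f \<nu>\<close> satisfy \<open>|f \<nu>| \<rho>\<^sup>\<nu> \<longlonglongrightarrow> 0\<close>. The case of one variable of radius \<open>r\<close> is
  \<open>d = 1\<close>, \<open>\<rho> = (\<lambda>_. r)\<close>.\<close>

definition tate :: "('a, 'm) ring_scheme \<Rightarrow> ('a \<Rightarrow> real) \<Rightarrow> nat \<Rightarrow> (nat \<Rightarrow> real)
    \<Rightarrow> ((nat \<Rightarrow>\<^sub>0 nat) \<Rightarrow> 'a) ring" where
  "tate R v d \<rho> = conv_ring R (+) 0
     {f. (\<forall>\<nu>. f \<nu> \<in> carrier R) \<and>
         (\<forall>\<nu>. f \<nu> \<noteq> \<zero>\<^bsub>R\<^esub> \<longrightarrow> Poly_Mapping.keys \<nu> \<subseteq> {..<d}) \<and>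
         (\<forall>\<epsilon>>0. finite {\<nu>. f \<nu> \<noteq> \<zero>\<^bsub>R\<^esub> \<and> v (f \<nu>) * radius_power d \<rho> \<nu> \<ge> \<epsilon>})}"

definition tate_const :: "('a, 'm) ring_scheme \<Rightarrow> 'a \<Rightarrow> (nat \<Rightarrow>\<^sub>0 nat) \<Rightarrow> 'a" where
  "tate_const R c = single R 0 c"

definition gauss_norm :: "('a \<Rightarrow> real) \<Rightarrow> nat \<Rightarrow> (nat \<Rightarrow> real) \<Rightarrow> ((nat \<Rightarrow>\<^sub>0 nat) \<Rightarrow> 'a) \<Rightarrow> real" where
  "gauss_norm v d \<rho> f = (SUP \<nu>. v (f \<nu>) * radius_power d \<rho> \<nu>)"

text \<open>Affinoid algebras in the sense of Berkovich: \<open>A\<close> with structure map \<open>\<alpha>\<close> and norm \<open>N\<close> is a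
  Banach algebra which is an admissible quotient of some \<^const>\<open>tate\<close> algebra, i.e. \<open>N\<close> is
  equivalent to the residue norm.\<close>

definition affinoid_algebra ::
  "'a ring \<Rightarrow> ('a \<Rightarrow> real) \<Rightarrow> 'b ring \<Rightarrow> ('a \<Rightarrow> 'b) \<Rightarrow> ('b \<Rightarrow> real) \<Rightarrow> bool" where
  "affinoid_algebra k v A \<alpha> N \<longleftrightarrow>
     cring A \<and> \<alpha> \<in> ring_hom k A \<and> nonarch_norm A N \<and> norm_complete A N \<and>
     (\<exists>d \<rho> \<phi>. (\<forall>i<d. \<rho> i > 0) \<and>
        \<phi> \<in> ring_hom (tate k v d \<rho>) A \<and> \<phi> ` carrier (tate k v d \<rho>) = carrier A \<and>
        (\<forall>c\<in>carrier k. \<phi> (tate_const k c) = \<alpha> c) \<and>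
        (\<exists>C>0. \<forall>a\<in>carrier A.
           (let q = Inf {gauss_norm v d \<rho> f | f. f \<in> carrier (tate k v d \<rho>) \<and> \<phi> f = a}
            in N a \<le> C * q \<and> q \<le> C * N a)))"

definition spectral_seminorm :: "('b, 'm) ring_scheme \<Rightarrow> ('b \<Rightarrow> real) \<Rightarrow> 'b \<Rightarrow> real" where
  "spectral_seminorm A N a = lim (\<lambda>j. root (Suc j) (N (a [^]\<^bsub>A\<^esub> Suc j)))"

definition is_form ::
  "'a ring \<Rightarrow> 'a ring \<Rightarrow> ('a \<Rightarrow> real) \<Rightarrow> real \<Rightarrow> 'b ring \<Rightarrow> ('a \<Rightarrow> 'b) \<Rightarrow> ('b \<Rightarrow> real) \<Rightarrow> bool" where
  "is_form k l v r A \<alpha> N \<longleftrightarrow>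
     affinoid_algebra k v A \<alpha> N \<and>
     (\<exists>\<Psi>\<in>ring_iso (tensor k l A (\<lambda>c. c) \<alpha>) (tate l v 1 (\<lambda>_. r)).
        \<forall>x\<in>carrier l. \<Psi> (tens k l A (\<lambda>c. c) \<alpha> x \<one>\<^bsub>A\<^esub>) = tate_const l x)"

text \<open>\<open>\<Oplus>\<^sub>\<gamma> R\<^sub>\<le>\<^sub>\<gamma> / R\<^sub><\<^sub>\<gamma>\<close> is formed as the quotient of \<open>\<Oplus>\<^sub>\<gamma> R\<^sub>\<le>\<^sub>\<gamma>\<close>, a subring of the monoid ring
  of the positive reals, by the ideal \<open>\<Oplus>\<^sub>\<gamma> R\<^sub><\<^sub>\<gamma>\<close>.\<close>

definition filt_ring :: "('a, 'm) ring_scheme \<Rightarrow> ('a \<Rightarrow> real) \<Rightarrow> (real \<Rightarrow> 'a) ring" where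
  "filt_ring R v = conv_ring R (*) 1
     {f. (\<forall>\<gamma>. f \<gamma> \<in> carrier R) \<and> finite {\<gamma>. f \<gamma> \<noteq> \<zero>\<^bsub>R\<^esub>} \<and>
         (\<forall>\<gamma>. f \<gamma> \<noteq> \<zero>\<^bsub>R\<^esub> \<longrightarrow> 0 < \<gamma> \<and> v (f \<gamma>) \<le> \<gamma>)}"

definition filt_ideal :: "('a, 'm) ring_scheme \<Rightarrow> ('a \<Rightarrow> real) \<Rightarrow> (real \<Rightarrow> 'a) set" where
  "filt_ideal R v =
     {f \<in> carrier (filt_ring R v). \<forall>\<gamma>. f \<gamma> \<noteq> \<zero>\<^bsub>R\<^esub> \<longrightarrow> v (f \<gamma>) < \<gamma>}"

definition graded_reduction :: "('a, 'm) ring_scheme \<Rightarrow> ('a \<Rightarrow> real) \<Rightarrow> (real \<Rightarrow> 'a) set ring" where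
  "graded_reduction R v = filt_ring R v Quot filt_ideal R v"

text \<open>The class in \<open>R\<^sub>\<le>\<^sub>\<gamma> / R\<^sub><\<^sub>\<gamma>\<close> of an element \<open>a\<close> with \<open>|a| \<le> \<gamma>\<close>.\<close>

definition symb :: "('a, 'm) ring_scheme \<Rightarrow> ('a \<Rightarrow> real) \<Rightarrow> real \<Rightarrow> 'a \<Rightarrow> (real \<Rightarrow> 'a) set" where
  "symb R v \<gamma> a = filt_ideal R v +>\<^bsub>filt_ring R v\<^esub> single R \<gamma> a"

definition gr_part :: "('a, 'm) ring_scheme \<Rightarrow> ('a \<Rightarrow> real) \<Rightarrow> real \<Rightarrow> (real \<Rightarrow> 'a) set set" where
  "gr_part R v \<gamma> = {symb R v \<gamma> a | a. a \<in> carrier R \<and> v a \<le> \<gamma>}"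

text \<open>The map induced by a ring homomorphism \<open>h\<close> from \<open>R\<close> to \<open>S\<close> that does not increase the
  seminorm; all members of the union coincide.\<close>

definition gr_map :: "('b, 'n) ring_scheme \<Rightarrow> ('b \<Rightarrow> real) \<Rightarrow> ('a \<Rightarrow> 'b)
    \<Rightarrow> (real \<Rightarrow> 'a) set \<Rightarrow> (real \<Rightarrow> 'b) set" where
  "gr_map S w h X = (\<Union>f\<in>X. filt_ideal S w +>\<^bsub>filt_ring S w\<^esub> (\<lambda>\<gamma>. h (f \<gamma>)))"

definition residue_char :: "('a, 'm) ring_scheme \<Rightarrow> ('a \<Rightarrow> real) \<Rightarrow> nat \<Rightarrow> bool" where
  "residue_char R v p \<longleftrightarrow> prime p \<and>
     (let \<kappa> = (graded_reduction R v)\<lparr>carrier := gr_part R v 1\<rparr> in [p] \<cdot>\<^bsub>\<kappa>\<^esub> \<one>\<^bsub>\<kappa>\<^esub> = \<zero>\<^bsub>\<kappa>\<^esub>)"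

definition wildly_ramified :: "'a ring \<Rightarrow> 'a ring \<Rightarrow> ('a \<Rightarrow> real) \<Rightarrow> nat \<Rightarrow> bool" where
  "wildly_ramified k l v p \<longleftrightarrow>
     (\<forall>x\<in>gr_part l v 1. \<exists>j::nat.
        x [^]\<^bsub>graded_reduction l v\<^esub> (p ^ j) \<in> gr_map l v (\<lambda>c. c) ` gr_part k v 1) \<and>
     (\<exists>j. value_index (value_set l v) (value_set k v) = p ^ j)"

definition totally_ramified :: "'a ring \<Rightarrow> 'a ring \<Rightarrow> ('a \<Rightarrow> real) \<Rightarrow> bool" where
  "totally_ramified k l v \<longleftrightarrow> gr_map l v (\<lambda>c. c) ` gr_part k v 1 = gr_part l v 1"

text \<open>\<open>D\<close> is the degree of the graded field \<open>S\<close> (with homogeneous parts \<open>g\<close>) over the graded field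
  \<open>R\<close>, embedded by \<open>i\<close>: the size of a basis of homogeneous elements.\<close>

definition graded_degree :: "('a, 'm) ring_scheme \<Rightarrow> ('b, 'n) ring_scheme \<Rightarrow> (real \<Rightarrow> 'b set)
    \<Rightarrow> ('a \<Rightarrow> 'b) \<Rightarrow> nat \<Rightarrow> bool" where
  "graded_degree R S g i D \<longleftrightarrow>
     (\<exists>X. finite X \<and> card X = D \<and> X \<subseteq> (\<Union>\<gamma>\<in>{0<..}. g \<gamma>) \<and>
        (\<forall>y\<in>carrier S. \<exists>!c. c \<in> X \<rightarrow>\<^sub>E carrier R \<and> y = (\<Oplus>\<^bsub>S\<^esub>x\<in>X. i (c x) \<otimes>\<^bsub>S\<^esub> x)))"

text \<open>Gradings are indexed by the multiplicative group of positive reals; \<open>g \<gamma>\<close> is the part of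
  degree \<open>\<gamma>\<close>, and is irrelevant for \<open>\<gamma> \<le> 0\<close>.\<close>

definition graded_ring :: "('a, 'm) ring_scheme \<Rightarrow> (real \<Rightarrow> 'a set) \<Rightarrow> bool" where
  "graded_ring R g \<longleftrightarrow> cring R \<and>
     (\<forall>\<gamma>>0. additive_subgroup (g \<gamma>) R) \<and> \<one>\<^bsub>R\<^esub> \<in> g 1 \<and>
     (\<forall>\<gamma>>0. \<forall>\<delta>>0. \<forall>x\<in>g \<gamma>. \<forall>y\<in>g \<delta>. x \<otimes>\<^bsub>R\<^esub> y \<in> g (\<gamma> * \<delta>)) \<and>
     (\<forall>x\<in>carrier R. \<exists>!c. (\<forall>\<gamma>>0. c \<gamma> \<in> g \<gamma>) \<and> (\<forall>\<gamma>\<le>0. c \<gamma> = \<zero>\<^bsub>R\<^esub>) \<and>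
        finite {\<gamma>. c \<gamma> \<noteq> \<zero>\<^bsub>R\<^esub>} \<and> x = (\<Oplus>\<^bsub>R\<^esub>\<gamma>\<in>{\<gamma>. c \<gamma> \<noteq> \<zero>\<^bsub>R\<^esub>}. c \<gamma>))"

definition graded_field :: "('a, 'm) ring_scheme \<Rightarrow> (real \<Rightarrow> 'a set) \<Rightarrow> bool" where
  "graded_field R g \<longleftrightarrow> graded_ring R g \<and> \<one>\<^bsub>R\<^esub> \<noteq> \<zero>\<^bsub>R\<^esub> \<and>
     (\<forall>\<gamma>>0. \<forall>x\<in>g \<gamma>. x \<noteq> \<zero>\<^bsub>R\<^esub> \<longrightarrow> x \<in> Units R)"

text \<open>In \<open>R[\<gamma>\<^sup>-\<^sup>1X]\<close> the variable \<open>X\<close> has degree \<open>\<gamma>\<close>, so that \<open>\<Sum> c\<^sub>j X\<^sup>j\<close> is homogeneous of degree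
  \<open>\<delta>\<close> iff \<open>c\<^sub>j\<close> has degree \<open>\<delta> \<gamma>\<^sup>-\<^sup>j\<close>. The coefficients are \<open>c\<^sub>0, \<dots>, c\<^sub>D\<close>.\<close>

definition homogeneous_poly :: "(real \<Rightarrow> 'a set) \<Rightarrow> real \<Rightarrow> real \<Rightarrow> nat \<Rightarrow> (nat \<Rightarrow> 'a) \<Rightarrow> bool" where
  "homogeneous_poly g \<gamma> \<delta> D c \<longleftrightarrow> (\<forall>j\<le>D. c j \<in> g (\<delta> / \<gamma> ^ j))"

definition graded_algebraic_closure ::
  "('a, 'm) ring_scheme \<Rightarrow> (real \<Rightarrow> 'a set) \<Rightarrow> ('f, 'n) ring_scheme \<Rightarrow> (real \<Rightarrow> 'f set) \<Rightarrow> ('a \<Rightarrow> 'f) \<Rightarrow> bool" where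
  "graded_algebraic_closure R g F h i \<longleftrightarrow>
     graded_field R g \<and> graded_field F h \<and>
     i \<in> ring_hom R F \<and> (\<forall>\<gamma>>0. i ` g \<gamma> \<subseteq> h \<gamma>) \<and>
     (\<forall>\<gamma>>0. \<forall>x\<in>h \<gamma>. \<exists>\<delta>>0. \<exists>D c. homogeneous_poly g \<gamma> \<delta> D c \<and> (\<exists>j\<le>D. c j \<noteq> \<zero>\<^bsub>R\<^esub>) \<and>
        (\<Oplus>\<^bsub>F\<^esub>j\<in>{..D}. i (c j) \<otimes>\<^bsub>F\<^esub> x [^]\<^bsub>F\<^esub> j) = \<zero>\<^bsub>F\<^esub>) \<and>
     (\<forall>\<gamma>>0. \<forall>\<delta>>0. \<forall>D\<ge>1. \<forall>c. homogeneous_poly h \<gamma> \<delta> D c \<and> c D \<noteq> \<zero>\<^bsub>F\<^esub> \<longrightarrow>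
        (\<exists>x\<in>h \<gamma>. (\<Oplus>\<^bsub>F\<^esub>j\<in>{..D}. c j \<otimes>\<^bsub>F\<^esub> x [^]\<^bsub>F\<^esub> j) = \<zero>\<^bsub>F\<^esub>))"

definition frac :: "('a, 'm) ring_scheme \<Rightarrow> 'a \<Rightarrow> 'a \<Rightarrow> ('a \<times> 'a) set" where
  "frac R a b = {(c, d). c \<in> carrier R \<and> d \<in> carrier R - {\<zero>\<^bsub>R\<^esub>} \<and> a \<otimes>\<^bsub>R\<^esub> d = c \<otimes>\<^bsub>R\<^esub> b}"

definition Frac :: "('a, 'm) ring_scheme \<Rightarrow> ('a \<times> 'a) set ring" where
  "Frac R =
     \<lparr>carrier = {frac R a b | a b. a \<in> carrier R \<and> b \<in> carrier R - {\<zero>\<^bsub>R\<^esub>}},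
      mult = (\<lambda>X Y. \<Union>(a, b)\<in>X. \<Union>(c, d)\<in>Y. frac R (a \<otimes>\<^bsub>R\<^esub> c) (b \<otimes>\<^bsub>R\<^esub> d)),
      one = frac R \<one>\<^bsub>R\<^esub> \<one>\<^bsub>R\<^esub>,
      zero = frac R \<zero>\<^bsub>R\<^esub> \<one>\<^bsub>R\<^esub>,
      add = (\<lambda>X Y. \<Union>(a, b)\<in>X. \<Union>(c, d)\<in>Y.
               frac R (a \<otimes>\<^bsub>R\<^esub> d \<oplus>\<^bsub>R\<^esub> c \<otimes>\<^bsub>R\<^esub> b) (b \<otimes>\<^bsub>R\<^esub> d))\<rparr>"

definition to_Frac :: "('a, 'm) ring_scheme \<Rightarrow> 'a \<Rightarrow> ('a \<times> 'a) set" where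
  "to_Frac R a = frac R a \<one>\<^bsub>R\<^esub>"

text \<open>The map of fraction fields induced by an injective ring homomorphism \<open>h\<close> into \<open>S\<close>.\<close>

definition Frac_map :: "('b, 'n) ring_scheme \<Rightarrow> ('a \<Rightarrow> 'b) \<Rightarrow> ('a \<times> 'a) set \<Rightarrow> ('b \<times> 'b) set" where
  "Frac_map S h X = (\<Union>(a, b)\<in>X. frac S (h a) (h b))"

definition trunc_class :: "('a, 'm) ring_scheme \<Rightarrow> nat \<Rightarrow> (nat \<Rightarrow> 'a) \<Rightarrow> (nat \<Rightarrow> 'a) set" where
  "trunc_class R m f = (PIdl\<^bsub>UP R\<^esub> (monom (UP R) \<one>\<^bsub>R\<^esub> (Suc m))) +>\<^bsub>UP R\<^esub> f"

definition trunc_poly :: "('a, 'm) ring_scheme \<Rightarrow> nat \<Rightarrow> (nat \<Rightarrow> 'a) set ring" where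
  "trunc_poly R m = UP R Quot (PIdl\<^bsub>UP R\<^esub> (monom (UP R) \<one>\<^bsub>R\<^esub> (Suc m)))"

definition trunc_const :: "('a, 'm) ring_scheme \<Rightarrow> nat \<Rightarrow> 'a \<Rightarrow> (nat \<Rightarrow> 'a) set" where
  "trunc_const R m a = trunc_class R m (monom (UP R) a 0)"

definition trunc_var :: "('a, 'm) ring_scheme \<Rightarrow> nat \<Rightarrow> (nat \<Rightarrow> 'a) set" where
  "trunc_var R m = trunc_class R m (monom (UP R) \<one>\<^bsub>R\<^esub> 1)"

text \<open>The map induced on coefficients by a ring homomorphism \<open>h\<close> into \<open>R'\<close>.\<close>

definition trunc_map :: "('b, 'n) ring_scheme \<Rightarrow> nat \<Rightarrow> ('a \<Rightarrow> 'b)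
    \<Rightarrow> (nat \<Rightarrow> 'a) set \<Rightarrow> (nat \<Rightarrow> 'b) set" where
  "trunc_map R' m h X = (\<Union>f\<in>X. trunc_class R' m (\<lambda>j. h (f j)))"

text \<open>The degree in \<open>T\<close> of an element of \<open>R[T][S]/(S\<^sup>m\<^sup>+\<^sup>1)\<close>, where \<open>R[T]\<close> is \<open>UP R\<close>: the largest
  \<open>T\<close>-degree of the coefficients of \<open>1, S, \<dots>, S\<^sup>m\<close>, which do not depend on the
  representative.\<close>

definition deg_T :: "('a, 'm) ring_scheme \<Rightarrow> nat \<Rightarrow> (nat \<Rightarrow> nat \<Rightarrow> 'a) set \<Rightarrow> nat" where
  "deg_T R m X = the_elem ((\<lambda>f. Max ((\<lambda>j. deg R (f j)) ` {..m})) ` X)"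

definition log_deriv :: "('a, 'm) ring_scheme \<Rightarrow> nat \<Rightarrow> ('a \<Rightarrow> (nat \<Rightarrow> 'a) set) \<Rightarrow> 'a \<Rightarrow> (nat \<Rightarrow> 'a) set" where
  "log_deriv L m D z = D z \<otimes>\<^bsub>trunc_poly L m\<^esub> inv\<^bsub>trunc_poly L m\<^esub> (trunc_const L m z)"

definition generated_by :: "('g, 'm) monoid_scheme \<Rightarrow> 'g \<Rightarrow> bool" where
  "generated_by G x \<longleftrightarrow> x \<in> carrier G \<and> subgroup_generated G {x} = G"

end

theory Submission
  imports Defs
begin

text \<open>The quotient is trivial: \<open>\<L>\<^sub>B\<close> equals the group of the logarithmic derivatives of units of
  \<open>B = lt[T]\<close>. Moreover, for a suitable \<open>c\<close> in \<open>lt\<close> the logarithmic derivative of \<open>T - c\<close> lies in this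
  group, so it generates the quotient, as does that of \<open>T\<close> whenever it is integral. Three ideas carry
  the argument.

  \<^emph>\<open>There are many constants.\<close> Call an element of \<open>B\<close> constant if \<open>\<partial>\<^sub>L\<close> sends it to itself. Constants
  include the image of the reduction \<open>At\<close> and, as the characteristic is \<open>p\<close>, all powers with exponent
  \<open>m + 1 = p\<^sup>n\<close>. Since the extension is totally ramified, each homogeneous element of \<open>lt\<close> is a power of
  \<open>t\<close> times a constant, so \<open>B\<close> is spanned over the constants by \<open>1, t, \<dots>, t\<^sup>m\<close>. Substituting \<open>S = -t\<close> in
  the expansions \<open>\<partial>\<^sub>L(f)\<close> is an additive projection of \<open>B\<close> onto the constants (lemma \<open>proj_const\<close>), and
  \<open>f\<close> can be recovered from the projections of the \<open>t\<^sup>-\<^sup>i f\<close> (lemma \<open>proj_decomposition\<close>).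

  \<^emph>\<open>The coordinate can be chosen constant.\<close> As \<open>\<partial>\<^sub>L(T)\<close> has degree one in \<open>T\<close>, the projection preserves
  polynomials of degree at most one, so that some constant has the form \<open>\<alpha> T + \<beta>\<close> with \<open>\<alpha> \<noteq> 0\<close>. To make
  \<open>\<alpha>\<close> a unit, the grading of \<open>lt\<close> is used. The coefficient of \<open>S\<^sup>j\<close> in \<open>\<partial>(x)\<close> is obtained by lowering
  degrees by that of \<open>t\<^sup>j\<close>; so if \<open>x\<close> divides all these coefficients, highest and lowest degrees show
  that the quotients are homogeneous (lemma \<open>homogeneous_quotient\<close>), and \<open>x\<close> may be replaced by its
  component of highest degree, which is a unit with the same logarithmic derivative (lemma
  \<open>homogeneous_eigenvector\<close>). Applied to \<open>x = \<alpha>\<^sup>m\<close> this yields a unit \<open>u\<close> whose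
  logarithmic derivative is the coefficient of \<open>T\<close> in \<open>\<partial>\<^sub>L(T)\<close>. Then \<open>T / u\<close> projects to a constant \<open>e T + \<beta>\<close>
  with the unit \<open>e = 1 / u\<close> (lemma \<open>constant_coordinate\<close>), and \<open>T + \<beta> / e\<close> is a constant times a unit.

  \<^emph>\<open>Logarithmic derivatives are carried by leading coefficients.\<close> Let \<open>\<partial>\<^sub>L(z) / z\<close> be integral. After
  multiplication by the constant power \<open>b\<^bsup>m+1\<^esup>\<close> of a denominator \<open>b\<close>, the element \<open>z\<close> lies in \<open>B\<close>.
  Expanded in powers of the constant coordinate, \<open>\<partial>\<^sub>L\<close> acts on the coefficients; comparing degrees,
  \<open>\<partial>\<^sub>L(z) / z\<close> has degree zero and is the logarithmic derivative of the leading coefficient of \<open>z\<close>, hence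
  by the previous step that of a unit (lemma \<open>unit_eigenvector\<close>).

  The remaining parts justify this use of the graded reductions: the reduction of a valued field is a
  graded field; the spectral seminorm is a nonarchimedean seminorm, bounded by the absolute value on
  scalars; and \<open>At\<close> embeds into \<open>B\<close>, because \<open>lt\<close> has a \<open>kt\<close>-linear retraction onto \<open>kt\<close> (lemmas
  \<open>linear_retraction\<close> and \<open>tens_left_inj\<close>).\<close>

section \<open>Truncated polynomials\<close>

text \<open>An element of \<^const>\<open>trunc_poly\<close> is a class of polynomials that agree up to the exponent \<open>m\<close>, so any
  representative gives the same coefficient.\<close>

definition tcoeff :: "nat \<Rightarrow> (nat \<Rightarrow> 'a) set \<Rightarrow> 'a" where
  "tcoeff j X = (SOME f. f \<in> X) j"

context cring
begin

lemma coeff_UP: "f \<in> carrier (UP R) \<Longrightarrow> coeff (UP R) f j = f j"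
  by (simp add: UP_def)

lemma UP_memI:
  assumes "\<And>j. f j \<in> carrier R" "\<And>j. j > m \<Longrightarrow> f j = \<zero>"
  shows "f \<in> carrier (UP R)"
  using assms by (auto simp: UP_def up_def bound_def)

lemma UP_memE:
  assumes "f \<in> carrier (UP R)"
  obtains M where "\<And>j. j > M \<Longrightarrow> f j = \<zero>"
  using assms by (auto simp: UP_def up_def bound_def)

interpretation UP: UP_cring R "UP R"
  by unfold_locales

lemma UP_apply_closed: "f \<in> carrier (UP R) \<Longrightarrow> f j \<in> carrier R"
  using UP.coeff_closed[of f j] by (simp add: coeff_UP)

lemma truncation_ideal:
  "PIdl\<^bsub>UP R\<^esub> (monom (UP R) \<one> (Suc m)) = {f \<in> carrier (UP R). \<forall>j\<le>m. f j = \<zero>}" (is "?I = ?J")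
proof
  show "?I \<subseteq> ?J"
  proof
    fix f assume "f \<in> ?I"
    then obtain x where x: "x \<in> carrier (UP R)" and f: "f = x \<otimes>\<^bsub>UP R\<^esub> monom (UP R) \<one> (Suc m)"
      by (auto simp: cgenideal_def)
    have f': "f = monom (UP R) \<one> (Suc m) \<otimes>\<^bsub>UP R\<^esub> x"
      unfolding f using x by (intro UP.UP_m_comm) auto
    have "f j = \<zero>" if "j \<le> m" for j
    proof -
      have "f j = coeff (UP R) f j" using x f by (simp add: coeff_UP)
      also have "\<dots> = (\<Oplus>i \<in> {..j}. coeff (UP R) (monom (UP R) \<one> (Suc m)) i \<otimes> coeff (UP R) x (j - i))"
        unfolding f' using x by (subst UP.coeff_mult) auto
      also have "\<dots> = (\<Oplus>i \<in> {..j}. \<zero>)"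
        using that x by (intro finsum_cong') auto
      finally show ?thesis by simp
    qed
    then show "f \<in> ?J" using x f by simp
  qed
  show "?J \<subseteq> ?I"
  proof
    fix f assume "f \<in> ?J"
    then have f: "f \<in> carrier (UP R)" and z: "\<And>j. j \<le> m \<Longrightarrow> f j = \<zero>" by auto
    obtain M where M: "\<And>j. j > M \<Longrightarrow> f j = \<zero>" using UP_memE[OF f] by blast
    define x where "x = (\<lambda>j. f (j + Suc m))"
    have x: "x \<in> carrier (UP R)"
      unfolding x_def by (rule UP_memI[of _ M]) (auto simp: f UP_apply_closed M)
    have "f = monom (UP R) \<one> (Suc m) \<otimes>\<^bsub>UP R\<^esub> x"
    proof (rule UP.up_eqI[OF _ f])
      show "monom (UP R) \<one> (Suc m) \<otimes>\<^bsub>UP R\<^esub> x \<in> carrier (UP R)" using x by simp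
      fix j
      have eq: "coeff (UP R) (monom (UP R) \<one> (Suc m) \<otimes>\<^bsub>UP R\<^esub> x) j
        = (\<Oplus>i \<in> {..j}. coeff (UP R) (monom (UP R) \<one> (Suc m)) i \<otimes> coeff (UP R) x (j - i))"
        using x by (subst UP.coeff_mult) auto
      also have "\<dots> = (\<Oplus>i \<in> {..j}. if Suc m = i then x (j - i) else \<zero>)"
        using x by (intro finsum_cong') (auto simp: coeff_UP[OF x] UP_apply_closed[OF x])
      also have "\<dots> = f j"
      proof (cases "Suc m \<le> j")
        case True
        then show ?thesis using x f
          by (subst finsum_singleton) (auto simp: UP_apply_closed x_def)
      next
        case False
        have "(\<Oplus>i \<in> {..j}. if Suc m = i then x (j - i) else \<zero>) = (\<Oplus>i \<in> {..j}. \<zero>)"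
          using False by (intro finsum_cong') auto
        then show ?thesis using z[of j] False by simp
      qed
      finally show "coeff (UP R) f j = coeff (UP R) (monom (UP R) \<one> (Suc m) \<otimes>\<^bsub>UP R\<^esub> x) j"
        using f by (simp add: coeff_UP)
    qed
    also have "\<dots> = x \<otimes>\<^bsub>UP R\<^esub> monom (UP R) \<one> (Suc m)"
      using x by (intro UP.UP_m_comm) auto
    finally show "f \<in> ?I" using x by (auto simp: cgenideal_def)
  qed
qed

lemma truncation_is_ideal: "ideal (PIdl\<^bsub>UP R\<^esub> (monom (UP R) \<one> (Suc m))) (UP R)"
  by (rule UP.cgenideal_ideal) simp

lemma trunc_class_eq:
  assumes f: "f \<in> carrier (UP R)"
  shows "trunc_class R m f = {g \<in> carrier (UP R). \<forall>j\<le>m. g j = f j}"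
proof (rule Set.set_eqI)
  fix g
  interpret I: ideal "PIdl\<^bsub>UP R\<^esub> (monom (UP R) \<one> (Suc m))" "UP R" by (rule truncation_is_ideal)
  show "g \<in> trunc_class R m f \<longleftrightarrow> g \<in> {g \<in> carrier (UP R). \<forall>j\<le>m. g j = f j}"
  proof (cases "g \<in> carrier (UP R)")
    case g: True
    have c: "(g \<ominus>\<^bsub>UP R\<^esub> f) j = g j \<ominus> f j" for j
      using UP.coeff_minus[OF g f, of j] unfolding coeff_UP[OF g] coeff_UP[OF f]
        coeff_UP[OF UP.P.minus_closed[OF g f]] .
    have "g \<in> trunc_class R m f \<longleftrightarrow> g \<ominus>\<^bsub>UP R\<^esub> f \<in> PIdl\<^bsub>UP R\<^esub> (monom (UP R) \<one> (Suc m))"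
      unfolding trunc_class_def by (rule I.a_rcos_module_minus[OF UP.UP_ring f g])
    also have "\<dots> \<longleftrightarrow> (\<forall>j\<le>m. g j \<ominus> f j = \<zero>)"
      unfolding truncation_ideal using UP.P.minus_closed[OF g f] by (simp only: mem_Collect_eq c simp_thms)
    also have "\<dots> \<longleftrightarrow> (\<forall>j\<le>m. g j = f j)"
      by (simp only: r_right_minus_eq[OF UP_apply_closed[OF g] UP_apply_closed[OF f]])
    finally show ?thesis using g by simp
  next
    case False
    then show ?thesis
      using f I.Icarr UP.P.a_closed by (fastforce simp: trunc_class_def a_r_coset_def')
  qed
qed

lemma trunc_poly_cring: "cring (trunc_poly R m)"
  unfolding trunc_poly_def
  by (rule ideal.quotient_is_cring[OF truncation_is_ideal UP.UP_cring])

lemma trunc_class_closed: "f \<in> carrier (UP R) \<Longrightarrow> trunc_class R m f \<in> carrier (trunc_poly R m)"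
  by (auto simp: trunc_class_def trunc_poly_def FactRing_simps)

lemma trunc_polyE:
  assumes "X \<in> carrier (trunc_poly R m)"
  obtains f where "f \<in> carrier (UP R)" "X = trunc_class R m f"
  using assms by (auto simp: trunc_class_def trunc_poly_def FactRing_simps)

lemma tcoeff_trunc_class: "f \<in> carrier (UP R) \<Longrightarrow> j \<le> m \<Longrightarrow> tcoeff j (trunc_class R m f) = f j"
  unfolding tcoeff_def by (rule someI2[of _ f]) (auto simp: trunc_class_eq)

lemma tcoeff_closed: "X \<in> carrier (trunc_poly R m) \<Longrightarrow> j \<le> m \<Longrightarrow> tcoeff j X \<in> carrier R"
  by (erule trunc_polyE) (simp add: tcoeff_trunc_class UP_apply_closed)

lemma trunc_poly_eqI:
  assumes "X \<in> carrier (trunc_poly R m)" "Y \<in> carrier (trunc_poly R m)"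
    and "\<And>j. j \<le> m \<Longrightarrow> tcoeff j X = tcoeff j Y"
  shows "X = Y"
proof -
  obtain f g where f: "f \<in> carrier (UP R)" "X = trunc_class R m f"
    and g: "g \<in> carrier (UP R)" "Y = trunc_class R m g"
    using assms by (metis trunc_polyE)
  have "f j = g j" if "j \<le> m" for j
    using assms(3)[OF that] f g that by (simp add: tcoeff_trunc_class)
  then show ?thesis using f g by (auto simp: trunc_class_eq)
qed

lemma trunc_poly_exists:
  assumes "\<And>j. j \<le> m \<Longrightarrow> a j \<in> carrier R"
  obtains X where "X \<in> carrier (trunc_poly R m)" "\<And>j. j \<le> m \<Longrightarrow> tcoeff j X = a j"
proof -
  define f where "f = (\<lambda>j. if j \<le> m then a j else \<zero>)"
  have f: "f \<in> carrier (UP R)" by (rule UP_memI[of _ m]) (auto simp: f_def assms)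
  show ?thesis
    by (rule that[OF trunc_class_closed[OF f]]) (simp add: tcoeff_trunc_class f, simp add: f_def)
qed

lemma tcoeff_add:
  assumes "X \<in> carrier (trunc_poly R m)" "Y \<in> carrier (trunc_poly R m)" "j \<le> m"
  shows "tcoeff j (X \<oplus>\<^bsub>trunc_poly R m\<^esub> Y) = tcoeff j X \<oplus> tcoeff j Y"
proof -
  interpret I: ideal "PIdl\<^bsub>UP R\<^esub> (monom (UP R) \<one> (Suc m))" "UP R" by (rule truncation_is_ideal)
  obtain f g where f: "f \<in> carrier (UP R)" "X = trunc_class R m f"
    and g: "g \<in> carrier (UP R)" "Y = trunc_class R m g"
    using assms by (metis trunc_polyE)
  have "X \<oplus>\<^bsub>trunc_poly R m\<^esub> Y = trunc_class R m (f \<oplus>\<^bsub>UP R\<^esub> g)"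
    unfolding f g trunc_poly_def trunc_class_def using f g
    by (simp add: FactRing_def I.a_rcos_sum)
  moreover have "(f \<oplus>\<^bsub>UP R\<^esub> g) j = f j \<oplus> g j"
    using UP.coeff_add[OF f(1) g(1), of j] f g by (simp add: coeff_UP)
  ultimately show ?thesis using f g assms by (simp add: tcoeff_trunc_class)
qed

lemma tcoeff_mult:
  assumes "X \<in> carrier (trunc_poly R m)" "Y \<in> carrier (trunc_poly R m)" "j \<le> m"
  shows "tcoeff j (X \<otimes>\<^bsub>trunc_poly R m\<^esub> Y) = (\<Oplus>i\<in>{..j}. tcoeff i X \<otimes> tcoeff (j - i) Y)"
proof -
  interpret I: ideal "PIdl\<^bsub>UP R\<^esub> (monom (UP R) \<one> (Suc m))" "UP R" by (rule truncation_is_ideal)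
  obtain f g where f: "f \<in> carrier (UP R)" "X = trunc_class R m f"
    and g: "g \<in> carrier (UP R)" "Y = trunc_class R m g"
    using assms by (metis trunc_polyE)
  have "X \<otimes>\<^bsub>trunc_poly R m\<^esub> Y = trunc_class R m (f \<otimes>\<^bsub>UP R\<^esub> g)"
    unfolding f g trunc_poly_def trunc_class_def using f g
    by (simp add: FactRing_def I.rcoset_mult_add)
  moreover have "(f \<otimes>\<^bsub>UP R\<^esub> g) j = (\<Oplus>i\<in>{..j}. f i \<otimes> g (j - i))"
    using UP.coeff_mult[OF f(1) g(1), of j] f g by (simp add: coeff_UP)
  moreover have "\<dots> = (\<Oplus>i\<in>{..j}. tcoeff i X \<otimes> tcoeff (j - i) Y)"
    using f g assms(3) by (intro finsum_cong') (auto simp: tcoeff_trunc_class UP_apply_closed)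
  ultimately show ?thesis using f g assms by (simp add: tcoeff_trunc_class)
qed

lemma trunc_const_closed: "a \<in> carrier R \<Longrightarrow> trunc_const R m a \<in> carrier (trunc_poly R m)"
  by (simp add: trunc_const_def trunc_class_closed)

lemma tcoeff_const:
  "a \<in> carrier R \<Longrightarrow> j \<le> m \<Longrightarrow> tcoeff j (trunc_const R m a) = (if j = 0 then a else \<zero>)"
  using UP.coeff_monom[of a 0 j] coeff_UP[of "monom (UP R) a 0" j]
  by (simp add: trunc_const_def tcoeff_trunc_class)

lemma trunc_var_closed: "trunc_var R m \<in> carrier (trunc_poly R m)"
  by (simp add: trunc_var_def trunc_class_closed)

lemma tcoeff_var: "j \<le> m \<Longrightarrow> tcoeff j (trunc_var R m) = (if j = 1 then \<one> else \<zero>)"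
  using UP.coeff_monom[of \<one> 1 j] coeff_UP[of "monom (UP R) \<one> 1" j]
  by (simp add: trunc_var_def tcoeff_trunc_class eq_commute[of j])

lemma trunc_one: "\<one>\<^bsub>trunc_poly R m\<^esub> = trunc_const R m \<one>"
proof -
  have "\<one>\<^bsub>UP R\<^esub> = monom (UP R) \<one> 0" by simp
  then show ?thesis by (simp add: trunc_poly_def trunc_const_def trunc_class_def FactRing_def)
qed

lemma tcoeff_one: "j \<le> m \<Longrightarrow> tcoeff j (\<one>\<^bsub>trunc_poly R m\<^esub>) = (if j = 0 then \<one> else \<zero>)"
  by (simp add: trunc_one tcoeff_const)

lemma tcoeff_const_mult:
  assumes a: "a \<in> carrier R" and X: "X \<in> carrier (trunc_poly R m)" and j: "j \<le> m"
  shows "tcoeff j (trunc_const R m a \<otimes>\<^bsub>trunc_poly R m\<^esub> X) = a \<otimes> tcoeff j X"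
proof -
  have "tcoeff j (trunc_const R m a \<otimes>\<^bsub>trunc_poly R m\<^esub> X)
    = (\<Oplus>i\<in>{..j}. if 0 = i then a \<otimes> tcoeff (j - i) X else \<zero>)"
    unfolding tcoeff_mult[OF trunc_const_closed[OF a] X j]
    using a X j by (intro finsum_cong') (auto simp: tcoeff_const tcoeff_closed)
  also have "\<dots> = a \<otimes> tcoeff j X"
    using a X j by (subst finsum_singleton) (auto simp: tcoeff_closed)
  finally show ?thesis .
qed

lemma trunc_const_hom: "trunc_const R m \<in> ring_hom R (trunc_poly R m)"
proof -
  interpret T: cring "trunc_poly R m" by (rule trunc_poly_cring)
  show ?thesis
  proof (rule ring_hom_memI)
    fix x y assume xy: "x \<in> carrier R" "y \<in> carrier R"
    show "trunc_const R m (x \<otimes> y) = trunc_const R m x \<otimes>\<^bsub>trunc_poly R m\<^esub> trunc_const R m y"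
      using xy by (intro trunc_poly_eqI) (auto simp: trunc_const_closed tcoeff_const tcoeff_const_mult)
    show "trunc_const R m (x \<oplus> y) = trunc_const R m x \<oplus>\<^bsub>trunc_poly R m\<^esub> trunc_const R m y"
      using xy by (intro trunc_poly_eqI) (auto simp: trunc_const_closed tcoeff_const tcoeff_add)
  qed (auto simp: trunc_const_closed trunc_one)
qed

end

lemma tcoeff_trunc_map:
  assumes R: "cring R" and S: "cring S"
    and h: "\<And>x. x \<in> carrier R \<Longrightarrow> h x \<in> carrier S" "h \<zero>\<^bsub>R\<^esub> = \<zero>\<^bsub>S\<^esub>"
    and X: "X \<in> carrier (trunc_poly R m)"
  shows "trunc_map S m h X \<in> carrier (trunc_poly S m)"
    and "j \<le> m \<Longrightarrow> tcoeff j (trunc_map S m h X) = h (tcoeff j X)"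
proof -
  interpret R: cring R by fact
  interpret S: cring S by fact
  have hUP: "(\<lambda>j. h (f j)) \<in> carrier (UP S)" if f: "f \<in> carrier (UP R)" for f
  proof -
    obtain M where M: "\<And>j. j > M \<Longrightarrow> f j = \<zero>\<^bsub>R\<^esub>" using R.UP_memE[OF f] by blast
    show ?thesis by (rule S.UP_memI[of _ M]) (auto simp: h R.UP_apply_closed[OF f] M)
  qed
  obtain f where f: "f \<in> carrier (UP R)" "X = trunc_class R m f"
    using X by (rule R.trunc_polyE)
  have fX: "f \<in> X" using f by (simp add: R.trunc_class_eq)
  have "trunc_class S m (\<lambda>j. h (g j)) = trunc_class S m (\<lambda>j. h (f j))" if "g \<in> X" for g
    using that f hUP[of g] hUP[of f] by (auto simp: R.trunc_class_eq S.trunc_class_eq)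
  then have eq: "trunc_map S m h X = trunc_class S m (\<lambda>j. h (f j))"
    unfolding trunc_map_def using fX by blast
  show "trunc_map S m h X \<in> carrier (trunc_poly S m)"
    unfolding eq by (rule S.trunc_class_closed[OF hUP[OF f(1)]])
  show "tcoeff j (trunc_map S m h X) = h (tcoeff j X)" if "j \<le> m"
    unfolding eq using that f hUP[OF f(1)] by (simp add: S.tcoeff_trunc_class R.tcoeff_trunc_class)
qed

lemma trunc_map_hom:
  assumes R: "cring R" and S: "cring S" and h: "h \<in> ring_hom R S"
  shows "trunc_map S m h \<in> ring_hom (trunc_poly R m) (trunc_poly S m)"
proof -
  interpret R: cring R by fact
  interpret S: cring S by fact
  interpret H: ring_hom_cring R S h by (intro ring_hom_cring.intro ring_hom_cring_axioms.intro assms)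
  interpret TR: cring "trunc_poly R m" by (rule R.trunc_poly_cring)
  interpret TS: cring "trunc_poly S m" by (rule S.trunc_poly_cring)
  note tm = tcoeff_trunc_map[where h = h, OF R S H.hom_closed H.hom_zero]
  show ?thesis
  proof (rule ring_hom_memI)
    fix X Y assume X: "X \<in> carrier (trunc_poly R m)" and Y: "Y \<in> carrier (trunc_poly R m)"
    show "trunc_map S m h (X \<otimes>\<^bsub>trunc_poly R m\<^esub> Y)
      = trunc_map S m h X \<otimes>\<^bsub>trunc_poly S m\<^esub> trunc_map S m h Y"
    proof (rule S.trunc_poly_eqI)
      fix j assume j: "j \<le> m"
      have "tcoeff j (trunc_map S m h (X \<otimes>\<^bsub>trunc_poly R m\<^esub> Y))
        = h (\<Oplus>\<^bsub>R\<^esub>i\<in>{..j}. tcoeff i X \<otimes>\<^bsub>R\<^esub> tcoeff (j - i) Y)"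
        using X Y j by (simp add: tm R.tcoeff_mult)
      also have "\<dots> = (\<Oplus>\<^bsub>S\<^esub>i\<in>{..j}. h (tcoeff i X \<otimes>\<^bsub>R\<^esub> tcoeff (j - i) Y))"
        using X Y j by (subst H.hom_finsum) (auto simp: R.tcoeff_closed o_def)
      also have "\<dots> = tcoeff j (trunc_map S m h X \<otimes>\<^bsub>trunc_poly S m\<^esub> trunc_map S m h Y)"
        using X Y j by (subst S.tcoeff_mult) (auto simp: tm R.tcoeff_closed intro!: S.finsum_cong')
      finally show "tcoeff j (trunc_map S m h (X \<otimes>\<^bsub>trunc_poly R m\<^esub> Y))
        = tcoeff j (trunc_map S m h X \<otimes>\<^bsub>trunc_poly S m\<^esub> trunc_map S m h Y)" .
    qed (use X Y in \<open>auto simp: tm\<close>)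
    show "trunc_map S m h (X \<oplus>\<^bsub>trunc_poly R m\<^esub> Y)
      = trunc_map S m h X \<oplus>\<^bsub>trunc_poly S m\<^esub> trunc_map S m h Y"
      by (rule S.trunc_poly_eqI)
        (use X Y in \<open>auto simp: tm R.tcoeff_add S.tcoeff_add R.tcoeff_closed\<close>)
  next
    show "trunc_map S m h \<one>\<^bsub>trunc_poly R m\<^esub> = \<one>\<^bsub>trunc_poly S m\<^esub>"
      by (rule S.trunc_poly_eqI) (auto simp: tm R.tcoeff_one S.tcoeff_one)
  qed (simp add: tm)
qed

section \<open>Fields of fractions\<close>

context "domain"
begin

lemma frac_memI:
  assumes "a \<in> carrier R" "b \<in> carrier R - {\<zero>}"
  shows "(a, b) \<in> frac R a b"
  using assms by (simp add: frac_def)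

lemma frac_trans:
  assumes c: "a \<in> carrier R" "b \<in> carrier R - {\<zero>}" "c \<in> carrier R" "d \<in> carrier R - {\<zero>}"
      "e \<in> carrier R" "f \<in> carrier R - {\<zero>}"
    and 1: "a \<otimes> d = c \<otimes> b" and 2: "a \<otimes> f = e \<otimes> b"
  shows "c \<otimes> f = e \<otimes> d"
proof -
  have "b \<otimes> (c \<otimes> f) = (c \<otimes> b) \<otimes> f" using c by (simp add: m_ac)
  also have "\<dots> = (a \<otimes> f) \<otimes> d" using c by (simp add: 1[symmetric] m_ac)
  also have "\<dots> = b \<otimes> (e \<otimes> d)" using c by (simp add: 2 m_ac)
  finally show ?thesis using c by (simp add: m_lcancel)
qed

lemma frac_eq_iff:
  assumes "a \<in> carrier R" "b \<in> carrier R - {\<zero>}" "c \<in> carrier R" "d \<in> carrier R - {\<zero>}"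
  shows "frac R a b = frac R c d \<longleftrightarrow> a \<otimes> d = c \<otimes> b"
proof
  assume "frac R a b = frac R c d"
  then have "(c, d) \<in> frac R a b" using frac_memI[OF assms(3,4)] by simp
  then show "a \<otimes> d = c \<otimes> b" by (simp add: frac_def)
next
  assume eq: "a \<otimes> d = c \<otimes> b"
  show "frac R a b = frac R c d"
    unfolding frac_def
    using frac_trans[OF assms _ _ eq] frac_trans[OF assms(3,4,1,2) _ _ eq[symmetric]] by blast
qed

text \<open>The operations of the field of fractions are unions over representatives; each
  representative contributes the same class.\<close>

lemma frac_UN:
  assumes a: "a \<in> carrier R" "b \<in> carrier R - {\<zero>}"
    and eq: "\<And>c d. c \<in> carrier R \<Longrightarrow> d \<in> carrier R - {\<zero>} \<Longrightarrow> a \<otimes> d = c \<otimes> b \<Longrightarrow> h c d = h a b"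
  shows "(\<Union>(c, d)\<in>frac R a b. h c d) = h a b"
proof -
  have "h c d = h a b" if "(c, d) \<in> frac R a b" for c d
    using that eq by (auto simp: frac_def)
  then show ?thesis using frac_memI[OF a] by fast
qed

lemma nonzero_mult_closed: "b \<in> carrier R - {\<zero>} \<Longrightarrow> d \<in> carrier R - {\<zero>} \<Longrightarrow> b \<otimes> d \<in> carrier R - {\<zero>}"
  using integral by auto

lemma frac_mult:
  assumes a: "a \<in> carrier R" "b \<in> carrier R - {\<zero>}" and c: "c \<in> carrier R" "d \<in> carrier R - {\<zero>}"
  shows "frac R a b \<otimes>\<^bsub>Frac R\<^esub> frac R c d = frac R (a \<otimes> c) (b \<otimes> d)"
proof -
  have "frac R a b \<otimes>\<^bsub>Frac R\<^esub> frac R c d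
    = (\<Union>(a, b)\<in>frac R a b. \<Union>(c, d)\<in>frac R c d. frac R (a \<otimes> c) (b \<otimes> d))"
    by (simp add: Frac_def)
  also have "\<dots> = (\<Union>(c, d)\<in>frac R c d. frac R (a \<otimes> c) (b \<otimes> d))"
  proof (rule frac_UN[OF a])
    fix a' b' assume a': "a' \<in> carrier R" "b' \<in> carrier R - {\<zero>}" and eq: "a \<otimes> b' = a' \<otimes> b"
    have "frac R (a' \<otimes> x) (b' \<otimes> y) = frac R (a \<otimes> x) (b \<otimes> y)"
      if x: "x \<in> carrier R" "y \<in> carrier R - {\<zero>}" for x y
    proof (subst frac_eq_iff)
      have "a' \<otimes> x \<otimes> (b \<otimes> y) = (a' \<otimes> b) \<otimes> (x \<otimes> y)" using a a' x by (simp add: m_ac)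
      also have "\<dots> = a \<otimes> x \<otimes> (b' \<otimes> y)" using a a' x by (simp add: eq[symmetric] m_ac)
      finally show "a' \<otimes> x \<otimes> (b \<otimes> y) = a \<otimes> x \<otimes> (b' \<otimes> y)" .
    qed (use a a' x nonzero_mult_closed in auto)
    then show "(\<Union>(c, d)\<in>frac R c d. frac R (a' \<otimes> c) (b' \<otimes> d))
      = (\<Union>(c, d)\<in>frac R c d. frac R (a \<otimes> c) (b \<otimes> d))"
      by (intro SUP_cong) (auto simp: frac_def[of R c d])
  qed
  also have "\<dots> = frac R (a \<otimes> c) (b \<otimes> d)"
  proof (rule frac_UN[OF c])
    fix c' d' assume c': "c' \<in> carrier R" "d' \<in> carrier R - {\<zero>}" and eq: "c \<otimes> d' = c' \<otimes> d"
    show "frac R (a \<otimes> c') (b \<otimes> d') = frac R (a \<otimes> c) (b \<otimes> d)"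
    proof (subst frac_eq_iff)
      have "a \<otimes> c' \<otimes> (b \<otimes> d) = (c' \<otimes> d) \<otimes> (a \<otimes> b)" using a c c' by (simp add: m_ac)
      also have "\<dots> = a \<otimes> c \<otimes> (b \<otimes> d')" using a c c' by (simp add: eq[symmetric] m_ac)
      finally show "a \<otimes> c' \<otimes> (b \<otimes> d) = a \<otimes> c \<otimes> (b \<otimes> d')" .
    qed (use a c c' nonzero_mult_closed in auto)
  qed
  finally show ?thesis .
qed

lemma frac_add:
  assumes a: "a \<in> carrier R" "b \<in> carrier R - {\<zero>}" and c: "c \<in> carrier R" "d \<in> carrier R - {\<zero>}"
  shows "frac R a b \<oplus>\<^bsub>Frac R\<^esub> frac R c d = frac R (a \<otimes> d \<oplus> c \<otimes> b) (b \<otimes> d)"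
proof -
  have "frac R a b \<oplus>\<^bsub>Frac R\<^esub> frac R c d
    = (\<Union>(a, b)\<in>frac R a b. \<Union>(c, d)\<in>frac R c d. frac R (a \<otimes> d \<oplus> c \<otimes> b) (b \<otimes> d))"
    by (simp add: Frac_def)
  also have "\<dots> = (\<Union>(c, d)\<in>frac R c d. frac R (a \<otimes> d \<oplus> c \<otimes> b) (b \<otimes> d))"
  proof (rule frac_UN[OF a])
    fix a' b' assume a': "a' \<in> carrier R" "b' \<in> carrier R - {\<zero>}" and eq: "a \<otimes> b' = a' \<otimes> b"
    have "frac R (a' \<otimes> y \<oplus> x \<otimes> b') (b' \<otimes> y) = frac R (a \<otimes> y \<oplus> x \<otimes> b) (b \<otimes> y)"
      if x: "x \<in> carrier R" "y \<in> carrier R - {\<zero>}" for x y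
    proof (subst frac_eq_iff)
      have "(a' \<otimes> y \<oplus> x \<otimes> b') \<otimes> (b \<otimes> y) = (a' \<otimes> b) \<otimes> (y \<otimes> y) \<oplus> x \<otimes> b' \<otimes> b \<otimes> y"
        using a a' x by (simp add: m_ac l_distr r_distr)
      also have "\<dots> = (a \<otimes> y \<oplus> x \<otimes> b) \<otimes> (b' \<otimes> y)"
        using a a' x by (simp add: eq[symmetric] m_ac l_distr r_distr)
      finally show "(a' \<otimes> y \<oplus> x \<otimes> b') \<otimes> (b \<otimes> y) = (a \<otimes> y \<oplus> x \<otimes> b) \<otimes> (b' \<otimes> y)" .
    qed (use a a' x nonzero_mult_closed in auto)
    then show "(\<Union>(c, d)\<in>frac R c d. frac R (a' \<otimes> d \<oplus> c \<otimes> b') (b' \<otimes> d))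
      = (\<Union>(c, d)\<in>frac R c d. frac R (a \<otimes> d \<oplus> c \<otimes> b) (b \<otimes> d))"
      by (intro SUP_cong) (auto simp: frac_def[of R c d])
  qed
  also have "\<dots> = frac R (a \<otimes> d \<oplus> c \<otimes> b) (b \<otimes> d)"
  proof (rule frac_UN[OF c])
    fix c' d' assume c': "c' \<in> carrier R" "d' \<in> carrier R - {\<zero>}" and eq: "c \<otimes> d' = c' \<otimes> d"
    show "frac R (a \<otimes> d' \<oplus> c' \<otimes> b) (b \<otimes> d') = frac R (a \<otimes> d \<oplus> c \<otimes> b) (b \<otimes> d)"
    proof (subst frac_eq_iff)
      have "(a \<otimes> d' \<oplus> c' \<otimes> b) \<otimes> (b \<otimes> d) = a \<otimes> d' \<otimes> b \<otimes> d \<oplus> (c' \<otimes> d) \<otimes> (b \<otimes> b)"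
        using a c c' by (simp add: m_ac l_distr r_distr)
      also have "\<dots> = (a \<otimes> d \<oplus> c \<otimes> b) \<otimes> (b \<otimes> d')"
        using a c c' by (simp add: eq[symmetric] m_ac l_distr r_distr)
      finally show "(a \<otimes> d' \<oplus> c' \<otimes> b) \<otimes> (b \<otimes> d) = (a \<otimes> d \<oplus> c \<otimes> b) \<otimes> (b \<otimes> d')" .
    qed (use a c c' nonzero_mult_closed in auto)
  qed
  finally show ?thesis .
qed

lemma frac_closed: "a \<in> carrier R \<Longrightarrow> b \<in> carrier R - {\<zero>} \<Longrightarrow> frac R a b \<in> carrier (Frac R)"
  by (auto simp: Frac_def)

lemma FracE:
  assumes "x \<in> carrier (Frac R)"
  obtains a b where "a \<in> carrier R" "b \<in> carrier R - {\<zero>}" "x = frac R a b"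
  using assms by (auto simp: Frac_def)

lemma Frac_zero: "\<zero>\<^bsub>Frac R\<^esub> = frac R \<zero> \<one>" and Frac_one: "\<one>\<^bsub>Frac R\<^esub> = frac R \<one> \<one>"
  by (simp_all add: Frac_def)

lemma frac_add_same:
  assumes "a \<in> carrier R" "c \<in> carrier R" "b \<in> carrier R - {\<zero>}"
  shows "frac R a b \<oplus>\<^bsub>Frac R\<^esub> frac R c b = frac R (a \<oplus> c) b"
  using assms nonzero_mult_closed[of b b] by (auto simp: frac_add frac_eq_iff m_ac l_distr r_distr)

text \<open>A common denominator reduces the additive axioms to those of the domain.\<close>

lemma Frac_common_denominator:
  assumes "x \<in> carrier (Frac R)" "y \<in> carrier (Frac R)" "z \<in> carrier (Frac R)"
  obtains a b c d where "a \<in> carrier R" "b \<in> carrier R" "c \<in> carrier R" "d \<in> carrier R - {\<zero>}"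
    "x = frac R a d" "y = frac R b d" "z = frac R c d"
proof -
  obtain a d1 b d2 c d3 where
    1: "a \<in> carrier R" "d1 \<in> carrier R - {\<zero>}" "x = frac R a d1" and
    2: "b \<in> carrier R" "d2 \<in> carrier R - {\<zero>}" "y = frac R b d2" and
    3: "c \<in> carrier R" "d3 \<in> carrier R - {\<zero>}" "z = frac R c d3"
    using assms by (metis FracE)
  have d: "d1 \<otimes> d2 \<otimes> d3 \<in> carrier R - {\<zero>}"
    using 1 2 3 nonzero_mult_closed by presburger
  show ?thesis
    by (rule that[of "a \<otimes> d2 \<otimes> d3" "b \<otimes> d1 \<otimes> d3" "c \<otimes> d1 \<otimes> d2" "d1 \<otimes> d2 \<otimes> d3"])
      (use 1 2 3 d in \<open>auto simp: frac_eq_iff m_ac\<close>)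
qed

lemma Frac_field: "field (Frac R)"
proof -
  have "cring (Frac R)"
  proof (rule cringI)
    show "abelian_group (Frac R)"
    proof (rule abelian_groupI)
      fix x y z assume x: "x \<in> carrier (Frac R)" and y: "y \<in> carrier (Frac R)" and z: "z \<in> carrier (Frac R)"
      obtain a b c d where abc: "a \<in> carrier R" "b \<in> carrier R" "c \<in> carrier R" "d \<in> carrier R - {\<zero>}"
          "x = frac R a d" "y = frac R b d" "z = frac R c d"
        using Frac_common_denominator[OF x y z] .
      show "x \<oplus>\<^bsub>Frac R\<^esub> y \<oplus>\<^bsub>Frac R\<^esub> z = x \<oplus>\<^bsub>Frac R\<^esub> (y \<oplus>\<^bsub>Frac R\<^esub> z)"
        using abc by (simp add: frac_add_same a_assoc)
    next
      fix x y assume x: "x \<in> carrier (Frac R)" and y: "y \<in> carrier (Frac R)"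
      obtain a b c d where abc: "a \<in> carrier R" "b \<in> carrier R" "c \<in> carrier R" "d \<in> carrier R - {\<zero>}"
          "x = frac R a d" "y = frac R b d" "y = frac R c d"
        using Frac_common_denominator[OF x y y] .
      show "x \<oplus>\<^bsub>Frac R\<^esub> y = y \<oplus>\<^bsub>Frac R\<^esub> x"
        using abc(1,2,4) unfolding abc(5,6) by (simp add: frac_add_same a_comm)
      show "x \<oplus>\<^bsub>Frac R\<^esub> y \<in> carrier (Frac R)"
        using abc(1,2,4) unfolding abc(5,6) by (simp add: frac_add_same frac_closed)
    next
      fix x assume x: "x \<in> carrier (Frac R)"
      then obtain a b where ab: "a \<in> carrier R" "b \<in> carrier R - {\<zero>}" "x = frac R a b" by (rule FracE)
      have z: "\<zero>\<^bsub>Frac R\<^esub> = frac R \<zero> b" using ab by (simp add: Frac_zero frac_eq_iff)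
      show "\<zero>\<^bsub>Frac R\<^esub> \<oplus>\<^bsub>Frac R\<^esub> x = x" using ab by (simp add: z frac_add_same)
      show "\<exists>y\<in>carrier (Frac R). y \<oplus>\<^bsub>Frac R\<^esub> x = \<zero>\<^bsub>Frac R\<^esub>"
        using ab by (intro bexI[of _ "frac R (\<ominus> a) b"]) (simp_all add: z frac_add_same frac_closed l_neg)
    qed (simp add: Frac_zero frac_closed)
    show "Group.comm_monoid (Frac R)"
    proof (rule comm_monoidI)
      fix x y z assume "x \<in> carrier (Frac R)" "y \<in> carrier (Frac R)" "z \<in> carrier (Frac R)"
      then show "x \<otimes>\<^bsub>Frac R\<^esub> y \<otimes>\<^bsub>Frac R\<^esub> z = x \<otimes>\<^bsub>Frac R\<^esub> (y \<otimes>\<^bsub>Frac R\<^esub> z)"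
        using nonzero_mult_closed
        by (elim FracE) (simp add: frac_mult del: Diff_iff, simp add: m_assoc)
    next
      fix x y assume "x \<in> carrier (Frac R)" "y \<in> carrier (Frac R)"
      then obtain a b c d where ab: "a \<in> carrier R" "b \<in> carrier R - {\<zero>}" "x = frac R a b"
        and cd: "c \<in> carrier R" "d \<in> carrier R - {\<zero>}" "y = frac R c d" by (metis FracE)
      show "x \<otimes>\<^bsub>Frac R\<^esub> y \<in> carrier (Frac R)"
        unfolding ab cd frac_mult[OF ab(1,2) cd(1,2)] using ab cd nonzero_mult_closed
        by (intro frac_closed) auto
      show "x \<otimes>\<^bsub>Frac R\<^esub> y = y \<otimes>\<^bsub>Frac R\<^esub> x"
        unfolding ab cd frac_mult[OF ab(1,2) cd(1,2)] frac_mult[OF cd(1,2) ab(1,2)]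
        using ab cd by (simp add: m_comm)
    next
      fix x assume "x \<in> carrier (Frac R)"
      then show "\<one>\<^bsub>Frac R\<^esub> \<otimes>\<^bsub>Frac R\<^esub> x = x"
        by (elim FracE) (simp add: Frac_one frac_mult)
    qed (simp add: Frac_one frac_closed)
    fix x y z assume x: "x \<in> carrier (Frac R)" and y: "y \<in> carrier (Frac R)" and z: "z \<in> carrier (Frac R)"
    obtain a b c d where abc: "a \<in> carrier R" "b \<in> carrier R" "c \<in> carrier R" "d \<in> carrier R - {\<zero>}"
        "x = frac R a d" "y = frac R b d" "z = frac R c d"
      using Frac_common_denominator[OF x y z] .
    have dd: "d \<otimes> d \<in> carrier R - {\<zero>}" using nonzero_mult_closed abc by blast
    show "(x \<oplus>\<^bsub>Frac R\<^esub> y) \<otimes>\<^bsub>Frac R\<^esub> z = x \<otimes>\<^bsub>Frac R\<^esub> z \<oplus>\<^bsub>Frac R\<^esub> y \<otimes>\<^bsub>Frac R\<^esub> z"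
      using abc dd by (simp add: frac_add_same frac_mult l_distr)
  qed
  then interpret F: cring "Frac R" .
  show ?thesis
  proof (rule F.cring_fieldI2)
    show "\<zero>\<^bsub>Frac R\<^esub> \<noteq> \<one>\<^bsub>Frac R\<^esub>" by (simp add: Frac_zero Frac_one frac_eq_iff)
    fix x assume "x \<in> carrier (Frac R)" and nz: "x \<noteq> \<zero>\<^bsub>Frac R\<^esub>"
    then obtain a b where ab: "a \<in> carrier R" "b \<in> carrier R - {\<zero>}" "x = frac R a b" by (elim FracE)
    then have "a \<noteq> \<zero>" using nz by (auto simp: Frac_zero frac_eq_iff)
    then have "x \<otimes>\<^bsub>Frac R\<^esub> frac R b a = \<one>\<^bsub>Frac R\<^esub>"
      using ab nonzero_mult_closed[of b a] by (simp add: frac_mult Frac_one frac_eq_iff m_comm)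
    then show "\<exists>y\<in>carrier (Frac R). x \<otimes>\<^bsub>Frac R\<^esub> y = \<one>\<^bsub>Frac R\<^esub>"
      using ab \<open>a \<noteq> \<zero>\<close> by (intro bexI) (auto intro: frac_closed)
  qed
qed

lemma to_Frac_hom: "to_Frac R \<in> ring_hom R (Frac R)"
  by (rule ring_hom_memI)
    (simp_all add: to_Frac_def frac_closed frac_mult frac_add_same Frac_one)

lemma to_Frac_eq_iff: "a \<in> carrier R \<Longrightarrow> b \<in> carrier R \<Longrightarrow> to_Frac R a = to_Frac R b \<longleftrightarrow> a = b"
  by (simp add: to_Frac_def frac_eq_iff)

lemma Frac_elem:
  assumes "x \<in> carrier (Frac R)"
  obtains a b where "a \<in> carrier R" "b \<in> carrier R - {\<zero>}" "x \<otimes>\<^bsub>Frac R\<^esub> to_Frac R b = to_Frac R a"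
proof -
  obtain a b where ab: "a \<in> carrier R" "b \<in> carrier R - {\<zero>}" "x = frac R a b"
    using assms by (rule FracE)
  show ?thesis
    by (rule that[OF ab(1,2)]) (use ab in \<open>simp add: to_Frac_def frac_mult frac_eq_iff m_comm\<close>)
qed

lemma Frac_map_frac:
  assumes S: "domain S" and h: "h \<in> ring_hom R S" and inj: "inj_on h (carrier R)"
    and a: "a \<in> carrier R" "b \<in> carrier R - {\<zero>}"
  shows "Frac_map S h (frac R a b) = frac S (h a) (h b)" and "h b \<in> carrier S - {\<zero>\<^bsub>S\<^esub>}"
proof -
  interpret S: "domain" S by fact
  interpret H: ring_hom_cring R S h by (intro ring_hom_cring.intro ring_hom_cring_axioms.intro h is_cring S.is_cring)
  have nz: "h d \<in> carrier S - {\<zero>\<^bsub>S\<^esub>}" if "d \<in> carrier R - {\<zero>}" for d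
    using that inj_onD[OF inj, of d \<zero>] by auto
  then show "h b \<in> carrier S - {\<zero>\<^bsub>S\<^esub>}" using a by blast
  show "Frac_map S h (frac R a b) = frac S (h a) (h b)"
    unfolding Frac_map_def
  proof (rule frac_UN[OF a])
    fix c d assume c: "c \<in> carrier R" "d \<in> carrier R - {\<zero>}" and eq: "a \<otimes> d = c \<otimes> b"
    have "h a \<otimes>\<^bsub>S\<^esub> h d = h c \<otimes>\<^bsub>S\<^esub> h b" using a c eq H.hom_mult by (metis DiffD1)
    then show "frac S (h c) (h d) = frac S (h a) (h b)"
      using a c nz by (subst S.frac_eq_iff) auto
  qed
qed

lemma Frac_map_to_Frac:
  assumes S: "domain S" and h: "h \<in> ring_hom R S" and inj: "inj_on h (carrier R)" and a: "a \<in> carrier R"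
  shows "Frac_map S h (to_Frac R a) = to_Frac S (h a)"
proof -
  show ?thesis
    unfolding to_Frac_def using a Frac_map_frac(1)[OF S h inj a, of \<one>] ring_hom_one[OF h] by simp
qed

lemma Frac_map_closed:
  assumes S: "domain S" and h: "h \<in> ring_hom R S" and inj: "inj_on h (carrier R)" and x: "x \<in> carrier (Frac R)"
  shows "Frac_map S h x \<in> carrier (Frac S)"
proof -
  obtain a b where ab: "a \<in> carrier R" "b \<in> carrier R - {\<zero>}" "x = frac R a b"
    using x by (rule FracE)
  show ?thesis
    unfolding ab(3) Frac_map_frac(1)[OF S h inj ab(1,2)]
    by (rule domain.frac_closed[OF S ring_hom_closed[OF h ab(1)] Frac_map_frac(2)[OF S h inj ab(1,2)]])
qed

end

section \<open>Convolution rings\<close>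

definition fsupp :: "('a, 'm) ring_scheme \<Rightarrow> 'i set \<Rightarrow> ('i \<Rightarrow> 'a) set" where
  "fsupp R I = {f. (\<forall>i. f i \<in> carrier R) \<and> finite {i. f i \<noteq> \<zero>\<^bsub>R\<^esub>} \<and> {i. f i \<noteq> \<zero>\<^bsub>R\<^esub>} \<subseteq> I}"

context ring
begin

lemma fsupp_closed: "f \<in> fsupp R I \<Longrightarrow> f i \<in> carrier R"
  by (simp add: fsupp_def)

lemma fsupp_single: "i \<in> I \<Longrightarrow> a \<in> carrier R \<Longrightarrow> single R i a \<in> fsupp R I"
  by (auto simp: fsupp_def single_def intro: finite_subset[of _ "{i}"])

lemma fsupp_zero: "(\<lambda>_. \<zero>) \<in> fsupp R I"
  by (simp add: fsupp_def)

lemma fsupp_add: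
  assumes f: "f \<in> fsupp R I" and g: "g \<in> fsupp R I"
  shows "(\<lambda>i. f i \<oplus> g i) \<in> fsupp R I"
proof -
  have s: "{i. f i \<oplus> g i \<noteq> \<zero>} \<subseteq> {i. f i \<noteq> \<zero>} \<union> {i. g i \<noteq> \<zero>}" by auto
  then have "finite {i. f i \<oplus> g i \<noteq> \<zero>}"
    using f g by (auto simp: fsupp_def intro: finite_subset[OF s])
  then show ?thesis using f g s by (auto simp: fsupp_def)
qed

lemma fsupp_subset:
  assumes "f \<in> fsupp R I" "\<And>j. g j \<in> {\<zero>, f j}"
  shows "g \<in> fsupp R I"
proof -
  have s: "{i. g i \<noteq> \<zero>} \<subseteq> {i. f i \<noteq> \<zero>}" using assms(2) by fastforce
  moreover have "g i \<in> carrier R" for i using assms(2)[of i] assms(1) by (auto simp: fsupp_def)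
  ultimately show ?thesis using assms(1) by (auto simp: fsupp_def intro: finite_subset[OF s])
qed

text \<open>The partial sums \<open>g\<close> of \<open>f\<close> agree with \<open>f\<close> where they do not vanish, so that they lie
  in every set of functions that, like the carrier of \<^const>\<open>filt_ring\<close>, is cut out by
  conditions on the individual values.\<close>

lemma fsupp_induct [consumes 1, case_names zero add]:
  assumes f: "f \<in> fsupp R I"
    and zero: "P (\<lambda>_. \<zero>)"
    and add: "\<And>i g. i \<in> I \<Longrightarrow> f i \<noteq> \<zero> \<Longrightarrow> g \<in> fsupp R I \<Longrightarrow> (\<And>j. g j \<in> {\<zero>, f j}) \<Longrightarrow> P g
      \<Longrightarrow> P (\<lambda>j. single R i (f i) j \<oplus> g j)"
  shows "P f"
proof -
  have "P (\<lambda>j. if j \<in> S then f j else \<zero>)" if "finite S" "S \<subseteq> {i. f i \<noteq> \<zero>}" for S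
    using that
  proof (induction S)
    case empty
    then show ?case using zero by simp
  next
    case (insert i S)
    have "P (\<lambda>j. single R i (f i) j \<oplus> (if j \<in> S then f j else \<zero>))"
      using insert f by (intro add fsupp_subset[OF f]) (auto simp: fsupp_def)
    moreover have "(\<lambda>j. single R i (f i) j \<oplus> (if j \<in> S then f j else \<zero>))
      = (\<lambda>j. if j \<in> insert i S then f j else \<zero>)"
      using insert f by (auto simp: single_def fsupp_def)
    ultimately show ?case by simp
  qed
  then have "P (\<lambda>j. if j \<in> {i. f i \<noteq> \<zero>} then f j else \<zero>)"
    using f unfolding fsupp_def by blast
  moreover have "(\<lambda>j. if j \<in> {i. f i \<noteq> \<zero>} then f j else \<zero>) = f" by auto
  ultimately show ?thesis by (simp only:)
qed

end

text \<open>The free abelian group on pairs and the rings of filtered families are both rings of finitely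
  supported functions under convolution. In the second case the values of the monoid on indices outside
  \<open>I\<close> are irrelevant, which makes the positive reals an index monoid.\<close>

locale convolution = cring R for R (structure) +
  fixes op :: "'i \<Rightarrow> 'i \<Rightarrow> 'i" and e :: 'i and I :: "'i set"
  assumes op_closed: "\<And>i j. i \<in> I \<Longrightarrow> j \<in> I \<Longrightarrow> op i j \<in> I"
    and unit_closed: "e \<in> I"
    and op_assoc: "\<And>i j k. i \<in> I \<Longrightarrow> j \<in> I \<Longrightarrow> k \<in> I \<Longrightarrow> op (op i j) k = op i (op j k)"
    and op_comm: "\<And>i j. i \<in> I \<Longrightarrow> j \<in> I \<Longrightarrow> op i j = op j i"
    and op_unit: "\<And>i. i \<in> I \<Longrightarrow> op e i = i"
begin

lemma conv_eq:
  assumes f: "f \<in> fsupp R I" and g: "g \<in> fsupp R I"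
    and F: "finite F" "{i. f i \<noteq> \<zero>} \<subseteq> F" and G: "finite G" "{i. g i \<noteq> \<zero>} \<subseteq> G"
  shows "conv R op f g x = (\<Oplus>p\<in>F \<times> G. if op (fst p) (snd p) = x then f (fst p) \<otimes> g (snd p) else \<zero>)"
  unfolding conv_def
proof (rule add.finprod_mono_neutral_cong_left)
  show "{(i, j). f i \<noteq> \<zero> \<and> g j \<noteq> \<zero> \<and> op i j = x} \<subseteq> F \<times> G" using F G by auto
  show "(\<lambda>p. if op (fst p) (snd p) = x then f (fst p) \<otimes> g (snd p) else \<zero>) \<in> F \<times> G \<rightarrow> carrier R"
    using fsupp_closed[OF f] fsupp_closed[OF g] by auto
  fix p assume "p \<in> F \<times> G - {(i, j). f i \<noteq> \<zero> \<and> g j \<noteq> \<zero> \<and> op i j = x}"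
  then show "(if op (fst p) (snd p) = x then f (fst p) \<otimes> g (snd p) else \<zero>) = \<zero>"
    using fsupp_closed[OF f] fsupp_closed[OF g] by (cases p) auto
qed (use F G in auto)

lemma conv_closed:
  assumes f: "f \<in> fsupp R I" and g: "g \<in> fsupp R I"
  shows "conv R op f g \<in> fsupp R I"
proof -
  have fin: "finite {i. f i \<noteq> \<zero>}" "finite {i. g i \<noteq> \<zero>}"
    and sub: "{i. f i \<noteq> \<zero>} \<subseteq> I" "{i. g i \<noteq> \<zero>} \<subseteq> I"
    using f g by (auto simp: fsupp_def)
  let ?S = "case_prod op ` ({i. f i \<noteq> \<zero>} \<times> {i. g i \<noteq> \<zero>})"
  have eq: "conv R op f g x = (\<Oplus>p\<in>{i. f i \<noteq> \<zero>} \<times> {i. g i \<noteq> \<zero>}.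
      if op (fst p) (snd p) = x then f (fst p) \<otimes> g (snd p) else \<zero>)" for x
    using f g fin by (intro conv_eq) auto
  have "conv R op f g x \<in> carrier R" for x
    unfolding eq using f g by (intro finsum_closed) (auto simp: fsupp_closed)
  moreover have "conv R op f g x = \<zero>" if x: "x \<notin> ?S" for x
    unfolding eq by (rule add.finprod_one_eqI) (use x in auto)
  ultimately have "{x. conv R op f g x \<noteq> \<zero>} \<subseteq> ?S" "\<forall>x. conv R op f g x \<in> carrier R" by blast+
  moreover have "?S \<subseteq> I" "finite ?S" using fin sub op_closed by auto
  ultimately show ?thesis by (auto simp: fsupp_def intro: finite_subset)
qed

lemma conv_add_left:
  assumes f: "f \<in> fsupp R I" and f': "f' \<in> fsupp R I" and g: "g \<in> fsupp R I"
  shows "conv R op (\<lambda>i. f i \<oplus> f' i) g = (\<lambda>x. conv R op f g x \<oplus> conv R op f' g x)"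
proof
  fix x
  let ?F = "{i. f i \<noteq> \<zero>} \<union> {i. f' i \<noteq> \<zero>}" and ?G = "{i. g i \<noteq> \<zero>}"
  have fin: "finite ?F" "finite ?G" using f f' g by (auto simp: fsupp_def)
  have "conv R op (\<lambda>i. f i \<oplus> f' i) g x = (\<Oplus>p\<in>?F \<times> ?G. (if op (fst p) (snd p) = x then (\<lambda>i. f i \<oplus> f' i) (fst p) \<otimes> g (snd p) else \<zero>))"
    using f f' g fsupp_add[OF f f'] fin by (intro conv_eq) auto
  also have "\<dots> = (\<Oplus>p\<in>?F \<times> ?G. (if op (fst p) (snd p) = x then f (fst p) \<otimes> g (snd p) else \<zero>) \<oplus> (if op (fst p) (snd p) = x then f' (fst p) \<otimes> g (snd p) else \<zero>))"
    by (rule finsum_cong') (simp_all add: fsupp_closed[OF f] fsupp_closed[OF f'] fsupp_closed[OF g] l_distr)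
  also have "\<dots> = (\<Oplus>p\<in>?F \<times> ?G. (if op (fst p) (snd p) = x then f (fst p) \<otimes> g (snd p) else \<zero>)) \<oplus> (\<Oplus>p\<in>?F \<times> ?G. (if op (fst p) (snd p) = x then f' (fst p) \<otimes> g (snd p) else \<zero>))"
    by (rule finsum_addf) (auto simp: fsupp_closed[OF f] fsupp_closed[OF f'] fsupp_closed[OF g])
  also have "(\<Oplus>p\<in>?F \<times> ?G. (if op (fst p) (snd p) = x then f (fst p) \<otimes> g (snd p) else \<zero>)) = conv R op f g x"
    using f f' g fin by (intro conv_eq[symmetric]) auto
  also have "(\<Oplus>p\<in>?F \<times> ?G. (if op (fst p) (snd p) = x then f' (fst p) \<otimes> g (snd p) else \<zero>)) = conv R op f' g x"
    using f f' g fin by (intro conv_eq[symmetric]) auto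
  finally show "conv R op (\<lambda>i. f i \<oplus> f' i) g x = conv R op f g x \<oplus> conv R op f' g x" .
qed

lemma conv_add_right:
  assumes f: "f \<in> fsupp R I" and g: "g \<in> fsupp R I" and g': "g' \<in> fsupp R I"
  shows "conv R op f (\<lambda>i. g i \<oplus> g' i) = (\<lambda>x. conv R op f g x \<oplus> conv R op f g' x)"
proof
  fix x
  let ?F = "{i. f i \<noteq> \<zero>}" and ?G = "{i. g i \<noteq> \<zero>} \<union> {i. g' i \<noteq> \<zero>}"
  have fin: "finite ?F" "finite ?G" using f g' g by (auto simp: fsupp_def)
  have "conv R op f (\<lambda>i. g i \<oplus> g' i) x = (\<Oplus>p\<in>?F \<times> ?G. (if op (fst p) (snd p) = x then f (fst p) \<otimes> (\<lambda>i. g i \<oplus> g' i) (snd p) else \<zero>))"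
    using f g g' fsupp_add[OF g g'] fin by (intro conv_eq) auto
  also have "\<dots> = (\<Oplus>p\<in>?F \<times> ?G. (if op (fst p) (snd p) = x then f (fst p) \<otimes> g (snd p) else \<zero>) \<oplus> (if op (fst p) (snd p) = x then f (fst p) \<otimes> g' (snd p) else \<zero>))"
    by (rule finsum_cong') (simp_all add: fsupp_closed[OF f] fsupp_closed[OF g] fsupp_closed[OF g'] r_distr)
  also have "\<dots> = (\<Oplus>p\<in>?F \<times> ?G. (if op (fst p) (snd p) = x then f (fst p) \<otimes> g (snd p) else \<zero>)) \<oplus> (\<Oplus>p\<in>?F \<times> ?G. (if op (fst p) (snd p) = x then f (fst p) \<otimes> g' (snd p) else \<zero>))"
    by (rule finsum_addf) (auto simp: fsupp_closed[OF f] fsupp_closed[OF g] fsupp_closed[OF g'])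
  also have "(\<Oplus>p\<in>?F \<times> ?G. (if op (fst p) (snd p) = x then f (fst p) \<otimes> g (snd p) else \<zero>)) = conv R op f g x"
    using f g g' fin by (intro conv_eq[symmetric]) auto
  also have "(\<Oplus>p\<in>?F \<times> ?G. (if op (fst p) (snd p) = x then f (fst p) \<otimes> g' (snd p) else \<zero>)) = conv R op f g' x"
    using f g g' fin by (intro conv_eq[symmetric]) auto
  finally show "conv R op f (\<lambda>i. g i \<oplus> g' i) x = conv R op f g x \<oplus> conv R op f g' x" .
qed

lemma conv_zero: "conv R op (\<lambda>_. \<zero>) g = (\<lambda>_. \<zero>)" "conv R op f (\<lambda>_. \<zero>) = (\<lambda>_. \<zero>)"
  by (auto simp: conv_def)

lemma conv_single:
  assumes "i \<in> I" "j \<in> I" "a \<in> carrier R" "b \<in> carrier R"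
  shows "conv R op (single R i a) (single R j b) = single R (op i j) (a \<otimes> b)"
proof
  fix x
  have "conv R op (single R i a) (single R j b) x = (\<Oplus>p\<in>{i} \<times> {j}.
    if op (fst p) (snd p) = x then single R i a (fst p) \<otimes> single R j b (snd p) else \<zero>)"
    using assms by (intro conv_eq fsupp_single) (auto simp: single_def)
  then show "conv R op (single R i a) (single R j b) x = single R (op i j) (a \<otimes> b) x"
    using assms by (auto simp: single_def)
qed

lemma conv_comm:
  assumes f: "f \<in> fsupp R I" and g: "g \<in> fsupp R I"
  shows "conv R op f g = conv R op g f"
  using f
proof (induction f rule: fsupp_induct)
  case zero
  then show ?case by (simp add: conv_zero)
next
  case (add i f')
  have fi: "f i \<in> carrier R" using f by (rule fsupp_closed)
  have "conv R op (single R i (f i)) g = conv R op g (single R i (f i))"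
    using g
  proof (induction g rule: fsupp_induct)
    case zero
    then show ?case by (simp add: conv_zero)
  next
    case (add j g')
    have gj: "g j \<in> carrier R" using g by (rule fsupp_closed)
    have "conv R op (single R i (f i)) (single R j (g j)) = conv R op (single R j (g j)) (single R i (f i))"
      unfolding conv_single[OF \<open>i \<in> I\<close> \<open>j \<in> I\<close> fi gj] conv_single[OF \<open>j \<in> I\<close> \<open>i \<in> I\<close> gj fi]
      by (simp only: op_comm[OF \<open>i \<in> I\<close> \<open>j \<in> I\<close>] m_comm[OF fi gj])
    then show ?case
      using conv_add_left[OF fsupp_single[OF add(1) gj] add(3) fsupp_single[OF \<open>i \<in> I\<close> fi]]
        conv_add_right[OF fsupp_single[OF \<open>i \<in> I\<close> fi] fsupp_single[OF add(1) gj] add(3)] add(5)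
      by simp
  qed
  then show ?case
    using conv_add_left[OF fsupp_single[OF add(1) fi] add(3) g]
      conv_add_right[OF g fsupp_single[OF add(1) fi] add(3)] add(5)
    by simp
qed

lemma conv_assoc:
  assumes f: "f \<in> fsupp R I" and g: "g \<in> fsupp R I" and h: "h \<in> fsupp R I"
  shows "conv R op (conv R op f g) h = conv R op f (conv R op g h)"
  using f
proof (induction f rule: fsupp_induct)
  case zero
  then show ?case by (simp add: conv_zero)
next
  case (add i f')
  let ?a = "single R i (f i)"
  have a: "?a \<in> fsupp R I" "f i \<in> carrier R" using add f by (auto intro: fsupp_single fsupp_closed)
  have "conv R op (conv R op ?a g) h = conv R op ?a (conv R op g h)"
    using g
  proof (induction g rule: fsupp_induct)
    case zero
    then show ?case by (simp add: conv_zero)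
  next
    case (add j g')
    let ?b = "single R j (g j)"
    have b: "?b \<in> fsupp R I" "g j \<in> carrier R" using add g by (auto intro: fsupp_single fsupp_closed)
    have "conv R op (conv R op ?a ?b) h = conv R op ?a (conv R op ?b h)"
      using h
    proof (induction h rule: fsupp_induct)
      case zero
      then show ?case by (simp add: conv_zero)
    next
      case (add k h')
      let ?c = "single R k (h k)"
      have c: "?c \<in> fsupp R I" "h k \<in> carrier R"
        using add h by (auto intro: fsupp_single fsupp_closed)
      have "conv R op (conv R op ?a ?b) ?c = conv R op ?a (conv R op ?b ?c)"
        using a(2) b(2) c(2) \<open>i \<in> I\<close> \<open>j \<in> I\<close> \<open>k \<in> I\<close>
        by (simp add: conv_single op_closed op_assoc m_assoc)
      then show ?case
        using conv_add_right[OF conv_closed[OF a(1) b(1)] c(1) add(3)]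
          conv_add_right[OF b(1) c(1) add(3)] add(5)
          conv_add_right[OF a(1) conv_closed[OF b(1) c(1)] conv_closed[OF b(1) add(3)]]
        by simp
    qed
    then show ?case
      using conv_add_right[OF a(1) b(1) add(3)] add(5) conv_add_left[OF b(1) add(3) h]
        conv_add_left[OF conv_closed[OF a(1) b(1)] conv_closed[OF a(1) add(3)] h]
        conv_add_right[OF a(1) conv_closed[OF b(1) h] conv_closed[OF add(3) h]]
      by simp
  qed
  then show ?case
    using conv_add_left[OF a(1) add(3) g] add(5)
      conv_add_left[OF conv_closed[OF a(1) g] conv_closed[OF add(3) g] h]
      conv_add_left[OF a(1) add(3) conv_closed[OF g h]]
    by simp
qed

lemma conv_unit:
  assumes f: "f \<in> fsupp R I"
  shows "conv R op (single R e \<one>) f = f"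
  using f
proof (induction f rule: fsupp_induct)
  case zero
  then show ?case by (simp add: conv_zero)
next
  case (add i f')
  have fi: "f i \<in> carrier R" using f by (rule fsupp_closed)
  show ?case
    using conv_add_right[OF fsupp_single[OF unit_closed one_closed] fsupp_single[OF add(1) fi] add(3)]
      add(1,5) fi conv_single[OF unit_closed add(1) one_closed fi] op_unit[OF add(1)]
    by simp
qed

lemma conv_ring_cring:
  assumes sub: "C \<subseteq> fsupp R I"
    and one: "single R e \<one> \<in> C" and zero: "(\<lambda>_. \<zero>) \<in> C"
    and add: "\<And>f g. f \<in> C \<Longrightarrow> g \<in> C \<Longrightarrow> (\<lambda>i. f i \<oplus> g i) \<in> C"
    and neg: "\<And>f. f \<in> C \<Longrightarrow> (\<lambda>i. \<ominus> f i) \<in> C"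
    and mult: "\<And>f g. f \<in> C \<Longrightarrow> g \<in> C \<Longrightarrow> conv R op f g \<in> C"
  shows "cring (conv_ring R op e C)"
proof -
  have c: "f i \<in> carrier R" if "f \<in> C" for f i
    using subsetD[OF sub that] by (rule fsupp_closed)
  show ?thesis
  proof (rule cringI)
    show "abelian_group (conv_ring R op e C)"
    proof (rule abelian_groupI)
      fix f assume "f \<in> carrier (conv_ring R op e C)"
      then show "\<exists>g\<in>carrier (conv_ring R op e C). g \<oplus>\<^bsub>conv_ring R op e C\<^esub> f = \<zero>\<^bsub>conv_ring R op e C\<^esub>"
        using neg by (intro bexI[of _ "\<lambda>i. \<ominus> f i"]) (auto simp: conv_ring_def c l_neg)
    qed (auto simp: conv_ring_def c add zero a_ac)
    show "Group.comm_monoid (conv_ring R op e C)"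
    proof (rule comm_monoidI)
      fix f g h
      assume fgh: "f \<in> carrier (conv_ring R op e C)" "g \<in> carrier (conv_ring R op e C)"
        "h \<in> carrier (conv_ring R op e C)"
      then have "f \<in> fsupp R I" "g \<in> fsupp R I" "h \<in> fsupp R I"
        using sub by (auto simp: conv_ring_def)
      then show "f \<otimes>\<^bsub>conv_ring R op e C\<^esub> g \<otimes>\<^bsub>conv_ring R op e C\<^esub> h =
          f \<otimes>\<^bsub>conv_ring R op e C\<^esub> (g \<otimes>\<^bsub>conv_ring R op e C\<^esub> h)"
        by (simp add: conv_ring_def conv_assoc)
    next
      fix f g assume "f \<in> carrier (conv_ring R op e C)" "g \<in> carrier (conv_ring R op e C)"
      then have fg: "f \<in> C" "g \<in> C" by (auto simp: conv_ring_def)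
      then show "f \<otimes>\<^bsub>conv_ring R op e C\<^esub> g \<in> carrier (conv_ring R op e C)"
        by (simp add: conv_ring_def mult)
      have "f \<in> fsupp R I" "g \<in> fsupp R I" using fg sub by auto
      then have "conv R op f g = conv R op g f" by (rule conv_comm)
      then show "f \<otimes>\<^bsub>conv_ring R op e C\<^esub> g = g \<otimes>\<^bsub>conv_ring R op e C\<^esub> f"
        by (simp add: conv_ring_def)
    next
      fix f assume "f \<in> carrier (conv_ring R op e C)"
      then have "f \<in> fsupp R I" using sub by (auto simp: conv_ring_def)
      then show "\<one>\<^bsub>conv_ring R op e C\<^esub> \<otimes>\<^bsub>conv_ring R op e C\<^esub> f = f"
        by (simp add: conv_ring_def conv_unit)
    qed (simp add: conv_ring_def one)
    fix f g h
    assume "f \<in> carrier (conv_ring R op e C)" "g \<in> carrier (conv_ring R op e C)"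
      "h \<in> carrier (conv_ring R op e C)"
    then have "f \<in> fsupp R I" "g \<in> fsupp R I" "h \<in> fsupp R I"
      using sub by (auto simp: conv_ring_def)
    then show "(f \<oplus>\<^bsub>conv_ring R op e C\<^esub> g) \<otimes>\<^bsub>conv_ring R op e C\<^esub> h =
        f \<otimes>\<^bsub>conv_ring R op e C\<^esub> h \<oplus>\<^bsub>conv_ring R op e C\<^esub> g \<otimes>\<^bsub>conv_ring R op e C\<^esub> h"
      by (simp add: conv_ring_def conv_add_left)
  qed
qed

end

section \<open>Graded reductions\<close>

definition gr_class :: "('a, 'm) ring_scheme \<Rightarrow> ('a \<Rightarrow> real) \<Rightarrow> (real \<Rightarrow> 'a) \<Rightarrow> (real \<Rightarrow> 'a) set" where
  "gr_class R w f = filt_ideal R w +>\<^bsub>filt_ring R w\<^esub> f"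

locale seminormed_cring = cring R for R (structure) +
  fixes w :: "'a \<Rightarrow> real"
  assumes w_nonneg: "x \<in> carrier R \<Longrightarrow> 0 \<le> w x"
    and w_zero: "w \<zero> = 0"
    and w_one: "w \<one> \<le> 1"
    and w_add: "x \<in> carrier R \<Longrightarrow> y \<in> carrier R \<Longrightarrow> w (x \<oplus> y) \<le> max (w x) (w y)"
    and w_uminus: "x \<in> carrier R \<Longrightarrow> w (\<ominus> x) = w x"
    and w_mult: "x \<in> carrier R \<Longrightarrow> y \<in> carrier R \<Longrightarrow> w (x \<otimes> y) \<le> w x * w y"
begin

abbreviation "FR \<equiv> filt_ring R w"
abbreviation "FI \<equiv> filt_ideal R w"
abbreviation "gr \<equiv> graded_reduction R w"

abbreviation "cls \<equiv> gr_class R w"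

interpretation convolution R "(*)" "1 :: real" "{0<..}"
  by unfold_locales auto

lemma w_finsum_le:
  assumes "finite S" "f \<in> S \<rightarrow> carrier R" "0 \<le> c" "\<And>i. i \<in> S \<Longrightarrow> w (f i) \<le> c"
  shows "w (finsum R f S) \<le> c"
  using assms
proof (induction S)
  case empty
  then show ?case by (simp add: w_zero)
next
  case (insert i S)
  have "w (f i \<oplus> finsum R f S) \<le> max (w (f i)) (w (finsum R f S))"
    using insert by (intro w_add finsum_closed) auto
  then show ?case using insert by fastforce
qed

lemma w_finsum_less:
  assumes "finite S" "f \<in> S \<rightarrow> carrier R" "0 < c" "\<And>i. i \<in> S \<Longrightarrow> w (f i) < c"
  shows "w (finsum R f S) < c"
  using assms
proof (induction S)
  case empty
  then show ?case by (simp add: w_zero)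
next
  case (insert i S)
  have "w (f i \<oplus> finsum R f S) \<le> max (w (f i)) (w (finsum R f S))"
    using insert by (intro w_add finsum_closed) auto
  then show ?case using insert by fastforce
qed

lemma filt_carrier: "carrier FR = {f \<in> fsupp R {0<..}. \<forall>\<gamma>>0. w (f \<gamma>) \<le> \<gamma>}"
proof -
  have "(\<forall>\<gamma>. f \<gamma> \<noteq> \<zero> \<longrightarrow> 0 < \<gamma> \<and> w (f \<gamma>) \<le> \<gamma>) \<longleftrightarrow>
      {\<gamma>. f \<gamma> \<noteq> \<zero>} \<subseteq> {0<..} \<and> (\<forall>\<gamma>>0. w (f \<gamma>) \<le> \<gamma>)" (is "?L \<longleftrightarrow> ?R") for f
  proof
    assume L: ?L
    have "w (f \<gamma>) \<le> \<gamma>" if "0 < \<gamma>" for \<gamma>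
      by (cases "f \<gamma> = \<zero>") (use L that w_zero in auto)
    then show ?R using L by auto
  qed auto
  then show ?thesis by (simp add: filt_ring_def conv_ring_def fsupp_def)
qed

lemma filt_ideal_eq: "FI = {f \<in> fsupp R {0<..}. \<forall>\<gamma>>0. w (f \<gamma>) < \<gamma>}"
proof -
  have "(\<forall>\<gamma>>0. w (f \<gamma>) \<le> \<gamma>) \<and> (\<forall>\<gamma>. f \<gamma> \<noteq> \<zero> \<longrightarrow> w (f \<gamma>) < \<gamma>) \<longleftrightarrow> (\<forall>\<gamma>>0. w (f \<gamma>) < \<gamma>)"
    (is "?L \<longleftrightarrow> ?R") if f: "f \<in> fsupp R {0<..}" for f
  proof
    assume L: ?L
    show ?R
    proof (intro allI impI)
      fix \<gamma> :: real assume "0 < \<gamma>"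
      then show "w (f \<gamma>) < \<gamma>" by (cases "f \<gamma> = \<zero>") (use L w_zero in auto)
    qed
  next
    assume R: ?R
    have "0 < \<gamma>" if "f \<gamma> \<noteq> \<zero>" for \<gamma> using f that unfolding fsupp_def by blast
    then show ?L using R by (auto intro: less_imp_le)
  qed
  then show ?thesis unfolding filt_ideal_def filt_carrier by blast
qed

lemma filt_conv:
  assumes f: "f \<in> carrier FR" and g: "g \<in> carrier FR"
  shows "conv R (*) f g \<in> carrier FR"
    and "f \<in> FI \<Longrightarrow> conv R (*) f g \<in> FI"
proof -
  have f': "f \<in> fsupp R {0<..}" and g': "g \<in> fsupp R {0<..}" using f g by (auto simp: filt_carrier)
  let ?F = "{i. f i \<noteq> \<zero>}" and ?G = "{i. g i \<noteq> \<zero>}"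
  have fin: "finite ?F" "finite ?G" and pos: "?F \<subseteq> {0<..}" "?G \<subseteq> {0<..}"
    using f' g' by (auto simp: fsupp_def)
  let ?t = "\<lambda>x p. if fst p * snd p = x then f (fst p) \<otimes> g (snd p) else \<zero>"
  have eq: "conv R (*) f g x = (\<Oplus>p\<in>?F \<times> ?G. ?t x p)" for x
    using f' g' fin by (intro conv_eq) auto
  have closed: "?t x \<in> ?F \<times> ?G \<rightarrow> carrier R" for x
    using fsupp_closed[OF f'] fsupp_closed[OF g'] by simp
  have prod: "w (f i \<otimes> g j) \<le> w (f i) * w (g j)" for i j
    by (rule w_mult[OF fsupp_closed[OF f'] fsupp_closed[OF g']])
  have nn: "0 \<le> w (f i)" "0 \<le> w (g i)" for i
    using w_nonneg[OF fsupp_closed[OF f']] w_nonneg[OF fsupp_closed[OF g']] .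
  have "w (conv R (*) f g x) \<le> x" if x: "x > 0" for x
    unfolding eq
  proof (rule w_finsum_le)
    fix p assume p: "p \<in> ?F \<times> ?G"
    have "w (f (fst p)) * w (g (snd p)) \<le> fst p * snd p"
      using p f g pos nn by (intro mult_mono) (auto simp: filt_carrier intro: less_imp_le)
    then show "w (?t x p) \<le> x"
      using prod[of "fst p" "snd p"] x by (auto simp: w_zero)
  qed (use x fin closed in auto)
  then show "conv R (*) f g \<in> carrier FR"
    using conv_closed[OF f' g'] by (simp add: filt_carrier)
  assume fI: "f \<in> FI"
  have "w (conv R (*) f g x) < x" if x: "x > 0" for x
    unfolding eq
  proof (rule w_finsum_less)
    fix p assume p: "p \<in> ?F \<times> ?G"
    have pp: "0 < fst p" "0 < snd p" using p pos by auto
    have "w (f (fst p)) * w (g (snd p)) \<le> w (f (fst p)) * snd p"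
      using pp g nn by (intro mult_left_mono) (auto simp: filt_carrier)
    also have "\<dots> < fst p * snd p"
      using pp fI by (intro mult_strict_right_mono) (auto simp: filt_ideal_eq)
    finally show "w (?t x p) < x"
      using prod[of "fst p" "snd p"] x by (auto simp: w_zero)
  qed (use x fin closed in auto)
  then show "conv R (*) f g \<in> FI"
    using conv_closed[OF f' g'] by (simp add: filt_ideal_eq)
qed

lemma filt_add: "f \<in> carrier FR \<Longrightarrow> g \<in> carrier FR \<Longrightarrow> (\<lambda>\<gamma>. f \<gamma> \<oplus> g \<gamma>) \<in> carrier FR"
  and filt_ideal_add: "f \<in> FI \<Longrightarrow> g \<in> FI \<Longrightarrow> (\<lambda>\<gamma>. f \<gamma> \<oplus> g \<gamma>) \<in> FI"
proof -
  have le: "w (f \<gamma> \<oplus> g \<gamma>) \<le> max (w (f \<gamma>)) (w (g \<gamma>))"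
    if "f \<in> fsupp R {0<..}" "g \<in> fsupp R {0<..}" for f g :: "real \<Rightarrow> 'a" and \<gamma>
    by (rule w_add[OF fsupp_closed[OF that(1)] fsupp_closed[OF that(2)]])
  show "(\<lambda>\<gamma>. f \<gamma> \<oplus> g \<gamma>) \<in> carrier FR" if "f \<in> carrier FR" "g \<in> carrier FR"
    using that le[of f g] fsupp_add[of f _ g] unfolding filt_carrier
    by (force intro: order_trans[OF le])
  show "(\<lambda>\<gamma>. f \<gamma> \<oplus> g \<gamma>) \<in> FI" if "f \<in> FI" "g \<in> FI"
    using that le[of f g] fsupp_add[of f _ g] unfolding filt_ideal_eq
    by (force intro: le_less_trans[OF le])
qed

lemma fsupp_uminus: "f \<in> fsupp R I \<Longrightarrow> (\<lambda>\<gamma>. \<ominus> f \<gamma>) \<in> fsupp R I"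
proof -
  assume f: "f \<in> fsupp R I"
  have "\<ominus> f \<gamma> \<noteq> \<zero> \<longleftrightarrow> f \<gamma> \<noteq> \<zero>" for \<gamma> using fsupp_closed[OF f, of \<gamma>] by auto
  then show ?thesis using f by (simp add: fsupp_def)
qed

lemma filt_uminus:
  shows "f \<in> carrier FR \<Longrightarrow> (\<lambda>\<gamma>. \<ominus> f \<gamma>) \<in> carrier FR" and "f \<in> FI \<Longrightarrow> (\<lambda>\<gamma>. \<ominus> f \<gamma>) \<in> FI"
proof -
  have eq: "w (\<ominus> f \<gamma>) = w (f \<gamma>)" if "f \<in> fsupp R {0<..}" for f :: "real \<Rightarrow> 'a" and \<gamma>
    by (rule w_uminus[OF fsupp_closed[OF that]])
  show "f \<in> carrier FR \<Longrightarrow> (\<lambda>\<gamma>. \<ominus> f \<gamma>) \<in> carrier FR" and "f \<in> FI \<Longrightarrow> (\<lambda>\<gamma>. \<ominus> f \<gamma>) \<in> FI"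
    by (simp_all add: filt_carrier filt_ideal_eq eq fsupp_uminus)
qed

lemma filt_single: "0 < \<gamma> \<Longrightarrow> a \<in> carrier R \<Longrightarrow> w a \<le> \<gamma> \<Longrightarrow> single R \<gamma> a \<in> carrier FR"
  by (simp add: filt_carrier fsupp_single) (simp add: single_def w_zero)

lemma filt_zero: "(\<lambda>_. \<zero>) \<in> FI" "(\<lambda>_. \<zero>) \<in> carrier FR"
  by (simp_all add: filt_ideal_eq filt_carrier fsupp_zero w_zero)

lemma filt_ring_cring: "cring FR"
  unfolding filt_ring_def
proof (rule conv_ring_cring)
  let ?C = "{f. (\<forall>\<gamma>. f \<gamma> \<in> carrier R) \<and> finite {\<gamma>. f \<gamma> \<noteq> \<zero>} \<and> (\<forall>\<gamma>. f \<gamma> \<noteq> \<zero> \<longrightarrow> 0 < \<gamma> \<and> w (f \<gamma>) \<le> \<gamma>)}"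
  have C: "?C = carrier FR" by (simp add: filt_ring_def conv_ring_def)
  show "?C \<subseteq> fsupp R {0<..}" unfolding C filt_carrier by blast
  show "single R 1 \<one> \<in> ?C" unfolding C by (intro filt_single) (auto simp: w_one)
  show "(\<lambda>_. \<zero>) \<in> ?C" unfolding C by (rule filt_zero)
  show "(\<lambda>i. f i \<oplus> g i) \<in> ?C" if "f \<in> ?C" "g \<in> ?C" for f g using that unfolding C by (rule filt_add)
  show "(\<lambda>i. \<ominus> f i) \<in> ?C" if "f \<in> ?C" for f using that unfolding C by (rule filt_uminus)
  show "conv R (*) f g \<in> ?C" if "f \<in> ?C" "g \<in> ?C" for f g using that unfolding C by (rule filt_conv)
qed

lemma filt_simps:
  "f \<oplus>\<^bsub>FR\<^esub> g = (\<lambda>\<gamma>. f \<gamma> \<oplus> g \<gamma>)" "f \<otimes>\<^bsub>FR\<^esub> g = conv R (*) f g" "\<zero>\<^bsub>FR\<^esub> = (\<lambda>_. \<zero>)" "\<one>\<^bsub>FR\<^esub> = single R 1 \<one>"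
  by (simp_all add: filt_ring_def conv_ring_def)

lemma filt_a_inv: "f \<in> carrier FR \<Longrightarrow> \<ominus>\<^bsub>FR\<^esub> f = (\<lambda>\<gamma>. \<ominus> f \<gamma>)"
proof -
  interpret F: cring FR by (rule filt_ring_cring)
  assume f: "f \<in> carrier FR"
  then have "f \<gamma> \<in> carrier R" for \<gamma> unfolding filt_carrier by (blast intro: fsupp_closed[of f "{0<..}"])
  then show ?thesis
    using f by (intro F.minus_equality) (auto simp: filt_simps l_neg filt_uminus)
qed

lemma filt_ideal_ideal: "ideal FI FR"
proof -
  interpret F: cring FR by (rule filt_ring_cring)
  have sub: "FI \<subseteq> carrier FR" by (auto simp: filt_ideal_eq filt_carrier intro: less_imp_le)
  show ?thesis
  proof (rule idealI[OF F.ring_axioms])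
    show "subgroup FI (add_monoid FR)"
    proof (rule F.add.subgroupI)
      show "FI \<subseteq> carrier FR" by (rule sub)
      show "FI \<noteq> {}" using filt_zero by blast
      show "\<ominus>\<^bsub>FR\<^esub> f \<in> FI" if "f \<in> FI" for f
        using that sub filt_a_inv[of f] filt_uminus(2)[of f] by auto
      show "f \<oplus>\<^bsub>FR\<^esub> g \<in> FI" if "f \<in> FI" "g \<in> FI" for f g
        using filt_ideal_add[OF that] by (simp add: filt_simps)
    qed
    fix f g assume f: "f \<in> FI" and g: "g \<in> carrier FR"
    show "f \<otimes>\<^bsub>FR\<^esub> g \<in> FI" using filt_conv(2)[of f g] f g sub by (auto simp: filt_simps)
    then show "g \<otimes>\<^bsub>FR\<^esub> f \<in> FI" using f g sub F.m_comm[of f g] by auto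
  qed
qed

sublocale FI: ideal FI FR
  by (rule filt_ideal_ideal)

lemma gr_cring: "cring gr"
  unfolding graded_reduction_def by (rule FI.quotient_is_cring[OF filt_ring_cring])

lemma cls_hom: "cls \<in> ring_hom FR gr"
  unfolding graded_reduction_def gr_class_def[abs_def] by (rule FI.rcos_ring_hom)

lemma gr_elem:
  assumes "X \<in> carrier gr"
  obtains f where "f \<in> carrier FR" "X = cls f"
  using assms unfolding graded_reduction_def gr_class_def[abs_def] FactRing_simps by auto

lemma cls_self: "f \<in> carrier FR \<Longrightarrow> f \<in> cls f"
  unfolding gr_class_def by (rule FI.a_rcos_self)

lemma filt_val: "f \<in> carrier FR \<Longrightarrow> f \<gamma> \<in> carrier R"
  unfolding filt_carrier by (blast intro: fsupp_closed[of f "{0<..}"])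

lemma filt_w: "f \<in> carrier FR \<Longrightarrow> 0 < \<gamma> \<Longrightarrow> w (f \<gamma>) \<le> \<gamma>"
  by (simp add: filt_carrier)

lemma cls_eq_iff:
  assumes f: "f \<in> carrier FR" and g: "g \<in> carrier FR"
  shows "cls f = cls g \<longleftrightarrow> (\<forall>\<gamma>>0. w (f \<gamma> \<ominus> g \<gamma>) < \<gamma>)"
proof -
  interpret F: cring FR by (rule filt_ring_cring)
  have "cls f = cls g \<longleftrightarrow> f \<ominus>\<^bsub>FR\<^esub> g \<in> FI"
    unfolding gr_class_def by (rule ring.quotient_eq_iff_same_a_r_cos[OF cring.axioms(1)[OF filt_ring_cring] filt_ideal_ideal f g, symmetric])
  also have "f \<ominus>\<^bsub>FR\<^esub> g = (\<lambda>\<gamma>. f \<gamma> \<ominus> g \<gamma>)"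
    using g by (simp add: a_minus_def filt_a_inv filt_simps)
  also have "\<dots> \<in> FI \<longleftrightarrow> (\<forall>\<gamma>>0. w (f \<gamma> \<ominus> g \<gamma>) < \<gamma>)"
    using fsupp_add[OF _ fsupp_uminus, of f "{0<..}" g] f g
    by (auto simp: filt_ideal_eq filt_carrier a_minus_def)
  finally show ?thesis .
qed

lemma symb_cls: "symb R w \<gamma> a = cls (single R \<gamma> a)"
  by (simp add: symb_def gr_class_def)

lemma symb_closed: "0 < \<gamma> \<Longrightarrow> a \<in> carrier R \<Longrightarrow> w a \<le> \<gamma> \<Longrightarrow> symb R w \<gamma> a \<in> carrier gr"
  unfolding symb_cls by (rule ring_hom_closed[OF cls_hom filt_single])

lemma symb_zero: "symb R w \<gamma> \<zero> = \<zero>\<^bsub>gr\<^esub>"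
proof -
  interpret H: ring_hom_cring FR gr cls
    by (intro ring_hom_cring.intro ring_hom_cring_axioms.intro cls_hom filt_ring_cring gr_cring)
  have "single R \<gamma> \<zero> = \<zero>\<^bsub>FR\<^esub>" by (auto simp: single_def filt_simps)
  then show ?thesis by (simp add: symb_cls)
qed

lemma symb_eq_iff:
  assumes "0 < \<gamma>" "a \<in> carrier R" "w a \<le> \<gamma>" "b \<in> carrier R" "w b \<le> \<gamma>"
  shows "symb R w \<gamma> a = symb R w \<gamma> b \<longleftrightarrow> w (a \<ominus> b) < \<gamma>"
proof -
  have "symb R w \<gamma> a = symb R w \<gamma> b \<longleftrightarrow> (\<forall>\<delta>>0. w (single R \<gamma> a \<delta> \<ominus> single R \<gamma> b \<delta>) < \<delta>)"
    unfolding symb_cls using assms by (intro cls_eq_iff filt_single)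
  also have "\<dots> \<longleftrightarrow> w (a \<ominus> b) < \<gamma>"
    using assms by (auto simp: single_def a_minus_def w_zero)
  finally show ?thesis .
qed

lemma symb_eq_zero_iff:
  assumes "0 < \<gamma>" "a \<in> carrier R" "w a \<le> \<gamma>"
  shows "symb R w \<gamma> a = \<zero>\<^bsub>gr\<^esub> \<longleftrightarrow> w a < \<gamma>"
  using symb_eq_iff[of \<gamma> a \<zero>] assms by (simp add: symb_zero w_zero a_minus_def)

lemma symb_mult:
  assumes "0 < \<gamma>" "a \<in> carrier R" "w a \<le> \<gamma>" "0 < \<delta>" "b \<in> carrier R" "w b \<le> \<delta>"
  shows "symb R w \<gamma> a \<otimes>\<^bsub>gr\<^esub> symb R w \<delta> b = symb R w (\<gamma> * \<delta>) (a \<otimes> b)"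
  using ring_hom_mult[OF cls_hom filt_single filt_single, of \<gamma> a \<delta> b] assms
  by (simp add: symb_cls filt_simps conv_single)

lemma symb_add:
  assumes "0 < \<gamma>" "a \<in> carrier R" "w a \<le> \<gamma>" "b \<in> carrier R" "w b \<le> \<gamma>"
  shows "symb R w \<gamma> a \<oplus>\<^bsub>gr\<^esub> symb R w \<gamma> b = symb R w \<gamma> (a \<oplus> b)"
proof -
  have "(\<lambda>\<delta>. single R \<gamma> a \<delta> \<oplus> single R \<gamma> b \<delta>) = single R \<gamma> (a \<oplus> b)"
    using assms by (auto simp: single_def)
  then show ?thesis
    using ring_hom_add[OF cls_hom filt_single filt_single, of \<gamma> a \<gamma> b] assms
    by (simp add: symb_cls filt_simps)
qed

lemma symb_one: "\<one>\<^bsub>gr\<^esub> = symb R w 1 \<one>"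
  using ring_hom_one[OF cls_hom] by (simp add: symb_cls filt_simps)

text \<open>Membership in \<^const>\<open>filt_ideal\<close> is tested degree by degree, so the choice of the representative
  does not affect the symbol.\<close>

definition gr_component :: "real \<Rightarrow> (real \<Rightarrow> 'a) set \<Rightarrow> (real \<Rightarrow> 'a) set" where
  "gr_component \<gamma> X = (if \<gamma> > 0 then symb R w \<gamma> ((SOME f. f \<in> carrier FR \<and> X = cls f) \<gamma>) else \<zero>\<^bsub>gr\<^esub>)"

lemma gr_component_cls:
  assumes f: "f \<in> carrier FR" and \<gamma>: "0 < \<gamma>"
  shows "gr_component \<gamma> (cls f) = symb R w \<gamma> (f \<gamma>)"
proof -
  define g where "g = (SOME g. g \<in> carrier FR \<and> cls f = cls g)"
  have g: "g \<in> carrier FR \<and> cls f = cls g"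
    unfolding g_def by (rule someI[of _ f]) (simp add: f)
  then have "w (f \<gamma> \<ominus> g \<gamma>) < \<gamma>" using cls_eq_iff[of f g] f \<gamma> by auto
  then have "symb R w \<gamma> (f \<gamma>) = symb R w \<gamma> (g \<gamma>)"
    using f g \<gamma> by (subst symb_eq_iff) (auto simp: filt_val filt_w)
  then show ?thesis using \<gamma> by (simp add: gr_component_def flip: g_def)
qed

lemma gr_component_symb:
  assumes "0 < \<gamma>" "a \<in> carrier R" "w a \<le> \<gamma>"
  shows "gr_component \<delta> (symb R w \<gamma> a) = (if \<delta> = \<gamma> then symb R w \<gamma> a else \<zero>\<^bsub>gr\<^esub>)"
proof (cases "\<delta> > 0")
  case True
  then show ?thesis
    using gr_component_cls[OF filt_single[OF assms] True] symb_zero[of \<delta>]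
    unfolding symb_cls[symmetric] by (simp add: single_def split: if_splits)
qed (use assms in \<open>auto simp: gr_component_def\<close>)

end

section \<open>Homogeneous components\<close>

text \<open>A grading by the multiplicative group of positive reals, given by its projections \<open>hc \<gamma>\<close> instead of
  its pieces, because the arguments below compare the components of one element with those of another.\<close>

locale graded_cring = cring R for R (structure) +
  fixes hc :: "real \<Rightarrow> 'a \<Rightarrow> 'a"
  assumes hc_closed: "x \<in> carrier R \<Longrightarrow> hc \<gamma> x \<in> carrier R"
    and hc_add: "x \<in> carrier R \<Longrightarrow> y \<in> carrier R \<Longrightarrow> hc \<gamma> (x \<oplus> y) = hc \<gamma> x \<oplus> hc \<gamma> y"
    and hc_hc: "x \<in> carrier R \<Longrightarrow> hc \<gamma> (hc \<delta> x) = (if \<gamma> = \<delta> then hc \<delta> x else \<zero>)"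
    and hc_finite: "x \<in> carrier R \<Longrightarrow> finite {\<gamma>. hc \<gamma> x \<noteq> \<zero>}"
    and hc_nonpos: "x \<in> carrier R \<Longrightarrow> \<gamma> \<le> 0 \<Longrightarrow> hc \<gamma> x = \<zero>"
    and hc_inj: "x \<in> carrier R \<Longrightarrow> (\<And>\<gamma>. hc \<gamma> x = \<zero>) \<Longrightarrow> x = \<zero>"
    and hc_mult: "x \<in> carrier R \<Longrightarrow> y \<in> carrier R \<Longrightarrow> 0 < \<gamma> \<Longrightarrow> 0 < \<delta> \<Longrightarrow>
      hc (\<gamma> * \<delta>) (hc \<gamma> x \<otimes> hc \<delta> y) = hc \<gamma> x \<otimes> hc \<delta> y"
begin

lemma hc_zero: "hc \<gamma> \<zero> = \<zero>"
  using hc_add[of \<zero> \<zero> \<gamma>] hc_closed[of \<zero> \<gamma>] by simp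

lemma hc_finsum:
  assumes "finite S" "f \<in> S \<rightarrow> carrier R"
  shows "hc \<gamma> (finsum R f S) = (\<Oplus>i\<in>S. hc \<gamma> (f i))"
  using assms
proof (induction S)
  case empty
  then show ?case by (simp add: hc_zero)
next
  case (insert i S)
  then have "f i \<in> carrier R" "f \<in> S \<rightarrow> carrier R" by auto
  then show ?case using insert
    by (subst (1 2) finsum_insert) (auto simp: hc_add hc_closed Pi_def)
qed

lemma hc_eqI:
  assumes x: "x \<in> carrier R" and y: "y \<in> carrier R" and eq: "\<And>\<gamma>. hc \<gamma> x = hc \<gamma> y"
  shows "x = y"
proof -
  have "hc \<gamma> (x \<ominus> y) = \<zero>" for \<gamma>
  proof -
    have "hc \<gamma> (x \<ominus> y) \<oplus> hc \<gamma> y = hc \<gamma> ((x \<ominus> y) \<oplus> y)" using x y by (simp add: hc_add)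
    also have "(x \<ominus> y) \<oplus> y = x" using x y by (simp add: a_minus_def a_assoc l_neg)
    finally have "hc \<gamma> (x \<ominus> y) \<oplus> hc \<gamma> y = hc \<gamma> y" by (simp only: eq)
    then show ?thesis
      by (simp only: add.r_cancel_one[OF hc_closed[OF y] hc_closed[OF minus_closed[OF x y]]])
  qed
  then have "x \<ominus> y = \<zero>" by (rule hc_inj[OF minus_closed[OF x y]])
  then show ?thesis by (simp only: r_right_minus_eq[OF x y])
qed

lemma hc_sum:
  assumes x: "x \<in> carrier R"
  shows "x = (\<Oplus>\<gamma>\<in>{\<gamma>. hc \<gamma> x \<noteq> \<zero>}. hc \<gamma> x)"
proof (rule hc_eqI[OF x])
  show "(\<Oplus>\<gamma>\<in>{\<gamma>. hc \<gamma> x \<noteq> \<zero>}. hc \<gamma> x) \<in> carrier R" using x by (auto intro!: finsum_closed simp: hc_closed)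
  fix \<delta>
  have "hc \<delta> (\<Oplus>\<gamma>\<in>{\<gamma>. hc \<gamma> x \<noteq> \<zero>}. hc \<gamma> x) = (\<Oplus>\<gamma>\<in>{\<gamma>. hc \<gamma> x \<noteq> \<zero>}. if \<delta> = \<gamma> then hc \<gamma> x else \<zero>)"
    using x by (subst hc_finsum) (auto simp: hc_finite hc_closed hc_hc)
  also have "\<dots> = hc \<delta> x"
  proof (cases "hc \<delta> x = \<zero>")
    case True
    then show ?thesis by (intro trans[OF add.finprod_one_eqI]) auto
  next
    case False
    then show ?thesis using x by (intro finsum_singleton) (auto simp: hc_finite hc_closed)
  qed
  finally show "hc \<delta> x = hc \<delta> (\<Oplus>\<gamma>\<in>{\<gamma>. hc \<gamma> x \<noteq> \<zero>}. hc \<gamma> x)" ..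
qed

lemma homogeneous_induct [consumes 1, case_names zero homogeneous add]:
  assumes x: "x \<in> carrier R"
    and zero: "P \<zero>"
    and hom: "\<And>\<gamma> h. 0 < \<gamma> \<Longrightarrow> h \<in> carrier R \<Longrightarrow> hc \<gamma> h = h \<Longrightarrow> h \<noteq> \<zero> \<Longrightarrow> P h"
    and add: "\<And>y z. y \<in> carrier R \<Longrightarrow> z \<in> carrier R \<Longrightarrow> P y \<Longrightarrow> P z \<Longrightarrow> P (y \<oplus> z)"
  shows "P x"
proof -
  have "P (\<Oplus>\<gamma>\<in>S. hc \<gamma> x)" if "finite S" "S \<subseteq> {\<gamma>. hc \<gamma> x \<noteq> \<zero>}" for S
    using that
  proof (induction S)
    case empty
    then show ?case using zero by simp
  next
    case (insert \<gamma> S)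
    have "0 < \<gamma>" using insert hc_nonpos[OF x, of \<gamma>] by (cases "0 < \<gamma>") auto
    then have "P (hc \<gamma> x)" using insert by (intro hom[of \<gamma>]) (auto simp: hc_hc hc_closed x)
    then show ?case using insert x
      by (subst finsum_insert) (auto intro!: add finsum_closed simp: hc_closed)
  qed
  from this[OF hc_finite[OF x] order_refl] show ?thesis using hc_sum[OF x] by simp
qed

lemma hc_homogeneous_mult:
  assumes \<sigma>: "0 < \<sigma>" and h: "h \<in> carrier R" "hc \<sigma> h = h" and y: "y \<in> carrier R"
  shows "hc (\<sigma> * \<rho>) (h \<otimes> y) = h \<otimes> hc \<rho> y"
  using y
proof (induction y rule: homogeneous_induct)
  case zero
  then show ?case using h by (simp add: hc_zero)
next
  case (homogeneous \<beta> y)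
  have "hc (\<sigma> * \<rho>) (h \<otimes> y) = hc (\<sigma> * \<rho>) (hc (\<sigma> * \<beta>) (h \<otimes> y))"
    using hc_mult[of h y \<sigma> \<beta>] \<sigma> h homogeneous by simp
  also have "\<dots> = (if \<rho> = \<beta> then hc (\<sigma> * \<beta>) (h \<otimes> y) else \<zero>)"
    using \<sigma> h homogeneous by (subst hc_hc) auto
  also have "\<dots> = h \<otimes> hc \<rho> y"
    using hc_mult[of h y \<sigma> \<beta>] \<sigma> h homogeneous hc_hc[of y \<rho> \<beta>] by auto
  finally show ?case .
next
  case (add y z)
  then show ?case using h by (simp add: r_distr hc_add hc_closed)
qed

text \<open>If \<open>\<sigma>\<rho>\<close> is a product of degrees of \<open>x\<close> and \<open>y\<close> in only one way, nothing can cancel.\<close>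

lemma hc_unique_product:
  assumes x: "x \<in> carrier R" and y: "y \<in> carrier R" and \<sigma>: "0 < \<sigma>"
    and unique: "\<And>\<alpha> \<beta>. hc \<alpha> x \<noteq> \<zero> \<Longrightarrow> hc \<beta> y \<noteq> \<zero> \<Longrightarrow> \<alpha> * \<beta> = \<sigma> * \<rho> \<Longrightarrow> \<alpha> = \<sigma>"
  shows "hc (\<sigma> * \<rho>) (x \<otimes> y) = hc \<sigma> x \<otimes> hc \<rho> y"
proof -
  let ?A = "{\<gamma>. hc \<gamma> x \<noteq> \<zero>}"
  have fin: "finite ?A" using x by (rule hc_finite)
  have cl: "hc \<alpha> x \<in> carrier R" "hc \<alpha> y \<in> carrier R" for \<alpha> using x y by (auto simp: hc_closed)
  have "x \<otimes> y = (\<Oplus>\<alpha>\<in>?A. hc \<alpha> x) \<otimes> y" using hc_sum[OF x] by simp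
  also have "\<dots> = (\<Oplus>\<alpha>\<in>?A. hc \<alpha> x \<otimes> y)" using fin y cl by (intro finsum_ldistr) auto
  finally have "hc (\<sigma> * \<rho>) (x \<otimes> y) = (\<Oplus>\<alpha>\<in>?A. hc (\<sigma> * \<rho>) (hc \<alpha> x \<otimes> y))"
    using fin y cl by (simp add: hc_finsum)
  also have "\<dots> = (\<Oplus>\<alpha>\<in>?A. if \<sigma> = \<alpha> then hc \<alpha> x \<otimes> hc \<rho> y else \<zero>)"
  proof (rule finsum_cong'[OF refl])
    fix \<alpha> assume \<alpha>: "\<alpha> \<in> ?A"
    then have pos: "0 < \<alpha>" using hc_nonpos[OF x, of \<alpha>] by (cases "0 < \<alpha>") auto
    have "hc (\<alpha> * (\<sigma> * \<rho> / \<alpha>)) (hc \<alpha> x \<otimes> y) = hc \<alpha> x \<otimes> hc (\<sigma> * \<rho> / \<alpha>) y"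
      using pos x y by (intro hc_homogeneous_mult) (auto simp: hc_closed hc_hc)
    moreover have "hc (\<sigma> * \<rho> / \<alpha>) y = \<zero>" if "\<sigma> \<noteq> \<alpha>"
      using unique[of \<alpha> "\<sigma> * \<rho> / \<alpha>"] that \<alpha> pos by auto
    ultimately show "hc (\<sigma> * \<rho>) (hc \<alpha> x \<otimes> y) = (if \<sigma> = \<alpha> then hc \<alpha> x \<otimes> hc \<rho> y else \<zero>)"
      using pos cl \<sigma> by auto
  qed (use cl in auto)
  also have "\<dots> = hc \<sigma> x \<otimes> hc \<rho> y"
  proof (cases "hc \<sigma> x = \<zero>")
    case True
    then show ?thesis using cl by (intro trans[OF add.finprod_one_eqI]) auto
  next
    case False
    then show ?thesis using cl fin by (intro finsum_singleton) auto
  qed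
  finally show ?thesis .
qed

definition degrees :: "'a \<Rightarrow> real set" where
  "degrees x = {\<gamma>. hc \<gamma> x \<noteq> \<zero>}"

lemma degrees_props:
  assumes "x \<in> carrier R"
  shows "finite (degrees x)" and "\<gamma> \<in> degrees x \<Longrightarrow> 0 < \<gamma>" and "x \<noteq> \<zero> \<Longrightarrow> degrees x \<noteq> {}"
  using hc_finite[OF assms] hc_nonpos[OF assms, of \<gamma>] hc_inj[OF assms]
  by (auto simp: degrees_def not_le intro: ccontr)

lemma hc_top_mult:
  assumes x: "x \<in> carrier R" "x \<noteq> \<zero>" and y: "y \<in> carrier R" "y \<noteq> \<zero>"
  shows "hc (Max (degrees x) * Max (degrees y)) (x \<otimes> y) = hc (Max (degrees x)) x \<otimes> hc (Max (degrees y)) y"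
proof (rule hc_unique_product[OF x(1) y(1)])
  note dx = degrees_props[OF x(1)] and dy = degrees_props[OF y(1)]
  show pos: "0 < Max (degrees x)" using dx x by auto
  fix \<alpha> \<beta> assume nz: "hc \<alpha> x \<noteq> \<zero>" "hc \<beta> y \<noteq> \<zero>" and eq: "\<alpha> * \<beta> = Max (degrees x) * Max (degrees y)"
  have \<alpha>: "\<alpha> \<in> degrees x" "0 < \<alpha>" and \<beta>: "\<beta> \<in> degrees y" "0 < \<beta>"
    using nz dx dy by (auto simp: degrees_def)
  have le: "\<alpha> \<le> Max (degrees x)" "\<beta> \<le> Max (degrees y)" using \<alpha> \<beta> dx dy by auto
  show "\<alpha> = Max (degrees x)"
  proof (rule ccontr)
    assume "\<alpha> \<noteq> Max (degrees x)"
    then have "\<alpha> * \<beta> < Max (degrees x) * Max (degrees y)"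
      using le \<alpha> \<beta> pos by (intro mult_less_le_imp_less) auto
    then show False using eq by simp
  qed
qed

lemma hc_bottom_mult:
  assumes x: "x \<in> carrier R" "x \<noteq> \<zero>" and y: "y \<in> carrier R" "y \<noteq> \<zero>"
  shows "hc (Min (degrees x) * Min (degrees y)) (x \<otimes> y) = hc (Min (degrees x)) x \<otimes> hc (Min (degrees y)) y"
proof (rule hc_unique_product[OF x(1) y(1)])
  note dx = degrees_props[OF x(1)] and dy = degrees_props[OF y(1)]
  show pos: "0 < Min (degrees x)" using dx x by auto
  have pos': "0 < Min (degrees y)" using dy y by auto
  fix \<alpha> \<beta> assume nz: "hc \<alpha> x \<noteq> \<zero>" "hc \<beta> y \<noteq> \<zero>" and eq: "\<alpha> * \<beta> = Min (degrees x) * Min (degrees y)"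
  have \<alpha>: "\<alpha> \<in> degrees x" "0 < \<alpha>" and \<beta>: "\<beta> \<in> degrees y" "0 < \<beta>"
    using nz dx dy by (auto simp: degrees_def)
  have le: "Min (degrees x) \<le> \<alpha>" "Min (degrees y) \<le> \<beta>" using \<alpha> \<beta> dx dy by auto
  show "\<alpha> = Min (degrees x)"
  proof (rule ccontr)
    assume "\<alpha> \<noteq> Min (degrees x)"
    then have "Min (degrees x) * Min (degrees y) < \<alpha> * \<beta>"
      using le \<alpha> \<beta> pos pos' by (intro mult_less_le_imp_less) auto
    then show False using eq by simp
  qed
qed

end

locale graded_field_ring = graded_cring +
  assumes homogeneous_unit: "0 < \<gamma> \<Longrightarrow> h \<in> carrier R \<Longrightarrow> hc \<gamma> h = h \<Longrightarrow> h \<noteq> \<zero> \<Longrightarrow> h \<in> Units R"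
    and one_not_zero: "\<one> \<noteq> \<zero>"
begin

lemma unit_mult_nonzero:
  assumes "u \<in> Units R" "y \<in> carrier R" "y \<noteq> \<zero>"
  shows "u \<otimes> y \<noteq> \<zero>"
proof
  assume "u \<otimes> y = \<zero>"
  then have "inv u \<otimes> (u \<otimes> y) = \<zero>" using assms by simp
  then show False using assms by (simp add: m_assoc[symmetric] Units_closed)
qed

lemma hc_unit:
  assumes "x \<in> carrier R" "\<gamma> \<in> degrees x"
  shows "hc \<gamma> x \<in> Units R"
  using assms degrees_props(2)[OF assms]
  by (intro homogeneous_unit[of \<gamma>]) (auto simp: hc_closed hc_hc degrees_def)

text \<open>The components of highest degree are units, so their product, the component of highest degree of
  the product, does not vanish.\<close>

lemma is_domain: "domain R"
proof (rule domainI)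
  show "\<one> \<noteq> \<zero>" by (rule one_not_zero)
  fix x y assume xy: "x \<otimes> y = \<zero>" and x: "x \<in> carrier R" and y: "y \<in> carrier R"
  show "x = \<zero> \<or> y = \<zero>"
  proof (rule ccontr)
    assume "\<not> (x = \<zero> \<or> y = \<zero>)"
    then have nz: "x \<noteq> \<zero>" "y \<noteq> \<zero>" by auto
    have M: "Max (degrees x) \<in> degrees x" "Max (degrees y) \<in> degrees y"
      using degrees_props[OF x] degrees_props[OF y] nz by (auto intro: Max_in)
    then have "hc (Max (degrees x)) x \<otimes> hc (Max (degrees y)) y \<noteq> \<zero>"
      using x y by (intro unit_mult_nonzero hc_unit) (auto simp: hc_closed degrees_def)
    then show False using hc_top_mult[OF x nz(1) y nz(2)] by (simp add: xy hc_zero)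
  qed
qed (rule is_cring)

text \<open>The highest and the lowest degree of \<open>x w\<close> add up from those of \<open>x\<close> and \<open>w\<close>. So if all
  degrees of \<open>x w\<close> are degrees of \<open>x\<close> shifted by \<open>\<kappa>\<close>, the highest and the lowest degree of \<open>w\<close>
  are both \<open>\<kappa>\<close>.\<close>

lemma homogeneous_quotient:
  assumes x: "x \<in> carrier R" "x \<noteq> \<zero>" and w: "w \<in> carrier R" and \<kappa>: "0 < \<kappa>"
    and shift: "\<And>\<gamma>. \<gamma> \<in> degrees (x \<otimes> w) \<Longrightarrow> \<gamma> / \<kappa> \<in> degrees x"
  shows "hc \<kappa> w = w"
proof (cases "w = \<zero>")
  case True
  then show ?thesis by (simp add: hc_zero)
next
  case False
  note dx = degrees_props[OF x(1)] and dw = degrees_props[OF w]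
  have nz: "hc \<alpha> x \<otimes> hc \<beta> w \<noteq> \<zero>" if "\<alpha> \<in> degrees x" "\<beta> \<in> degrees w" for \<alpha> \<beta>
    using that x w by (intro unit_mult_nonzero hc_unit) (auto simp: hc_closed degrees_def)
  have "Max (degrees x) * Max (degrees w) / \<kappa> \<in> degrees x"
    using nz[of "Max (degrees x)" "Max (degrees w)"] hc_top_mult[OF x w False] dx dw x False
    by (intro shift) (auto simp: degrees_def[of "x \<otimes> w"])
  then have "Max (degrees x) * Max (degrees w) / \<kappa> \<le> Max (degrees x)" using dx by auto
  then have up: "Max (degrees w) \<le> \<kappa>"
    using \<kappa> dx(1) dx(2)[of "Max (degrees x)"] dx(3) x by (simp add: field_simps)
  have "Min (degrees x) * Min (degrees w) / \<kappa> \<in> degrees x"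
    using nz[of "Min (degrees x)" "Min (degrees w)"] hc_bottom_mult[OF x w False] dx dw x False
    by (intro shift) (auto simp: degrees_def[of "x \<otimes> w"])
  then have "Min (degrees x) \<le> Min (degrees x) * Min (degrees w) / \<kappa>" using dx by auto
  then have low: "\<kappa> \<le> Min (degrees w)"
    using \<kappa> dx(1) dx(2)[of "Min (degrees x)"] dx(3) x by (simp add: field_simps)
  have "\<gamma> = \<kappa>" if "\<gamma> \<in> degrees w" for \<gamma>
    using that up low Max_ge[OF dw(1) that] Min_le[OF dw(1) that] by linarith
  then have zero: "hc \<gamma> w = \<zero>" if "\<gamma> \<noteq> \<kappa>" for \<gamma> using that unfolding degrees_def by blast
  show ?thesis
  proof (rule hc_eqI[OF hc_closed[OF w] w])
    fix \<gamma>
    show "hc \<gamma> (hc \<kappa> w) = hc \<gamma> w" by (cases "\<gamma> = \<kappa>") (simp_all add: hc_hc[OF w] zero)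
  qed
qed

end

context seminormed_cring
begin

lemma gr_component_symbE:
  assumes X: "X \<in> carrier gr" and \<gamma>: "0 < \<gamma>"
  obtains a where "a \<in> carrier R" "w a \<le> \<gamma>" "gr_component \<gamma> X = symb R w \<gamma> a"
  by (rule gr_elem[OF X]) (metis \<gamma> filt_val filt_w gr_component_cls)

lemma gr_graded: "graded_cring gr gr_component"
proof (intro graded_cring.intro graded_cring_axioms.intro gr_cring)
  interpret gr: cring gr by (rule gr_cring)
  have nonpos: "gr_component \<gamma> X = \<zero>\<^bsub>gr\<^esub>" if "\<gamma> \<le> 0" for \<gamma> X
    using that by (simp add: gr_component_def)
  fix X \<gamma> assume X: "X \<in> carrier gr"
  obtain f where f: "f \<in> carrier FR" "X = cls f" using X by (rule gr_elem)
  have fv: "f \<delta> \<in> carrier R" "0 < \<delta> \<Longrightarrow> w (f \<delta>) \<le> \<delta>" for \<delta> using f by (auto simp: filt_val filt_w)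
  show closed: "gr_component \<gamma> X \<in> carrier gr"
    using fv nonpos f by (cases "0 < \<gamma>") (auto simp: gr_component_cls symb_closed)
  show "gr_component \<gamma> X = \<zero>\<^bsub>gr\<^esub>" if "\<gamma> \<le> 0" using that by (rule nonpos)
  show "gr_component \<gamma> (gr_component \<delta> X) = (if \<gamma> = \<delta> then gr_component \<delta> X else \<zero>\<^bsub>gr\<^esub>)" for \<delta>
  proof (cases "0 < \<delta>")
    case True
    then show ?thesis using f fv by (simp add: gr_component_cls gr_component_symb)
  next
    case False
    then have "gr_component \<delta> X = symb R w 1 \<zero>" by (simp add: nonpos symb_zero)
    then show ?thesis using gr_component_symb[of 1 \<zero> \<gamma>] by (auto simp: symb_zero w_zero)
  qed
  have sub: "{\<gamma>. gr_component \<gamma> X \<noteq> \<zero>\<^bsub>gr\<^esub>} \<subseteq> {\<gamma>. f \<gamma> \<noteq> \<zero>}"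
  proof
    fix \<gamma> assume \<gamma>: "\<gamma> \<in> {\<gamma>. gr_component \<gamma> X \<noteq> \<zero>\<^bsub>gr\<^esub>}"
    then have "0 < \<gamma>" using nonpos[of \<gamma> X] by (cases "0 < \<gamma>") auto
    then show "\<gamma> \<in> {\<gamma>. f \<gamma> \<noteq> \<zero>}" using \<gamma> f by (auto simp: gr_component_cls symb_zero)
  qed
  have "finite {\<gamma>. f \<gamma> \<noteq> \<zero>}" using f unfolding filt_carrier fsupp_def by blast
  then show "finite {\<gamma>. gr_component \<gamma> X \<noteq> \<zero>\<^bsub>gr\<^esub>}" by (rule finite_subset[OF sub])
  show "X = \<zero>\<^bsub>gr\<^esub>" if all: "\<And>\<gamma>. gr_component \<gamma> X = \<zero>\<^bsub>gr\<^esub>"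
  proof -
    have "w (f \<gamma>) < \<gamma>" if "0 < \<gamma>" for \<gamma>
      using all[of \<gamma>] f fv[of \<gamma>] that by (simp add: gr_component_cls symb_eq_zero_iff)
    then have "cls f = cls (\<lambda>_. \<zero>)"
      using f fv by (subst cls_eq_iff) (auto simp: filt_zero a_minus_def)
    moreover have "single R 1 \<zero> = (\<lambda>_ :: real. \<zero>)" by (auto simp: single_def)
    ultimately show ?thesis using f symb_zero[of 1] by (simp add: symb_cls)
  qed
  fix Y assume Y: "Y \<in> carrier gr"
  obtain g where g: "g \<in> carrier FR" "Y = cls g" using Y by (rule gr_elem)
  have gv: "g \<delta> \<in> carrier R" "0 < \<delta> \<Longrightarrow> w (g \<delta>) \<le> \<delta>" for \<delta> using g by (auto simp: filt_val filt_w)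
  show "gr_component \<gamma> (X \<oplus>\<^bsub>gr\<^esub> Y) = gr_component \<gamma> X \<oplus>\<^bsub>gr\<^esub> gr_component \<gamma> Y"
  proof (cases "0 < \<gamma>")
    case True
    have "X \<oplus>\<^bsub>gr\<^esub> Y = cls (\<lambda>\<delta>. f \<delta> \<oplus> g \<delta>)"
      using ring_hom_add[OF cls_hom f(1) g(1)] f g by (simp add: filt_simps)
    then show ?thesis
      using True f g fv gv filt_add[OF f(1) g(1)] by (simp add: gr_component_cls symb_add)
  qed (simp add: nonpos)
  show "gr_component (\<gamma> * \<delta>) (gr_component \<gamma> X \<otimes>\<^bsub>gr\<^esub> gr_component \<delta> Y) =
      gr_component \<gamma> X \<otimes>\<^bsub>gr\<^esub> gr_component \<delta> Y" if "0 < \<gamma>" "0 < \<delta>" for \<delta>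
  proof -
    have "w (f \<gamma> \<otimes> g \<delta>) \<le> w (f \<gamma>) * w (g \<delta>)" by (rule w_mult[OF fv(1) gv(1)])
    also have "\<dots> \<le> \<gamma> * \<delta>" using that fv gv w_nonneg by (intro mult_mono) auto
    finally show ?thesis
      using that f g fv gv by (simp add: gr_component_cls symb_mult gr_component_symb)
  qed
qed

end

section \<open>Reductions of valued fields\<close>

lemma gr_map_cls:
  assumes R: "seminormed_cring R w" and S: "seminormed_cring S u" and h: "h \<in> ring_hom R S"
    and contr: "\<forall>x\<in>carrier R. u (h x) \<le> w x" and f: "f \<in> carrier (filt_ring R w)"
  shows "(\<lambda>\<gamma>. h (f \<gamma>)) \<in> carrier (filt_ring S u)"
    and "gr_map S u h (gr_class R w f) = gr_class S u (\<lambda>\<gamma>. h (f \<gamma>))"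
proof -
  interpret R: seminormed_cring R w by fact
  interpret S: seminormed_cring S u by fact
  interpret H: ring_hom_cring R S h
    by (intro ring_hom_cring.intro ring_hom_cring_axioms.intro h R.is_cring S.is_cring)
  have hf: "(\<lambda>\<gamma>. h (f \<gamma>)) \<in> carrier (filt_ring S u)" if f: "f \<in> carrier (filt_ring R w)" for f
  proof -
    have sub: "{\<gamma>. h (f \<gamma>) \<noteq> \<zero>\<^bsub>S\<^esub>} \<subseteq> {\<gamma>. f \<gamma> \<noteq> \<zero>\<^bsub>R\<^esub>}" by auto
    have f': "f \<in> fsupp R {0<..}" using f by (simp add: R.filt_carrier)
    then have "finite {\<gamma>. f \<gamma> \<noteq> \<zero>\<^bsub>R\<^esub>}" "{\<gamma>. f \<gamma> \<noteq> \<zero>\<^bsub>R\<^esub>} \<subseteq> {0<..}" by (simp_all add: fsupp_def)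
    then have "(\<lambda>\<gamma>. h (f \<gamma>)) \<in> fsupp S {0<..}"
      using sub R.filt_val[OF f] by (auto simp: fsupp_def dest: finite_subset[OF sub])
    then show ?thesis
      using R.filt_val[OF f] R.filt_w[OF f] contr by (auto simp: S.filt_carrier intro: order_trans)
  qed
  show "(\<lambda>\<gamma>. h (f \<gamma>)) \<in> carrier (filt_ring S u)" using f by (rule hf)
  have "gr_class S u (\<lambda>\<gamma>. h (g \<gamma>)) = gr_class S u (\<lambda>\<gamma>. h (f \<gamma>))" if g: "g \<in> gr_class R w f" for g
  proof -
    obtain i where i: "i \<in> filt_ideal R w" and gi: "g = (\<lambda>\<gamma>. i \<gamma> \<oplus>\<^bsub>R\<^esub> f \<gamma>)"
      using g by (auto simp: gr_class_def a_r_coset_def' R.filt_simps)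
    have iF: "i \<in> carrier (filt_ring R w)" using i by (rule R.FI.Icarr)
    have gF: "g \<in> carrier (filt_ring R w)" unfolding gi by (rule R.filt_add[OF iF f])
    have less: "w (g \<gamma> \<ominus>\<^bsub>R\<^esub> f \<gamma>) < \<gamma>" if "\<gamma> > 0" for \<gamma>
    proof -
      have "g \<gamma> \<ominus>\<^bsub>R\<^esub> f \<gamma> = i \<gamma>"
        using R.filt_val[OF iF, of \<gamma>] R.filt_val[OF f, of \<gamma>]
        by (simp add: gi a_minus_def R.a_assoc R.r_neg)
      then show ?thesis using i that by (simp add: R.filt_ideal_eq)
    qed
    have "u (h (g \<gamma>) \<ominus>\<^bsub>S\<^esub> h (f \<gamma>)) < \<gamma>" if "\<gamma> > 0" for \<gamma>
    proof -
      have "h (g \<gamma>) \<ominus>\<^bsub>S\<^esub> h (f \<gamma>) = h (g \<gamma> \<ominus>\<^bsub>R\<^esub> f \<gamma>)"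
        using R.filt_val[OF gF] R.filt_val[OF f] by (simp add: a_minus_def)
      then show ?thesis
        using bspec[OF contr, of "g \<gamma> \<ominus>\<^bsub>R\<^esub> f \<gamma>"] less[OF that] R.filt_val[OF gF] R.filt_val[OF f] by fastforce
    qed
    then show ?thesis using S.cls_eq_iff[OF hf[OF gF] hf[OF f]] by blast
  qed
  then show "gr_map S u h (gr_class R w f) = gr_class S u (\<lambda>\<gamma>. h (f \<gamma>))"
    using R.cls_self[OF f] unfolding gr_map_def gr_class_def[symmetric] by blast
qed

lemma gr_map_symb:
  assumes R: "seminormed_cring R w" and S: "seminormed_cring S u" and h: "h \<in> ring_hom R S"
    and contr: "\<forall>x\<in>carrier R. u (h x) \<le> w x"
    and a: "a \<in> carrier R" "w a \<le> \<gamma>" "0 < \<gamma>"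
  shows "gr_map S u h (symb R w \<gamma> a) = symb S u \<gamma> (h a)"
proof -
  interpret R: seminormed_cring R w by fact
  interpret S: seminormed_cring S u by fact
  interpret H: ring_hom_cring R S h
    by (intro ring_hom_cring.intro ring_hom_cring_axioms.intro h R.is_cring S.is_cring)
  have "(\<lambda>\<delta>. h (single R \<gamma> a \<delta>)) = single S \<gamma> (h a)" by (auto simp: single_def)
  then show ?thesis
    using gr_map_cls(2)[OF R S h contr R.filt_single[OF a(3,1,2)]]
    by (simp add: R.symb_cls S.symb_cls)
qed

lemma gr_map_hom:
  assumes R: "seminormed_cring R w" and S: "seminormed_cring S u" and h: "h \<in> ring_hom R S"
    and contr: "\<forall>x\<in>carrier R. u (h x) \<le> w x"
  shows "gr_map S u h \<in> ring_hom (graded_reduction R w) (graded_reduction S u)"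
proof -
  interpret R: seminormed_cring R w by fact
  interpret S: seminormed_cring S u by fact
  interpret gR: graded_cring "graded_reduction R w" R.gr_component by (rule R.gr_graded)
  interpret gS: cring "graded_reduction S u" by (rule S.gr_cring)
  interpret H: ring_hom_cring R S h
    by (intro ring_hom_cring.intro ring_hom_cring_axioms.intro h R.is_cring S.is_cring)
  note g1 = gr_map_cls(1)[OF R S h contr] and g2 = gr_map_cls(2)[OF R S h contr]
    and gs = gr_map_symb[OF R S h contr]
  let ?G = "gr_map S u h"
  have closed: "?G X \<in> carrier (graded_reduction S u)" if X: "X \<in> carrier (graded_reduction R w)" for X
  proof -
    obtain f where f: "f \<in> carrier (filt_ring R w)" "X = gr_class R w f" using X by (rule R.gr_elem)
    then show ?thesis using g2[OF f(1)] ring_hom_closed[OF S.cls_hom g1[OF f(1)]] by simp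
  qed
  have add: "?G (X \<oplus>\<^bsub>graded_reduction R w\<^esub> Y) = ?G X \<oplus>\<^bsub>graded_reduction S u\<^esub> ?G Y"
    if X: "X \<in> carrier (graded_reduction R w)" and Y: "Y \<in> carrier (graded_reduction R w)" for X Y
  proof -
    obtain f where f: "f \<in> carrier (filt_ring R w)" "X = gr_class R w f" using X by (rule R.gr_elem)
    obtain g where g: "g \<in> carrier (filt_ring R w)" "Y = gr_class R w g" using Y by (rule R.gr_elem)
    have "X \<oplus>\<^bsub>graded_reduction R w\<^esub> Y = gr_class R w (\<lambda>\<gamma>. f \<gamma> \<oplus>\<^bsub>R\<^esub> g \<gamma>)"
      using ring_hom_add[OF R.cls_hom f(1) g(1)] f g by (simp add: R.filt_simps)
    then have "?G (X \<oplus>\<^bsub>graded_reduction R w\<^esub> Y) = gr_class S u (\<lambda>\<gamma>. h (f \<gamma> \<oplus>\<^bsub>R\<^esub> g \<gamma>))"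
      using g2[OF R.filt_add[OF f(1) g(1)]] by simp
    also have "(\<lambda>\<gamma>. h (f \<gamma> \<oplus>\<^bsub>R\<^esub> g \<gamma>)) = (\<lambda>\<gamma>. h (f \<gamma>)) \<oplus>\<^bsub>filt_ring S u\<^esub> (\<lambda>\<gamma>. h (g \<gamma>))"
      using R.filt_val[OF f(1)] R.filt_val[OF g(1)] by (simp add: S.filt_simps)
    also have "gr_class S u \<dots> = ?G X \<oplus>\<^bsub>graded_reduction S u\<^esub> ?G Y"
      using ring_hom_add[OF S.cls_hom g1[OF f(1)] g1[OF g(1)]] g2[OF f(1)] g2[OF g(1)] f g by simp
    finally show ?thesis .
  qed
  have zero: "?G \<zero>\<^bsub>graded_reduction R w\<^esub> = \<zero>\<^bsub>graded_reduction S u\<^esub>"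
    using gs[of "\<zero>\<^bsub>R\<^esub>" 1] by (simp add: R.symb_zero S.symb_zero R.w_zero)
  have homog: "\<exists>a\<in>carrier R. w a \<le> \<gamma> \<and> x = symb R w \<gamma> a"
    if "0 < \<gamma>" "x \<in> carrier (graded_reduction R w)" "R.gr_component \<gamma> x = x" for \<gamma> x
    using R.gr_component_symbE[OF that(2,1)] that(3) by metis
  have mult: "?G (X \<otimes>\<^bsub>graded_reduction R w\<^esub> Y) = ?G X \<otimes>\<^bsub>graded_reduction S u\<^esub> ?G Y"
    if X: "X \<in> carrier (graded_reduction R w)" and Y: "Y \<in> carrier (graded_reduction R w)" for X Y
    using X
  proof (induction X rule: gR.homogeneous_induct)
    case zero
    then show ?case using Y closed[OF Y] by (simp add: \<open>?G \<zero>\<^bsub>_\<^esub> = _\<close>)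
  next
    case X: (homogeneous \<gamma> x)
    obtain a where a: "a \<in> carrier R" "w a \<le> \<gamma>" "x = symb R w \<gamma> a"
      using homog[OF X(1-3)] by blast
    show ?case
      using Y
    proof (induction Y rule: gR.homogeneous_induct)
      case zero
      then show ?case using X(2) closed[OF X(2)] by (simp add: \<open>?G \<zero>\<^bsub>_\<^esub> = _\<close>)
    next
      case Y: (homogeneous \<delta> y)
      obtain b where b: "b \<in> carrier R" "w b \<le> \<delta>" "y = symb R w \<delta> b"
        using homog[OF Y(1-3)] by blast
      have ab: "w (a \<otimes>\<^bsub>R\<^esub> b) \<le> \<gamma> * \<delta>"
        using R.w_mult[OF a(1) b(1)] mult_mono[OF a(2) b(2)] R.w_nonneg[OF b(1)] X(1) by linarith
      have "?G (x \<otimes>\<^bsub>graded_reduction R w\<^esub> y) = symb S u (\<gamma> * \<delta>) (h (a \<otimes>\<^bsub>R\<^esub> b))"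
        using gs[of "a \<otimes>\<^bsub>R\<^esub> b" "\<gamma> * \<delta>"] a b ab X(1) Y(1) by (simp add: R.symb_mult)
      also have "\<dots> = ?G x \<otimes>\<^bsub>graded_reduction S u\<^esub> ?G y"
        using a b X(1) Y(1) gs[of a \<gamma>] gs[of b \<delta>] bspec[OF contr a(1)] bspec[OF contr b(1)]
        by (simp add: S.symb_mult)
      finally show ?case .
    next
      case (add y z)
      then show ?case using X(2) closed by (simp add: gR.r_distr gS.r_distr \<open>\<And>X Y. _ \<Longrightarrow> _ \<Longrightarrow> ?G (X \<oplus>\<^bsub>_\<^esub> Y) = _\<close>)
    qed
  next
    case (add x z)
    then show ?case using Y closed by (simp add: gR.l_distr gS.l_distr \<open>\<And>X Y. _ \<Longrightarrow> _ \<Longrightarrow> ?G (X \<oplus>\<^bsub>_\<^esub> Y) = _\<close>)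
  qed
  have one: "?G \<one>\<^bsub>graded_reduction R w\<^esub> = \<one>\<^bsub>graded_reduction S u\<^esub>"
    using gs[of "\<one>\<^bsub>R\<^esub>" 1] by (simp add: R.symb_one S.symb_one R.w_one)
  show ?thesis by (rule ring_hom_memI) (simp_all add: closed mult add one)
qed

locale valued_field = field R for R (structure) +
  fixes v :: "'a \<Rightarrow> real"
  assumes nonarch: "nonarch_abs R v"
begin

lemma v_props:
  "x \<in> carrier R \<Longrightarrow> 0 \<le> v x" "x \<in> carrier R \<Longrightarrow> v x = 0 \<longleftrightarrow> x = \<zero>"
  "x \<in> carrier R \<Longrightarrow> y \<in> carrier R \<Longrightarrow> v (x \<otimes> y) = v x * v y"
  "x \<in> carrier R \<Longrightarrow> y \<in> carrier R \<Longrightarrow> v (x \<oplus> y) \<le> max (v x) (v y)"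
  using nonarch by (auto simp: nonarch_abs_def)

lemma v_one: "v \<one> = 1"
  using v_props(3)[of \<one> \<one>] v_props(2)[of \<one>] by simp

lemma v_uminus: "x \<in> carrier R \<Longrightarrow> v (\<ominus> x) = v x"
proof -
  assume x: "x \<in> carrier R"
  have "v (\<ominus> \<one>) * v (\<ominus> \<one>) = 1" using v_props(3)[of "\<ominus> \<one>" "\<ominus> \<one>"] v_one by (simp add: l_minus)
  then have "v (\<ominus> \<one>) = 1" using v_props(1)[of "\<ominus> \<one>"] by (simp add: square_eq_1_iff)
  then show ?thesis using v_props(3)[of "\<ominus> \<one>" x] x by (simp add: l_minus)
qed

sublocale seminormed_cring R v
  by unfold_locales (auto simp: v_props v_one v_uminus)

lemma v_pos: "x \<in> carrier R \<Longrightarrow> x \<noteq> \<zero> \<Longrightarrow> 0 < v x"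
  using v_props(1,2)[of x] by fastforce

lemma v_inv: "x \<in> carrier R \<Longrightarrow> x \<noteq> \<zero> \<Longrightarrow> inv x \<in> carrier R \<and> inv x \<noteq> \<zero> \<and> v (inv x) = 1 / v x"
proof -
  assume x: "x \<in> carrier R" "x \<noteq> \<zero>"
  then have u: "x \<in> Units R" by (simp add: field_Units)
  have "v x * v (inv x) = 1" using v_props(3)[of x "inv x"] u x by (simp add: v_one)
  then show ?thesis using u x v_props(2)[of "inv x"] v_pos[OF x] by (auto simp: field_simps)
qed

text \<open>A nonzero homogeneous element is the symbol of an element of that absolute value, and is
  inverted by the symbol of the inverse.\<close>

lemma homogeneous_symb:
  assumes X: "X \<in> carrier gr" "gr_component \<gamma> X = X" "X \<noteq> \<zero>\<^bsub>gr\<^esub>" and \<gamma>: "0 < \<gamma>"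
  obtains a where "a \<in> carrier R" "a \<noteq> \<zero>" "v a = \<gamma>" "X = symb R v \<gamma> a"
proof -
  obtain a where a: "a \<in> carrier R" "v a \<le> \<gamma>" "X = symb R v \<gamma> a"
    using gr_component_symbE[OF X(1) \<gamma>] X(2) by metis
  then have "\<not> v a < \<gamma>" using X(3) \<gamma> symb_eq_zero_iff by auto
  then show ?thesis using that[OF a(1) _ _ a(3)] a \<gamma> v_props(2)[OF a(1)] by auto
qed

lemma gr_graded_field: "graded_field_ring gr gr_component"
proof (intro graded_field_ring.intro graded_field_ring_axioms.intro gr_graded)
  interpret gr: cring gr by (rule gr_cring)
  show "\<one>\<^bsub>gr\<^esub> \<noteq> \<zero>\<^bsub>gr\<^esub>" using symb_eq_zero_iff[of 1 \<one>] by (simp add: symb_one v_one)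
  fix \<gamma> h assume h: "0 < \<gamma>" "h \<in> carrier gr" "gr_component \<gamma> h = h" "h \<noteq> \<zero>\<^bsub>gr\<^esub>"
  obtain a where a: "a \<in> carrier R" "a \<noteq> \<zero>" "v a = \<gamma>" "h = symb R v \<gamma> a"
    using homogeneous_symb[OF h(2-4,1)] by blast
  have i: "inv a \<in> carrier R" "v (inv a) = 1 / \<gamma>" using v_inv[OF a(1,2)] a by auto
  have "h \<otimes>\<^bsub>gr\<^esub> symb R v (1 / \<gamma>) (inv a) = symb R v 1 (a \<otimes> inv a)"
    using symb_mult[of \<gamma> a "1 / \<gamma>" "inv a"] a i h by simp
  also have "\<dots> = \<one>\<^bsub>gr\<^esub>" using a by (simp add: field_Units symb_one)
  finally show "h \<in> Units gr"
    unfolding Units_def using h(2) symb_closed[of "1 / \<gamma>" "inv a"] i h(1) gr.m_comm by fastforce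
qed

end

locale totally_ramified_extension =
  fixes k l :: "'a ring" and v :: "'a \<Rightarrow> real"
  assumes ext: "field_extension k l" and abs: "nonarch_abs l v" and total: "totally_ramified k l v"
begin

lemma k_simps: "x \<oplus>\<^bsub>k\<^esub> y = x \<oplus>\<^bsub>l\<^esub> y" "x \<otimes>\<^bsub>k\<^esub> y = x \<otimes>\<^bsub>l\<^esub> y" "\<zero>\<^bsub>k\<^esub> = \<zero>\<^bsub>l\<^esub>" "\<one>\<^bsub>k\<^esub> = \<one>\<^bsub>l\<^esub>"
proof -
  have "k = l\<lparr>carrier := carrier k\<rparr>" using ext by (simp add: field_extension_def)
  then have "\<exists>K. k = l\<lparr>carrier := K\<rparr>" by blast
  then show "x \<oplus>\<^bsub>k\<^esub> y = x \<oplus>\<^bsub>l\<^esub> y" "x \<otimes>\<^bsub>k\<^esub> y = x \<otimes>\<^bsub>l\<^esub> y" "\<zero>\<^bsub>k\<^esub> = \<zero>\<^bsub>l\<^esub>" "\<one>\<^bsub>k\<^esub> = \<one>\<^bsub>l\<^esub>" by auto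
qed

lemma k_subset: "x \<in> carrier k \<Longrightarrow> x \<in> carrier l"
  using ext subfieldE(3)[of "carrier k" l] by (auto simp: field_extension_def)

sublocale l: valued_field l v
  using ext abs by (auto simp: field_extension_def valued_field_def valued_field_axioms_def)

sublocale k: valued_field k v
proof (intro valued_field.intro valued_field_axioms.intro)
  show "field k"
    using l.subfield_iff(2)[of "carrier k"] ext by (simp add: field_extension_def)
  show "nonarch_abs k v"
    using abs k_subset unfolding nonarch_abs_def k_simps by blast
qed

abbreviation "kt \<equiv> graded_reduction k v"
abbreviation "lt \<equiv> graded_reduction l v"
abbreviation "\<iota> \<equiv> gr_map l v (\<lambda>c. c)"

sublocale kt: graded_cring kt k.gr_component
  by (rule k.gr_graded)

sublocale lt: graded_field_ring lt l.gr_component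
  by (rule l.gr_graded_field)

lemma incl_hom: "(\<lambda>c. c) \<in> ring_hom k l"
  by (rule ring_hom_memI) (auto simp: k_simps k_subset)

lemma iota_hom: "\<iota> \<in> ring_hom kt lt"
  by (rule gr_map_hom[OF k.seminormed_cring_axioms l.seminormed_cring_axioms incl_hom]) simp

lemma iota_symb: "a \<in> carrier k \<Longrightarrow> v a \<le> \<gamma> \<Longrightarrow> 0 < \<gamma> \<Longrightarrow> \<iota> (symb k v \<gamma> a) = symb l v \<gamma> a"
  by (rule gr_map_symb[OF k.seminormed_cring_axioms l.seminormed_cring_axioms incl_hom]) simp_all

sublocale iota: ring_hom_cring kt lt \<iota>
  by (intro ring_hom_cring.intro ring_hom_cring_axioms.intro iota_hom kt.is_cring lt.is_cring)

lemma iota_inj: "inj_on \<iota> (carrier kt)"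
proof (rule inj_onI)
  fix X Y assume X: "X \<in> carrier kt" and Y: "Y \<in> carrier kt" and eq: "\<iota> X = \<iota> Y"
  obtain f where f: "f \<in> carrier (filt_ring k v)" "X = gr_class k v f" using X by (rule k.gr_elem)
  obtain g where g: "g \<in> carrier (filt_ring k v)" "Y = gr_class k v g" using Y by (rule k.gr_elem)
  have "\<forall>x\<in>carrier k. v x \<le> v x" by simp
  note m = gr_map_cls[OF k.seminormed_cring_axioms l.seminormed_cring_axioms incl_hom this]
  have "gr_class l v f = gr_class l v g" using eq f g m(2)[OF f(1)] m(2)[OF g(1)] by simp
  then have "v (f \<gamma> \<ominus>\<^bsub>l\<^esub> g \<gamma>) < \<gamma>" if "\<gamma> > 0" for \<gamma>
    using l.cls_eq_iff[OF m(1)[OF f(1)] m(1)[OF g(1)]] that by blast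
  moreover have "f \<gamma> \<ominus>\<^bsub>k\<^esub> g \<gamma> = f \<gamma> \<ominus>\<^bsub>l\<^esub> g \<gamma>" for \<gamma>
  proof -
    interpret H: ring_hom_cring k l "\<lambda>c. c"
      by (intro ring_hom_cring.intro ring_hom_cring_axioms.intro incl_hom k.is_cring l.is_cring)
    show ?thesis using H.hom_a_inv[OF k.filt_val[OF g(1), of \<gamma>]] by (simp add: a_minus_def k_simps)
  qed
  ultimately show "X = Y" using k.cls_eq_iff[OF f(1) g(1)] f g by simp
qed

lemma unit_degree_image:
  assumes b: "b \<in> carrier l" "v b = 1"
  obtains c where "c \<in> carrier k" "v c \<le> 1" "symb l v 1 b = \<iota> (symb k v 1 c)"
proof -
  have "symb l v 1 b \<in> gr_part l v 1" using b by (auto simp: gr_part_def)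
  then have "symb l v 1 b \<in> \<iota> ` gr_part k v 1" using total by (simp add: totally_ramified_def)
  then show ?thesis using that by (auto simp: gr_part_def)
qed

text \<open>The values of \<open>k\<close> form a group, and as the extension is totally ramified, \<open>\<iota>\<close> is onto in
  these degrees. Keeping the components with these degrees is a \<open>kt\<close>-linear retraction of \<open>\<iota>\<close>.\<close>

lemma value_degree_image:
  assumes h: "h \<in> carrier lt" "l.gr_component \<gamma> h = h" "h \<noteq> \<zero>\<^bsub>lt\<^esub>" and \<gamma>: "\<gamma> \<in> value_set k v"
  shows "h \<in> \<iota> ` carrier kt"
proof -
  obtain c where c: "c \<in> carrier k" "c \<noteq> \<zero>\<^bsub>k\<^esub>" "v c = \<gamma>" using \<gamma> by (auto simp: value_set_def)
  then have pos: "0 < \<gamma>" using k.v_pos by blast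
  obtain a where a: "a \<in> carrier l" "a \<noteq> \<zero>\<^bsub>l\<^esub>" "v a = \<gamma>" "h = symb l v \<gamma> a"
    using l.homogeneous_symb[OF h pos] by blast
  have cl: "c \<in> carrier l" "c \<noteq> \<zero>\<^bsub>l\<^esub>" using c k_subset by (auto simp: k_simps)
  define b where "b = inv\<^bsub>l\<^esub> c \<otimes>\<^bsub>l\<^esub> a"
  have i: "inv\<^bsub>l\<^esub> c \<in> carrier l" "v (inv\<^bsub>l\<^esub> c) = 1 / \<gamma>" using l.v_inv[OF cl] c by auto
  have b: "b \<in> carrier l" "v b = 1" using i a pos by (auto simp: b_def l.v_props)
  have cb: "c \<otimes>\<^bsub>l\<^esub> b = a"
    using cl a i by (simp add: b_def l.m_assoc[symmetric] l.field_Units)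
  obtain e where e: "e \<in> carrier k" "v e \<le> 1" "symb l v 1 b = \<iota> (symb k v 1 e)"
    using unit_degree_image[OF b] .
  have "h = symb l v \<gamma> c \<otimes>\<^bsub>lt\<^esub> symb l v 1 b"
    using l.symb_mult[of \<gamma> c 1 b] cl b c pos cb a by simp
  also have "\<dots> = \<iota> (symb k v \<gamma> c) \<otimes>\<^bsub>lt\<^esub> \<iota> (symb k v 1 e)"
    using e c pos by (simp add: iota_symb)
  also have "\<dots> = \<iota> (symb k v \<gamma> c \<otimes>\<^bsub>kt\<^esub> symb k v 1 e)"
    using c e pos by (simp add: k.symb_closed)
  finally show ?thesis using c e pos by (auto intro!: imageI k.symb_closed)
qed

definition value_part :: "(real \<Rightarrow> 'a) set \<Rightarrow> (real \<Rightarrow> 'a) set" where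
  "value_part y = (\<Oplus>\<^bsub>lt\<^esub>\<gamma>\<in>lt.degrees y \<inter> value_set k v. l.gr_component \<gamma> y)"

lemma value_part_closed: "y \<in> carrier lt \<Longrightarrow> value_part y \<in> carrier lt"
  unfolding value_part_def by (auto intro!: lt.finsum_closed lt.hc_closed)

lemma value_part_component:
  assumes y: "y \<in> carrier lt"
  shows "l.gr_component \<delta> (value_part y) = (if \<delta> \<in> value_set k v then l.gr_component \<delta> y else \<zero>\<^bsub>lt\<^esub>)"
proof -
  let ?S = "lt.degrees y \<inter> value_set k v"
  have fin: "finite ?S" using lt.degrees_props[OF y] by auto
  have "l.gr_component \<delta> (value_part y)
    = (\<Oplus>\<^bsub>lt\<^esub>\<gamma>\<in>?S. if \<delta> = \<gamma> then l.gr_component \<gamma> y else \<zero>\<^bsub>lt\<^esub>)"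
    unfolding value_part_def using y fin
    by (subst lt.hc_finsum) (auto simp: lt.hc_closed lt.hc_hc)
  also have "\<dots> = (if \<delta> \<in> value_set k v then l.gr_component \<delta> y else \<zero>\<^bsub>lt\<^esub>)"
  proof (cases "\<delta> \<in> ?S")
    case True
    then show ?thesis using y fin by (subst lt.finsum_singleton) (auto simp: lt.hc_closed)
  next
    case False
    then have "(\<Oplus>\<^bsub>lt\<^esub>\<gamma>\<in>?S. if \<delta> = \<gamma> then l.gr_component \<gamma> y else \<zero>\<^bsub>lt\<^esub>) = \<zero>\<^bsub>lt\<^esub>"
      by (intro lt.add.finprod_one_eqI) auto
    then show ?thesis using False by (auto simp: lt.degrees_def)
  qed
  finally show ?thesis .
qed

lemma value_part_image:
  assumes y: "y \<in> carrier lt"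
  shows "value_part y \<in> \<iota> ` carrier kt"
proof -
  have "(\<Oplus>\<^bsub>lt\<^esub>\<gamma>\<in>S. l.gr_component \<gamma> y) \<in> \<iota> ` carrier kt"
    if "finite S" "S \<subseteq> lt.degrees y \<inter> value_set k v" for S
    using that
  proof (induction S)
    case empty
    have "\<iota> \<zero>\<^bsub>kt\<^esub> = \<zero>\<^bsub>lt\<^esub>" by simp
    then show ?case by (metis imageI lt.finsum_empty kt.zero_closed)
  next
    case (insert \<gamma> S)
    have "l.gr_component \<gamma> y \<in> \<iota> ` carrier kt"
      using insert y by (intro value_degree_image[of _ \<gamma>]) (auto simp: lt.hc_closed lt.hc_hc lt.degrees_def)
    then obtain c e where ce: "c \<in> carrier kt" "l.gr_component \<gamma> y = \<iota> c"
      "e \<in> carrier kt" "(\<Oplus>\<^bsub>lt\<^esub>\<gamma>\<in>S. l.gr_component \<gamma> y) = \<iota> e" using insert by auto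
    have "(\<Oplus>\<^bsub>lt\<^esub>\<gamma>\<in>insert \<gamma> S. l.gr_component \<gamma> y) = \<iota> (c \<oplus>\<^bsub>kt\<^esub> e)"
      using insert y ce by (subst lt.finsum_insert) (auto simp: lt.hc_closed)
    then show ?case using ce by (metis imageI kt.a_closed)
  qed
  then show ?thesis using lt.degrees_props[OF y] by (auto simp: value_part_def)
qed

lemma value_part_linear:
  assumes c: "c \<in> carrier kt" and y: "y \<in> carrier lt"
  shows "value_part (\<iota> c \<otimes>\<^bsub>lt\<^esub> y) = \<iota> c \<otimes>\<^bsub>lt\<^esub> value_part y"
proof (rule lt.hc_eqI)
  fix \<gamma>
  show "l.gr_component \<gamma> (value_part (\<iota> c \<otimes>\<^bsub>lt\<^esub> y)) = l.gr_component \<gamma> (\<iota> c \<otimes>\<^bsub>lt\<^esub> value_part y)"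
    using c
  proof (induction c rule: kt.homogeneous_induct)
    case zero
    then show ?case using y value_part_closed[OF y] by (simp add: value_part_component lt.hc_zero)
  next
    case (homogeneous \<delta> c)
    obtain a where a: "a \<in> carrier k" "a \<noteq> \<zero>\<^bsub>k\<^esub>" "v a = \<delta>" "c = symb k v \<delta> a"
      using k.homogeneous_symb[OF homogeneous(2,3,4,1)] by blast
    have hom: "l.gr_component \<delta> (\<iota> c) = \<iota> c"
      using a homogeneous(1) k_subset by (simp add: iota_symb l.gr_component_symb)
    have "\<gamma> \<in> value_set k v \<longleftrightarrow> \<gamma> / \<delta> \<in> value_set k v"
    proof
      assume "\<gamma> \<in> value_set k v"
      then obtain b where b: "b \<in> carrier k" "b \<noteq> \<zero>\<^bsub>k\<^esub>" "v b = \<gamma>" by (auto simp: value_set_def)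
      have i: "inv\<^bsub>k\<^esub> a \<in> carrier k" "inv\<^bsub>k\<^esub> a \<noteq> \<zero>\<^bsub>k\<^esub>" "v (inv\<^bsub>k\<^esub> a) = 1 / \<delta>"
        using k.v_inv[OF a(1,2)] a by auto
      then have "b \<otimes>\<^bsub>k\<^esub> inv\<^bsub>k\<^esub> a \<in> carrier k - {\<zero>\<^bsub>k\<^esub>}" "v (b \<otimes>\<^bsub>k\<^esub> inv\<^bsub>k\<^esub> a) = \<gamma> / \<delta>"
        using b k.integral by (auto simp: k.v_props)
      then show "\<gamma> / \<delta> \<in> value_set k v" unfolding value_set_def by (metis imageI)
    next
      assume "\<gamma> / \<delta> \<in> value_set k v"
      then have "\<exists>b\<in>carrier k - {\<zero>\<^bsub>k\<^esub>}. \<gamma> / \<delta> = v b" unfolding value_set_def by blast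
      then obtain b where b: "b \<in> carrier k" "b \<noteq> \<zero>\<^bsub>k\<^esub>" "v b = \<gamma> / \<delta>" by fastforce
      have "b \<otimes>\<^bsub>k\<^esub> a \<in> carrier k - {\<zero>\<^bsub>k\<^esub>}" "v (b \<otimes>\<^bsub>k\<^esub> a) = \<gamma>"
        using b a homogeneous(1) k.integral by (auto simp: k.v_props)
      then show "\<gamma> \<in> value_set k v" unfolding value_set_def by (metis imageI)
    qed
    moreover have "l.gr_component \<gamma> (\<iota> c \<otimes>\<^bsub>lt\<^esub> z) = \<iota> c \<otimes>\<^bsub>lt\<^esub> l.gr_component (\<gamma> / \<delta>) z" if "z \<in> carrier lt" for z
      using lt.hc_homogeneous_mult[OF homogeneous(1) _ hom that, of "\<gamma> / \<delta>"] homogeneous by simp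
    ultimately show ?case using y homogeneous(2)
      by (simp add: value_part_component value_part_closed)
  next
    case (add b c)
    have "l.gr_component \<gamma> (value_part (\<iota> (b \<oplus>\<^bsub>kt\<^esub> c) \<otimes>\<^bsub>lt\<^esub> y))
      = l.gr_component \<gamma> (value_part (\<iota> b \<otimes>\<^bsub>lt\<^esub> y)) \<oplus>\<^bsub>lt\<^esub> l.gr_component \<gamma> (value_part (\<iota> c \<otimes>\<^bsub>lt\<^esub> y))"
      using add(1,2) y by (simp add: lt.l_distr value_part_component lt.hc_add)
    also have "\<dots> = l.gr_component \<gamma> (\<iota> (b \<oplus>\<^bsub>kt\<^esub> c) \<otimes>\<^bsub>lt\<^esub> value_part y)"
      using add y by (simp add: lt.l_distr value_part_closed lt.hc_add)
    finally show ?case .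
  qed
qed (use c y in \<open>auto intro!: value_part_closed\<close>)

lemma linear_retraction:
  obtains retr where "\<And>y. y \<in> carrier lt \<Longrightarrow> retr y \<in> carrier kt" "retr \<one>\<^bsub>lt\<^esub> = \<one>\<^bsub>kt\<^esub>"
    "\<And>x y. x \<in> carrier lt \<Longrightarrow> y \<in> carrier lt \<Longrightarrow> retr (x \<oplus>\<^bsub>lt\<^esub> y) = retr x \<oplus>\<^bsub>kt\<^esub> retr y"
    "\<And>c y. c \<in> carrier kt \<Longrightarrow> y \<in> carrier lt \<Longrightarrow> retr (\<iota> c \<otimes>\<^bsub>lt\<^esub> y) = c \<otimes>\<^bsub>kt\<^esub> retr y"
proof -
  define retr where "retr = (\<lambda>y. inv_into (carrier kt) \<iota> (value_part y))"
  have mem: "retr y \<in> carrier kt" and eq: "\<iota> (retr y) = value_part y" if "y \<in> carrier lt" for y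
    unfolding retr_def by (rule inv_into_into[OF value_part_image[OF that]], rule f_inv_into_f[OF value_part_image[OF that]])
  have uniq: "retr y = c" if "y \<in> carrier lt" "c \<in> carrier kt" "value_part y = \<iota> c" for y c
    using inj_onD[OF iota_inj, of "retr y" c] mem eq that by simp
  have one: "1 \<in> value_set k v"
    unfolding value_set_def using k.v_one by (intro image_eqI[of _ _ "\<one>\<^bsub>k\<^esub>"]) auto
  have "value_part \<one>\<^bsub>lt\<^esub> = \<one>\<^bsub>lt\<^esub>"
  proof (rule lt.hc_eqI[OF value_part_closed[OF lt.one_closed] lt.one_closed])
    fix \<gamma>
    have "l.gr_component \<gamma> \<one>\<^bsub>lt\<^esub> = (if \<gamma> = 1 then \<one>\<^bsub>lt\<^esub> else \<zero>\<^bsub>lt\<^esub>)"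
      using l.gr_component_symb[of 1 "\<one>\<^bsub>l\<^esub>" \<gamma>] unfolding l.symb_one[symmetric]
      by (simp only: l.v_one order_refl zero_less_one l.one_closed)
    then show "l.gr_component \<gamma> (value_part \<one>\<^bsub>lt\<^esub>) = l.gr_component \<gamma> \<one>\<^bsub>lt\<^esub>"
      using one by (cases "\<gamma> = 1") (simp_all add: value_part_component[OF lt.one_closed])
  qed
  then have "retr \<one>\<^bsub>lt\<^esub> = \<one>\<^bsub>kt\<^esub>" by (intro uniq) auto
  moreover have "retr (x \<oplus>\<^bsub>lt\<^esub> y) = retr x \<oplus>\<^bsub>kt\<^esub> retr y" if xy: "x \<in> carrier lt" "y \<in> carrier lt" for x y
  proof (rule uniq)
    have "value_part (x \<oplus>\<^bsub>lt\<^esub> y) = value_part x \<oplus>\<^bsub>lt\<^esub> value_part y"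
      by (rule lt.hc_eqI) (use xy in \<open>simp_all add: value_part_closed value_part_component lt.hc_add\<close>)
    then show "value_part (x \<oplus>\<^bsub>lt\<^esub> y) = \<iota> (retr x \<oplus>\<^bsub>kt\<^esub> retr y)"
      using xy mem eq by simp
  qed (use xy mem in auto)
  moreover have "retr (\<iota> c \<otimes>\<^bsub>lt\<^esub> y) = c \<otimes>\<^bsub>kt\<^esub> retr y" if "c \<in> carrier kt" "y \<in> carrier lt" for c y
    using that mem eq by (intro uniq) (auto simp: value_part_linear)
  ultimately show ?thesis using that[of retr] mem by blast
qed

end

section \<open>Tensor products\<close>

locale tensor_product = C: cring C + S: cring S + T: cring T +
    i: ring_hom_cring C S i + j: ring_hom_cring C T j
  for C :: "'c ring" and S :: "'s ring" and T :: "'t ring" and i j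
begin

abbreviation "PP \<equiv> free_pairs S T"
abbreviation "KK \<equiv> Idl\<^bsub>PP\<^esub> (tensor_rels C S T i j)"
abbreviation "TP \<equiv> tensor C S T i j"
abbreviation "tn \<equiv> tens C S T i j"
abbreviation "mul \<equiv> \<lambda>z w. (fst z \<otimes>\<^bsub>S\<^esub> fst w, snd z \<otimes>\<^bsub>T\<^esub> snd w)"
abbreviation "II \<equiv> carrier S \<times> carrier T"

lemma Z_ring: "ring \<Z>"
  by (rule cring.axioms(1)[OF int_is_cring])

sublocale Z: convolution \<Z> mul "(\<one>\<^bsub>S\<^esub>, \<one>\<^bsub>T\<^esub>)" II
proof (intro convolution.intro convolution_axioms.intro)
  show "cring \<Z>" by (rule int_is_cring)
qed (auto simp: S.m_ac T.m_ac)

lemma free_carrier: "carrier PP = fsupp \<Z> II"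
  by (auto simp: free_pairs_def conv_ring_def fsupp_def)

lemma free_simps:
  "f \<oplus>\<^bsub>PP\<^esub> g = (\<lambda>z. f z + g z)" "f \<otimes>\<^bsub>PP\<^esub> g = conv \<Z> mul f g" "\<zero>\<^bsub>PP\<^esub> = (\<lambda>_. 0)"
  "\<one>\<^bsub>PP\<^esub> = pair_gen \<one>\<^bsub>S\<^esub> \<one>\<^bsub>T\<^esub>"
  by (simp_all add: free_pairs_def conv_ring_def pair_gen_def)

lemma free_uminus_closed: "f \<in> fsupp \<Z> II \<Longrightarrow> (\<lambda>z. - f z) \<in> fsupp \<Z> II"
  by (auto simp: fsupp_def)

sublocale P: cring PP
proof -
  have neg: "\<ominus>\<^bsub>\<Z>\<^esub> n = - n" for n :: int
    using Z.add.inv_unique'[of n "- n"] by (simp add: a_inv_def)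
  have "cring (conv_ring \<Z> mul (\<one>\<^bsub>S\<^esub>, \<one>\<^bsub>T\<^esub>) (fsupp \<Z> II))"
  proof (rule convolution.conv_ring_cring[OF Z.convolution_axioms])
    show "(\<lambda>z. \<ominus>\<^bsub>\<Z>\<^esub> f z) \<in> fsupp \<Z> II" if "f \<in> fsupp \<Z> II" for f
      using free_uminus_closed[OF that] by (simp only: neg)
    show "(\<lambda>z. f z \<oplus>\<^bsub>\<Z>\<^esub> g z) \<in> fsupp \<Z> II" if "f \<in> fsupp \<Z> II" "g \<in> fsupp \<Z> II" for f g
      using that by (rule ring.fsupp_add[OF Z_ring])
    show "(\<lambda>_. \<zero>\<^bsub>\<Z>\<^esub>) \<in> fsupp \<Z> II" by (rule ring.fsupp_zero[OF Z_ring])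
    show "single \<Z> (\<one>\<^bsub>S\<^esub>, \<one>\<^bsub>T\<^esub>) \<one>\<^bsub>\<Z>\<^esub> \<in> fsupp \<Z> II" by (rule ring.fsupp_single[OF Z_ring]) auto
  qed (auto intro: Z.conv_closed)
  moreover have "conv_ring \<Z> mul (\<one>\<^bsub>S\<^esub>, \<one>\<^bsub>T\<^esub>) (fsupp \<Z> II) = PP"
    unfolding free_carrier[symmetric] by (simp add: free_pairs_def conv_ring_def)
  ultimately show "cring PP" by simp
qed

lemma free_a_inv: "f \<in> carrier PP \<Longrightarrow> \<ominus>\<^bsub>PP\<^esub> f = (\<lambda>z. - f z)"
  by (rule P.minus_equality) (auto simp: free_simps free_carrier free_uminus_closed)

lemma single_closed: "x \<in> carrier S \<Longrightarrow> y \<in> carrier T \<Longrightarrow> single \<Z> (x, y) n \<in> carrier PP"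
  unfolding free_carrier by (rule ring.fsupp_single[OF Z_ring]) auto

lemma pair_gen_closed: "x \<in> carrier S \<Longrightarrow> y \<in> carrier T \<Longrightarrow> pair_gen x y \<in> carrier PP"
  unfolding pair_gen_def by (rule single_closed)

lemma rels_subset: "tensor_rels C S T i j \<subseteq> carrier PP"
  unfolding tensor_rels_def Let_def by (auto intro!: P.minus_closed P.add.m_closed pair_gen_closed)

sublocale K: ideal KK PP
  by (rule P.genideal_ideal[OF rels_subset])

lemma tensor_cring: "cring TP"
  unfolding tensor_def by (rule K.quotient_is_cring[OF P.is_cring])

definition tclass :: "('s \<times> 't \<Rightarrow> int) \<Rightarrow> ('s \<times> 't \<Rightarrow> int) set" where
  "tclass f = KK +>\<^bsub>PP\<^esub> f"

lemma tclass_hom: "tclass \<in> ring_hom PP TP"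
  unfolding tensor_def tclass_def[abs_def] by (rule K.rcos_ring_hom)

lemma tens_class: "tn x y = tclass (pair_gen x y)"
  by (simp add: tens_def tclass_def)

lemma tensor_elem:
  assumes "X \<in> carrier TP"
  obtains f where "f \<in> carrier PP" "X = tclass f"
  using assms unfolding tensor_def tclass_def[abs_def] FactRing_simps by auto

lemma tclass_eq_iff: "f \<in> carrier PP \<Longrightarrow> g \<in> carrier PP \<Longrightarrow> tclass f = tclass g \<longleftrightarrow> f \<ominus>\<^bsub>PP\<^esub> g \<in> KK"
  unfolding tclass_def by (rule P.quotient_eq_iff_same_a_r_cos[OF K.is_ideal, symmetric])

lemma tens_closed: "x \<in> carrier S \<Longrightarrow> y \<in> carrier T \<Longrightarrow> tn x y \<in> carrier TP"
  unfolding tens_class by (rule ring_hom_closed[OF tclass_hom pair_gen_closed])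

lemma rel_mem: "g \<in> tensor_rels C S T i j \<Longrightarrow> g \<in> KK"
  using P.genideal_self[OF rels_subset] by blast

lemma tens_add_left:
  assumes "x \<in> carrier S" "x' \<in> carrier S" "y \<in> carrier T"
  shows "tn (x \<oplus>\<^bsub>S\<^esub> x') y = tn x y \<oplus>\<^bsub>TP\<^esub> tn x' y"
proof -
  have "pair_gen (x \<oplus>\<^bsub>S\<^esub> x') y \<ominus>\<^bsub>PP\<^esub> (pair_gen x y \<oplus>\<^bsub>PP\<^esub> pair_gen x' y) \<in> KK"
    by (rule rel_mem) (use assms in \<open>unfold tensor_rels_def Let_def, blast\<close>)
  then have "tclass (pair_gen (x \<oplus>\<^bsub>S\<^esub> x') y) = tclass (pair_gen x y \<oplus>\<^bsub>PP\<^esub> pair_gen x' y)"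
    using assms by (subst tclass_eq_iff) (auto intro!: pair_gen_closed)
  then show ?thesis
    using assms ring_hom_add[OF tclass_hom, of "pair_gen x y" "pair_gen x' y"]
    by (simp add: tens_class pair_gen_closed)
qed

lemma tens_balanced:
  assumes "x \<in> carrier S" "c \<in> carrier C" "y \<in> carrier T"
  shows "tn (x \<otimes>\<^bsub>S\<^esub> i c) y = tn x (j c \<otimes>\<^bsub>T\<^esub> y)"
proof -
  have "pair_gen (x \<otimes>\<^bsub>S\<^esub> i c) y \<ominus>\<^bsub>PP\<^esub> pair_gen x (j c \<otimes>\<^bsub>T\<^esub> y) \<in> KK"
    by (rule rel_mem) (use assms in \<open>unfold tensor_rels_def Let_def, blast\<close>)
  then show ?thesis
    unfolding tens_class using assms by (subst tclass_eq_iff) (auto intro!: pair_gen_closed)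
qed

lemma tens_mult:
  assumes "x \<in> carrier S" "x' \<in> carrier S" "y \<in> carrier T" "y' \<in> carrier T"
  shows "tn x y \<otimes>\<^bsub>TP\<^esub> tn x' y' = tn (x \<otimes>\<^bsub>S\<^esub> x') (y \<otimes>\<^bsub>T\<^esub> y')"
proof -
  have "pair_gen x y \<otimes>\<^bsub>PP\<^esub> pair_gen x' y' = pair_gen (x \<otimes>\<^bsub>S\<^esub> x') (y \<otimes>\<^bsub>T\<^esub> y')"
    unfolding free_simps pair_gen_def using assms by (subst Z.conv_single) auto
  then show ?thesis
    using assms ring_hom_mult[OF tclass_hom, of "pair_gen x y" "pair_gen x' y'"]
    by (simp add: tens_class pair_gen_closed)
qed

lemma tens_one: "\<one>\<^bsub>TP\<^esub> = tn \<one>\<^bsub>S\<^esub> \<one>\<^bsub>T\<^esub>"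
  using ring_hom_one[OF tclass_hom] by (simp add: tens_class free_simps)

lemma tens_left_hom: "(\<lambda>x. tn x \<one>\<^bsub>T\<^esub>) \<in> ring_hom S TP"
  by (rule ring_hom_memI) (auto simp: tens_closed tens_mult tens_add_left tens_one)

lemma tensor_induct [consumes 1, case_names zero tens add]:
  assumes X: "X \<in> carrier TP"
    and zero: "P \<zero>\<^bsub>TP\<^esub>"
    and tens: "\<And>x y. x \<in> carrier S \<Longrightarrow> y \<in> carrier T \<Longrightarrow> P (tn x y)"
    and add: "\<And>X Y. X \<in> carrier TP \<Longrightarrow> Y \<in> carrier TP \<Longrightarrow> P X \<Longrightarrow> P Y \<Longrightarrow> P (X \<oplus>\<^bsub>TP\<^esub> Y)"
  shows "P X"
proof -
  interpret TP: cring TP by (rule tensor_cring)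
  interpret H: ring_hom_cring PP TP tclass
    by (intro ring_hom_cring.intro ring_hom_cring_axioms.intro tclass_hom P.is_cring tensor_cring)
  have zero': "P (tclass (\<lambda>_. 0))" using zero H.hom_zero by (simp add: free_simps)
  have add': "P (tclass (\<lambda>z. f z + g z))"
    if "f \<in> carrier PP" "g \<in> carrier PP" "P (tclass f)" "P (tclass g)" for f g
    using that H.hom_add[OF that(1,2)] add[of "tclass f" "tclass g"] by (simp add: free_simps)
  have single: "P (tclass (single \<Z> (x, y) n))" if xy: "x \<in> carrier S" "y \<in> carrier T" for x y n
  proof -
    have plus: "single \<Z> (x, y) (a + b) = (\<lambda>z. single \<Z> (x, y) a z + single \<Z> (x, y) b z)" for a b
      by (auto simp: single_def)
    have 1: "P (tclass (single \<Z> (x, y) 1))"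
      using tens[OF xy] by (simp add: tens_class pair_gen_def)
    have "tn (\<ominus>\<^bsub>S\<^esub> x) y \<oplus>\<^bsub>TP\<^esub> tn x y = tn \<zero>\<^bsub>S\<^esub> y"
      using xy by (simp add: S.l_neg flip: tens_add_left)
    also have "tn \<zero>\<^bsub>S\<^esub> y = \<zero>\<^bsub>TP\<^esub>"
      using tens_add_left[of "\<zero>\<^bsub>S\<^esub>" "\<zero>\<^bsub>S\<^esub>" y] xy tens_closed[of "\<zero>\<^bsub>S\<^esub>" y] by simp
    finally have "\<ominus>\<^bsub>TP\<^esub> tn x y = tn (\<ominus>\<^bsub>S\<^esub> x) y"
      using xy by (intro TP.minus_equality) (auto simp: tens_closed)
    moreover have "\<ominus>\<^bsub>TP\<^esub> tn x y = tclass (\<ominus>\<^bsub>PP\<^esub> pair_gen x y)"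
      using xy by (simp add: tens_class pair_gen_closed)
    moreover have "\<ominus>\<^bsub>PP\<^esub> pair_gen x y = single \<Z> (x, y) (- 1)"
      unfolding free_a_inv[OF pair_gen_closed[OF xy]] by (auto simp: pair_gen_def single_def)
    ultimately have 2: "P (tclass (single \<Z> (x, y) (- 1)))"
      using tens[of "\<ominus>\<^bsub>S\<^esub> x" y] xy by simp
    show ?thesis
    proof (induction n rule: int_induct[where k = 0])
      case base
      have "single \<Z> (x, y) 0 = (\<lambda>_. 0)" by (auto simp: single_def)
      then show ?case using zero' by simp
    next
      case (step1 n)
      then show ?case unfolding plus using 1 xy by (intro add' single_closed) auto
    next
      case (step2 n)
      have "single \<Z> (x, y) (n - 1) = (\<lambda>z. single \<Z> (x, y) n z + single \<Z> (x, y) (- 1) z)"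
        using plus[of n "- 1"] by simp
      then show ?case using step2 2 xy by (auto intro!: add' single_closed)
    qed
  qed
  obtain f where f: "f \<in> carrier PP" "X = tclass f" using X by (rule tensor_elem)
  have "f \<in> fsupp \<Z> II" using f by (simp add: free_carrier)
  then have "P (tclass f)"
  proof (induction f rule: ring.fsupp_induct[OF Z_ring, consumes 1, case_names zero add])
    case zero
    then show ?case using zero' by simp
  next
    case (add z g)
    obtain x y where z: "z = (x, y)" "x \<in> carrier S" "y \<in> carrier T" using add(1) by auto
    have "P (tclass (\<lambda>w. single \<Z> z (f z) w + g w))"
      using add z by (intro add' single) (auto simp: free_carrier intro!: ring.fsupp_single[OF Z_ring] single)
    then show ?case by simp
  qed
  then show ?thesis using f by simp
qed

text \<open>A \<open>C\<close>-linear map \<open>retr\<close> from \<open>T\<close> to \<open>C\<close> with \<open>retr 1 = 1\<close> induces a map from the tensor product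
  to \<open>S\<close> that inverts \<open>x \<mapsto> x \<otimes> 1\<close>. On the free group it is the \<open>pairing\<close> below; the elements
  all of whose multiples pair to zero form an ideal, which contains the relations.\<close>

context
  fixes retr
  assumes retr_closed: "\<And>y. y \<in> carrier T \<Longrightarrow> retr y \<in> carrier C" and retr_one: "retr \<one>\<^bsub>T\<^esub> = \<one>\<^bsub>C\<^esub>"
    and retr_add: "\<And>x y. x \<in> carrier T \<Longrightarrow> y \<in> carrier T \<Longrightarrow> retr (x \<oplus>\<^bsub>T\<^esub> y) = retr x \<oplus>\<^bsub>C\<^esub> retr y"
    and retr_linear: "\<And>c y. c \<in> carrier C \<Longrightarrow> y \<in> carrier T \<Longrightarrow> retr (j c \<otimes>\<^bsub>T\<^esub> y) = c \<otimes>\<^bsub>C\<^esub> retr y"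
begin

definition scal :: "'s \<times> 't \<Rightarrow> 's" where
  "scal z = fst z \<otimes>\<^bsub>S\<^esub> i (retr (snd z))"

definition pairing :: "('s \<times> 't \<Rightarrow> int) \<Rightarrow> 's" where
  "pairing f = (\<Oplus>\<^bsub>S\<^esub>z\<in>{z. f z \<noteq> 0}. [f z] \<cdot>\<^bsub>S\<^esub> scal z)"

lemma scal_closed: "z \<in> II \<Longrightarrow> scal z \<in> carrier S"
  by (auto simp: scal_def retr_closed)

lemma pairing_eq:
  assumes f: "f \<in> fsupp \<Z> II" and A: "finite A" "{z. f z \<noteq> 0} \<subseteq> A" "A \<subseteq> II"
  shows "pairing f = (\<Oplus>\<^bsub>S\<^esub>z\<in>A. [f z] \<cdot>\<^bsub>S\<^esub> scal z)"
proof -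
  have "[f z] \<cdot>\<^bsub>S\<^esub> scal z \<in> carrier S" if "z \<in> A" for z
    using scal_closed[of z] that A by (auto intro!: S.add.int_pow_closed)
  then show ?thesis
    unfolding pairing_def using A
    by (intro S.add.finprod_mono_neutral_cong_left) (auto simp: add_pow_def)
qed

lemma pairing_closed: "f \<in> fsupp \<Z> II \<Longrightarrow> pairing f \<in> carrier S"
  unfolding pairing_def fsupp_def
  by (auto intro!: S.finsum_closed S.add.int_pow_closed scal_closed)

lemma pairing_add:
  assumes f: "f \<in> fsupp \<Z> II" and g: "g \<in> fsupp \<Z> II"
  shows "pairing (\<lambda>z. f z + g z) = pairing f \<oplus>\<^bsub>S\<^esub> pairing g"
proof -
  let ?A = "{z. f z \<noteq> 0} \<union> {z. g z \<noteq> 0}"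
  have A: "finite ?A" "?A \<subseteq> II" using f g by (auto simp: fsupp_def)
  have fg: "(\<lambda>z. f z + g z) \<in> fsupp \<Z> II" using ring.fsupp_add[OF Z_ring f g] by simp
  have cl: "[n] \<cdot>\<^bsub>S\<^esub> scal z \<in> carrier S" if "z \<in> ?A" for z and n :: int
    using scal_closed[of z] that A by (auto intro!: S.add.int_pow_closed)
  have "pairing (\<lambda>z. f z + g z) = (\<Oplus>\<^bsub>S\<^esub>z\<in>?A. [(f z + g z)] \<cdot>\<^bsub>S\<^esub> scal z)"
    using A by (intro pairing_eq[OF fg]) auto
  also have "\<dots> = (\<Oplus>\<^bsub>S\<^esub>z\<in>?A. ([f z] \<cdot>\<^bsub>S\<^esub> scal z) \<oplus>\<^bsub>S\<^esub> ([g z] \<cdot>\<^bsub>S\<^esub> scal z))"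
    using A cl scal_closed by (intro S.finsum_cong') (auto simp: S.add.int_pow_mult)
  also have "\<dots> = (\<Oplus>\<^bsub>S\<^esub>z\<in>?A. [f z] \<cdot>\<^bsub>S\<^esub> scal z) \<oplus>\<^bsub>S\<^esub> (\<Oplus>\<^bsub>S\<^esub>z\<in>?A. [g z] \<cdot>\<^bsub>S\<^esub> scal z)"
    using cl by (intro S.finsum_addf) auto
  also have "(\<Oplus>\<^bsub>S\<^esub>z\<in>?A. [f z] \<cdot>\<^bsub>S\<^esub> scal z) = pairing f"
    using A by (intro pairing_eq[OF f, symmetric]) auto
  also have "(\<Oplus>\<^bsub>S\<^esub>z\<in>?A. [g z] \<cdot>\<^bsub>S\<^esub> scal z) = pairing g"
    using A by (intro pairing_eq[OF g, symmetric]) auto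
  finally show ?thesis .
qed

lemma pairing_single: "z \<in> II \<Longrightarrow> pairing (single \<Z> z n) = [n] \<cdot>\<^bsub>S\<^esub> scal z"
proof -
  assume z: "z \<in> II"
  have "pairing (single \<Z> z n) = (\<Oplus>\<^bsub>S\<^esub>w\<in>{z}. [single \<Z> z n w] \<cdot>\<^bsub>S\<^esub> scal w)"
  proof (rule pairing_eq[OF ring.fsupp_single[OF Z_ring]])
    show "{w. single \<Z> z n w \<noteq> 0} \<subseteq> {z}" by (auto simp: single_def)
  qed (use z in auto)
  also have "\<dots> = [n] \<cdot>\<^bsub>S\<^esub> scal z" using scal_closed[OF z] by (simp add: single_def)
  finally show ?thesis .
qed

definition null_ideal :: "('s \<times> 't \<Rightarrow> int) set" where
  "null_ideal = {g \<in> carrier PP. \<forall>h\<in>carrier PP. pairing (g \<otimes>\<^bsub>PP\<^esub> h) = \<zero>\<^bsub>S\<^esub>}"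

lemma pairing_zero: "pairing \<zero>\<^bsub>PP\<^esub> = \<zero>\<^bsub>S\<^esub>"
  by (simp add: pairing_def free_simps)

lemma pairing_plus: "f \<in> carrier PP \<Longrightarrow> g \<in> carrier PP \<Longrightarrow> pairing (f \<oplus>\<^bsub>PP\<^esub> g) = pairing f \<oplus>\<^bsub>S\<^esub> pairing g"
  using pairing_add by (simp add: free_simps free_carrier)

lemma pairing_uminus: "f \<in> carrier PP \<Longrightarrow> pairing (\<ominus>\<^bsub>PP\<^esub> f) = \<ominus>\<^bsub>S\<^esub> pairing f"
proof -
  assume f: "f \<in> carrier PP"
  have "pairing (\<ominus>\<^bsub>PP\<^esub> f) \<oplus>\<^bsub>S\<^esub> pairing f = \<zero>\<^bsub>S\<^esub>"
    using pairing_plus[of "\<ominus>\<^bsub>PP\<^esub> f" f] f by (simp add: P.l_neg pairing_zero)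
  then show ?thesis
    using f pairing_closed by (intro S.minus_equality[symmetric]) (auto simp: free_carrier[symmetric])
qed

lemma null_ideal_ideal: "ideal null_ideal PP"
proof (rule idealI[OF P.ring_axioms])
  show "subgroup null_ideal (add_monoid PP)"
  proof (rule P.add.subgroupI)
    show "null_ideal \<subseteq> carrier PP" by (auto simp: null_ideal_def)
    have "\<zero>\<^bsub>PP\<^esub> \<in> null_ideal" by (simp add: null_ideal_def pairing_zero)
    then show "null_ideal \<noteq> {}" by blast
    show "\<ominus>\<^bsub>PP\<^esub> g \<in> null_ideal" if "g \<in> null_ideal" for g
      using that by (auto simp: null_ideal_def P.l_minus pairing_uminus)
    show "f \<oplus>\<^bsub>PP\<^esub> g \<in> null_ideal" if "f \<in> null_ideal" "g \<in> null_ideal" for f g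
      using that by (auto simp: null_ideal_def P.l_distr pairing_plus)
  qed
  fix g h assume g: "g \<in> null_ideal" and h: "h \<in> carrier PP"
  show "g \<otimes>\<^bsub>PP\<^esub> h \<in> null_ideal" using g h by (auto simp: null_ideal_def P.m_assoc)
  then show "h \<otimes>\<^bsub>PP\<^esub> g \<in> null_ideal" using g h P.m_comm[of h g] by (simp add: null_ideal_def)
qed

lemma null_idealI:
  assumes g: "g \<in> carrier PP"
    and gen: "\<And>s t n. s \<in> carrier S \<Longrightarrow> t \<in> carrier T \<Longrightarrow> pairing (g \<otimes>\<^bsub>PP\<^esub> single \<Z> (s, t) n) = \<zero>\<^bsub>S\<^esub>"
  shows "g \<in> null_ideal"
proof -
  have "pairing (g \<otimes>\<^bsub>PP\<^esub> h) = \<zero>\<^bsub>S\<^esub>" if h: "h \<in> carrier PP" for h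
  proof -
    have "h \<in> fsupp \<Z> II" using h by (simp add: free_carrier)
    then show ?thesis
    proof (induction h rule: ring.fsupp_induct[OF Z_ring, consumes 1, case_names zero add])
      case zero
      have "g \<otimes>\<^bsub>PP\<^esub> \<zero>\<^bsub>PP\<^esub> = \<zero>\<^bsub>PP\<^esub>" using g by simp
      then show ?case by (simp add: free_simps(3) pairing_zero[unfolded free_simps(3)])
    next
      case (add z f)
      obtain s t where z: "z = (s, t)" "s \<in> carrier S" "t \<in> carrier T" using add(1) by auto
      have f: "f \<in> carrier PP" using add(3) by (simp add: free_carrier)
      have e: "(\<lambda>w. single \<Z> z (h z) w \<oplus>\<^bsub>\<Z>\<^esub> f w) = single \<Z> (s, t) (h z) \<oplus>\<^bsub>PP\<^esub> f"
        by (simp add: free_simps z)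
      show ?case
        unfolding e using g f z add(5) gen[OF z(2,3)] single_closed[OF z(2,3)]
        by (simp add: P.r_distr pairing_plus)
    qed
  qed
  then show ?thesis using g by (simp add: null_ideal_def)
qed

lemma pair_gen_single:
  assumes "x \<in> carrier S" "y \<in> carrier T" "s \<in> carrier S" "t \<in> carrier T"
  shows "pairing (pair_gen x y \<otimes>\<^bsub>PP\<^esub> single \<Z> (s, t) n) = [n] \<cdot>\<^bsub>S\<^esub> ((x \<otimes>\<^bsub>S\<^esub> s) \<otimes>\<^bsub>S\<^esub> i (retr (y \<otimes>\<^bsub>T\<^esub> t)))"
  unfolding free_simps pair_gen_def using assms
  by (subst Z.conv_single) (auto simp: pairing_single scal_def)

lemma rels_null: "tensor_rels C S T i j \<subseteq> null_ideal"
proof -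
  have npow: "[n] \<cdot>\<^bsub>S\<^esub> (a \<oplus>\<^bsub>S\<^esub> b) = ([n] \<cdot>\<^bsub>S\<^esub> a) \<oplus>\<^bsub>S\<^esub> ([n] \<cdot>\<^bsub>S\<^esub> b)"
    if "a \<in> carrier S" "b \<in> carrier S" for a b and n :: int
    using that by (rule S.add.int_pow_distrib)
  have cl: "[n] \<cdot>\<^bsub>S\<^esub> a \<in> carrier S" if "a \<in> carrier S" for a and n :: int
    using that by (rule S.add.int_pow_closed)
  have left: "pair_gen (x \<oplus>\<^bsub>S\<^esub> x') y \<ominus>\<^bsub>PP\<^esub> (pair_gen x y \<oplus>\<^bsub>PP\<^esub> pair_gen x' y) \<in> null_ideal" (is "?g \<in> _")
    if c: "x \<in> carrier S" "x' \<in> carrier S" "y \<in> carrier T" for x x' y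
  proof (rule null_idealI)
    fix s t n assume st: "s \<in> carrier S" "t \<in> carrier T"
    show "pairing (?g \<otimes>\<^bsub>PP\<^esub> single \<Z> (s, t) n) = \<zero>\<^bsub>S\<^esub>"
      using c st
      by (simp add: a_minus_def P.l_distr P.l_minus pairing_plus pairing_uminus pair_gen_closed
          single_closed pair_gen_single npow S.l_distr retr_closed cl S.r_neg)
  qed (use c in \<open>simp add: pair_gen_closed\<close>)
  have right: "pair_gen x (y \<oplus>\<^bsub>T\<^esub> y') \<ominus>\<^bsub>PP\<^esub> (pair_gen x y \<oplus>\<^bsub>PP\<^esub> pair_gen x y') \<in> null_ideal" (is "?g \<in> _")
    if c: "x \<in> carrier S" "y \<in> carrier T" "y' \<in> carrier T" for x y y'
  proof (rule null_idealI)
    fix s t n assume st: "s \<in> carrier S" "t \<in> carrier T"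
    show "pairing (?g \<otimes>\<^bsub>PP\<^esub> single \<Z> (s, t) n) = \<zero>\<^bsub>S\<^esub>"
      using c st
      by (simp add: a_minus_def P.l_distr P.l_minus pairing_plus pairing_uminus pair_gen_closed
          single_closed pair_gen_single npow S.r_distr T.l_distr retr_add retr_closed cl S.r_neg)
  qed (use c in \<open>simp add: pair_gen_closed\<close>)
  have balanced: "pair_gen (x \<otimes>\<^bsub>S\<^esub> i c) y \<ominus>\<^bsub>PP\<^esub> pair_gen x (j c \<otimes>\<^bsub>T\<^esub> y) \<in> null_ideal" (is "?g \<in> _")
    if c: "x \<in> carrier S" "c \<in> carrier C" "y \<in> carrier T" for x c y
  proof (rule null_idealI)
    fix s t n assume st: "s \<in> carrier S" "t \<in> carrier T"
    have "(x \<otimes>\<^bsub>S\<^esub> i c \<otimes>\<^bsub>S\<^esub> s) \<otimes>\<^bsub>S\<^esub> i (retr (y \<otimes>\<^bsub>T\<^esub> t))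
      = (x \<otimes>\<^bsub>S\<^esub> s) \<otimes>\<^bsub>S\<^esub> i (retr (j c \<otimes>\<^bsub>T\<^esub> y \<otimes>\<^bsub>T\<^esub> t))"
      using c st by (simp add: T.m_assoc retr_linear retr_closed S.m_ac)
    then show "pairing (?g \<otimes>\<^bsub>PP\<^esub> single \<Z> (s, t) n) = \<zero>\<^bsub>S\<^esub>"
      using c st
      by (simp add: a_minus_def P.l_distr P.l_minus pairing_plus pairing_uminus pair_gen_closed
          single_closed pair_gen_single retr_closed cl S.r_neg)
  qed (use c in \<open>simp add: pair_gen_closed\<close>)
  show ?thesis
    unfolding tensor_rels_def Let_def
    by (intro Un_least subsetI; elim CollectE exE conjE; simp only: left right balanced)
qed

lemma tens_left_inj: "inj_on (\<lambda>x. tn x \<one>\<^bsub>T\<^esub>) (carrier S)"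
proof (rule inj_onI)
  fix a b assume a: "a \<in> carrier S" and b: "b \<in> carrier S" and eq: "tn a \<one>\<^bsub>T\<^esub> = tn b \<one>\<^bsub>T\<^esub>"
  have pg: "pair_gen a \<one>\<^bsub>T\<^esub> \<in> carrier PP" "pair_gen b \<one>\<^bsub>T\<^esub> \<in> carrier PP"
    using a b by (auto intro: pair_gen_closed)
  have "pair_gen a \<one>\<^bsub>T\<^esub> \<ominus>\<^bsub>PP\<^esub> pair_gen b \<one>\<^bsub>T\<^esub> \<in> KK"
    using eq pg by (simp add: tens_class tclass_eq_iff)
  then have "pair_gen a \<one>\<^bsub>T\<^esub> \<ominus>\<^bsub>PP\<^esub> pair_gen b \<one>\<^bsub>T\<^esub> \<in> null_ideal"
    using P.genideal_minimal[OF null_ideal_ideal rels_null] by blast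
  then have "pairing ((pair_gen a \<one>\<^bsub>T\<^esub> \<ominus>\<^bsub>PP\<^esub> pair_gen b \<one>\<^bsub>T\<^esub>) \<otimes>\<^bsub>PP\<^esub> \<one>\<^bsub>PP\<^esub>) = \<zero>\<^bsub>S\<^esub>"
    unfolding null_ideal_def using P.one_closed by blast
  then have "pairing (pair_gen a \<one>\<^bsub>T\<^esub>) \<ominus>\<^bsub>S\<^esub> pairing (pair_gen b \<one>\<^bsub>T\<^esub>) = \<zero>\<^bsub>S\<^esub>"
    using pg by (simp add: a_minus_def pairing_plus pairing_uminus)
  moreover have "pairing (pair_gen x \<one>\<^bsub>T\<^esub>) = x" if "x \<in> carrier S" for x
    unfolding pair_gen_def using that by (simp add: pairing_single scal_def retr_one)
  ultimately show "a = b" using a b by (simp add: S.r_right_minus_eq)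
qed

end

end

section \<open>The spectral seminorm\<close>

lemma root_bounded_limit:
  assumes lim: "(\<lambda>n. root (Suc n) (c (Suc n))) \<longlonglongrightarrow> s"
    and C: "0 < C" and \<sigma>: "0 \<le> \<sigma>" and le: "\<And>n. c (Suc n) \<le> C * \<sigma> ^ Suc n"
  shows "s \<le> (\<sigma> :: real)"
proof -
  have 1: "(\<lambda>n. root (Suc n) C) \<longlonglongrightarrow> 1" using LIMSEQ_root_const[OF C] by (rule LIMSEQ_Suc)
  have "(\<lambda>n. root (Suc n) C * \<sigma>) \<longlonglongrightarrow> 1 * \<sigma>" by (rule tendsto_mult[OF 1 tendsto_const])
  then have lim': "(\<lambda>n. root (Suc n) C * \<sigma>) \<longlonglongrightarrow> \<sigma>" by (simp only: mult_1)
  have "root (Suc n) (c (Suc n)) \<le> root (Suc n) C * \<sigma>" for n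
  proof -
    have "root (Suc n) (c (Suc n)) \<le> root (Suc n) (C * \<sigma> ^ Suc n)"
      by (rule real_root_le_mono[OF _ le]) simp
    also have "\<dots> = root (Suc n) C * \<sigma>"
      unfolding real_root_mult by (simp only: real_root_pos2[OF zero_less_Suc \<sigma>])
    finally show ?thesis .
  qed
  then show ?thesis using LIMSEQ_le[OF lim lim'] by blast
qed

text \<open>If \<open>c M \<le> \<sigma> ^ M\<close> for one positive \<open>M\<close>, division by \<open>M\<close> with remainder bounds every \<open>c n\<close> by
  a constant multiple of \<open>\<sigma> ^ n\<close>. So the limit is the infimum of the roots.\<close>

lemma submultiplicative_limit:
  fixes c :: "nat \<Rightarrow> real"
  assumes nonneg: "\<And>n. 0 \<le> c n" and mult: "\<And>m n. c (m + n) \<le> c m * c n"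
  obtains s where "0 \<le> s" "(\<lambda>n. root (Suc n) (c (Suc n))) \<longlonglongrightarrow> s"
    "\<And>\<sigma>. s < \<sigma> \<Longrightarrow> \<exists>C>0. \<forall>n. c n \<le> C * \<sigma> ^ n"
proof -
  define f where "f n = root (Suc n) (c (Suc n))" for n
  define s where "s = Inf (range f)"
  have f0: "0 \<le> f n" for n by (simp add: f_def nonneg)
  have bdd: "bdd_below (range f)" by (rule bdd_belowI[of _ 0]) (use f0 in auto)
  have s0: "0 \<le> s" unfolding s_def by (rule cInf_greatest) (use f0 in auto)
  have sf: "s \<le> f n" for n unfolding s_def by (rule cInf_lower[OF _ bdd]) simp
  have bound: "\<exists>C>0. \<forall>n. c n \<le> C * \<sigma> ^ n" if \<sigma>: "s < \<sigma>" for \<sigma>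
  proof -
    have pos: "0 < \<sigma>" using \<sigma> s0 by simp
    obtain x where "x \<in> range f" "x < \<sigma>" using cInf_lessD[of "range f" \<sigma>] \<sigma> by (auto simp: s_def)
    then obtain m where m: "f m < \<sigma>" by auto
    define M where "M = Suc m"
    have cM: "c M \<le> \<sigma> ^ M"
    proof -
      have "c M = f m ^ M" unfolding f_def M_def by (rule real_root_pow_pos2[symmetric]) (auto simp: nonneg)
      also have "\<dots> \<le> \<sigma> ^ M" by (rule power_mono) (use m f0 in auto)
      finally show ?thesis .
    qed
    define C where "C = (\<Sum>r<M. c r / \<sigma> ^ r) + 1"
    have C0: "0 \<le> (\<Sum>r<M. c r / \<sigma> ^ r)" by (rule sum_nonneg) (use nonneg pos in auto)
    have small: "c r \<le> C * \<sigma> ^ r" if "r < M" for r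
    proof -
      have "c r / \<sigma> ^ r \<le> (\<Sum>r<M. c r / \<sigma> ^ r)"
        by (rule member_le_sum) (use that nonneg pos in auto)
      then have "c r / \<sigma> ^ r \<le> C" by (simp add: C_def)
      then show ?thesis using pos by (simp add: pos_divide_le_eq)
    qed
    have "c (q * M + r) \<le> C * \<sigma> ^ (q * M + r)" if r: "r < M" for q r
    proof (induction q)
      case 0
      then show ?case using small[OF r] by simp
    next
      case (Suc q)
      have "c (Suc q * M + r) = c (M + (q * M + r))" by (simp add: add.assoc)
      also have "\<dots> \<le> c M * c (q * M + r)" by (rule mult)
      also have "\<dots> \<le> \<sigma> ^ M * (C * \<sigma> ^ (q * M + r))"
        by (rule mult_mono[OF cM Suc]) (use pos nonneg in auto)
      also have "\<dots> = C * \<sigma> ^ (Suc q * M + r)" by (simp add: power_add)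
      finally show ?case .
    qed
    then have "c n \<le> C * \<sigma> ^ n" for n
      using div_mult_mod_eq[of n M] mod_less_divisor[of M n] by (metis M_def zero_less_Suc)
    then show ?thesis using C0 by (intro exI[of _ C]) (auto simp: C_def)
  qed
  have "f \<longlonglongrightarrow> s"
  proof (rule order_tendstoI)
    fix a assume "a < s"
    then show "\<forall>\<^sub>F n in sequentially. a < f n" using sf by (auto intro: always_eventually less_le_trans)
  next
    fix a assume a: "s < a"
    define \<sigma> where "\<sigma> = (s + a) / 2"
    have \<sigma>: "s < \<sigma>" "\<sigma> < a" "0 \<le> \<sigma>" using a s0 by (auto simp: \<sigma>_def)
    obtain C where C: "C > 0" "\<And>n. c n \<le> C * \<sigma> ^ n" using bound[OF \<sigma>(1)] by blast
    have 1: "(\<lambda>n. root (Suc n) C) \<longlonglongrightarrow> 1" using LIMSEQ_root_const[OF C(1)] by (rule LIMSEQ_Suc)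
    have "(\<lambda>n. root (Suc n) C * \<sigma>) \<longlonglongrightarrow> 1 * \<sigma>" by (rule tendsto_mult[OF 1 tendsto_const])
    then have ev: "\<forall>\<^sub>F n in sequentially. root (Suc n) C * \<sigma> < a"
      using \<sigma> by (auto intro: order_tendstoD(2))
    have le: "f n \<le> root (Suc n) C * \<sigma>" for n
    proof -
      have "f n \<le> root (Suc n) (C * \<sigma> ^ Suc n)"
        unfolding f_def by (rule real_root_le_mono[OF _ C(2)]) simp
      also have "\<dots> = root (Suc n) C * \<sigma>"
        unfolding real_root_mult by (simp only: real_root_pos2[OF zero_less_Suc \<sigma>(3)])
      finally show ?thesis .
    qed
    show "\<forall>\<^sub>F n in sequentially. f n < a"
      by (rule eventually_mono[OF ev]) (rule le_less_trans[OF le])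
  qed
  then show ?thesis using that[OF s0 _ bound] by (simp add: f_def[abs_def])
qed

locale normed_cring = cring R for R (structure) +
  fixes N :: "'a \<Rightarrow> real"
  assumes norm: "nonarch_norm R N"
begin

abbreviation "sp \<equiv> spectral_seminorm R N"

lemma N_props:
  "x \<in> carrier R \<Longrightarrow> 0 \<le> N x" "N \<zero> = 0" "N \<one> \<le> 1"
  "x \<in> carrier R \<Longrightarrow> y \<in> carrier R \<Longrightarrow> N (x \<otimes> y) \<le> N x * N y"
  "x \<in> carrier R \<Longrightarrow> y \<in> carrier R \<Longrightarrow> N (x \<ominus> y) \<le> max (N x) (N y)"
  using norm by (auto simp: nonarch_norm_def)

lemma N_uminus: "x \<in> carrier R \<Longrightarrow> N (\<ominus> x) \<le> N x"
  using N_props(5)[of \<zero> x] N_props(1)[of x] N_props(2) by (simp add: a_minus_def)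

lemma N_add: "x \<in> carrier R \<Longrightarrow> y \<in> carrier R \<Longrightarrow> N (x \<oplus> y) \<le> max (N x) (N y)"
  using N_props(5)[of x "\<ominus> y"] N_uminus[of y] by (auto simp: a_minus_def)

lemma spectral_limit:
  assumes a: "a \<in> carrier R"
  shows "(\<lambda>n. root (Suc n) (N (a [^] Suc n))) \<longlonglongrightarrow> sp a" and "0 \<le> sp a"
    and "sp a < \<sigma> \<Longrightarrow> \<exists>C>0. \<forall>n. N (a [^] n) \<le> C * \<sigma> ^ n"
proof -
  have "0 \<le> N (a [^] n)" for n :: nat using a by (simp add: N_props)
  moreover have "N (a [^] (m + n)) \<le> N (a [^] m) * N (a [^] n)" for m n :: nat
    using a N_props(4)[of "a [^] m" "a [^] n"] by (simp add: nat_pow_mult)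
  ultimately obtain s where s: "0 \<le> s" "(\<lambda>n. root (Suc n) (N (a [^] Suc n))) \<longlonglongrightarrow> s"
      "\<And>\<sigma>. s < \<sigma> \<Longrightarrow> \<exists>C>0. \<forall>n. N (a [^] n) \<le> C * \<sigma> ^ n"
    by (rule submultiplicative_limit[of "\<lambda>n. N (a [^] n)"]) blast
  have "sp a = s" unfolding spectral_seminorm_def by (rule limI[OF s(2)])
  then show "(\<lambda>n. root (Suc n) (N (a [^] Suc n))) \<longlonglongrightarrow> sp a" and "0 \<le> sp a"
    and "sp a < \<sigma> \<Longrightarrow> \<exists>C>0. \<forall>n. N (a [^] n) \<le> C * \<sigma> ^ n"
    using s by auto
qed

lemma spectral_leI:
  assumes a: "a \<in> carrier R" and C: "0 < C" "0 \<le> \<sigma>" and le: "\<And>n :: nat. N (a [^] n) \<le> C * \<sigma> ^ n"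
  shows "sp a \<le> \<sigma>"
  by (rule root_bounded_limit[OF spectral_limit(1)[OF a] C le])

lemma spectral_mult:
  assumes a: "a \<in> carrier R" and b: "b \<in> carrier R"
  shows "sp (a \<otimes> b) \<le> sp a * sp b"
proof (rule LIMSEQ_le)
  show "(\<lambda>n. root (Suc n) (N ((a \<otimes> b) [^] Suc n))) \<longlonglongrightarrow> sp (a \<otimes> b)"
    using a b by (intro spectral_limit) auto
  show "(\<lambda>n. root (Suc n) (N (a [^] Suc n)) * root (Suc n) (N (b [^] Suc n))) \<longlonglongrightarrow> sp a * sp b"
    using a b by (intro tendsto_mult spectral_limit)
  have "root (Suc n) (N ((a \<otimes> b) [^] Suc n)) \<le> root (Suc n) (N (a [^] Suc n)) * root (Suc n) (N (b [^] Suc n))" for n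
  proof -
    have "N ((a \<otimes> b) [^] Suc n) \<le> N (a [^] Suc n) * N (b [^] Suc n)"
      unfolding nat_pow_distrib[OF a b] using a b by (intro N_props nat_pow_closed)
    then show ?thesis unfolding real_root_mult[symmetric] by (intro real_root_le_mono) auto
  qed
  then show "\<exists>M. \<forall>n\<ge>M. root (Suc n) (N ((a \<otimes> b) [^] Suc n))
    \<le> root (Suc n) (N (a [^] Suc n)) * root (Suc n) (N (b [^] Suc n))" by blast
qed

text \<open>Expanding one factor \<open>a \<oplus> b\<close> at a time replaces the binomial theorem: for a nonarchimedean norm the
  binomial coefficients do not matter. The factor \<open>a\<^sup>i b\<^sup>j\<close> collects what has been expanded.\<close>

lemma spectral_add_bound:
  assumes a: "a \<in> carrier R" and b: "b \<in> carrier R" and \<sigma>: "0 < \<sigma>"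
    and C: "0 < C" "\<And>n :: nat. N (a [^] n) \<le> C * \<sigma> ^ n" and D: "0 < D" "\<And>n :: nat. N (b [^] n) \<le> D * \<sigma> ^ n"
  shows "N ((a \<oplus> b) [^] (n :: nat) \<otimes> (a [^] (i :: nat) \<otimes> b [^] (j :: nat))) \<le> C * D * \<sigma> ^ (n + i + j)"
proof (induction n arbitrary: i j)
  case 0
  have "N (a [^] i \<otimes> b [^] j) \<le> N (a [^] i) * N (b [^] j)" using a b by (intro N_props) auto
  also have "\<dots> \<le> (C * \<sigma> ^ i) * (D * \<sigma> ^ j)"
    using C D \<sigma> a b by (intro mult_mono) (auto simp: N_props)
  finally show ?case using a b by (simp add: power_add mult_ac)
next
  case (Suc n)
  let ?z = "(a \<oplus> b) [^] n"
  have z: "?z \<in> carrier R" using a b by simp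
  have eq: "(a \<oplus> b) [^] Suc n \<otimes> (a [^] i \<otimes> b [^] j)
    = ?z \<otimes> (a [^] Suc i \<otimes> b [^] j) \<oplus> ?z \<otimes> (a [^] i \<otimes> b [^] Suc j)"
    using a b z by (simp add: l_distr r_distr m_ac)
  have "N ((a \<oplus> b) [^] Suc n \<otimes> (a [^] i \<otimes> b [^] j))
    \<le> max (N (?z \<otimes> (a [^] Suc i \<otimes> b [^] j))) (N (?z \<otimes> (a [^] i \<otimes> b [^] Suc j)))"
    unfolding eq using a b z by (intro N_add) auto
  moreover have "\<dots> \<le> C * D * \<sigma> ^ (Suc n + i + j)"
    using Suc[of "Suc i" j] Suc[of i "Suc j"] by (intro max.boundedI) (simp_all only: add_Suc add_Suc_right)
  ultimately show ?case by (rule order_trans)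
qed

lemma spectral_add:
  assumes a: "a \<in> carrier R" and b: "b \<in> carrier R"
  shows "sp (a \<oplus> b) \<le> max (sp a) (sp b)"
proof (rule dense_ge)
  fix \<sigma> assume \<sigma>: "max (sp a) (sp b) < \<sigma>"
  then have pos: "0 < \<sigma>" using spectral_limit(2)[OF a] by simp
  obtain C where C: "0 < C" "\<And>n :: nat. N (a [^] n) \<le> C * \<sigma> ^ n"
    using spectral_limit(3)[OF a, of \<sigma>] \<sigma> by auto
  obtain D where D: "0 < D" "\<And>n :: nat. N (b [^] n) \<le> D * \<sigma> ^ n"
    using spectral_limit(3)[OF b, of \<sigma>] \<sigma> by auto
  show "sp (a \<oplus> b) \<le> \<sigma>"
  proof (rule spectral_leI)
    show "N ((a \<oplus> b) [^] n) \<le> C * D * \<sigma> ^ n" for n :: nat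
      using spectral_add_bound[OF a b pos C D, of n 0 0] a b by simp
  qed (use a b C(1) D(1) pos in \<open>simp_all add: less_imp_le\<close>)
qed

lemma spectral_zero: "sp \<zero> = 0"
proof -
  have "N (\<zero> [^] (n :: nat)) \<le> 1 * 0 ^ n" for n
    using N_props(2,3) by (cases n) auto
  then have "sp \<zero> \<le> 0" by (intro spectral_leI[of _ 1]) auto
  then show ?thesis using spectral_limit(2)[of \<zero>] by simp
qed

lemma spectral_one: "sp \<one> \<le> 1"
  by (rule spectral_leI[of _ 1]) (auto simp: N_props)

lemma spectral_uminus_le:
  assumes a: "a \<in> carrier R"
  shows "sp (\<ominus> a) \<le> sp a"
proof -
  have "N ((\<ominus> \<one>) [^] (n :: nat)) \<le> 1" for n
  proof (induction n)
    case 0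
    then show ?case by (simp add: N_props)
  next
    case (Suc n)
    have "(\<ominus> \<one>) [^] Suc n = \<ominus> ((\<ominus> \<one>) [^] n)" by (simp add: r_minus)
    then show ?case using Suc N_uminus[of "(\<ominus> \<one>) [^] n"] by auto
  qed
  then have "sp (\<ominus> \<one>) \<le> 1" by (intro spectral_leI[of _ 1]) auto
  moreover have "\<ominus> a = \<ominus> \<one> \<otimes> a" using a by (simp add: l_minus)
  ultimately show ?thesis
    using spectral_mult[of "\<ominus> \<one>" a] a spectral_limit(2)[OF a] mult_right_mono[of "sp (\<ominus> \<one>)" 1 "sp a"] by auto
qed

lemma spectral_seminormed: "seminormed_cring R sp"
proof unfold_locales
  show "sp (\<ominus> x) = sp x" if "x \<in> carrier R" for x
    using spectral_uminus_le[OF that] spectral_uminus_le[of "\<ominus> x"] that by simp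
qed (auto simp: spectral_zero spectral_one spectral_add spectral_mult spectral_limit)

end

text \<open>The norm of an affinoid algebra is bounded by a multiple of the residue norm, so on powers of
  a constant by a multiple of the powers of its absolute value; taking roots, the factor
  disappears.\<close>

lemma affinoid_spectral_const:
  assumes K: "valued_field K v" and A: "affinoid_algebra K v A \<alpha> N" and c: "c \<in> carrier K"
  shows "spectral_seminorm A N (\<alpha> c) \<le> v c"
proof -
  interpret K: valued_field K v by fact
  obtain d \<rho> \<phi> C where cA: "cring A" and \<alpha>: "\<alpha> \<in> ring_hom K A" and N: "nonarch_norm A N"
    and \<rho>: "\<forall>i<d. \<rho> i > 0" and \<phi>c: "\<forall>c\<in>carrier K. \<phi> (tate_const K c) = \<alpha> c"
    and C: "C > 0" and bound: "\<forall>a\<in>carrier A. (let q = Inf {gauss_norm v d \<rho> f | f. f \<in> carrier (tate K v d \<rho>) \<and> \<phi> f = a}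
            in N a \<le> C * q \<and> q \<le> C * N a)"
    using A unfolding affinoid_algebra_def by blast
  interpret A: normed_cring A N
    by (intro normed_cring.intro normed_cring_axioms.intro cA N)
  interpret \<alpha>: ring_hom_cring K A \<alpha>
    by (intro ring_hom_cring.intro ring_hom_cring_axioms.intro \<alpha> K.is_cring cA)
  have r0: "0 \<le> radius_power d \<rho> \<nu>" for \<nu>
    unfolding radius_power_def by (rule prod_nonneg) (use \<rho> in \<open>auto simp: less_imp_le\<close>)
  have bdd: "bdd_above (range (\<lambda>\<nu>. v (f \<nu>) * radius_power d \<rho> \<nu>))" and nonneg: "0 \<le> gauss_norm v d \<rho> f"
    if f: "f \<in> carrier (tate K v d \<rho>)" for f
  proof -
    have fc: "f \<nu> \<in> carrier K" for \<nu> using f by (simp add: tate_def conv_ring_def)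
    have fin: "finite {\<nu>. f \<nu> \<noteq> \<zero>\<^bsub>K\<^esub> \<and> v (f \<nu>) * radius_power d \<rho> \<nu> \<ge> 1}" (is "finite ?F")
      using f by (simp add: tate_def conv_ring_def)
    let ?g = "\<lambda>\<nu>. v (f \<nu>) * radius_power d \<rho> \<nu>"
    have "?g \<nu> \<le> Max (insert 1 (?g ` ?F))" for \<nu>
    proof (cases "\<nu> \<in> ?F")
      case True
      then show ?thesis using fin by (intro Max_ge) auto
    next
      case False
      then have "?g \<nu> \<le> 1" by (auto simp: K.w_zero)
      also have "1 \<le> Max (insert 1 (?g ` ?F))" using fin by (intro Max_ge) auto
      finally show ?thesis .
    qed
    then show bdd: "bdd_above (range ?g)" by (intro bdd_aboveI2)
    have "0 \<le> ?g 0" using K.v_props(1)[OF fc] r0 by simp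
    also have "\<dots> \<le> gauss_norm v d \<rho> f"
      unfolding gauss_norm_def by (rule cSUP_upper[OF UNIV_I bdd])
    finally show "0 \<le> gauss_norm v d \<rho> f" .
  qed
  have const: "N (\<alpha> x) \<le> C * v x" if x: "x \<in> carrier K" for x
  proof -
    let ?f = "tate_const K x"
    have mem: "?f \<in> carrier (tate K v d \<rho>)"
    proof -
      have "finite {\<nu>. ?f \<nu> \<noteq> \<zero>\<^bsub>K\<^esub> \<and> v (?f \<nu>) * radius_power d \<rho> \<nu> \<ge> \<epsilon>}" for \<epsilon>
        by (rule finite_subset[of _ "{0}"]) (auto simp: tate_const_def single_def)
      then show ?thesis using x by (auto simp: tate_def conv_ring_def tate_const_def single_def)
    qed
    have "gauss_norm v d \<rho> ?f \<le> v x"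
      unfolding gauss_norm_def
    proof (rule cSUP_least)
      fix \<nu> show "v (?f \<nu>) * radius_power d \<rho> \<nu> \<le> v x"
        using K.v_props(1)[OF x] by (auto simp: tate_const_def single_def K.w_zero radius_power_def)
    qed simp
    moreover have "Inf {gauss_norm v d \<rho> f | f. f \<in> carrier (tate K v d \<rho>) \<and> \<phi> f = \<alpha> x} \<le> gauss_norm v d \<rho> ?f"
    proof (rule cInf_lower)
      show "bdd_below {gauss_norm v d \<rho> f | f. f \<in> carrier (tate K v d \<rho>) \<and> \<phi> f = \<alpha> x}"
        by (rule bdd_belowI[of _ 0]) (use nonneg in auto)
    qed (use mem \<phi>c x in blast)
    moreover have "N (\<alpha> x) \<le> C * Inf {gauss_norm v d \<rho> f | f. f \<in> carrier (tate K v d \<rho>) \<and> \<phi> f = \<alpha> x}"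
      using bound \<alpha>.hom_closed[OF x] unfolding Let_def by blast
    ultimately show ?thesis using C by (meson mult_left_mono less_imp_le order_trans)
  qed
  have pow: "v (c [^]\<^bsub>K\<^esub> n) = v c ^ n" for n :: nat
    using c by (induction n) (simp_all add: K.v_one K.v_props)
  have "N (\<alpha> c [^]\<^bsub>A\<^esub> n) \<le> C * v c ^ n" for n :: nat
    using const[of "c [^]\<^bsub>K\<^esub> n"] c pow[of n] \<alpha>.hom_pow[OF c, of n] by simp
  then show ?thesis using c C K.v_props(1) by (intro A.spectral_leI[of _ C]) auto
qed

section \<open>Higher derivations on a polynomial ring\<close>

text \<open>The operators \<open>\<Delta> j\<close> are the coefficients of a truncated Taylor expansion in which \<open>\<tau>\<close> becomes \<open>\<tau> + S\<close>.
  That \<open>R\<close> and the constants span the polynomial ring, and that homogeneous elements of \<open>R\<close> are powers of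
  \<open>\<tau>\<close> times constants, makes the powers of \<open>\<tau>\<close> span it over the constants.\<close>

locale polynomial_higher_derivation = graded_field_ring R hc for R (structure) and hc +
  fixes m :: nat and \<Delta> :: "nat \<Rightarrow> (nat \<Rightarrow> 'a) \<Rightarrow> nat \<Rightarrow> 'a" and \<tau> :: 'a and \<theta> :: real
  fixes Cst :: "(nat \<Rightarrow> 'a) set"
  defines Cst_def: "Cst \<equiv> {c \<in> carrier (UP R). \<forall>j\<in>{1..m}. \<Delta> j c = \<zero>\<^bsub>UP R\<^esub>}"
  assumes der_closed: "\<And>j x. j \<le> m \<Longrightarrow> x \<in> carrier (UP R) \<Longrightarrow> \<Delta> j x \<in> carrier (UP R)"
    and der_add: "\<And>j x y. j \<le> m \<Longrightarrow> x \<in> carrier (UP R) \<Longrightarrow> y \<in> carrier (UP R) \<Longrightarrow>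
      \<Delta> j (x \<oplus>\<^bsub>UP R\<^esub> y) = \<Delta> j x \<oplus>\<^bsub>UP R\<^esub> \<Delta> j y"
    and der_mult: "\<And>j x y. j \<le> m \<Longrightarrow> x \<in> carrier (UP R) \<Longrightarrow> y \<in> carrier (UP R) \<Longrightarrow>
      \<Delta> j (x \<otimes>\<^bsub>UP R\<^esub> y) = (\<Oplus>\<^bsub>UP R\<^esub>i\<in>{..j}. \<Delta> i x \<otimes>\<^bsub>UP R\<^esub> \<Delta> (j - i) y)"
    and der_0: "\<And>x. x \<in> carrier (UP R) \<Longrightarrow> \<Delta> 0 x = x"
    and der_one: "\<And>j. 1 \<le> j \<Longrightarrow> j \<le> m \<Longrightarrow> \<Delta> j \<one>\<^bsub>UP R\<^esub> = \<zero>\<^bsub>UP R\<^esub>"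
    and tau_unit: "\<tau> \<in> Units R" and theta_pos: "0 < \<theta>" and tau_homogeneous: "hc \<theta> \<tau> = \<tau>"
    and der_tau: "\<And>j. 1 \<le> j \<Longrightarrow> j \<le> m \<Longrightarrow>
      \<Delta> j (monom (UP R) \<tau> 0) = (if j = 1 then \<one>\<^bsub>UP R\<^esub> else \<zero>\<^bsub>UP R\<^esub>)"
    and frobenius_const: "\<And>x. x \<in> carrier (UP R) \<Longrightarrow> x [^]\<^bsub>UP R\<^esub> Suc m \<in> Cst"
    and generated: "\<And>Q x. x \<in> carrier (UP R) \<Longrightarrow> Q \<zero>\<^bsub>UP R\<^esub> \<Longrightarrow>
      (\<And>r c. r \<in> carrier R \<Longrightarrow> c \<in> Cst \<Longrightarrow> Q (monom (UP R) r 0 \<otimes>\<^bsub>UP R\<^esub> c)) \<Longrightarrow>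
      (\<And>x y. x \<in> carrier (UP R) \<Longrightarrow> y \<in> carrier (UP R) \<Longrightarrow> Q x \<Longrightarrow> Q y \<Longrightarrow> Q (x \<oplus>\<^bsub>UP R\<^esub> y)) \<Longrightarrow> Q x"
    and homogeneous_tau: "\<And>\<gamma> h. 0 < \<gamma> \<Longrightarrow> h \<in> carrier R \<Longrightarrow> hc \<gamma> h = h \<Longrightarrow> h \<noteq> \<zero> \<Longrightarrow>
      \<exists>i::nat. \<exists>c\<in>carrier R. monom (UP R) c 0 \<in> Cst \<and> h = \<tau> [^] i \<otimes> c"
    and der_T_linear: "\<And>j n. j \<le> m \<Longrightarrow> 1 < n \<Longrightarrow> coeff (UP R) (\<Delta> j (monom (UP R) \<one> 1)) n = \<zero>"
begin

sublocale UP: UP_domain R "UP R"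
  using is_domain by (intro UP_domain.intro) (auto simp: UP_cring_def is_cring)

abbreviation P where "P \<equiv> UP R"
abbreviation con :: "'a \<Rightarrow> nat \<Rightarrow> 'a" where "con a \<equiv> monom P a 0"

sublocale con: ring_hom_cring R P con
  by (intro ring_hom_cring.intro ring_hom_cring_axioms.intro is_cring UP.UP_cring UP.const_ring_hom)

lemma coeff_con_mult: "r \<in> carrier R \<Longrightarrow> f \<in> carrier P \<Longrightarrow> coeff P (con r \<otimes>\<^bsub>P\<^esub> f) n = r \<otimes> coeff P f n"
  by (simp add: UP.monom_mult_is_smult)

lemma con_inj: "a \<in> carrier R \<Longrightarrow> b \<in> carrier R \<Longrightarrow> con a = con b \<Longrightarrow> a = b"
  by (rule inj_onD[OF UP.monom_inj])

lemma CstD: "c \<in> Cst \<Longrightarrow> c \<in> carrier P" "c \<in> Cst \<Longrightarrow> 1 \<le> j \<Longrightarrow> j \<le> m \<Longrightarrow> \<Delta> j c = \<zero>\<^bsub>P\<^esub>"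
  by (auto simp: Cst_def)

lemma der_const_mult:
  assumes c: "c \<in> Cst" and x: "x \<in> carrier P" and j: "j \<le> m"
  shows "\<Delta> j (c \<otimes>\<^bsub>P\<^esub> x) = c \<otimes>\<^bsub>P\<^esub> \<Delta> j x"
proof -
  have cP: "c \<in> carrier P" using c by (rule CstD)
  have "\<Delta> j (c \<otimes>\<^bsub>P\<^esub> x) = (\<Oplus>\<^bsub>P\<^esub>i\<in>{..j}. if 0 = i then c \<otimes>\<^bsub>P\<^esub> \<Delta> (j - i) x else \<zero>\<^bsub>P\<^esub>)"
    unfolding der_mult[OF j cP x]
  proof (rule UP.P.finsum_cong'[OF refl])
    fix i assume i: "i \<in> {..j}"
    then have \<Delta>x: "\<Delta> (j - i) x \<in> carrier P" using j x by (intro der_closed) auto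
    show "\<Delta> i c \<otimes>\<^bsub>P\<^esub> \<Delta> (j - i) x = (if 0 = i then c \<otimes>\<^bsub>P\<^esub> \<Delta> (j - i) x else \<zero>\<^bsub>P\<^esub>)"
      using CstD(2)[OF c, of i] i j \<Delta>x der_0[OF cP] by (cases "i = 0") auto
  qed (use j x cP der_closed in auto)
  also have "\<dots> = c \<otimes>\<^bsub>P\<^esub> \<Delta> j x"
    using j x cP der_closed by (subst UP.P.finsum_singleton) auto
  finally show ?thesis .
qed

lemma Cst_mult: "c \<in> Cst \<Longrightarrow> e \<in> Cst \<Longrightarrow> c \<otimes>\<^bsub>P\<^esub> e \<in> Cst"
  using der_const_mult[of c e] by (auto simp: Cst_def)

lemma Cst_add: "c \<in> Cst \<Longrightarrow> e \<in> Cst \<Longrightarrow> c \<oplus>\<^bsub>P\<^esub> e \<in> Cst"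
  by (auto simp: Cst_def der_add)

lemma der_zero: "j \<le> m \<Longrightarrow> \<Delta> j \<zero>\<^bsub>P\<^esub> = \<zero>\<^bsub>P\<^esub>"
  using der_add[of j "\<zero>\<^bsub>P\<^esub>" "\<zero>\<^bsub>P\<^esub>"] der_closed[of j "\<zero>\<^bsub>P\<^esub>"] by simp

lemma Cst_zero: "\<zero>\<^bsub>P\<^esub> \<in> Cst"
  by (auto simp: Cst_def der_zero)

lemma Cst_one: "\<one>\<^bsub>P\<^esub> \<in> Cst"
  unfolding Cst_def using der_one by fastforce

lemma Cst_pow: "c \<in> Cst \<Longrightarrow> c [^]\<^bsub>P\<^esub> (i::nat) \<in> Cst"
  by (induction i) (auto simp: Cst_one Cst_mult)

lemma con_pow: "a \<in> carrier R \<Longrightarrow> con (a [^] (i::nat)) = con a [^]\<^bsub>P\<^esub> i"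
  by (rule con.hom_pow)

lemma con_nat_mult: "a \<in> carrier R \<Longrightarrow> con ([(N :: nat)] \<cdot> a) = [N] \<cdot>\<^bsub>P\<^esub> con a"
  by (induction N) simp_all

definition \<sigma> :: 'a where "\<sigma> = inv \<tau>"

lemma tau: "\<tau> \<in> carrier R" "\<sigma> \<in> carrier R" "\<tau> \<otimes> \<sigma> = \<one>" "\<sigma> \<otimes> \<tau> = \<one>"
  using tau_unit by (auto simp: \<sigma>_def Units_closed)

lemma tau_sigma_pow: "\<tau> [^] (i::nat) \<otimes> \<sigma> [^] i = \<one>"
  using tau nat_pow_distrib[of \<tau> \<sigma> i] by simp

lemma tau_sigma_le: "j \<le> i \<Longrightarrow> \<tau> [^] i \<otimes> \<sigma> [^] j = \<tau> [^] (i - j :: nat)"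
  and sigma_tau_le: "j \<le> i \<Longrightarrow> \<sigma> [^] i \<otimes> \<tau> [^] j = \<sigma> [^] (i - j :: nat)"
proof -
  assume "j \<le> i"
  then have t: "\<tau> [^] i = \<tau> [^] (i - j) \<otimes> \<tau> [^] j" and s: "\<sigma> [^] i = \<sigma> [^] (i - j) \<otimes> \<sigma> [^] j"
    using tau by (simp_all add: nat_pow_mult)
  show "\<tau> [^] i \<otimes> \<sigma> [^] j = \<tau> [^] (i - j)" using tau tau_sigma_pow[of j] by (simp add: t m_assoc)
  show "\<sigma> [^] i \<otimes> \<tau> [^] j = \<sigma> [^] (i - j)"
    using tau tau_sigma_pow[of j] by (simp add: s m_assoc m_comm[of "\<sigma> [^] j" "\<tau> [^] j"])
qed

text \<open>As \<open>\<tau>\<^bsup>m+1\<^esup>\<close> is constant, exponents of \<open>\<tau>\<close> can be reduced modulo \<open>m + 1\<close>.\<close>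

lemma homogeneous_normal_form:
  assumes h: "0 < \<gamma>" "h \<in> carrier R" "hc \<gamma> h = h" "h \<noteq> \<zero>"
  obtains i c where "i \<le> m" "c \<in> carrier R" "con c \<in> Cst" "h = \<tau> [^] i \<otimes> c"
proof -
  note goal = that
  have pow: "con (a [^] Suc m) \<in> Cst" if "a \<in> carrier R" for a
    unfolding con_pow[OF that] by (rule frobenius_const) (use that in simp)
  have red: thesis if c: "c \<in> carrier R" "con c \<in> Cst" "h = \<tau> [^] i \<otimes> c" for i :: nat and c
  proof (rule goal)
    let ?e = "(\<tau> [^] Suc m) [^] (i div Suc m)"
    show "i mod Suc m \<le> m" by (simp add: less_Suc_eq_le[symmetric])
    have e: "?e \<in> carrier R" using tau by simp
    show "?e \<otimes> c \<in> carrier R" using e c by simp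
    have "con ?e \<in> Cst" unfolding con_pow[OF nat_pow_closed[OF tau(1)]] by (rule Cst_pow[OF pow[OF tau(1)]])
    then show "con (?e \<otimes> c) \<in> Cst" using e c by (simp only: con.hom_mult Cst_mult)
    have "\<tau> [^] i = \<tau> [^] (i mod Suc m + Suc m * (i div Suc m))" by (simp only: mod_mult_div_eq)
    also have "\<dots> = \<tau> [^] (i mod Suc m) \<otimes> ?e"
      using tau by (simp only: nat_pow_mult[symmetric] nat_pow_pow)
    finally show "h = \<tau> [^] (i mod Suc m) \<otimes> (?e \<otimes> c)"
      using c e tau by (simp only: m_assoc nat_pow_closed)
  qed
  show thesis using homogeneous_tau[OF h] red by blast
qed

lemma der_tau_step:
  assumes y: "y \<in> carrier P" and j: "j \<le> m"
  shows "\<Delta> j (y \<otimes>\<^bsub>P\<^esub> con \<tau>) = (if j = 0 then y \<otimes>\<^bsub>P\<^esub> con \<tau> else \<Delta> j y \<otimes>\<^bsub>P\<^esub> con \<tau> \<oplus>\<^bsub>P\<^esub> \<Delta> (j - 1) y)"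
proof (cases j)
  case 0
  then show ?thesis using y tau by (simp add: der_0)
next
  case (Suc k)
  have \<Delta>y: "i \<le> j \<Longrightarrow> \<Delta> i y \<in> carrier P" for i using y j by (intro der_closed) auto
  have \<Delta>t: "i \<le> j \<Longrightarrow> \<Delta> i (con \<tau>) \<in> carrier P" for i using tau j by (intro der_closed) auto
  have "(\<Oplus>\<^bsub>P\<^esub>i\<in>{..k}. \<Delta> i y \<otimes>\<^bsub>P\<^esub> \<Delta> (j - i) (con \<tau>)) = (\<Oplus>\<^bsub>P\<^esub>i\<in>{..k}. if k = i then \<Delta> i y else \<zero>\<^bsub>P\<^esub>)"
  proof (rule UP.P.finsum_cong'[OF refl])
    fix i assume i: "i \<in> {..k}"
    have "\<Delta> (j - i) (con \<tau>) = (if j - i = 1 then \<one>\<^bsub>P\<^esub> else \<zero>\<^bsub>P\<^esub>)"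
      using i j Suc by (intro der_tau) auto
    then show "\<Delta> i y \<otimes>\<^bsub>P\<^esub> \<Delta> (j - i) (con \<tau>) = (if k = i then \<Delta> i y else \<zero>\<^bsub>P\<^esub>)"
      using i Suc \<Delta>y[of i] by auto
  qed (use \<Delta>y Suc in auto)
  also have "\<dots> = \<Delta> k y" using \<Delta>y Suc by (intro UP.P.finsum_singleton) auto
  finally have rest: "(\<Oplus>\<^bsub>P\<^esub>i\<in>{..k}. \<Delta> i y \<otimes>\<^bsub>P\<^esub> \<Delta> (j - i) (con \<tau>)) = \<Delta> k y" .
  have "\<Delta> j (y \<otimes>\<^bsub>P\<^esub> con \<tau>) = (\<Oplus>\<^bsub>P\<^esub>i\<in>{..Suc k}. \<Delta> i y \<otimes>\<^bsub>P\<^esub> \<Delta> (j - i) (con \<tau>))"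
    using der_mult[OF j y, of "con \<tau>"] tau Suc by simp
  also have "\<dots> = \<Delta> (Suc k) y \<otimes>\<^bsub>P\<^esub> \<Delta> (j - Suc k) (con \<tau>)
      \<oplus>\<^bsub>P\<^esub> (\<Oplus>\<^bsub>P\<^esub>i\<in>{..k}. \<Delta> i y \<otimes>\<^bsub>P\<^esub> \<Delta> (j - i) (con \<tau>))"
    using \<Delta>y \<Delta>t Suc by (intro UP.P.finsum_Suc) auto
  finally show ?thesis unfolding rest using Suc tau by (simp add: der_0)
qed

lemma der_tau_pow:
  assumes "j \<le> m"
  shows "\<Delta> j (con (\<tau> [^] i)) = [(i choose j)] \<cdot>\<^bsub>P\<^esub> con (\<tau> [^] i \<otimes> \<sigma> [^] j)"
  using assms
proof (induction i arbitrary: j)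
  case 0
  show ?case
  proof (cases "j = 0")
    case True
    then show ?thesis using der_0[of "con \<one>"] by simp
  next
    case False
    then show ?thesis using der_one[of j] 0 by (cases j) auto
  qed
next
  case (Suc i)
  have ct: "con (\<tau> [^] Suc i) = con (\<tau> [^] i) \<otimes>\<^bsub>P\<^esub> con \<tau>" using tau by simp
  show ?case
  proof (cases j)
    case 0
    then show ?thesis using tau by (simp add: der_0)
  next
    case (Suc k)
    have "[(i choose j)] \<cdot>\<^bsub>P\<^esub> con (\<tau> [^] i \<otimes> \<sigma> [^] j) \<otimes>\<^bsub>P\<^esub> con \<tau> = [(i choose j)] \<cdot>\<^bsub>P\<^esub> con (\<tau> [^] Suc i \<otimes> \<sigma> [^] j)"
      using tau by (simp add: UP.P.add_pow_ldistr m_ac flip: con.hom_mult)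
    moreover have "\<tau> [^] i \<otimes> \<sigma> [^] k = \<tau> [^] Suc i \<otimes> \<sigma> [^] j"
    proof -
      have "\<tau> [^] Suc i \<otimes> \<sigma> [^] j = (\<tau> [^] i \<otimes> \<sigma> [^] k) \<otimes> (\<tau> \<otimes> \<sigma>)"
        using tau(1,2) Suc by (simp add: m_ac)
      then show ?thesis using tau by simp
    qed
    ultimately have "\<Delta> j (con (\<tau> [^] Suc i)) = [(i choose j)] \<cdot>\<^bsub>P\<^esub> con (\<tau> [^] Suc i \<otimes> \<sigma> [^] j)
        \<oplus>\<^bsub>P\<^esub> [(i choose k)] \<cdot>\<^bsub>P\<^esub> con (\<tau> [^] Suc i \<otimes> \<sigma> [^] j)"
      unfolding ct using Suc Suc.IH[of j] Suc.IH[of k] Suc.prems tau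
      by (subst der_tau_step) auto
    also have "\<dots> = [(Suc i choose j)] \<cdot>\<^bsub>P\<^esub> con (\<tau> [^] Suc i \<otimes> \<sigma> [^] j)"
      using tau Suc by (simp add: UP.P.add.nat_pow_mult add.commute)
    finally show ?thesis .
  qed
qed

lemma der_homogeneous:
  assumes h: "0 < \<gamma>" "h \<in> carrier R" "hc \<gamma> h = h" "h \<noteq> \<zero>" and j: "j \<le> m"
  obtains N :: nat where "\<Delta> j (con h) = con ([N] \<cdot> (h \<otimes> \<sigma> [^] j))"
proof -
  obtain i :: nat and c where c: "c \<in> carrier R" "con c \<in> Cst" "h = \<tau> [^] i \<otimes> c"
    using homogeneous_normal_form[OF h] .
  have "con h = con c \<otimes>\<^bsub>P\<^esub> con (\<tau> [^] i)"
    unfolding c(3) using c tau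
    by (simp only: con.hom_mult nat_pow_closed con.hom_closed UP.P.m_comm[of "con (\<tau> [^] i)"])
  then have "\<Delta> j (con h) = con c \<otimes>\<^bsub>P\<^esub> [(i choose j)] \<cdot>\<^bsub>P\<^esub> con (\<tau> [^] i \<otimes> \<sigma> [^] j)"
    using c tau j by (simp only: der_const_mult der_tau_pow con.hom_closed nat_pow_closed)
  also have "\<dots> = [(i choose j)] \<cdot>\<^bsub>P\<^esub> con (h \<otimes> \<sigma> [^] j)"
    using c tau by (simp add: UP.P.add_pow_rdistr m_ac flip: con.hom_mult)
  also have "\<dots> = con ([(i choose j)] \<cdot> (h \<otimes> \<sigma> [^] j))"
    using h tau by (simp only: con_nat_mult m_closed nat_pow_closed)
  finally show ?thesis by (rule that)
qed

declare con.hom_pow [simp del]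

lemma one_homogeneous: "hc 1 \<one> = \<one>"
proof -
  have "hc (\<theta> * 1) (\<tau> \<otimes> \<one>) = \<tau> \<otimes> hc 1 \<one>"
    by (rule hc_homogeneous_mult[OF theta_pos tau(1) tau_homogeneous one_closed])
  then have "\<sigma> \<otimes> (\<tau> \<otimes> hc 1 \<one>) = \<sigma> \<otimes> \<tau>" using tau tau_homogeneous by simp
  then show ?thesis using tau hc_closed[OF one_closed, of 1] by (simp add: m_assoc[symmetric])
qed

lemma sigma_homogeneous: "hc (1 / \<theta>) \<sigma> = \<sigma>"
proof -
  have "hc (\<theta> * (1 / \<theta>)) (\<tau> \<otimes> \<sigma>) = \<tau> \<otimes> hc (1 / \<theta>) \<sigma>"
    by (rule hc_homogeneous_mult[OF theta_pos tau(1) tau_homogeneous tau(2)])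
  then have "hc 1 \<one> = \<tau> \<otimes> hc (1 / \<theta>) \<sigma>" using theta_pos by (simp add: tau(3))
  then have "\<sigma> \<otimes> (\<tau> \<otimes> hc (1 / \<theta>) \<sigma>) = \<sigma> \<otimes> \<one>" by (simp only: one_homogeneous)
  then show ?thesis using tau hc_closed[OF tau(2), of "1 / \<theta>"] by (simp add: m_assoc[symmetric])
qed

lemma sigma_pow_homogeneous: "hc ((1 / \<theta>) ^ j) (\<sigma> [^] j) = \<sigma> [^] j"
proof (induction j)
  case 0
  then show ?case by (simp add: one_homogeneous)
next
  case (Suc j)
  have "hc ((1 / \<theta>) ^ j * (1 / \<theta>)) (\<sigma> [^] j \<otimes> \<sigma>) = \<sigma> [^] j \<otimes> hc (1 / \<theta>) \<sigma>"
    using theta_pos tau Suc by (intro hc_homogeneous_mult) auto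
  then show ?case by (simp add: sigma_homogeneous mult.commute)
qed

lemma hc_nat_mult: "x \<in> carrier R \<Longrightarrow> hc \<gamma> ([(N :: nat)] \<cdot> x) = [N] \<cdot> hc \<gamma> x"
  by (induction N) (simp_all add: hc_zero hc_add)

lemma der_con_ex:
  assumes "r \<in> carrier R" "j \<le> m"
  shows "\<exists>s\<in>carrier R. \<Delta> j (con r) = con s"
  using assms(1)
proof (induction r rule: homogeneous_induct)
  case zero
  then show ?case using assms(2) by (intro bexI[of _ \<zero>]) (auto simp: der_zero)
next
  case (homogeneous \<gamma> h)
  show ?case
    by (rule der_homogeneous[OF homogeneous assms(2)]) (use homogeneous tau in auto)
next
  case (add y z)
  then obtain a b where "a \<in> carrier R" "b \<in> carrier R" "\<Delta> j (con y) = con a" "\<Delta> j (con z) = con b"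
    by blast
  then show ?case using add assms(2) by (intro bexI[of _ "a \<oplus> b"]) (auto simp: der_add)
qed

text \<open>On the subring \<open>R\<close> each operator takes values in \<open>R\<close>: homogeneous elements are powers of \<open>\<tau>\<close> times
  constants, and \<open>\<Delta> j\<close> maps a power of \<open>\<tau>\<close> to a multiple of another.\<close>

definition \<delta> :: "nat \<Rightarrow> 'a \<Rightarrow> 'a" where "\<delta> j r = coeff P (\<Delta> j (con r)) 0"

lemma der_con:
  assumes r: "r \<in> carrier R" and j: "j \<le> m"
  shows "\<Delta> j (con r) = con (\<delta> j r)" and "\<delta> j r \<in> carrier R"
proof -
  obtain s where s: "s \<in> carrier R" "\<Delta> j (con r) = con s" using der_con_ex[OF r j] by blast
  then have "\<delta> j r = s" using UP.coeff_monom[of s 0 0] by (simp add: \<delta>_def)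
  then show "\<Delta> j (con r) = con (\<delta> j r)" and "\<delta> j r \<in> carrier R" using s by simp_all
qed

lemma delta_add:
  assumes "r \<in> carrier R" "s \<in> carrier R" "j \<le> m"
  shows "\<delta> j (r \<oplus> s) = \<delta> j r \<oplus> \<delta> j s"
proof (rule con_inj)
  show "con (\<delta> j (r \<oplus> s)) = con (\<delta> j r \<oplus> \<delta> j s)"
    using assms by (simp add: der_con(2) der_add flip: der_con(1))
qed (use assms in \<open>auto simp: der_con\<close>)

lemma delta_zero: "j \<le> m \<Longrightarrow> \<delta> j \<zero> = \<zero>"
  by (simp add: \<delta>_def der_zero)

text \<open>On \<open>\<tau>\<^sup>i c\<close> with \<open>c\<close> constant, \<open>\<delta> j\<close> is multiplication by a binomial coefficient and by \<open>\<tau>\<^sup>-\<^sup>j\<close>.\<close>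

lemma delta_shift:
  assumes r: "r \<in> carrier R" and j: "j \<le> m"
  shows "hc \<gamma> (\<delta> j r) = \<delta> j (hc (\<gamma> * \<theta> ^ j) r)"
  using r
proof (induction r rule: homogeneous_induct)
  case zero
  then show ?case using j by (simp add: hc_zero delta_zero)
next
  case (homogeneous \<beta> h)
  have hs: "h \<otimes> \<sigma> [^] j \<in> carrier R" using homogeneous(2) tau by simp
  obtain N :: nat where "\<Delta> j (con h) = con ([N] \<cdot> (h \<otimes> \<sigma> [^] j))"
    using der_homogeneous[OF homogeneous j] .
  then have dh: "\<delta> j h = [N] \<cdot> (h \<otimes> \<sigma> [^] j)"
    using der_con[OF homogeneous(2) j] hs by (intro con_inj) auto
  have "hc (\<beta> * (1 / \<theta>) ^ j) (h \<otimes> \<sigma> [^] j) = h \<otimes> \<sigma> [^] j"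
    using hc_homogeneous_mult[OF homogeneous(1-3), of "\<sigma> [^] j" "(1 / \<theta>) ^ j"] tau
    by (simp add: sigma_pow_homogeneous)
  then have hw: "hc \<gamma> (h \<otimes> \<sigma> [^] j) = (if \<gamma> = \<beta> * (1 / \<theta>) ^ j then h \<otimes> \<sigma> [^] j else \<zero>)"
    using hc_hc[OF hs, of \<gamma> "\<beta> * (1 / \<theta>) ^ j"] by (auto split: if_splits)
  have hh: "hc (\<gamma> * \<theta> ^ j) h = (if \<gamma> * \<theta> ^ j = \<beta> then h else \<zero>)"
    using hc_hc[OF homogeneous(2), of "\<gamma> * \<theta> ^ j" \<beta>] homogeneous(3) by (auto split: if_splits)
  have "\<gamma> * \<theta> ^ j = \<beta> \<longleftrightarrow> \<gamma> = \<beta> * (1 / \<theta>) ^ j" using theta_pos by (auto simp: field_simps)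
  then show ?case using hs j by (auto simp: dh hh hc_nat_mult hw delta_zero)
next
  case (add y z)
  then show ?case using j by (simp add: delta_add hc_add hc_closed der_con(2))
qed

text \<open>If each \<open>\<delta> j x\<close> is the multiple \<open>x w\<^sub>j\<close>, then \<open>w\<^sub>j\<close> is homogeneous, because \<open>\<delta> j\<close> shifts
  degrees. Comparing the components of highest degree replaces \<open>x\<close> by a unit.\<close>

lemma homogeneous_eigenvector:
  assumes x: "x \<in> carrier R" "x \<noteq> \<zero>"
    and w: "\<And>j. j \<le> m \<Longrightarrow> w j \<in> carrier R" and eq: "\<And>j. j \<le> m \<Longrightarrow> \<delta> j x = x \<otimes> w j"
  obtains e where "e \<in> Units R" "\<And>j. j \<le> m \<Longrightarrow> \<delta> j e = e \<otimes> w j"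
proof -
  define \<mu> where "\<mu> = Max (degrees x)"
  have \<mu>: "\<mu> \<in> degrees x" unfolding \<mu>_def using degrees_props[OF x(1)] x by (intro Max_in) auto
  show ?thesis
  proof (rule that)
    show "hc \<mu> x \<in> Units R" by (rule hc_unit[OF x(1) \<mu>])
    fix j assume j: "j \<le> m"
    define \<kappa> where "\<kappa> = 1 / \<theta> ^ j"
    have \<kappa>: "0 < \<kappa>" "\<kappa> * \<mu> * \<theta> ^ j = \<mu>" using theta_pos by (auto simp: \<kappa>_def)
    have "hc \<kappa> (w j) = w j"
    proof (rule homogeneous_quotient[OF x w[OF j] \<kappa>(1)])
      fix \<gamma> assume "\<gamma> \<in> degrees (x \<otimes> w j)"
      then have "\<delta> j (hc (\<gamma> * \<theta> ^ j) x) \<noteq> \<zero>"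
        using delta_shift[OF x(1) j, of \<gamma>] eq[OF j] by (simp add: degrees_def)
      then have "hc (\<gamma> * \<theta> ^ j) x \<noteq> \<zero>" using delta_zero[OF j] by auto
      then show "\<gamma> / \<kappa> \<in> degrees x" by (simp add: degrees_def \<kappa>_def)
    qed
    then have "hc (\<kappa> * \<mu>) (w j \<otimes> x) = w j \<otimes> hc \<mu> x"
      using x w[OF j] \<kappa> by (intro hc_homogeneous_mult) auto
    moreover have "hc (\<kappa> * \<mu>) (\<delta> j x) = \<delta> j (hc \<mu> x)"
      using delta_shift[OF x(1) j, of "\<kappa> * \<mu>"] \<kappa> by simp
    ultimately show "\<delta> j (hc \<mu> x) = hc \<mu> x \<otimes> w j"
      using x w[OF j] eq[OF j] by (simp add: m_comm hc_closed)
  qed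
qed

text \<open>Substituting \<open>-\<tau>\<close> for the variable in the expansion of an element: as \<open>\<tau>\<close> expands to \<open>\<tau> + S\<close>,
  this kills \<open>\<tau>, \<dots>, \<tau>\<^sup>m\<close> and fixes constants, so it projects onto the constants.\<close>

definition proj :: "(nat \<Rightarrow> 'a) \<Rightarrow> nat \<Rightarrow> 'a" where
  "proj f = (\<Oplus>\<^bsub>P\<^esub>j\<in>{..m}. con ((\<ominus> \<tau>) [^] j) \<otimes>\<^bsub>P\<^esub> \<Delta> j f)"

lemma proj_closed: "f \<in> carrier P \<Longrightarrow> proj f \<in> carrier P"
  unfolding proj_def using tau by (intro UP.P.finsum_closed) (auto simp: der_closed)

lemma proj_add:
  assumes f: "f \<in> carrier P" and g: "g \<in> carrier P"
  shows "proj (f \<oplus>\<^bsub>P\<^esub> g) = proj f \<oplus>\<^bsub>P\<^esub> proj g"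
proof -
  have "proj (f \<oplus>\<^bsub>P\<^esub> g) = (\<Oplus>\<^bsub>P\<^esub>j\<in>{..m}. con ((\<ominus> \<tau>) [^] j) \<otimes>\<^bsub>P\<^esub> \<Delta> j f
      \<oplus>\<^bsub>P\<^esub> con ((\<ominus> \<tau>) [^] j) \<otimes>\<^bsub>P\<^esub> \<Delta> j g)"
    unfolding proj_def using f g tau
    by (intro UP.P.finsum_cong') (auto simp: der_add der_closed UP.P.r_distr)
  also have "\<dots> = proj f \<oplus>\<^bsub>P\<^esub> proj g"
    unfolding proj_def using f g tau by (intro UP.P.finsum_addf) (auto simp: der_closed)
  finally show ?thesis .
qed

lemma proj_const_mult:
  assumes c: "c \<in> Cst" and x: "x \<in> carrier P"
  shows "proj (c \<otimes>\<^bsub>P\<^esub> x) = c \<otimes>\<^bsub>P\<^esub> proj x"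
proof -
  have cP: "c \<in> carrier P" using c by (rule CstD)
  have "proj (c \<otimes>\<^bsub>P\<^esub> x) = (\<Oplus>\<^bsub>P\<^esub>j\<in>{..m}. c \<otimes>\<^bsub>P\<^esub> (con ((\<ominus> \<tau>) [^] j) \<otimes>\<^bsub>P\<^esub> \<Delta> j x))"
    unfolding proj_def using c cP x tau
    by (intro UP.P.finsum_cong') (auto simp: der_const_mult der_closed UP.P.m_ac)
  also have "\<dots> = c \<otimes>\<^bsub>P\<^esub> proj x"
    unfolding proj_def using cP x tau
    by (intro UP.P.finsum_rdistr[symmetric]) (auto simp: der_closed)
  finally show ?thesis .
qed

lemma finsum_int_multiples:
  assumes "finite S" "x \<in> carrier P"
  shows "(\<Oplus>\<^bsub>P\<^esub>i\<in>S. [(k i :: int)] \<cdot>\<^bsub>P\<^esub> x) = [(sum k S)] \<cdot>\<^bsub>P\<^esub> x"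
  using assms(1)
proof (induction S)
  case empty
  show ?case using assms(2) by (simp add: add_pow_def)
next
  case (insert i S)
  have c: "[(k i)] \<cdot>\<^bsub>P\<^esub> x \<in> carrier P" for i using assms(2) by (rule UP.P.add.int_pow_closed)
  show ?case using insert c assms(2)
    by (subst UP.P.finsum_insert) (auto simp: UP.P.add.int_pow_mult)
qed

lemma minus_one_pow: "(\<ominus> \<one>) [^] (j::nat) = [((- 1) ^ j :: int)] \<cdot> \<one>"
proof (induction j)
  case 0
  then show ?case by (simp add: add.int_pow_1)
next
  case (Suc j)
  have "(\<ominus> \<one>) [^] Suc j = \<ominus> ([((- 1) ^ j :: int)] \<cdot> \<one>)"
    using Suc add.int_pow_closed[OF one_closed, of "(- 1) ^ j"] by (simp add: r_minus)
  then show ?case by (simp add: add.int_pow_neg)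
qed

text \<open>The terms are the alternating binomial coefficients, times \<open>\<tau>\<^sup>i\<close>.\<close>

lemma proj_tau_pow:
  assumes i: "i \<le> m"
  shows "proj (con (\<tau> [^] i)) = (if i = 0 then \<one>\<^bsub>P\<^esub> else \<zero>\<^bsub>P\<^esub>)"
proof -
  have ti: "\<tau> [^] i \<in> carrier R" using tau by simp
  have "con ((\<ominus> \<tau>) [^] j) \<otimes>\<^bsub>P\<^esub> \<Delta> j (con (\<tau> [^] i)) = [((- 1) ^ j * int (i choose j))] \<cdot>\<^bsub>P\<^esub> con (\<tau> [^] i)"
    if j: "j \<le> m" for j
  proof -
    have "(\<ominus> \<tau>) [^] j \<otimes> (\<tau> [^] i \<otimes> \<sigma> [^] j) = ((\<ominus> \<tau>) \<otimes> \<sigma>) [^] j \<otimes> \<tau> [^] i"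
      using tau(1,2) by (simp add: nat_pow_distrib m_ac)
    also have "(\<ominus> \<tau>) \<otimes> \<sigma> = \<ominus> \<one>" using tau by (simp add: l_minus)
    finally have e: "(\<ominus> \<tau>) [^] j \<otimes> (\<tau> [^] i \<otimes> \<sigma> [^] j) = [((- 1) ^ j :: int)] \<cdot> (\<tau> [^] i)"
      using ti by (simp add: minus_one_pow add_pow_ldistr_int)
    have "con ([(k :: int)] \<cdot> a) = [k] \<cdot>\<^bsub>P\<^esub> con a" if "a \<in> carrier R" for k a
    proof -
      show ?thesis using that con_nat_mult[OF that] by (cases "k \<ge> 0") (simp_all add: add_pow_int_ge add_pow_int_lt)
    qed
    then have "con ((\<ominus> \<tau>) [^] j) \<otimes>\<^bsub>P\<^esub> con (\<tau> [^] i \<otimes> \<sigma> [^] j) = [((- 1) ^ j :: int)] \<cdot>\<^bsub>P\<^esub> con (\<tau> [^] i)"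
      using con.hom_mult[of "(\<ominus> \<tau>) [^] j" "\<tau> [^] i \<otimes> \<sigma> [^] j"] tau ti e by simp
    moreover have "[(i choose j)] \<cdot>\<^bsub>P\<^esub> con (\<tau> [^] i \<otimes> \<sigma> [^] j) = [int (i choose j)] \<cdot>\<^bsub>P\<^esub> con (\<tau> [^] i \<otimes> \<sigma> [^] j)"
      by (simp add: add_pow_int_ge)
    ultimately show ?thesis
      using tau ti j UP.P.add.int_pow_pow[of "con (\<tau> [^] i)" "int (i choose j)" "(- 1) ^ j"]
      by (simp add: der_tau_pow UP.P.add_pow_rdistr_int mult.commute)
  qed
  then have "proj (con (\<tau> [^] i)) = (\<Oplus>\<^bsub>P\<^esub>j\<in>{..m}. [((- 1) ^ j * int (i choose j))] \<cdot>\<^bsub>P\<^esub> con (\<tau> [^] i))"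
    unfolding proj_def using ti by (intro UP.P.finsum_cong') auto
  also have "\<dots> = [(\<Sum>j\<le>m. (- 1) ^ j * int (i choose j))] \<cdot>\<^bsub>P\<^esub> con (\<tau> [^] i)"
    using ti by (intro finsum_int_multiples) auto
  also have "(\<Sum>j\<le>m. (- 1) ^ j * int (i choose j)) = (\<Sum>j\<le>i. (- 1) ^ j * int (i choose j))"
    using i by (intro sum.mono_neutral_right) auto
  also have "\<dots> = (if i = 0 then 1 else 0)"
    using choose_alternating_sum[of i, where 'a = int] by auto
  finally show ?thesis using ti by (auto simp: add_pow_int_ge)
qed

lemma tau_generated [consumes 1, case_names zero gen add]:
  assumes x: "x \<in> carrier P" and zero: "Q \<zero>\<^bsub>P\<^esub>"
    and gen: "\<And>l c. l \<le> m \<Longrightarrow> c \<in> Cst \<Longrightarrow> Q (con (\<tau> [^] l) \<otimes>\<^bsub>P\<^esub> c)"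
    and add: "\<And>x y. x \<in> carrier P \<Longrightarrow> y \<in> carrier P \<Longrightarrow> Q x \<Longrightarrow> Q y \<Longrightarrow> Q (x \<oplus>\<^bsub>P\<^esub> y)"
  shows "Q x"
proof (rule generated[OF x zero _ add])
  fix r c assume r: "r \<in> carrier R" and c: "c \<in> Cst"
  have cP: "c \<in> carrier P" using c by (rule CstD)
  show "Q (con r \<otimes>\<^bsub>P\<^esub> c)"
    using r
  proof (induction r rule: homogeneous_induct)
    case zero
    then show ?case using assms(2) cP by simp
  next
    case (homogeneous \<gamma> h)
    obtain l e where l: "l \<le> m" "e \<in> carrier R" "con e \<in> Cst" "h = \<tau> [^] l \<otimes> e"
      using homogeneous_normal_form[OF homogeneous] .
    have "con h \<otimes>\<^bsub>P\<^esub> c = con (\<tau> [^] l) \<otimes>\<^bsub>P\<^esub> (con e \<otimes>\<^bsub>P\<^esub> c)"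
      using l cP tau(1) by (simp add: UP.P.m_assoc)
    then show ?case using gen[OF l(1) Cst_mult[OF l(3) c]] by simp
  next
    case (add y z)
    then show ?case using assms(4)[of "con y \<otimes>\<^bsub>P\<^esub> c" "con z \<otimes>\<^bsub>P\<^esub> c"] cP by (simp add: UP.P.l_distr)
  qed
qed

lemma proj_const:
  assumes "x \<in> carrier P"
  shows "proj x \<in> Cst"
  using assms
proof (induction x rule: tau_generated)
  case zero
  have "proj \<zero>\<^bsub>P\<^esub> = \<zero>\<^bsub>P\<^esub>"
    unfolding proj_def using tau by (intro UP.P.add.finprod_one_eqI) (auto simp: der_zero)
  then show ?case by (simp add: Cst_zero)
next
  case (gen l c)
  have c: "c \<in> carrier P" using gen CstD by blast
  have "proj (con (\<tau> [^] l) \<otimes>\<^bsub>P\<^esub> c) = c \<otimes>\<^bsub>P\<^esub> proj (con (\<tau> [^] l))"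
    using proj_const_mult[OF gen(2), of "con (\<tau> [^] l)"] c tau(1) by (simp add: UP.P.m_comm)
  then show ?case using gen c by (simp add: proj_tau_pow Cst_zero)
next
  case (add x y)
  then show ?case by (simp add: proj_add Cst_add)
qed

text \<open>It suffices to treat \<open>x = \<tau>\<^sup>l c\<close> with \<open>l \<le> m\<close> and \<open>c\<close> constant. Up to a constant factor, \<open>\<tau>\<^bsup>l-i\<^esup>\<close> is a power
  of \<open>\<tau>\<close> with exponent between \<open>1\<close> and \<open>m\<close> unless \<open>i = l\<close>, so only that term survives the projection.\<close>

lemma proj_decomposition:
  assumes "x \<in> carrier P"
  shows "x = (\<Oplus>\<^bsub>P\<^esub>i\<in>{..m}. con (\<tau> [^] i) \<otimes>\<^bsub>P\<^esub> proj (con (\<sigma> [^] i) \<otimes>\<^bsub>P\<^esub> x))"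
  using assms
proof (induction x rule: tau_generated)
  case zero
  have "proj \<zero>\<^bsub>P\<^esub> = \<zero>\<^bsub>P\<^esub>"
    unfolding proj_def using tau by (intro UP.P.add.finprod_one_eqI) (auto simp: der_zero)
  then have "(\<Oplus>\<^bsub>P\<^esub>i\<in>{..m}. con (\<tau> [^] i) \<otimes>\<^bsub>P\<^esub> proj (con (\<sigma> [^] i) \<otimes>\<^bsub>P\<^esub> \<zero>\<^bsub>P\<^esub>)) = \<zero>\<^bsub>P\<^esub>"
    using tau by (intro UP.P.add.finprod_one_eqI) auto
  then show ?case by simp
next
  case (gen l c)
  have c: "c \<in> carrier P" using gen CstD by blast
  let ?x = "con (\<tau> [^] l) \<otimes>\<^bsub>P\<^esub> c"
  have pr: "proj (con a \<otimes>\<^bsub>P\<^esub> e) = e \<otimes>\<^bsub>P\<^esub> proj (con a)" if "a \<in> carrier R" "e \<in> Cst" for a e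
    using proj_const_mult[OF that(2), of "con a"] that CstD(1)[OF that(2)] by (simp add: UP.P.m_comm)
  have "proj (con (\<sigma> [^] i) \<otimes>\<^bsub>P\<^esub> ?x) = (if i = l then c else \<zero>\<^bsub>P\<^esub>)" if i: "i \<le> m" for i
  proof (cases "i \<le> l")
    case True
    have "con (\<sigma> [^] i) \<otimes>\<^bsub>P\<^esub> ?x = con (\<tau> [^] (l - i)) \<otimes>\<^bsub>P\<^esub> c"
    proof -
      have "con (\<sigma> [^] i) \<otimes>\<^bsub>P\<^esub> con (\<tau> [^] l) = con (\<tau> [^] (l - i))"
        using tau(1,2) tau_sigma_le[OF True] m_comm[of "\<sigma> [^] i" "\<tau> [^] l"]
        by (simp add: con.hom_mult[symmetric] del: con.hom_mult)
      then show ?thesis using c tau(1,2) by (simp add: UP.P.m_assoc[symmetric])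
    qed
    then show ?thesis
      using pr[of "\<tau> [^] (l - i)" c] gen c tau(1) True proj_tau_pow[of "l - i"] by auto
  next
    case False
    let ?k = "Suc m - (i - l)"
    have k: "?k \<le> m" "?k \<noteq> 0" "?k + (i - l) = Suc m" using False i by auto
    have "\<sigma> [^] i \<otimes> \<tau> [^] l = \<sigma> [^] (i - l)" using sigma_tau_le[of l i] False by simp
    also have "\<dots> = \<tau> [^] ?k \<otimes> \<sigma> [^] ?k \<otimes> \<sigma> [^] (i - l)" using tau(2) tau_sigma_pow by simp
    also have "\<dots> = \<tau> [^] ?k \<otimes> \<sigma> [^] Suc m"
      using tau(1,2) by (simp only: m_assoc nat_pow_mult nat_pow_closed k)
    finally have e: "con (\<sigma> [^] i) \<otimes>\<^bsub>P\<^esub> con (\<tau> [^] l) = con (\<tau> [^] ?k) \<otimes>\<^bsub>P\<^esub> con (\<sigma> [^] Suc m)"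
      using tau(1,2) by (simp only: con.hom_mult[symmetric] nat_pow_closed)
    have s: "con (\<sigma> [^] Suc m) \<in> Cst"
      unfolding con_pow[OF tau(2)] by (rule frobenius_const) (use tau in simp)
    have "con (\<sigma> [^] i) \<otimes>\<^bsub>P\<^esub> ?x = con (\<tau> [^] ?k) \<otimes>\<^bsub>P\<^esub> (con (\<sigma> [^] Suc m) \<otimes>\<^bsub>P\<^esub> c)"
    proof -
      have "con (\<sigma> [^] i) \<otimes>\<^bsub>P\<^esub> ?x = (con (\<sigma> [^] i) \<otimes>\<^bsub>P\<^esub> con (\<tau> [^] l)) \<otimes>\<^bsub>P\<^esub> c"
        using c tau(1,2) by (intro UP.P.m_assoc[symmetric]) auto
      also have "\<dots> = con (\<tau> [^] ?k) \<otimes>\<^bsub>P\<^esub> (con (\<sigma> [^] Suc m) \<otimes>\<^bsub>P\<^esub> c)"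
        unfolding e using c tau(1,2) by (intro UP.P.m_assoc) auto
      finally show ?thesis .
    qed
    then have "proj (con (\<sigma> [^] i) \<otimes>\<^bsub>P\<^esub> ?x) = \<zero>\<^bsub>P\<^esub>"
      using pr[OF _ Cst_mult[OF s gen(2)], of "\<tau> [^] ?k"] tau(1) c CstD(1)[OF s] proj_tau_pow[OF k(1)] k(2)
      by simp
    then show ?thesis using False by simp
  qed
  then have eq1: "(\<Oplus>\<^bsub>P\<^esub>i\<in>{..m}. con (\<tau> [^] i) \<otimes>\<^bsub>P\<^esub> proj (con (\<sigma> [^] i) \<otimes>\<^bsub>P\<^esub> ?x))
    = (\<Oplus>\<^bsub>P\<^esub>i\<in>{..m}. if l = i then con (\<tau> [^] i) \<otimes>\<^bsub>P\<^esub> c else \<zero>\<^bsub>P\<^esub>)"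
    using tau(1) c by (intro UP.P.finsum_cong') auto
  have eq2: "(\<Oplus>\<^bsub>P\<^esub>i\<in>{..m}. if l = i then con (\<tau> [^] i) \<otimes>\<^bsub>P\<^esub> c else \<zero>\<^bsub>P\<^esub>) = ?x"
    using gen tau(1) c by (subst UP.P.finsum_singleton) auto
  show ?case by (rule sym[OF trans[OF eq1 eq2]])
next
  case (add x y)
  let ?t = "\<lambda>x i. con (\<tau> [^] i) \<otimes>\<^bsub>P\<^esub> proj (con (\<sigma> [^] i) \<otimes>\<^bsub>P\<^esub> x)"
  have cl: "con (\<tau> [^] i) \<in> carrier P" "con (\<sigma> [^] i) \<in> carrier P" for i :: nat using tau by auto
  have tc: "?t z i \<in> carrier P" if "z \<in> carrier P" for z and i :: nat
    using that cl by (intro UP.P.m_closed proj_closed)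
  have "?t (x \<oplus>\<^bsub>P\<^esub> y) i = ?t x i \<oplus>\<^bsub>P\<^esub> ?t y i" for i :: nat
    using add(1,2) cl[of i] by (simp only: UP.P.r_distr proj_add UP.P.m_closed proj_closed)
  then have eq1: "(\<Oplus>\<^bsub>P\<^esub>i\<in>{..m}. ?t (x \<oplus>\<^bsub>P\<^esub> y) i) = (\<Oplus>\<^bsub>P\<^esub>i\<in>{..m}. ?t x i \<oplus>\<^bsub>P\<^esub> ?t y i)" by simp
  have eq2: "(\<Oplus>\<^bsub>P\<^esub>i\<in>{..m}. ?t x i \<oplus>\<^bsub>P\<^esub> ?t y i) = (\<Oplus>\<^bsub>P\<^esub>i\<in>{..m}. ?t x i) \<oplus>\<^bsub>P\<^esub> (\<Oplus>\<^bsub>P\<^esub>i\<in>{..m}. ?t y i)"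
    using tc add(1,2) by (intro UP.P.finsum_addf) auto
  have eq3: "(\<Oplus>\<^bsub>P\<^esub>i\<in>{..m}. ?t x i) \<oplus>\<^bsub>P\<^esub> (\<Oplus>\<^bsub>P\<^esub>i\<in>{..m}. ?t y i) = x \<oplus>\<^bsub>P\<^esub> y"
    by (rule arg_cong2[where f = "(\<oplus>\<^bsub>P\<^esub>)", OF add(3,4)[symmetric]])
  show ?case by (rule sym[OF trans[OF eq1 trans[OF eq2 eq3]]])
qed

declare UP.coeff_mult [simp del]

definition linear :: "(nat \<Rightarrow> 'a) set" where
  "linear = {f \<in> carrier P. \<forall>n>1. coeff P f n = \<zero>}"

abbreviation TT :: "nat \<Rightarrow> 'a" where "TT \<equiv> monom P \<one> 1"

lemma linear_closed:
  "f \<in> linear \<Longrightarrow> g \<in> linear \<Longrightarrow> f \<oplus>\<^bsub>P\<^esub> g \<in> linear"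
  "r \<in> carrier R \<Longrightarrow> f \<in> linear \<Longrightarrow> con r \<otimes>\<^bsub>P\<^esub> f \<in> linear"
  by (auto simp: linear_def coeff_con_mult)

lemma linear_finsum:
  assumes "finite S" "\<And>i. i \<in> S \<Longrightarrow> f i \<in> linear"
  shows "(\<Oplus>\<^bsub>P\<^esub>i\<in>S. f i) \<in> linear"
  using assms
proof (induction S)
  case empty
  then show ?case by (simp add: linear_def)
next
  case (insert i S)
  then have "f i \<in> carrier P" "f \<in> S \<rightarrow> carrier P" by (auto simp: linear_def)
  then show ?case using insert by (subst UP.P.finsum_insert) (auto intro: linear_closed)
qed

lemma linear_repr:
  assumes f: "f \<in> linear"
  shows "f = con (coeff P f 1) \<otimes>\<^bsub>P\<^esub> TT \<oplus>\<^bsub>P\<^esub> con (coeff P f 0)"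
proof (rule UP.up_eqI)
  have fP: "f \<in> carrier P" using f by (simp add: linear_def)
  fix n
  have "coeff P (con (coeff P f 1) \<otimes>\<^bsub>P\<^esub> TT \<oplus>\<^bsub>P\<^esub> con (coeff P f 0)) n
    = coeff P f 1 \<otimes> coeff P TT n \<oplus> coeff P (con (coeff P f 0)) n"
    using fP by (simp add: coeff_con_mult)
  then show "coeff P f n = coeff P (con (coeff P f 1) \<otimes>\<^bsub>P\<^esub> TT \<oplus>\<^bsub>P\<^esub> con (coeff P f 0)) n"
    using fP f by (cases "n > 1") (auto simp: linear_def not_less le_Suc_eq)
qed (use f in \<open>auto simp: linear_def\<close>)

lemma der_linear:
  assumes f: "f \<in> linear" and j: "j \<le> m"
  shows "\<Delta> j f \<in> linear"
proof -
  have fP: "f \<in> carrier P" using f by (simp add: linear_def)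
  have T: "\<Delta> i TT \<in> linear" if "i \<le> j" for i
    using der_closed[of i TT] der_T_linear[of i] that j by (simp add: linear_def)
  have con: "con r \<in> linear" if "r \<in> carrier R" for r using that by (simp add: linear_def)
  have "\<Delta> j f = \<Delta> j (con (coeff P f 1) \<otimes>\<^bsub>P\<^esub> TT) \<oplus>\<^bsub>P\<^esub> \<Delta> j (con (coeff P f 0))"
    using fP j linear_repr[OF f] der_add[of j "con (coeff P f 1) \<otimes>\<^bsub>P\<^esub> TT" "con (coeff P f 0)"] by simp
  moreover have "\<Delta> j (con (coeff P f 1) \<otimes>\<^bsub>P\<^esub> TT) \<in> linear"
  proof -
    have "\<Delta> i (con (coeff P f 1)) \<otimes>\<^bsub>P\<^esub> \<Delta> (j - i) TT \<in> linear" if "i \<in> {..j}" for i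
      using that j fP T[of "j - i"] der_con[of "coeff P f 1" i] by (auto intro!: linear_closed)
    then show ?thesis using fP j by (subst der_mult) (auto intro!: linear_finsum)
  qed
  moreover have "\<Delta> j (con (coeff P f 0)) \<in> linear" using fP j by (simp add: der_con con)
  ultimately show ?thesis by (simp add: linear_closed)
qed

lemma proj_linear: "f \<in> linear \<Longrightarrow> proj f \<in> linear"
  unfolding proj_def using tau by (auto intro!: linear_finsum linear_closed der_linear)

lemma coeff_der_con_mult:
  assumes "r \<in> carrier R" "c \<in> Cst" "j \<le> m"
  shows "coeff P (\<Delta> j (con r \<otimes>\<^bsub>P\<^esub> c)) n = \<delta> j r \<otimes> coeff P c n"
proof -
  have c: "c \<in> carrier P" using assms CstD by blast
  have "\<Delta> j (con r \<otimes>\<^bsub>P\<^esub> c) = con (\<delta> j r) \<otimes>\<^bsub>P\<^esub> c"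
    using assms c der_const_mult[OF assms(2), of "con r" j] by (simp add: UP.P.m_comm der_con)
  then show ?thesis using assms c by (simp add: coeff_con_mult der_con)
qed

text \<open>Polynomials of degree at most one are stable under the derivation and under the projection, so
  the projection produces a constant \<open>\<alpha> T + \<beta>\<close> with \<open>\<alpha> \<noteq> 0\<close>. The element \<open>x = \<alpha>\<^sup>m\<close> is then an
  eigenvector: \<open>x\<close> times the constant is \<open>\<alpha>\<^bsup>m+1\<^esup> T + x \<beta>\<close>, where \<open>\<alpha>\<^bsup>m+1\<^esup>\<close> is constant.\<close>

lemma linear_eigenvector:
  obtains e where "e \<in> Units R" "\<And>j. j \<le> m \<Longrightarrow> \<delta> j e = e \<otimes> coeff P (\<Delta> j TT) 1"
proof -
  have TTl: "TT \<in> linear" by (auto simp: linear_def)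
  define c where "c i = proj (con (\<sigma> [^] i) \<otimes>\<^bsub>P\<^esub> TT)" for i :: nat
  have cl: "c i \<in> linear" "c i \<in> Cst" "c i \<in> carrier P" for i
    using tau linear_closed(2)[OF _ TTl] proj_linear proj_const CstD
    by (auto simp: c_def)
  have "\<exists>i\<le>m. coeff P (c i) 1 \<noteq> \<zero>"
  proof (rule ccontr)
    assume "\<not> (\<exists>i\<le>m. coeff P (c i) 1 \<noteq> \<zero>)"
    then have z: "coeff P (c i) 1 = \<zero>" if "i \<le> m" for i using that by blast
    have "TT = (\<Oplus>\<^bsub>P\<^esub>i\<in>{..m}. con (\<tau> [^] i) \<otimes>\<^bsub>P\<^esub> c i)"
      unfolding c_def by (rule proj_decomposition) simp
    then have "coeff P TT 1 = coeff P (\<Oplus>\<^bsub>P\<^esub>i\<in>{..m}. con (\<tau> [^] i) \<otimes>\<^bsub>P\<^esub> c i) 1" by (rule arg_cong)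
    also have "\<dots> = (\<Oplus>i\<in>{..m}. coeff P (con (\<tau> [^] i) \<otimes>\<^bsub>P\<^esub> c i) 1)"
      using cl(3) tau by (intro UP.coeff_finsum) auto
    also have "\<dots> = \<zero>"
      using z cl(3) tau by (intro add.finprod_one_eqI) (simp add: coeff_con_mult)
    finally show False using one_not_zero by simp
  qed
  then obtain i where i: "coeff P (c i) 1 \<noteq> \<zero>" by blast
  define \<alpha> where "\<alpha> = coeff P (c i) 1"
  define \<beta> where "\<beta> = coeff P (c i) 0"
  have \<alpha>: "\<alpha> \<in> carrier R" "\<alpha> \<noteq> \<zero>" and \<beta>: "\<beta> \<in> carrier R" using cl(3) i by (auto simp: \<alpha>_def \<beta>_def)
  have ci: "c i = con \<alpha> \<otimes>\<^bsub>P\<^esub> TT \<oplus>\<^bsub>P\<^esub> con \<beta>"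
    unfolding \<alpha>_def \<beta>_def by (rule linear_repr[OF cl(1)])
  define x where "x = \<alpha> [^] m"
  have "\<alpha> [^] n \<noteq> \<zero>" for n :: nat
    using \<alpha> one_not_zero domain.integral[OF is_domain] by (induction n) auto
  then have x: "x \<in> carrier R" "x \<noteq> \<zero>" using \<alpha> by (auto simp: x_def)
  have q: "con (x \<otimes> \<alpha>) \<in> Cst"
    using frobenius_const[of "con \<alpha>"] \<alpha> by (simp add: x_def con.hom_pow)
  have eq: "\<delta> j x = x \<otimes> coeff P (\<Delta> j TT) 1" if j: "j \<le> m" for j
  proof -
    have dT: "\<Delta> j TT \<in> carrier P" using j by (intro der_closed) auto
    have "con x \<otimes>\<^bsub>P\<^esub> c i = con (x \<otimes> \<alpha>) \<otimes>\<^bsub>P\<^esub> TT \<oplus>\<^bsub>P\<^esub> con (x \<otimes> \<beta>)"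
      unfolding ci using x \<alpha> \<beta> by (simp add: UP.P.r_distr UP.P.m_assoc)
    then have "\<Delta> j (con x \<otimes>\<^bsub>P\<^esub> c i) = con (x \<otimes> \<alpha>) \<otimes>\<^bsub>P\<^esub> \<Delta> j TT \<oplus>\<^bsub>P\<^esub> con (\<delta> j (x \<otimes> \<beta>))"
      using x \<alpha> \<beta> j
      by (simp add: der_add der_const_mult[OF q] der_con(1) del: con.hom_mult)
    then have "coeff P (\<Delta> j (con x \<otimes>\<^bsub>P\<^esub> c i)) 1 = (x \<otimes> \<alpha>) \<otimes> coeff P (\<Delta> j TT) 1"
      using x \<alpha> \<beta> j dT by (simp add: coeff_con_mult der_con(2) del: con.hom_mult)
    moreover have "coeff P (\<Delta> j (con x \<otimes>\<^bsub>P\<^esub> c i)) 1 = \<delta> j x \<otimes> \<alpha>"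
      unfolding \<alpha>_def by (rule coeff_der_con_mult[OF x(1) cl(2) j])
    ultimately have "\<delta> j x \<otimes> \<alpha> = (x \<otimes> \<alpha>) \<otimes> coeff P (\<Delta> j TT) 1" by (simp only:)
    then have "\<delta> j x \<otimes> \<alpha> = (x \<otimes> coeff P (\<Delta> j TT) 1) \<otimes> \<alpha>"
      using x \<alpha> dT by (simp add: m_ac)
    then show ?thesis using x \<alpha> dT der_con(2)[OF x(1) j] by (subst (asm) domain.m_rcancel[OF is_domain]) auto
  qed
  show ?thesis
    by (rule homogeneous_eigenvector[OF x _ eq]) (use der_closed that in auto)
qed

text \<open>Dividing \<open>T\<close> by the unit \<open>e\<close> with the same eigenvalue leaves an element whose higher
  derivatives have degree zero. Its projection to the constants then has the same leading
  coefficient, which is a unit.\<close>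

lemma constant_coordinate:
  obtains e \<beta> where "e \<in> Units R" "\<beta> \<in> carrier R" "con e \<otimes>\<^bsub>P\<^esub> TT \<oplus>\<^bsub>P\<^esub> con \<beta> \<in> Cst"
proof -
  define w where "w j = coeff P (\<Delta> j TT) 1" for j
  obtain e where e: "e \<in> Units R" and ew: "\<And>j. j \<le> m \<Longrightarrow> \<delta> j e = e \<otimes> w j"
    unfolding w_def by (rule linear_eigenvector) blast
  have eR: "e \<in> carrier R" and iR: "inv e \<in> carrier R" and ie: "inv e \<otimes> e = \<one>" "e \<otimes> inv e = \<one>"
    using e by (auto simp: Units_closed)
  have wR: "w j \<in> carrier R" if "j \<le> m" for j unfolding w_def using that by (intro UP.coeff_closed der_closed) auto
  have w0: "w 0 = \<one>" by (simp add: w_def der_0)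
  define f where "f = con (inv e) \<otimes>\<^bsub>P\<^esub> TT"
  have TTl: "TT \<in> linear" by (auto simp: linear_def)
  have fl: "f \<in> linear" unfolding f_def by (rule linear_closed(2)[OF iR TTl])
  have fP: "f \<in> carrier P" using fl by (simp add: linear_def)
  define y where "y j = coeff P (\<Delta> j f) 1" for j
  have yR: "y j \<in> carrier R" if "j \<le> m" for j unfolding y_def using that fP by (intro UP.coeff_closed der_closed)
  have y0: "y 0 = inv e" using fP iR by (simp add: y_def der_0) (simp add: f_def coeff_con_mult)
  have Tf: "TT = con e \<otimes>\<^bsub>P\<^esub> f"
    unfolding f_def using eR iR ie by (simp add: UP.P.m_assoc[symmetric] flip: con.hom_mult)
  \<comment> \<open>compare the coefficients of \<open>T\<close> in the Leibniz expansion of \<open>T = e f\<close>; the terms other than the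
    first and the last vanish by induction\<close>
  have y: "y j = \<zero>" if "1 \<le> j" "j \<le> m" for j
    using that
  proof (induction j rule: less_induct)
    case (less j)
    have cl: "\<Delta> (j - a) f \<in> carrier P" if "a \<le> j" for a using that less.prems fP by (intro der_closed) auto
    have "\<Delta> j TT = (\<Oplus>\<^bsub>P\<^esub>a\<in>{..j}. \<Delta> a (con e) \<otimes>\<^bsub>P\<^esub> \<Delta> (j - a) f)"
      unfolding Tf using eR fP less.prems by (intro der_mult) auto
    also have "\<dots> = (\<Oplus>\<^bsub>P\<^esub>a\<in>{..j}. con (e \<otimes> w a) \<otimes>\<^bsub>P\<^esub> \<Delta> (j - a) f)"
      using eR wR less.prems cl
      by (intro UP.P.finsum_cong') (auto simp: der_con(1) ew simp del: con.hom_mult)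
    finally have "w j = coeff P (\<Oplus>\<^bsub>P\<^esub>a\<in>{..j}. con (e \<otimes> w a) \<otimes>\<^bsub>P\<^esub> \<Delta> (j - a) f) 1"
      by (simp only: w_def)
    also have "\<dots> = (\<Oplus>a\<in>{..j}. coeff P (con (e \<otimes> w a) \<otimes>\<^bsub>P\<^esub> \<Delta> (j - a) f) 1)"
      using eR wR less.prems cl by (intro UP.coeff_finsum) (auto simp del: con.hom_mult)
    also have "\<dots> = (\<Oplus>a\<in>{..j}. (e \<otimes> w a) \<otimes> y (j - a))"
      using eR wR yR less.prems cl
      by (intro finsum_cong') (auto simp: coeff_con_mult y_def simp del: con.hom_mult)
    also have "\<dots> = (\<Oplus>a\<in>insert j (insert 0 ({..j} - {0, j})). (e \<otimes> w a) \<otimes> y (j - a))"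
      by (rule arg_cong[where f = "\<lambda>S. finsum R _ S"]) auto
    also have "\<dots> = (e \<otimes> w j) \<otimes> y 0 \<oplus> ((e \<otimes> w 0) \<otimes> y j \<oplus> (\<Oplus>a\<in>{..j} - {0, j}. (e \<otimes> w a) \<otimes> y (j - a)))"
    proof -
      have t: "(e \<otimes> w a) \<otimes> y (j - a) \<in> carrier R" if "a \<le> j" for a
        using that less.prems eR wR yR by auto
      have s: "(\<Oplus>a\<in>insert 0 ({..j} - {0, j}). (e \<otimes> w a) \<otimes> y (j - a))
          = (e \<otimes> w 0) \<otimes> y (j - 0) \<oplus> (\<Oplus>a\<in>{..j} - {0, j}. (e \<otimes> w a) \<otimes> y (j - a))"
        using t t[of 0] t[of j] less.prems by (intro finsum_insert) auto
      have "(\<Oplus>a\<in>insert j (insert 0 ({..j} - {0, j})). (e \<otimes> w a) \<otimes> y (j - a))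
          = (e \<otimes> w j) \<otimes> y (j - j) \<oplus> (\<Oplus>a\<in>insert 0 ({..j} - {0, j}). (e \<otimes> w a) \<otimes> y (j - a))"
        using t t[of 0] t[of j] less.prems by (intro finsum_insert) auto
      then show ?thesis unfolding s by simp
    qed
    also have "(\<Oplus>a\<in>{..j} - {0, j}. (e \<otimes> w a) \<otimes> y (j - a)) = \<zero>"
    proof (rule add.finprod_one_eqI)
      fix a assume "a \<in> {..j} - {0, j}"
      then have "y (j - a) = \<zero>" "a \<le> m" using less by auto
      then show "(e \<otimes> w a) \<otimes> y (j - a) = \<zero>" using eR wR by simp
    qed
    also have "(e \<otimes> w j) \<otimes> y 0 \<oplus> ((e \<otimes> w 0) \<otimes> y j \<oplus> \<zero>) = w j \<oplus> e \<otimes> y j"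
    proof -
      have "(e \<otimes> w j) \<otimes> inv e = w j"
      proof -
        have "(e \<otimes> w j) \<otimes> inv e = w j \<otimes> (e \<otimes> inv e)"
          using eR iR wR[OF less.prems(2)] by (simp add: m_ac)
        then show ?thesis using ie wR[OF less.prems(2)] by simp
      qed
      then show ?thesis using eR yR[OF less.prems(2)] by (simp add: y0 w0)
    qed
    finally have "w j = w j \<oplus> e \<otimes> y j" .
    then have "e \<otimes> y j = \<zero>" using wR[OF less.prems(2)] yR[OF less.prems(2)] eR
      by (metis add.l_cancel_one' m_closed)
    then have "inv e \<otimes> (e \<otimes> y j) = \<zero>" using iR by simp
    then show ?case using iR eR ie yR[OF less.prems(2)] by (simp add: m_assoc[symmetric])
  qed
  have pc: "proj f \<in> Cst" by (rule proj_const[OF fP])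
  have pl: "proj f \<in> linear" by (rule proj_linear[OF fl])
  have "coeff P (proj f) 1 = (\<Oplus>j\<in>{..m}. coeff P (con ((\<ominus> \<tau>) [^] j) \<otimes>\<^bsub>P\<^esub> \<Delta> j f) 1)"
    unfolding proj_def using tau fP by (intro UP.coeff_finsum) (auto simp: der_closed)
  also have "\<dots> = (\<Oplus>j\<in>{..m}. if 0 = j then inv e else \<zero>)"
  proof (rule finsum_cong'[OF refl])
    fix j assume j: "j \<in> {..m}"
    have "coeff P (con ((\<ominus> \<tau>) [^] j) \<otimes>\<^bsub>P\<^esub> \<Delta> j f) 1 = (\<ominus> \<tau>) [^] j \<otimes> y j"
      using tau fP j by (simp add: coeff_con_mult der_closed y_def)
    then show "coeff P (con ((\<ominus> \<tau>) [^] j) \<otimes>\<^bsub>P\<^esub> \<Delta> j f) 1 = (if 0 = j then inv e else \<zero>)"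
      using y[of j] y0 j tau iR by (cases "j = 0") auto
  qed (use iR in auto)
  also have "\<dots> = inv e" using iR by (intro finsum_singleton) auto
  finally have lead: "coeff P (proj f) 1 = inv e" .
  show ?thesis
  proof (rule that)
    show "inv e \<in> Units R" using e by simp
    show "coeff P (proj f) 0 \<in> carrier R" using pl by (simp add: linear_def)
    show "con (inv e) \<otimes>\<^bsub>P\<^esub> TT \<oplus>\<^bsub>P\<^esub> con (coeff P (proj f) 0) \<in> Cst"
      using linear_repr[OF pl] pc lead by simp
  qed
qed

text \<open>A polynomial \<open>z\<close> that divides its higher derivatives is replaced by its leading coefficient with
  respect to the constant coordinate \<open>c\<close>: the quotients have degree zero, and \<open>\<Delta> j\<close> acts on the
  coefficients of powers of \<open>c\<close>.\<close>

lemma unit_eigenvector: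
  assumes z: "z \<in> carrier P" "z \<noteq> \<zero>\<^bsub>P\<^esub>"
    and W: "\<And>j. j \<le> m \<Longrightarrow> W j \<in> carrier P" and eq: "\<And>j. j \<le> m \<Longrightarrow> \<Delta> j z = z \<otimes>\<^bsub>P\<^esub> W j"
  obtains u where "u \<in> Units R" "\<And>j. j \<le> m \<Longrightarrow> \<Delta> j (con u) = con u \<otimes>\<^bsub>P\<^esub> W j"
proof -
  obtain e \<beta> where e: "e \<in> Units R" and \<beta>: "\<beta> \<in> carrier R" and cC: "con e \<otimes>\<^bsub>P\<^esub> TT \<oplus>\<^bsub>P\<^esub> con \<beta> \<in> Cst"
    by (rule constant_coordinate)
  have eR: "e \<in> carrier R" and iR: "inv e \<in> carrier R" and ie: "inv e \<otimes> e = \<one>"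
    using e by (auto simp: Units_closed)
  define c where "c = con e \<otimes>\<^bsub>P\<^esub> TT \<oplus>\<^bsub>P\<^esub> con \<beta>"
  have cP: "c \<in> carrier P" using eR \<beta> by (simp add: c_def)
  define below where "below d = {f \<in> carrier P. \<forall>n\<ge>d. coeff P f n = \<zero>}" for d
  have below_add: "f \<oplus>\<^bsub>P\<^esub> g \<in> below d" if "f \<in> below d" "g \<in> below d" for f g d
    using that by (auto simp: below_def)
  have cpow: "c [^]\<^bsub>P\<^esub> d \<in> below (Suc d) \<and> coeff P (c [^]\<^bsub>P\<^esub> d) d = e [^] d" for d :: nat
  proof (induction d)
    case 0
    then show ?case by (auto simp: below_def)
  next
    case (Suc d)
    let ?f = "c [^]\<^bsub>P\<^esub> d"
    have f: "?f \<in> carrier P" using cP by simp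
    have "coeff P (g \<otimes>\<^bsub>P\<^esub> c) (Suc n) = e \<otimes> coeff P g n \<oplus> \<beta> \<otimes> coeff P g (Suc n)"
      if g: "g \<in> carrier P" for g n
    proof -
      have "g \<otimes>\<^bsub>P\<^esub> c = con e \<otimes>\<^bsub>P\<^esub> (TT \<otimes>\<^bsub>P\<^esub> g) \<oplus>\<^bsub>P\<^esub> con \<beta> \<otimes>\<^bsub>P\<^esub> g"
        unfolding c_def using g eR \<beta> by (simp add: UP.P.r_distr UP.P.m_ac)
      moreover have "coeff P (TT \<otimes>\<^bsub>P\<^esub> g) (Suc n) = coeff P g n"
        using UP.coeff_monom_mult[OF one_closed g, of 1 n] g by simp
      ultimately show ?thesis using g eR \<beta> by (simp add: coeff_con_mult)
    qed
    note this[OF f]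
    moreover have "\<forall>n\<ge>Suc d. coeff P ?f n = \<zero>" using Suc by (simp add: below_def)
    ultimately have k: "coeff P (?f \<otimes>\<^bsub>P\<^esub> c) (Suc n) = e \<otimes> coeff P ?f n" if "n \<ge> d" for n
      using that f eR \<beta> by simp
    have "coeff P (?f \<otimes>\<^bsub>P\<^esub> c) n = \<zero>" if n: "n \<ge> Suc (Suc d)" for n
    proof -
      obtain n' where n': "n = Suc n'" "n' \<ge> Suc d" using n by (cases n) auto
      then show ?thesis using k[of n'] Suc eR by (simp add: below_def)
    qed
    then show ?case using k[of d] Suc f cP eR by (simp add: below_def m_comm)
  qed
  have split: "\<exists>x z'. x \<in> carrier R \<and> z' \<in> below d \<and> z = con x \<otimes>\<^bsub>P\<^esub> c [^]\<^bsub>P\<^esub> d \<oplus>\<^bsub>P\<^esub> z' \<and> x \<otimes> e [^] d = coeff P z d"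
    if z: "z \<in> below (Suc d)" for z d
  proof -
    have zP: "z \<in> carrier P" using z by (simp add: below_def)
    have ied: "inv e [^] d \<otimes> e [^] d = \<one>" using nat_pow_distrib[OF iR eR, of d] ie by simp
    define x where "x = coeff P z d \<otimes> inv e [^] d"
    have x: "x \<in> carrier R" "x \<otimes> e [^] d = coeff P z d"
      using zP iR eR ied by (auto simp: x_def m_assoc)
    let ?y = "con x \<otimes>\<^bsub>P\<^esub> c [^]\<^bsub>P\<^esub> d"
    have yP: "?y \<in> carrier P" using x cP by simp
    have "coeff P (z \<ominus>\<^bsub>P\<^esub> ?y) n = \<zero>" if "n \<ge> d" for n
    proof -
      have "coeff P (z \<ominus>\<^bsub>P\<^esub> ?y) n = coeff P z n \<ominus> x \<otimes> coeff P (c [^]\<^bsub>P\<^esub> d) n"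
        using x zP cP yP by (simp add: coeff_con_mult)
      moreover have "coeff P z n = x \<otimes> coeff P (c [^]\<^bsub>P\<^esub> d) n"
        using that cpow[of d] z x zP by (cases "n = d") (auto simp: below_def)
      ultimately show ?thesis using x cP by simp
    qed
    then have "z \<ominus>\<^bsub>P\<^esub> ?y \<in> below d" using zP yP by (simp add: below_def)
    moreover have "z = ?y \<oplus>\<^bsub>P\<^esub> (z \<ominus>\<^bsub>P\<^esub> ?y)"
      using zP yP UP.P.a_lcomm[of ?y z "\<ominus>\<^bsub>P\<^esub> ?y"] by (simp add: a_minus_def UP.P.r_neg)
    ultimately show ?thesis using x by blast
  qed
  have lead: "\<Delta> j (con x \<otimes>\<^bsub>P\<^esub> c [^]\<^bsub>P\<^esub> d \<oplus>\<^bsub>P\<^esub> z') = con (\<delta> j x) \<otimes>\<^bsub>P\<^esub> c [^]\<^bsub>P\<^esub> d \<oplus>\<^bsub>P\<^esub> \<Delta> j z'"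
    if x: "x \<in> carrier R" and z': "z' \<in> carrier P" and j: "j \<le> m" for x z' j and d :: nat
  proof -
    have k: "c [^]\<^bsub>P\<^esub> d \<in> Cst" unfolding c_def by (rule Cst_pow[OF cC])
    have "\<Delta> j (con x \<otimes>\<^bsub>P\<^esub> c [^]\<^bsub>P\<^esub> d) = con (\<delta> j x) \<otimes>\<^bsub>P\<^esub> c [^]\<^bsub>P\<^esub> d"
      using der_const_mult[OF k, of "con x" j] x j cP by (simp add: UP.P.m_comm der_con)
    then show ?thesis using der_add[of j "con x \<otimes>\<^bsub>P\<^esub> c [^]\<^bsub>P\<^esub> d" z'] x z' j cP by simp
  qed
  have top: "con x \<otimes>\<^bsub>P\<^esub> c [^]\<^bsub>P\<^esub> d \<in> below (Suc d)" if "x \<in> carrier R" for x d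
    using that cpow[of d] cP by (auto simp: below_def coeff_con_mult)
  \<comment> \<open>so degrees do not grow: remove leading terms with respect to \<open>c\<close> one by one\<close>
  have stable: "\<Delta> j z \<in> below d" if "z \<in> below d" and j: "j \<le> m" for z j d
    using that(1)
  proof (induction d arbitrary: z)
    case 0
    then have "z \<in> carrier P" "\<And>n. coeff P z n = \<zero>" by (auto simp: below_def)
    then have "z = \<zero>\<^bsub>P\<^esub>" by (intro UP.up_eqI) auto
    then show ?case using der_zero[OF j] 0 by simp
  next
    case (Suc d)
    obtain x z' where x: "x \<in> carrier R" and z': "z' \<in> below d" and zz: "z = con x \<otimes>\<^bsub>P\<^esub> c [^]\<^bsub>P\<^esub> d \<oplus>\<^bsub>P\<^esub> z'"
      using split[OF Suc.prems] by blast
    have "\<Delta> j z' \<in> below (Suc d)" using Suc.IH[OF z'] by (simp add: below_def)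
    moreover have "z' \<in> carrier P" using z' by (simp add: below_def)
    ultimately show ?case
      unfolding zz lead[OF x \<open>z' \<in> carrier P\<close> j]
      using below_add top[OF der_con(2)[OF x j]] by blast
  qed
  define d where "d = deg R z"
  have zb: "z \<in> below (Suc d)" using z by (auto simp: below_def d_def intro: UP.deg_aboveD)
  obtain x z' where x: "x \<in> carrier R" and z': "z' \<in> below d" and zz: "z = con x \<otimes>\<^bsub>P\<^esub> c [^]\<^bsub>P\<^esub> d \<oplus>\<^bsub>P\<^esub> z'"
    and xl: "x \<otimes> e [^] d = coeff P z d"
    using split[OF zb] by blast
  have z'P: "z' \<in> carrier P" using z' by (simp add: below_def)
  have ln: "coeff P z d \<noteq> \<zero>" unfolding d_def by (rule UP.lcoeff_nonzero2[OF z])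
  then have xn: "x \<noteq> \<zero>" using xl eR by auto
  have Wc: "W j = con (coeff P (W j) 0)" and del: "\<delta> j x = x \<otimes> coeff P (W j) 0" if j: "j \<le> m" for j
  proof -
    have b: "z \<otimes>\<^bsub>P\<^esub> W j \<in> below (Suc d)" using stable[OF zb j] eq[OF j] by simp
    have "deg R (W j) = 0"
    proof (cases "W j = \<zero>\<^bsub>P\<^esub>")
      case False
      have nz: "z \<otimes>\<^bsub>P\<^esub> W j \<noteq> \<zero>\<^bsub>P\<^esub>" using UP.UP_integral[OF _ z(1) W[OF j]] z(2) False by blast
      have "coeff P (z \<otimes>\<^bsub>P\<^esub> W j) (deg R (z \<otimes>\<^bsub>P\<^esub> W j)) \<noteq> \<zero>"
        using z W[OF j] nz by (intro UP.lcoeff_nonzero2) auto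
      then have "deg R (z \<otimes>\<^bsub>P\<^esub> W j) \<le> d" using b by (auto simp: below_def not_less_eq_eq intro: ccontr)
      moreover have "deg R (z \<otimes>\<^bsub>P\<^esub> W j) = deg R z + deg R (W j)"
        by (rule UP.deg_mult[OF z(2) False z(1) W[OF j]])
      ultimately show ?thesis by (simp add: d_def)
    qed simp
    then show Wc: "W j = con (coeff P (W j) 0)" by (rule UP.deg_zero_impl_monom[OF W[OF j]])
    let ?v = "coeff P (W j) 0"
    have v: "?v \<in> carrier R" using W[OF j] by simp
    have "z \<otimes>\<^bsub>P\<^esub> W j = con ?v \<otimes>\<^bsub>P\<^esub> z"
      by (simp only: Wc[symmetric] UP.P.m_comm[OF z(1) W[OF j]])
    then have "coeff P (\<Delta> j z) d = ?v \<otimes> coeff P z d" using eq[OF j] v z by (simp add: coeff_con_mult)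
    moreover have "coeff P (\<Delta> j z) d = \<delta> j x \<otimes> e [^] d"
      unfolding zz lead[OF x z'P j]
      using stable[OF z' j] cpow[of d] der_con(2)[OF x j] cP eR by (simp add: below_def coeff_con_mult)
    ultimately have "\<delta> j x \<otimes> e [^] d = (x \<otimes> ?v) \<otimes> e [^] d"
      using v x eR by (simp add: xl[symmetric] m_ac)
    moreover have "e [^] d \<noteq> \<zero>" using ln xl x by auto
    ultimately show "\<delta> j x = x \<otimes> ?v"
      using der_con(2)[OF x j] x v eR by (subst (asm) domain.m_rcancel[OF is_domain]) auto
  qed
  obtain u where u: "u \<in> Units R" and du: "\<And>j. j \<le> m \<Longrightarrow> \<delta> j u = u \<otimes> coeff P (W j) 0"
    by (rule homogeneous_eigenvector[OF x xn _ del]) (use W in auto)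
  have uR: "u \<in> carrier R" using u by (rule Units_closed)
  show ?thesis
  proof (rule that[OF u])
    fix j assume j: "j \<le> m"
    have "\<Delta> j (con u) = con (u \<otimes> coeff P (W j) 0)" using der_con(1)[OF uR j] du[OF j] by simp
    also have "\<dots> = con u \<otimes>\<^bsub>P\<^esub> con (coeff P (W j) 0)" using uR W[OF j] by simp
    finally show "\<Delta> j (con u) = con u \<otimes>\<^bsub>P\<^esub> W j" by (simp only: Wc[OF j, symmetric])
  qed
qed

end

section \<open>Powers of truncated polynomials in characteristic p\<close>

context cring
begin

lemma binomial_expansion:
  assumes a: "a \<in> carrier R" and b: "b \<in> carrier R"
  shows "(a \<oplus> b) [^] n = (\<Oplus>i\<in>{..n}. [(n choose i)] \<cdot> (a [^] i \<otimes> b [^] (n - i :: nat)))"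
proof (induction n)
  case 0
  then show ?case by simp
next
  case (Suc n)
  let ?t = "\<lambda>n i. [(n choose i)] \<cdot> (a [^] i \<otimes> b [^] (n - i :: nat))"
  have t: "?t n i \<in> carrier R" for n i using a b by simp
  let ?u = "\<lambda>i. [(n choose i)] \<cdot> (a [^] i \<otimes> b [^] (Suc n - i :: nat))"
  have u: "?u i \<in> carrier R" for i using a b by simp
  have left: "(\<Oplus>i\<in>{..n}. ?t n i) \<otimes> a = (\<Oplus>i\<in>{..n}. [(n choose i)] \<cdot> (a [^] Suc i \<otimes> b [^] (n - i)))"
  proof -
    have "?t n i \<otimes> a = [(n choose i)] \<cdot> (a [^] Suc i \<otimes> b [^] (n - i))" for i
    proof -
      have "(a [^] i \<otimes> b [^] (n - i)) \<otimes> a = a [^] Suc i \<otimes> b [^] (n - i)" using a b by (simp add: m_ac)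
      then show ?thesis using a b by (simp only: add_pow_ldistr m_closed nat_pow_closed)
    qed
    then show ?thesis using a t by (subst finsum_ldistr) auto
  qed
  have "(\<Oplus>i\<in>{..n}. ?t n i) \<otimes> b = (\<Oplus>i\<in>{..n}. ?u i)"
    using a b t by (subst finsum_ldistr) (auto intro!: finsum_cong' simp: add_pow_ldistr m_assoc Suc_diff_le)
  also have "\<dots> = (\<Oplus>i\<in>{..Suc n}. ?u i)"
  proof -
    have "n choose Suc n = 0" by simp
    then have "?u (Suc n) = \<zero>" using a b by (simp only: add.nat_pow_0)
    then show ?thesis using u by (subst finsum_Suc) (auto intro!: finsum_closed)
  qed
  also have "\<dots> = (\<Oplus>i\<in>{..n}. ?u (Suc i)) \<oplus> ?u 0" using u by (intro finsum_Suc2) blast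
  finally have right: "(\<Oplus>i\<in>{..n}. ?t n i) \<otimes> b = (\<Oplus>i\<in>{..n}. ?u (Suc i)) \<oplus> ?u 0" .
  have step: "?t (Suc n) (Suc i) = [(n choose i)] \<cdot> (a [^] Suc i \<otimes> b [^] (n - i)) \<oplus> ?u (Suc i)" for i
  proof -
    have c: "a [^] Suc i \<otimes> b [^] (n - i) \<in> carrier R" using a b by simp
    show ?thesis using add.nat_pow_mult[OF c, of "n choose i" "n choose Suc i"] by simp
  qed
  have "(a \<oplus> b) [^] Suc n = (\<Oplus>i\<in>{..n}. ?t n i) \<otimes> a \<oplus> (\<Oplus>i\<in>{..n}. ?t n i) \<otimes> b"
    using a b t Suc by (simp add: r_distr finsum_closed)
  also have "\<dots> = (\<Oplus>i\<in>{..n}. ?t (Suc n) (Suc i)) \<oplus> ?u 0"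
  proof -
    let ?v = "\<lambda>i. [(n choose i)] \<cdot> (a [^] Suc i \<otimes> b [^] (n - i))"
    have v: "?v i \<in> carrier R" for i using a b by simp
    have "(\<Oplus>i\<in>{..n}. ?t (Suc n) (Suc i)) = (\<Oplus>i\<in>{..n}. ?v i \<oplus> ?u (Suc i))"
      by (simp only: step)
    also have "\<dots> = (\<Oplus>i\<in>{..n}. ?v i) \<oplus> (\<Oplus>i\<in>{..n}. ?u (Suc i))"
      using u v by (intro finsum_addf) blast+
    finally have e: "(\<Oplus>i\<in>{..n}. ?t (Suc n) (Suc i)) = (\<Oplus>i\<in>{..n}. ?v i) \<oplus> (\<Oplus>i\<in>{..n}. ?u (Suc i))" .
    have "(\<Oplus>i\<in>{..n}. ?v i) \<in> carrier R" "(\<Oplus>i\<in>{..n}. ?u (Suc i)) \<in> carrier R"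
      using u v by (blast intro: finsum_closed)+
    then show ?thesis unfolding left right e using u[of 0] by (intro a_assoc[symmetric])
  qed
  also have "\<dots> = (\<Oplus>i\<in>{..Suc n}. ?t (Suc n) i)"
  proof -
    have "(\<Oplus>i\<in>{..Suc n}. ?t (Suc n) i) = (\<Oplus>i\<in>{..n}. ?t (Suc n) (Suc i)) \<oplus> ?t (Suc n) 0"
      using t by (intro finsum_Suc2) blast
    then show ?thesis by simp
  qed
  finally show ?case .
qed

lemma char_multiple:
  assumes p: "[(p :: nat)] \<cdot> \<one> = \<zero>" and x: "x \<in> carrier R" and dvd: "p dvd k"
  shows "[k] \<cdot> x = \<zero>"
proof -
  obtain c where k: "k = p * c" using dvd by (elim dvdE)
  have "[p] \<cdot> x = ([p] \<cdot> \<one>) \<otimes> x" using x by (simp add: add_pow_ldistr)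
  then have "[p] \<cdot> x = \<zero>" using p x by simp
  then show ?thesis using add.nat_pow_pow[OF x, of c p] by (simp add: k)
qed

lemma prime_power_add:
  assumes p: "[p] \<cdot> \<one> = \<zero>" "prime p" and a: "a \<in> carrier R" and b: "b \<in> carrier R"
  shows "(a \<oplus> b) [^] p = a [^] p \<oplus> b [^] (p :: nat)"
proof -
  obtain p' where p': "p = Suc p'" using prime_gt_0_nat[OF p(2)] by (cases p) auto
  let ?t = "\<lambda>i. [(p choose i)] \<cdot> (a [^] i \<otimes> b [^] (p - i :: nat))"
  have t: "?t i \<in> carrier R" for i using a b by simp
  have z: "?t i = \<zero>" if "0 < i" "i < p" for i
    using a b that p by (intro char_multiple[OF p(1)] dvd_choose_prime) auto
  have "(a \<oplus> b) [^] p = (\<Oplus>i\<in>{..Suc p'}. ?t i)" 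
    using binomial_expansion[OF a b, of p] unfolding p'[symmetric] .
  also have "\<dots> = ?t (Suc p') \<oplus> (\<Oplus>i\<in>{..p'}. ?t i)" using t by (intro finsum_Suc) blast
  also have "(\<Oplus>i\<in>{..p'}. ?t i) = (\<Oplus>i\<in>{..p'}. if 0 = i then b [^] p else \<zero>)"
  proof (rule finsum_cong'[OF refl])
    fix i assume "i \<in> {..p'}"
    then show "?t i = (if 0 = i then b [^] p else \<zero>)" using z[of i] p' b by (cases "i = 0") auto
  qed (use b in auto)
  also have "\<dots> = b [^] p" using b by (intro finsum_singleton) auto
  finally show ?thesis using a p' by simp
qed

lemma prime_power_power_add:
  assumes p: "[p] \<cdot> \<one> = \<zero>" "prime p" and a: "a \<in> carrier R" and b: "b \<in> carrier R"
  shows "(a \<oplus> b) [^] (p ^ n) = a [^] (p ^ n) \<oplus> b [^] (p ^ n :: nat)"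
proof (induction n)
  case 0
  then show ?case using a b by simp
next
  case (Suc n)
  have pw: "x [^] (p ^ Suc n) = (x [^] (p ^ n)) [^] p" if "x \<in> carrier R" for x
    using that by (simp add: nat_pow_pow mult.commute)
  show ?case
    using a b Suc prime_power_add[OF p, of "a [^] (p ^ n)" "b [^] (p ^ n)"]
    by (simp only: pw nat_pow_closed a_closed)
qed

text \<open>A truncated polynomial is its constant term plus a multiple of \<open>S\<close>, whose power with exponent
  \<open>m + 1\<close> vanishes; in characteristic \<open>p\<close> powers with exponent \<open>p ^ n\<close> are additive.\<close>

lemma trunc_poly_prime_power:
  assumes p: "[p] \<cdot> \<one> = \<zero>" "prime p" and m: "Suc m = p ^ n" and X: "X \<in> carrier (trunc_poly R m)"
  shows "X [^]\<^bsub>trunc_poly R m\<^esub> Suc m = trunc_const R m (tcoeff 0 X [^] Suc m)"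
proof -
  interpret T: cring "trunc_poly R m" by (rule trunc_poly_cring)
  interpret c: ring_hom_cring R "trunc_poly R m" "trunc_const R m"
    by (intro ring_hom_cring.intro ring_hom_cring_axioms.intro is_cring trunc_poly_cring trunc_const_hom)
  let ?T = "trunc_poly R m"
  have x0: "tcoeff 0 X \<in> carrier R" by (rule tcoeff_closed[OF X]) simp
  obtain Y where Y: "Y \<in> carrier ?T" and Yc: "\<And>j. j \<le> m \<Longrightarrow> tcoeff j Y = (if j = 0 then \<zero> else tcoeff j X)"
  proof (rule trunc_poly_exists[of m "\<lambda>j. if j = 0 then \<zero> else tcoeff j X"])
    show "(if j = 0 then \<zero> else tcoeff j X) \<in> carrier R" if "j \<le> m" for j
      using tcoeff_closed[OF X that] by simp
  qed blast
  have XY: "X = trunc_const R m (tcoeff 0 X) \<oplus>\<^bsub>?T\<^esub> Y"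
    using X Y x0
    by (intro trunc_poly_eqI) (auto simp: trunc_const_closed tcoeff_add tcoeff_const Yc tcoeff_closed)
  have van: "tcoeff j (Y [^]\<^bsub>?T\<^esub> i) = \<zero>" if "j < i" "j \<le> m" for i j :: nat
    using that
  proof (induction i arbitrary: j)
    case (Suc i)
    have Yi: "Y [^]\<^bsub>?T\<^esub> i \<in> carrier ?T" using Y by simp
    have "tcoeff a (Y [^]\<^bsub>?T\<^esub> i) \<otimes> tcoeff (j - a) Y = \<zero>" if a: "a \<in> {..j}" for a
    proof (cases "a < i")
      case True
      then show ?thesis using Suc.IH[of a] Suc.prems a tcoeff_closed[OF Y, of "j - a"] by simp
    next
      case False
      then have "j - a = 0" using a Suc.prems by simp
      then show ?thesis using Yc[of 0] a Suc.prems tcoeff_closed[OF Yi, of a] by simp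
    qed
    then have "(\<Oplus>a\<in>{..j}. tcoeff a (Y [^]\<^bsub>?T\<^esub> i) \<otimes> tcoeff (j - a) Y) = \<zero>"
      by (rule add.finprod_one_eqI)
    then show ?case using tcoeff_mult[OF Yi Y Suc.prems(2)] by simp
  qed simp
  have zero: "\<zero>\<^bsub>?T\<^esub> = trunc_const R m \<zero>" by simp
  have "Y [^]\<^bsub>?T\<^esub> Suc m = \<zero>\<^bsub>?T\<^esub>"
    unfolding zero
  proof (rule trunc_poly_eqI)
    fix j assume j: "j \<le> m"
    have "tcoeff j (Y [^]\<^bsub>?T\<^esub> Suc m) = \<zero>" by (rule van) (use j in auto)
    moreover have "tcoeff j (trunc_const R m \<zero>) = \<zero>" using tcoeff_const[OF zero_closed j] by simp
    ultimately show "tcoeff j (Y [^]\<^bsub>?T\<^esub> Suc m) = tcoeff j (trunc_const R m \<zero>)" by (simp only:)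
  qed (use Y in \<open>auto simp: trunc_const_closed\<close>)
  moreover have "[p] \<cdot>\<^bsub>?T\<^esub> \<one>\<^bsub>?T\<^esub> = \<zero>\<^bsub>?T\<^esub>"
  proof -
    have "trunc_const R m ([(k :: nat)] \<cdot> \<one>) = [k] \<cdot>\<^bsub>?T\<^esub> \<one>\<^bsub>?T\<^esub>" for k by (induction k) simp_all
    from this[of p] show ?thesis by (simp add: p)
  qed
  ultimately have "(trunc_const R m (tcoeff 0 X) \<oplus>\<^bsub>?T\<^esub> Y) [^]\<^bsub>?T\<^esub> Suc m = trunc_const R m (tcoeff 0 X) [^]\<^bsub>?T\<^esub> Suc m"
    using T.prime_power_power_add[OF _ p(2), of "trunc_const R m (tcoeff 0 X)" Y n] x0 Y
    unfolding m by (simp add: trunc_const_closed)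
  then show ?thesis using XY x0 c.hom_pow[OF x0, of "Suc m"] by (simp del: nat_pow_Suc T.nat_pow_Suc)
qed

end

lemma hom_nat_multiple_one:
  assumes "cring R" "cring S" "h \<in> ring_hom R S" and "[(p :: nat)] \<cdot>\<^bsub>R\<^esub> \<one>\<^bsub>R\<^esub> = \<zero>\<^bsub>R\<^esub>"
  shows "[p] \<cdot>\<^bsub>S\<^esub> \<one>\<^bsub>S\<^esub> = \<zero>\<^bsub>S\<^esub>"
proof -
  interpret h: ring_hom_cring R S h
    by (intro ring_hom_cring.intro ring_hom_cring_axioms.intro assms)
  have "h ([(k :: nat)] \<cdot>\<^bsub>R\<^esub> \<one>\<^bsub>R\<^esub>) = [k] \<cdot>\<^bsub>S\<^esub> \<one>\<^bsub>S\<^esub>" for k by (induction k) simp_all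
  from this[of p] show ?thesis by (simp add: assms(4))
qed

section \<open>Logarithmic derivatives\<close>

locale log_derivation = field L for L (structure) +
  fixes m :: nat and D
  assumes D_hom: "D \<in> ring_hom L (trunc_poly L m)"
begin

abbreviation "TL \<equiv> trunc_poly L m"
abbreviation "cL \<equiv> trunc_const L m"
abbreviation "ld \<equiv> log_deriv L m D"

sublocale TL: cring TL by (rule trunc_poly_cring)

sublocale D: ring_hom_cring L TL D
  by (intro ring_hom_cring.intro ring_hom_cring_axioms.intro is_cring trunc_poly_cring D_hom)

sublocale cL: ring_hom_cring L TL cL
  by (intro ring_hom_cring.intro ring_hom_cring_axioms.intro is_cring trunc_poly_cring trunc_const_hom)

lemma const_unit: "x \<in> Units L \<Longrightarrow> cL x \<in> Units TL"
  and D_unit: "x \<in> Units L \<Longrightarrow> D x \<in> Units TL"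
proof -
  assume x: "x \<in> Units L"
  have U: "X \<in> Units TL" if "X \<in> carrier TL" "Y \<in> carrier TL" "X \<otimes>\<^bsub>TL\<^esub> Y = \<one>\<^bsub>TL\<^esub>" for X Y
    unfolding Units_def using that TL.m_comm[of X Y] by auto
  have "cL x \<otimes>\<^bsub>TL\<^esub> cL (inv x) = \<one>\<^bsub>TL\<^esub>" "D x \<otimes>\<^bsub>TL\<^esub> D (inv x) = \<one>\<^bsub>TL\<^esub>"
    using x by (simp_all add: Units_closed flip: cL.hom_mult D.hom_mult)
  note e = this
  show "cL x \<in> Units TL" by (rule U[OF _ _ e(1)]) (use x in \<open>auto simp: Units_closed\<close>)
  show "D x \<in> Units TL" by (rule U[OF _ _ e(2)]) (use x in \<open>auto simp: Units_closed\<close>)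
qed

lemma log_deriv_eq_iff:
  assumes x: "x \<in> Units L" and X: "X \<in> carrier TL"
  shows "X = ld x \<longleftrightarrow> D x = cL x \<otimes>\<^bsub>TL\<^esub> X"
proof -
  note c = const_unit[OF x]
  have cl: "cL x \<in> carrier TL" "D x \<in> carrier TL" "inv\<^bsub>TL\<^esub> cL x \<in> carrier TL"
    using x c by (auto simp: Units_closed)
  show ?thesis
  proof
    assume "X = ld x"
    then have "cL x \<otimes>\<^bsub>TL\<^esub> X = D x \<otimes>\<^bsub>TL\<^esub> (cL x \<otimes>\<^bsub>TL\<^esub> inv\<^bsub>TL\<^esub> cL x)"
      using cl by (simp add: log_deriv_def TL.m_ac)
    then show "D x = cL x \<otimes>\<^bsub>TL\<^esub> X" using c cl by (simp add: TL.Units_r_inv)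
  next
    assume "D x = cL x \<otimes>\<^bsub>TL\<^esub> X"
    then have "ld x = (cL x \<otimes>\<^bsub>TL\<^esub> inv\<^bsub>TL\<^esub> cL x) \<otimes>\<^bsub>TL\<^esub> X"
      using cl X by (simp add: log_deriv_def TL.m_ac)
    then show "X = ld x" using c X by (simp add: TL.Units_r_inv)
  qed
qed

lemma log_deriv_unit: "x \<in> Units L \<Longrightarrow> ld x \<in> Units TL"
  unfolding log_deriv_def by (intro TL.Units_m_closed D_unit TL.Units_inv_Units const_unit)

lemma log_deriv_mult:
  assumes x: "x \<in> Units L" and y: "y \<in> Units L"
  shows "ld (x \<otimes> y) = ld x \<otimes>\<^bsub>TL\<^esub> ld y"
proof -
  have c: "ld x \<in> carrier TL" "ld y \<in> carrier TL" "cL x \<in> carrier TL" "cL y \<in> carrier TL" "x \<in> carrier L" "y \<in> carrier L"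
    using x y log_deriv_unit by (auto simp: TL.Units_closed Units_closed)
  have "D x = cL x \<otimes>\<^bsub>TL\<^esub> ld x" "D y = cL y \<otimes>\<^bsub>TL\<^esub> ld y"
    using log_deriv_eq_iff[OF x c(1)] log_deriv_eq_iff[OF y c(2)] by auto
  then have "D (x \<otimes> y) = cL (x \<otimes> y) \<otimes>\<^bsub>TL\<^esub> (ld x \<otimes>\<^bsub>TL\<^esub> ld y)"
    using c by (simp add: TL.m_ac)
  then show ?thesis
    using log_deriv_eq_iff[of "x \<otimes> y" "ld x \<otimes>\<^bsub>TL\<^esub> ld y"] x y c by simp
qed

lemma log_deriv_const: "x \<in> Units L \<Longrightarrow> D x = cL x \<Longrightarrow> ld x = \<one>\<^bsub>TL\<^esub>"
  using log_deriv_eq_iff[of x "\<one>\<^bsub>TL\<^esub>"] Units_closed[of x] by simp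

end

section \<open>The quotient of logarithmic derivatives\<close>

text \<open>Here \<open>S\<close> is the image of the reduction of the form in the polynomial ring over the reduction of the
  larger field. Homogeneous elements are powers of \<open>\<tau>\<close> times elements of \<open>S\<close>, with integer exponents; two
  cases avoid negative exponents.\<close>

locale log_derivative_setting = graded_field_ring R hc for R (structure) and hc +
  fixes p n m :: nat and \<tau> :: 'a and \<theta> :: real and D and S :: "(nat \<Rightarrow> 'a) set"
  assumes prime: "prime p" and char_p: "[p] \<cdot> \<one> = \<zero>" and m: "Suc m = p ^ n"
    and D_hom: "D \<in> ring_hom (Frac (UP R)) (trunc_poly (Frac (UP R)) m)"
    and S_subset: "S \<subseteq> carrier (UP R)"
    and S_const: "\<And>c. c \<in> S \<Longrightarrow> D (to_Frac (UP R) c) = trunc_const (Frac (UP R)) m (to_Frac (UP R) c)"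
    and generated: "\<And>Q x. x \<in> carrier (UP R) \<Longrightarrow> Q \<zero>\<^bsub>UP R\<^esub> \<Longrightarrow>
      (\<And>r c. r \<in> carrier R \<Longrightarrow> c \<in> S \<Longrightarrow> Q (monom (UP R) r 0 \<otimes>\<^bsub>UP R\<^esub> c)) \<Longrightarrow>
      (\<And>x y. x \<in> carrier (UP R) \<Longrightarrow> y \<in> carrier (UP R) \<Longrightarrow> Q x \<Longrightarrow> Q y \<Longrightarrow> Q (x \<oplus>\<^bsub>UP R\<^esub> y)) \<Longrightarrow> Q x"
    and tau: "\<tau> \<in> carrier R" "\<tau> \<noteq> \<zero>" "0 < \<theta>" "hc \<theta> \<tau> = \<tau>"
    and D_tau: "D (to_Frac (UP R) (monom (UP R) \<tau> 0)) =
      trunc_const (Frac (UP R)) m (to_Frac (UP R) (monom (UP R) \<tau> 0))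
        \<oplus>\<^bsub>trunc_poly (Frac (UP R)) m\<^esub> trunc_var (Frac (UP R)) m"
    and homogeneous_tau: "\<And>\<gamma> h. 0 < \<gamma> \<Longrightarrow> h \<in> carrier R \<Longrightarrow> hc \<gamma> h = h \<Longrightarrow> h \<noteq> \<zero> \<Longrightarrow>
      \<exists>i::nat. \<exists>c\<in>carrier R. monom (UP R) c 0 \<in> S \<and> (h = \<tau> [^] i \<otimes> c \<or> h \<otimes> \<tau> [^] i = c)"
    and D_T: "\<And>j. j \<le> m \<Longrightarrow> \<exists>g\<in>carrier (UP R). (\<forall>i>1. coeff (UP R) g i = \<zero>) \<and>
      to_Frac (UP R) g = tcoeff j (D (to_Frac (UP R) (monom (UP R) \<one> 1)))"
begin

sublocale UP: UP_domain R "UP R"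
  using is_domain by (intro UP_domain.intro) (auto simp: UP_cring_def is_cring)

abbreviation "P \<equiv> UP R"
abbreviation "con a \<equiv> monom (UP R) a 0"
abbreviation "L \<equiv> Frac P"
abbreviation "E \<equiv> to_Frac P"

lemma P_domain: "domain P"
  by (rule UP.UP_domain)

lemma L_field: "field L"
  by (rule domain.Frac_field[OF P_domain])

sublocale L: log_derivation L m D
  by (intro log_derivation.intro log_derivation_axioms.intro L_field D_hom)

sublocale con: ring_hom_cring R P con
  by (intro ring_hom_cring.intro ring_hom_cring_axioms.intro is_cring UP.UP_cring UP.const_ring_hom)

sublocale E: ring_hom_cring P L E
  by (intro ring_hom_cring.intro ring_hom_cring_axioms.intro UP.UP_cring L.is_cring domain.to_Frac_hom[OF P_domain])

lemma E_inj: "a \<in> carrier P \<Longrightarrow> b \<in> carrier P \<Longrightarrow> E a = E b \<Longrightarrow> a = b"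
  using domain.to_Frac_eq_iff[OF P_domain] by blast

lemma D_closed: "x \<in> carrier P \<Longrightarrow> D (E x) \<in> carrier L.TL"
  by simp

lemma tcoeff_0_mult:
  assumes "X \<in> carrier L.TL" "Y \<in> carrier L.TL"
  shows "tcoeff 0 (X \<otimes>\<^bsub>L.TL\<^esub> Y) = tcoeff 0 X \<otimes>\<^bsub>L\<^esub> tcoeff 0 Y"
  using assms L.tcoeff_mult[OF assms, of 0] L.tcoeff_closed[of _ m 0] by simp

lemma tau_unit: "\<tau> \<in> Units R"
  using tau by (intro homogeneous_unit[of \<theta>])

text \<open>Taking the constant term of the expansion is a ring homomorphism. It fixes \<open>S\<close> and \<open>\<tau>\<close>, hence
  everything that they generate by sums, products and quotients.\<close>

lemma D_constant_term:
  assumes "x \<in> carrier P"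
  shows "tcoeff 0 (D (E x)) = E x"
proof -
  define \<phi> where "\<phi> x = tcoeff 0 (D x)" for x
  have \<phi>c: "\<phi> x \<in> carrier L" if "x \<in> carrier L" for x
    unfolding \<phi>_def using that by (intro L.tcoeff_closed) auto
  have \<phi>m: "\<phi> (x \<otimes>\<^bsub>L\<^esub> y) = \<phi> x \<otimes>\<^bsub>L\<^esub> \<phi> y" if "x \<in> carrier L" "y \<in> carrier L" for x y
    using that by (simp add: \<phi>_def tcoeff_0_mult)
  have \<phi>a: "\<phi> (x \<oplus>\<^bsub>L\<^esub> y) = \<phi> x \<oplus>\<^bsub>L\<^esub> \<phi> y" if "x \<in> carrier L" "y \<in> carrier L" for x y
    using that L.tcoeff_add[of "D x" m "D y" 0] by (simp add: \<phi>_def)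
  have S: "\<phi> (E c) = E c" if "c \<in> S" for c
    using that S_subset by (auto simp: \<phi>_def S_const L.tcoeff_const)
  have t: "E (con \<tau>) \<in> carrier L" using tau by simp
  have "\<phi> (E (con \<tau>)) = E (con \<tau>)"
    using t by (simp add: \<phi>_def D_tau L.tcoeff_add L.tcoeff_const L.tcoeff_var L.trunc_const_closed L.trunc_var_closed)
  note \<phi>t = this
  have pow: "\<phi> (E (con \<tau>) [^]\<^bsub>L\<^esub> (i::nat)) = E (con \<tau>) [^]\<^bsub>L\<^esub> i" for i
  proof (induction i)
    case 0
    show ?case by (simp add: \<phi>_def L.tcoeff_one)
  next
    case (Suc i)
    then show ?case using t by (simp add: \<phi>m \<phi>t)
  qed
  have Et: "E (con \<tau>) \<noteq> \<zero>\<^bsub>L\<^esub>"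
  proof
    assume "E (con \<tau>) = \<zero>\<^bsub>L\<^esub>"
    then have "con \<tau> = con \<zero>" using E_inj[of "con \<tau>" "\<zero>\<^bsub>P\<^esub>"] tau by simp
    then show False using inj_onD[OF UP.monom_inj[of 0], of \<tau> \<zero>] tau by simp
  qed
  have hom: "\<phi> (E (con h)) = E (con h)" if h: "0 < \<gamma>" "h \<in> carrier R" "hc \<gamma> h = h" "h \<noteq> \<zero>" for \<gamma> h
  proof -
    obtain i :: nat and c where c: "c \<in> carrier R" "con c \<in> S" and hc: "h = \<tau> [^] i \<otimes> c \<or> h \<otimes> \<tau> [^] i = c"
      using homogeneous_tau[OF h] by blast
    from hc show ?thesis
    proof
      assume "h = \<tau> [^] i \<otimes> c"
      then have "E (con h) = E (con \<tau>) [^]\<^bsub>L\<^esub> i \<otimes>\<^bsub>L\<^esub> E (con c)" using c tau(1) by simp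
      then show ?thesis using S[OF c(2)] c t pow[of i] by (simp add: \<phi>m)
    next
      assume "h \<otimes> \<tau> [^] i = c"
      then have e: "E (con h) \<otimes>\<^bsub>L\<^esub> E (con \<tau>) [^]\<^bsub>L\<^esub> i = E (con c)" using h tau(1) by auto
      have "\<phi> (E (con h) \<otimes>\<^bsub>L\<^esub> E (con \<tau>) [^]\<^bsub>L\<^esub> i) = E (con h) \<otimes>\<^bsub>L\<^esub> E (con \<tau>) [^]\<^bsub>L\<^esub> i"
        using S[OF c(2)] by (simp only: e)
      then have "\<phi> (E (con h)) \<otimes>\<^bsub>L\<^esub> E (con \<tau>) [^]\<^bsub>L\<^esub> i = E (con h) \<otimes>\<^bsub>L\<^esub> E (con \<tau>) [^]\<^bsub>L\<^esub> i"
        using h(2) t pow[of i] by (simp add: \<phi>m)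
      moreover have "E (con \<tau>) [^]\<^bsub>L\<^esub> i \<in> Units L"
        using t Et by (intro L.Units_pow_closed) (simp add: L.field_Units)
      ultimately show ?thesis
        using h(2) t \<phi>c[of "E (con h)"] domain.m_rcancel[OF field.axioms(1)[OF L_field], of "E (con \<tau>) [^]\<^bsub>L\<^esub> i"]
        by (simp add: L.field_Units)
    qed
  qed
  have "\<phi> (E x) = E x"
    using assms
  proof (rule generated)
    show "\<phi> (E \<zero>\<^bsub>P\<^esub>) = E \<zero>\<^bsub>P\<^esub>" using L.tcoeff_const[of "\<zero>\<^bsub>L\<^esub>" 0 m] by (simp add: \<phi>_def)
    show "\<phi> (E (x \<oplus>\<^bsub>P\<^esub> y)) = E (x \<oplus>\<^bsub>P\<^esub> y)"
      if "x \<in> carrier P" "y \<in> carrier P" "\<phi> (E x) = E x" "\<phi> (E y) = E y" for x y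
      using that by (simp add: \<phi>a)
    fix r c assume r: "r \<in> carrier R" and c: "c \<in> S"
    have cP: "c \<in> carrier P" using c S_subset by blast
    have "\<phi> (E (con r)) = E (con r)"
      using r
    proof (induction r rule: homogeneous_induct)
      case zero
      show ?case using L.tcoeff_const[of "\<zero>\<^bsub>L\<^esub>" 0 m] by (simp add: \<phi>_def)
    next
      case (homogeneous \<gamma> h)
      then show ?case by (rule hom)
    next
      case (add y z)
      then show ?case by (simp add: \<phi>a)
    qed
    then show "\<phi> (E (con r \<otimes>\<^bsub>P\<^esub> c)) = E (con r \<otimes>\<^bsub>P\<^esub> c)" using r cP S[OF c] by (simp add: \<phi>m)
  qed
  then show ?thesis by (simp add: \<phi>_def)
qed

definition D_constants :: "(nat \<Rightarrow> 'a) set" where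
  "D_constants = {x \<in> carrier P. D (E x) = L.cL (E x)}"

lemma S_constant: "c \<in> S \<Longrightarrow> c \<in> D_constants"
  using S_subset by (auto simp: D_constants_def S_const)

lemma D_constants_mult: "x \<in> D_constants \<Longrightarrow> y \<in> D_constants \<Longrightarrow> x \<otimes>\<^bsub>P\<^esub> y \<in> D_constants"
  by (auto simp: D_constants_def)

lemma D_constants_pow: "x \<in> D_constants \<Longrightarrow> x [^]\<^bsub>P\<^esub> (i::nat) \<in> D_constants"
  by (induction i) (auto simp: D_constants_mult, auto simp: D_constants_def)

text \<open>A power with exponent \<open>p\<^sup>n\<close> of an expansion is that power of its constant term.\<close>

lemma frobenius_constant: "x \<in> carrier P \<Longrightarrow> x [^]\<^bsub>P\<^esub> Suc m \<in> D_constants"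
proof -
  assume x: "x \<in> carrier P"
  have pL: "[p] \<cdot>\<^bsub>L\<^esub> \<one>\<^bsub>L\<^esub> = \<zero>\<^bsub>L\<^esub>"
    using hom_nat_multiple_one[OF UP.UP_cring L.is_cring domain.to_Frac_hom[OF P_domain]
        hom_nat_multiple_one[OF is_cring UP.UP_cring UP.const_ring_hom char_p]] .
  have "D (E (x [^]\<^bsub>P\<^esub> Suc m)) = D (E x) [^]\<^bsub>L.TL\<^esub> Suc m"
    using x by (simp only: E.hom_pow L.D.hom_pow E.hom_closed)
  also have "\<dots> = L.cL (tcoeff 0 (D (E x)) [^]\<^bsub>L\<^esub> Suc m)"
    by (rule L.trunc_poly_prime_power[OF pL prime m D_closed[OF x]])
  also have "\<dots> = L.cL (E (x [^]\<^bsub>P\<^esub> Suc m))"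
    using x by (simp only: D_constant_term E.hom_pow)
  finally show ?thesis using x by (simp only: D_constants_def mem_Collect_eq UP.P.nat_pow_closed simp_thms)
qed

lemma homogeneous_constant_multiple:
  assumes h: "0 < \<gamma>" "h \<in> carrier R" "hc \<gamma> h = h" "h \<noteq> \<zero>"
  shows "\<exists>i::nat. \<exists>c\<in>carrier R. con c \<in> D_constants \<and> h = \<tau> [^] i \<otimes> c"
proof -
  obtain i :: nat and c where c: "c \<in> carrier R" "con c \<in> S" and hc: "h = \<tau> [^] i \<otimes> c \<or> h \<otimes> \<tau> [^] i = c"
    using homogeneous_tau[OF h] by blast
  from hc show ?thesis
  proof
    assume "h = \<tau> [^] i \<otimes> c"
    then show ?thesis using c S_constant by blast
  next
    assume hi: "h \<otimes> \<tau> [^] i = c"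
    \<comment> \<open>here \<open>h = \<tau>\<^sup>-\<^sup>i c = \<tau>\<^bsup>mi\<^esup> e c\<close>, where \<open>e = \<tau>\<^bsup>-(m+1)i\<^esup>\<close> is constant\<close>
    let ?s = "inv \<tau>" let ?e = "(?s [^] Suc m) [^] i"
    have s: "?s \<in> carrier R" "\<tau> \<otimes> ?s = \<one>" using tau_unit by auto
    have ts: "\<tau> [^] k \<otimes> ?s [^] k = \<one>" for k :: nat
      using nat_pow_distrib[OF tau(1) s(1), of k] s(2) by simp
    have e: "?e = ?s [^] (m * i) \<otimes> ?s [^] i"
      using nat_pow_pow[OF s(1), of "Suc m" i] nat_pow_mult[OF s(1), of "m * i" i]
      by (simp only: mult_Suc add.commute)
    have eR: "?e \<in> carrier R" using s by simp
    have "con (?s [^] Suc m) \<in> D_constants" using frobenius_constant[of "con ?s"] s by (simp only: con.hom_pow con.hom_closed)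
    then have "con ?e \<in> D_constants" using s(1) by (simp only: con.hom_pow nat_pow_closed D_constants_pow)
    then have C: "con (?e \<otimes> c) \<in> D_constants" using S_constant[OF c(2)] eR c(1) by (simp only: con.hom_mult D_constants_mult)
    have "\<tau> [^] (m * i) \<otimes> (?e \<otimes> c) = (\<tau> [^] (m * i) \<otimes> ?s [^] (m * i)) \<otimes> (h \<otimes> (\<tau> [^] i \<otimes> ?s [^] i))"
      unfolding e hi[symmetric] using tau(1) s(1) h(2) by (simp add: m_ac)
    then have "h = \<tau> [^] (m * i) \<otimes> (?e \<otimes> c)" using h(2) by (simp add: ts)
    then show ?thesis using C eR c(1) by blast
  qed
qed

definition integral_expansions where
  "integral_expansions = {X \<in> carrier L.TL. \<forall>j\<le>m. tcoeff j X \<in> E ` carrier P}"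

lemma integral_expansions_mult:
  assumes "X \<in> integral_expansions" "Y \<in> integral_expansions"
  shows "X \<otimes>\<^bsub>L.TL\<^esub> Y \<in> integral_expansions"
proof -
  have X: "X \<in> carrier L.TL" "Y \<in> carrier L.TL" using assms by (auto simp: integral_expansions_def)
  have "\<forall>j\<le>m. \<exists>x\<in>carrier P. tcoeff j X = E x" "\<forall>j\<le>m. \<exists>x\<in>carrier P. tcoeff j Y = E x"
    using assms unfolding integral_expansions_def by blast+
  then obtain x y where x: "\<And>j. j \<le> m \<Longrightarrow> x j \<in> carrier P \<and> tcoeff j X = E (x j)"
    and y: "\<And>j. j \<le> m \<Longrightarrow> y j \<in> carrier P \<and> tcoeff j Y = E (y j)" by metis
  have "tcoeff j (X \<otimes>\<^bsub>L.TL\<^esub> Y) = E (\<Oplus>\<^bsub>P\<^esub>i\<in>{..j}. x i \<otimes>\<^bsub>P\<^esub> y (j - i))" if "j \<le> m" for j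
  proof -
    have "tcoeff j (X \<otimes>\<^bsub>L.TL\<^esub> Y) = (\<Oplus>\<^bsub>L\<^esub>i\<in>{..j}. tcoeff i X \<otimes>\<^bsub>L\<^esub> tcoeff (j - i) Y)"
      by (rule L.tcoeff_mult[OF X that])
    also have "\<dots> = (\<Oplus>\<^bsub>L\<^esub>i\<in>{..j}. E (x i \<otimes>\<^bsub>P\<^esub> y (j - i)))"
      using that x y by (intro L.finsum_cong') auto
    also have "\<dots> = E (\<Oplus>\<^bsub>P\<^esub>i\<in>{..j}. x i \<otimes>\<^bsub>P\<^esub> y (j - i))"
      using that x y by (subst E.hom_finsum) (auto simp: o_def)
    finally show ?thesis .
  qed
  moreover have "(\<Oplus>\<^bsub>P\<^esub>i\<in>{..j}. x i \<otimes>\<^bsub>P\<^esub> y (j - i)) \<in> carrier P" if "j \<le> m" for j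
    using that x y by (intro UP.P.finsum_closed) auto
  ultimately show ?thesis using X by (auto simp: integral_expansions_def)
qed

lemma integral_expansions_const: "x \<in> carrier P \<Longrightarrow> L.cL (E x) \<in> integral_expansions"
  by (auto simp: integral_expansions_def L.tcoeff_const intro: image_eqI[of _ _ "\<zero>\<^bsub>P\<^esub>"])

lemma integral_expansions_add: "X \<in> integral_expansions \<Longrightarrow> Y \<in> integral_expansions \<Longrightarrow> X \<oplus>\<^bsub>L.TL\<^esub> Y \<in> integral_expansions"
proof -
  assume XY: "X \<in> integral_expansions" "Y \<in> integral_expansions"
  have "tcoeff j X \<oplus>\<^bsub>L\<^esub> tcoeff j Y \<in> E ` carrier P" if j: "j \<le> m" for j
  proof -
    obtain x y where "x \<in> carrier P" "tcoeff j X = E x" "y \<in> carrier P" "tcoeff j Y = E y"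
      using XY j unfolding integral_expansions_def by blast
    then show ?thesis by (intro image_eqI[of _ _ "x \<oplus>\<^bsub>P\<^esub> y"]) auto
  qed
  then show ?thesis using XY by (auto simp: integral_expansions_def L.tcoeff_add)
qed

text \<open>It suffices to look at elements of \<open>S\<close> and at \<open>\<tau>\<close>, whose expansions are explicit; homogeneous elements
  are written with nonnegative powers of \<open>\<tau>\<close> to stay clear of denominators.\<close>

lemma D_integral:
  assumes "x \<in> carrier P"
  shows "D (E x) \<in> integral_expansions"
  using assms
proof (rule generated)
  have zero: "D (E \<zero>\<^bsub>P\<^esub>) = L.cL (E \<zero>\<^bsub>P\<^esub>)" by simp
  show z: "D (E \<zero>\<^bsub>P\<^esub>) \<in> integral_expansions" unfolding zero by (rule integral_expansions_const) simp
  show add: "D (E (x \<oplus>\<^bsub>P\<^esub> y)) \<in> integral_expansions" if "x \<in> carrier P" "y \<in> carrier P" "D (E x) \<in> integral_expansions" "D (E y) \<in> integral_expansions" for x y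
    using that by (simp add: integral_expansions_add)
  have var: "trunc_var L m \<in> integral_expansions"
    by (auto simp: integral_expansions_def L.tcoeff_var L.trunc_var_closed
        intro: image_eqI[of _ _ "\<zero>\<^bsub>P\<^esub>"] image_eqI[of _ _ "\<one>\<^bsub>P\<^esub>"])
  have "D (E (con \<tau>)) \<in> integral_expansions" unfolding D_tau using tau by (intro integral_expansions_add integral_expansions_const var) auto
  then have pow: "D (E (con \<tau>)) [^]\<^bsub>L.TL\<^esub> (i::nat) \<in> integral_expansions" for i
    using integral_expansions_const[of "\<one>\<^bsub>P\<^esub>"] by (induction i) (auto simp: integral_expansions_mult)
  fix r c assume r: "r \<in> carrier R" and c: "c \<in> S"
  have cP: "c \<in> carrier P" using c S_subset by blast
  have "D (E (con r)) \<in> integral_expansions"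
    using r
  proof (induction r rule: homogeneous_induct)
    case zero
    then show ?case using z by simp
  next
    case (homogeneous \<gamma> h)
    obtain i :: nat and e where e: "e \<in> carrier R" "con e \<in> D_constants" "h = \<tau> [^] i \<otimes> e"
      using homogeneous_constant_multiple[OF homogeneous] by blast
    have "D (E (con h)) = D (E (con \<tau>)) [^]\<^bsub>L.TL\<^esub> i \<otimes>\<^bsub>L.TL\<^esub> L.cL (E (con e))"
      using e tau(1) by (simp add: D_constants_def)
    then show ?case using integral_expansions_mult[OF pow integral_expansions_const] e by simp
  next
    case (add y z)
    then show ?case by (simp add: integral_expansions_add)
  qed
  then show "D (E (con r \<otimes>\<^bsub>P\<^esub> c)) \<in> integral_expansions"
    using r cP S_const[OF c] by (simp add: integral_expansions_mult integral_expansions_const)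
qed

definition \<Delta> :: "nat \<Rightarrow> (nat \<Rightarrow> 'a) \<Rightarrow> nat \<Rightarrow> 'a" where
  "\<Delta> j x = inv_into (carrier P) E (tcoeff j (D (E x)))"

lemma Delta:
  assumes "x \<in> carrier P" "j \<le> m"
  shows "\<Delta> j x \<in> carrier P" and "E (\<Delta> j x) = tcoeff j (D (E x))"
proof -
  have "tcoeff j (D (E x)) \<in> E ` carrier P" using D_integral[OF assms(1)] assms(2) by (simp add: integral_expansions_def)
  then show "\<Delta> j x \<in> carrier P" and "E (\<Delta> j x) = tcoeff j (D (E x))"
    unfolding \<Delta>_def by (rule inv_into_into, rule f_inv_into_f)
qed

lemma Delta_eqI: "x \<in> carrier P \<Longrightarrow> j \<le> m \<Longrightarrow> y \<in> carrier P \<Longrightarrow> tcoeff j (D (E x)) = E y \<Longrightarrow> \<Delta> j x = y"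
  using Delta[of x j] by (intro E_inj) auto

lemma D_constants_eq: "D_constants = {c \<in> carrier P. \<forall>j\<in>{1..m}. \<Delta> j c = \<zero>\<^bsub>P\<^esub>}"
proof (rule Set.set_eqI)
  fix c
  have "D (E c) = L.cL (E c) \<longleftrightarrow> (\<forall>j\<in>{1..m}. \<Delta> j c = \<zero>\<^bsub>P\<^esub>)" if c: "c \<in> carrier P"
  proof
    assume "D (E c) = L.cL (E c)"
    then show "\<forall>j\<in>{1..m}. \<Delta> j c = \<zero>\<^bsub>P\<^esub>" using c by (auto intro!: Delta_eqI simp: L.tcoeff_const)
  next
    assume z: "\<forall>j\<in>{1..m}. \<Delta> j c = \<zero>\<^bsub>P\<^esub>"
    show "D (E c) = L.cL (E c)"
    proof (rule L.trunc_poly_eqI)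
      fix j assume j: "j \<le> m"
      show "tcoeff j (D (E c)) = tcoeff j (L.cL (E c))"
        using z j c D_constant_term[OF c] Delta(2)[OF c j]
        by (cases "j = 0") (auto simp: L.tcoeff_const)
    qed (use c in auto)
  qed
  then show "c \<in> D_constants \<longleftrightarrow> c \<in> {c \<in> carrier P. \<forall>j\<in>{1..m}. \<Delta> j c = \<zero>\<^bsub>P\<^esub>}" by (auto simp: D_constants_def)
qed

lemma polynomial_higher_derivation: "polynomial_higher_derivation R hc m \<Delta> \<tau> \<theta>"
proof (intro polynomial_higher_derivation.intro polynomial_higher_derivation_axioms.intro
    graded_field_ring_axioms, unfold D_constants_eq[symmetric])
  show "\<tau> \<in> Units R" by (rule tau_unit)
  show "0 < \<theta>" "hc \<theta> \<tau> = \<tau>" by (rule tau)+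
  fix j x y assume j: "j \<le> m" and x: "x \<in> carrier P"
  show "\<Delta> j x \<in> carrier P" by (rule Delta(1)[OF x j])
  assume y: "y \<in> carrier P"
  have Dx: "\<Delta> i x \<in> carrier P" "\<Delta> i y \<in> carrier P" if "i \<le> j" for i using Delta(1) x y j that by auto
  show "\<Delta> j (x \<oplus>\<^bsub>P\<^esub> y) = \<Delta> j x \<oplus>\<^bsub>P\<^esub> \<Delta> j y"
    using x y j Delta by (intro Delta_eqI) (auto simp: L.tcoeff_add)
  show "\<Delta> j (x \<otimes>\<^bsub>P\<^esub> y) = (\<Oplus>\<^bsub>P\<^esub>i\<in>{..j}. \<Delta> i x \<otimes>\<^bsub>P\<^esub> \<Delta> (j - i) y)"
  proof (rule Delta_eqI)
    show cl: "(\<Oplus>\<^bsub>P\<^esub>i\<in>{..j}. \<Delta> i x \<otimes>\<^bsub>P\<^esub> \<Delta> (j - i) y) \<in> carrier P"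
      using Dx by (intro UP.P.finsum_closed) auto
    show "tcoeff j (D (E (x \<otimes>\<^bsub>P\<^esub> y))) = E (\<Oplus>\<^bsub>P\<^esub>i\<in>{..j}. \<Delta> i x \<otimes>\<^bsub>P\<^esub> \<Delta> (j - i) y)"
    proof -
      have "tcoeff j (D (E (x \<otimes>\<^bsub>P\<^esub> y))) = (\<Oplus>\<^bsub>L\<^esub>i\<in>{..j}. tcoeff i (D (E x)) \<otimes>\<^bsub>L\<^esub> tcoeff (j - i) (D (E y)))"
        using x y j by (simp add: L.tcoeff_mult)
      also have "\<dots> = (\<Oplus>\<^bsub>L\<^esub>i\<in>{..j}. E (\<Delta> i x \<otimes>\<^bsub>P\<^esub> \<Delta> (j - i) y))"
        using x y j Dx Delta by (intro L.finsum_cong') auto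
      also have "\<dots> = E (\<Oplus>\<^bsub>P\<^esub>i\<in>{..j}. \<Delta> i x \<otimes>\<^bsub>P\<^esub> \<Delta> (j - i) y)"
        using Dx by (subst E.hom_finsum) (auto simp: o_def)
      finally show ?thesis .
    qed
  qed (use x y j in auto)
next
  show "\<Delta> 0 x = x" if "x \<in> carrier P" for x using that D_constant_term by (intro Delta_eqI) auto
  fix j assume j: "1 \<le> j" "j \<le> m"
  show "\<Delta> j \<one>\<^bsub>P\<^esub> = \<zero>\<^bsub>P\<^esub>" using j by (intro Delta_eqI) (auto simp: L.tcoeff_one)
  show "\<Delta> j (con \<tau>) = (if j = 1 then \<one>\<^bsub>P\<^esub> else \<zero>\<^bsub>P\<^esub>)"
    using j tau
    by (intro Delta_eqI)
      (auto simp: D_tau L.tcoeff_add L.tcoeff_const L.tcoeff_var L.trunc_const_closed L.trunc_var_closed)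
next
  show "x [^]\<^bsub>P\<^esub> Suc m \<in> D_constants" if "x \<in> carrier P" for x by (rule frobenius_constant[OF that])
  show "\<exists>i::nat. \<exists>c\<in>carrier R. con c \<in> D_constants \<and> h = \<tau> [^] i \<otimes> c"
    if "0 < \<gamma>" "h \<in> carrier R" "hc \<gamma> h = h" "h \<noteq> \<zero>" for \<gamma> h by (rule homogeneous_constant_multiple[OF that])
  show "Q x" if x: "x \<in> carrier P" and z: "Q \<zero>\<^bsub>P\<^esub>"
      and g: "\<And>r c. r \<in> carrier R \<Longrightarrow> c \<in> D_constants \<Longrightarrow> Q (con r \<otimes>\<^bsub>P\<^esub> c)"
      and a: "\<And>x y. x \<in> carrier P \<Longrightarrow> y \<in> carrier P \<Longrightarrow> Q x \<Longrightarrow> Q y \<Longrightarrow> Q (x \<oplus>\<^bsub>P\<^esub> y)" for Q x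
    by (rule generated[OF x z g[OF _ S_constant] a])
  fix j i :: nat assume j: "j \<le> m" and i: "1 < i"
  obtain g where g: "g \<in> carrier P" "\<forall>i>1. coeff P g i = \<zero>" "E g = tcoeff j (D (E (monom P \<one> 1)))"
    using D_T[OF j] by blast
  have "\<Delta> j (monom P \<one> 1) = g" using g j by (intro Delta_eqI) auto
  then show "coeff P (\<Delta> j (monom P \<one> 1)) i = \<zero>" using g(2) i by blast
qed

abbreviation "tm \<equiv> trunc_map L m E"
abbreviation "TP \<equiv> trunc_poly P m"

lemma tm_props:
  assumes "X \<in> carrier TP"
  shows "tm X \<in> carrier L.TL" and "j \<le> m \<Longrightarrow> tcoeff j (tm X) = E (tcoeff j X)"
  by (rule tcoeff_trunc_map[OF UP.UP_cring L.is_cring _ _ assms]; simp)+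

lemma tm_inj: "X \<in> carrier TP \<Longrightarrow> Y \<in> carrier TP \<Longrightarrow> tm X = tm Y \<Longrightarrow> X = Y"
  by (rule UP.P.trunc_poly_eqI, assumption, assumption, rule E_inj)
    (auto simp: UP.P.tcoeff_closed simp flip: tm_props(2))

lemma integral_expansions_image:
  assumes "X \<in> integral_expansions"
  obtains X' where "X' \<in> carrier TP" "tm X' = X"
proof -
  have X: "X \<in> carrier L.TL" and c: "\<And>j. j \<le> m \<Longrightarrow> tcoeff j X \<in> E ` carrier P"
    using assms unfolding integral_expansions_def by blast+
  obtain X' where X': "X' \<in> carrier TP" "\<And>j. j \<le> m \<Longrightarrow> tcoeff j X' = inv_into (carrier P) E (tcoeff j X)"
  proof (rule UP.P.trunc_poly_exists[of m "\<lambda>j. inv_into (carrier P) E (tcoeff j X)"])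
    show "inv_into (carrier P) E (tcoeff j X) \<in> carrier P" if "j \<le> m" for j by (rule inv_into_into[OF c[OF that]])
  qed blast
  have "tm X' = X"
    by (rule L.trunc_poly_eqI[OF tm_props(1)[OF X'(1)] X])
      (simp add: tm_props(2)[OF X'(1)] X'(2) f_inv_into_f[OF c])
  then show ?thesis using that X' by blast
qed

lemma E_unit: "x \<in> carrier P \<Longrightarrow> x \<noteq> \<zero>\<^bsub>P\<^esub> \<Longrightarrow> E x \<in> Units L"
  using E_inj[of x "\<zero>\<^bsub>P\<^esub>"] by (auto simp: L.field_Units)

lemma E_unit_unit: "u \<in> Units P \<Longrightarrow> E u \<in> Units L"
proof -
  assume u: "u \<in> Units P"
  have uP: "u \<in> carrier P" "inv\<^bsub>P\<^esub> u \<in> carrier P" using u by auto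
  have "E u \<otimes>\<^bsub>L\<^esub> E (inv\<^bsub>P\<^esub> u) = E (u \<otimes>\<^bsub>P\<^esub> inv\<^bsub>P\<^esub> u)" by (rule E.hom_mult[OF uP, symmetric])
  also have "\<dots> = \<one>\<^bsub>L\<^esub>" using u by simp
  finally have "E u \<otimes>\<^bsub>L\<^esub> E (inv\<^bsub>P\<^esub> u) = \<one>\<^bsub>L\<^esub>" .
  then have "E u \<noteq> \<zero>\<^bsub>L\<^esub>" using u by auto
  then show "E u \<in> Units L" using u by (auto simp: L.field_Units)
qed

lemma log_deriv_unit_integral:
  assumes u: "u \<in> Units P"
  shows "L.ld (E u) \<in> integral_expansions"
proof -
  have uP: "u \<in> carrier P" "inv\<^bsub>P\<^esub> u \<in> carrier P" using u by auto
  let ?X = "D (E u) \<otimes>\<^bsub>L.TL\<^esub> L.cL (E (inv\<^bsub>P\<^esub> u))"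
  have "L.cL (E u) \<otimes>\<^bsub>L.TL\<^esub> ?X = D (E u) \<otimes>\<^bsub>L.TL\<^esub> L.cL (E (u \<otimes>\<^bsub>P\<^esub> inv\<^bsub>P\<^esub> u))"
    using uP by (simp add: L.TL.m_ac del: UP.P.Units_r_inv)
  also have "\<dots> = D (E u)" using u uP by simp
  finally have "?X = L.ld (E u)"
    using L.log_deriv_eq_iff[OF E_unit_unit[OF u], of ?X] uP by simp
  moreover have "?X \<in> integral_expansions" using uP by (intro integral_expansions_mult D_integral integral_expansions_const)
  ultimately show ?thesis by simp
qed

definition integral_log_derivs where
  "integral_log_derivs = L.ld ` Units L \<inter> tm ` Units TP"

definition unit_log_derivs where
  "unit_log_derivs = (\<lambda>u. L.ld (E u)) ` Units P"

text \<open>The logarithmic derivative of the inverse unit is an inverse with coefficients in \<open>P\<close>.\<close>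

lemma unit_log_derivs_subset: "unit_log_derivs \<subseteq> integral_log_derivs"
proof
  fix X assume "X \<in> unit_log_derivs"
  then obtain u where u: "u \<in> Units P" and X: "X = L.ld (E u)" by (auto simp: unit_log_derivs_def)
  have iu: "inv\<^bsub>P\<^esub> u \<in> Units P" using u by simp
  have uP: "u \<in> carrier P" "inv\<^bsub>P\<^esub> u \<in> carrier P" using u by auto
  interpret tm: ring_hom_cring TP L.TL tm
    by (intro ring_hom_cring.intro ring_hom_cring_axioms.intro UP.P.trunc_poly_cring L.trunc_poly_cring
        trunc_map_hom UP.UP_cring L.is_cring domain.to_Frac_hom[OF P_domain])
  obtain X' where X': "X' \<in> carrier TP" "tm X' = X"
    using integral_expansions_image[OF log_deriv_unit_integral[OF u]] unfolding X .
  obtain Y' where Y': "Y' \<in> carrier TP" "tm Y' = L.ld (E (inv\<^bsub>P\<^esub> u))"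
    using integral_expansions_image[OF log_deriv_unit_integral[OF iu]] .
  have "X \<otimes>\<^bsub>L.TL\<^esub> L.ld (E (inv\<^bsub>P\<^esub> u)) = L.ld (E u \<otimes>\<^bsub>L\<^esub> E (inv\<^bsub>P\<^esub> u))"
    unfolding X by (rule L.log_deriv_mult[OF E_unit_unit[OF u] E_unit_unit[OF iu], symmetric])
  also have "E u \<otimes>\<^bsub>L\<^esub> E (inv\<^bsub>P\<^esub> u) = \<one>\<^bsub>L\<^esub>"
    unfolding E.hom_mult[OF uP, symmetric] using u by simp
  also have "L.ld \<one>\<^bsub>L\<^esub> = \<one>\<^bsub>L.TL\<^esub>" by (rule L.log_deriv_const) simp_all
  finally have "tm (X' \<otimes>\<^bsub>TP\<^esub> Y') = tm \<one>\<^bsub>TP\<^esub>" using X' Y' by simp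
  then have "X' \<otimes>\<^bsub>TP\<^esub> Y' = \<one>\<^bsub>TP\<^esub>" using X' Y' by (intro tm_inj) auto
  then have "X' \<in> Units TP" unfolding Units_def using X'(1) Y'(1) tm.R.m_comm[of X' Y'] by auto
  then show "X \<in> integral_log_derivs"
    unfolding integral_log_derivs_def using X' X E_unit_unit[OF u] by blast
qed

text \<open>Write \<open>z = a / b\<close>. Multiplying \<open>z\<close> by the constant \<open>b\<^bsup>m+1\<^esup>\<close> preserves the logarithmic derivative and
  leaves the element \<open>y = a b\<^sup>m\<close> of \<open>P\<close>, which divides its higher derivatives because the logarithmic
  derivative is integral.\<close>

lemma integral_log_derivs_subset: "integral_log_derivs \<subseteq> unit_log_derivs"
proof
  fix X assume "X \<in> integral_log_derivs"
  then obtain z W where z: "z \<in> Units L" "X = L.ld z" and W: "W \<in> Units TP" "X = tm W"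
    by (auto simp: integral_log_derivs_def)
  interpret TP: cring TP by (rule UP.P.trunc_poly_cring)
  have WP: "W \<in> carrier TP" using W by (simp add: TP.Units_closed)
  have Wj: "tcoeff j W \<in> carrier P" "tcoeff j X = E (tcoeff j W)" if "j \<le> m" for j
    using that WP W by (auto simp: UP.P.tcoeff_closed tm_props)
  have XT: "X \<in> carrier L.TL" unfolding W(2) by (rule tm_props(1)[OF WP])
  have zL: "z \<in> carrier L" using z by (simp add: L.Units_closed)
  obtain a b where a: "a \<in> carrier P" and b': "b \<in> carrier P - {\<zero>\<^bsub>P\<^esub>}" and zab: "z \<otimes>\<^bsub>L\<^esub> E b = E a"
    using domain.Frac_elem[OF P_domain zL] .
  have b: "b \<in> carrier P" "b \<noteq> \<zero>\<^bsub>P\<^esub>" using b' by auto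
  define y where "y = a \<otimes>\<^bsub>P\<^esub> b [^]\<^bsub>P\<^esub> m"
  have yP: "y \<in> carrier P" using a b by (simp add: y_def)
  have bq: "b [^]\<^bsub>P\<^esub> Suc m \<in> D_constants" by (rule frobenius_constant[OF b(1)])
  have bU: "E (b [^]\<^bsub>P\<^esub> Suc m) \<in> Units L"
    unfolding E.hom_pow[OF b(1)] by (rule L.Units_pow_closed[OF E_unit[OF b]])
  have Ey: "E y = z \<otimes>\<^bsub>L\<^esub> E (b [^]\<^bsub>P\<^esub> Suc m)"
    using a b zL by (simp add: y_def zab[symmetric] L.m_ac)
  then have yU: "E y \<in> Units L" using z bU by simp
  then have y0: "y \<noteq> \<zero>\<^bsub>P\<^esub>" by (auto simp: L.field_Units)
  have "L.ld (E y) = X \<otimes>\<^bsub>L.TL\<^esub> L.ld (E (b [^]\<^bsub>P\<^esub> Suc m))"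
    unfolding Ey z(2) by (rule L.log_deriv_mult[OF z(1) bU])
  also have "L.ld (E (b [^]\<^bsub>P\<^esub> Suc m)) = \<one>\<^bsub>L.TL\<^esub>"
    using bq by (intro L.log_deriv_const[OF bU]) (simp add: D_constants_def)
  finally have "X = L.ld (E y)" using XT by simp
  then have Dy: "D (E y) = L.cL (E y) \<otimes>\<^bsub>L.TL\<^esub> X" using L.log_deriv_eq_iff[OF yU XT] by blast
  have eq: "\<Delta> j y = y \<otimes>\<^bsub>P\<^esub> tcoeff j W" if j: "j \<le> m" for j
    using yP j Wj[OF j] XT by (intro Delta_eqI) (auto simp: Dy L.tcoeff_const_mult)
  obtain u where u: "u \<in> Units R" and du: "\<And>j. j \<le> m \<Longrightarrow> \<Delta> j (con u) = con u \<otimes>\<^bsub>P\<^esub> tcoeff j W"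
    by (rule polynomial_higher_derivation.unit_eigenvector[OF polynomial_higher_derivation yP y0 Wj(1) eq]) blast+
  have uR: "u \<in> carrier R" using u by (rule Units_closed)
  have cu: "con u \<in> Units P"
  proof -
    have "con u \<otimes>\<^bsub>P\<^esub> con (inv u) = \<one>\<^bsub>P\<^esub>" using u uR by (simp flip: con.hom_mult)
    then show ?thesis
      unfolding Units_def using u uR UP.P.m_comm[of "con u" "con (inv u)"] by auto
  qed
  have "D (E (con u)) = L.cL (E (con u)) \<otimes>\<^bsub>L.TL\<^esub> X"
  proof (rule L.trunc_poly_eqI)
    fix j assume j: "j \<le> m"
    have "tcoeff j (D (E (con u))) = E (\<Delta> j (con u))" using Delta(2)[of "con u" j] uR j by simp
    also have "\<dots> = E (con u) \<otimes>\<^bsub>L\<^esub> tcoeff j X" using du[OF j] Wj[OF j] uR by simp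
    finally show "tcoeff j (D (E (con u))) = tcoeff j (L.cL (E (con u)) \<otimes>\<^bsub>L.TL\<^esub> X)"
      using uR XT j by (simp add: L.tcoeff_const_mult)
  qed (use uR XT in auto)
  then have "X = L.ld (E (con u))" using L.log_deriv_eq_iff[OF E_unit_unit[OF cu] XT] by blast
  then show "X \<in> unit_log_derivs" using cu by (auto simp: unit_log_derivs_def)
qed

lemma integral_log_derivs_eq: "integral_log_derivs = unit_log_derivs"
  using integral_log_derivs_subset unit_log_derivs_subset by blast

lemma unit_log_derivs_subgroup: "subgroup unit_log_derivs (units_of L.TL)"
proof -
  have "group_hom (units_of P) (units_of L.TL) (\<lambda>u. L.ld (E u))"
    by (intro group_hom.intro group_hom_axioms.intro UP.P.units_group L.TL.units_group)
      (auto simp: hom_def units_of_def UP.P.Units_closed L.log_deriv_unit L.log_deriv_mult E_unit_unit)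
  from group_hom.img_is_subgroup[OF this] show ?thesis by (simp add: unit_log_derivs_def units_of_def)
qed

text \<open>The constant \<open>e T + \<beta>\<close> with \<open>e\<close> a unit shows that \<open>T - c\<close> with \<open>c = - \<beta> / e\<close> is a constant
  times a unit.\<close>

lemma translated_coordinate:
  obtains c where "c \<in> carrier R" "L.ld (E (monom P \<one> 1 \<ominus>\<^bsub>P\<^esub> con c)) \<in> unit_log_derivs"
proof -
  let ?T = "monom P \<one> 1"
  obtain e \<beta> where e: "e \<in> Units R" and \<beta>: "\<beta> \<in> carrier R"
    and C: "con e \<otimes>\<^bsub>P\<^esub> ?T \<oplus>\<^bsub>P\<^esub> con \<beta> \<in> D_constants"
    unfolding D_constants_eq by (rule polynomial_higher_derivation.constant_coordinate[OF polynomial_higher_derivation]) blast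
  have eR: "e \<in> carrier R" "inv e \<in> carrier R" "inv e \<otimes> e = \<one>" using e by (auto simp: Units_closed)
  let ?k = "con e \<otimes>\<^bsub>P\<^esub> ?T \<oplus>\<^bsub>P\<^esub> con \<beta>"
  define c where "c = \<ominus> (inv e \<otimes> \<beta>)"
  have cR: "c \<in> carrier R" using eR \<beta> by (simp add: c_def)
  have kP: "?k \<in> carrier P" using eR \<beta> by simp
  have Tc: "?T \<ominus>\<^bsub>P\<^esub> con c = con (inv e) \<otimes>\<^bsub>P\<^esub> ?k"
  proof -
    have "con (inv e) \<otimes>\<^bsub>P\<^esub> ?k = con (inv e \<otimes> e) \<otimes>\<^bsub>P\<^esub> ?T \<oplus>\<^bsub>P\<^esub> con (inv e \<otimes> \<beta>)"
      using eR(1,2) \<beta> by (simp add: UP.P.r_distr UP.P.m_assoc)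
    then show ?thesis using eR \<beta> by (simp add: c_def a_minus_def)
  qed
  have ie: "con (inv e) \<in> Units P"
  proof -
    have "con (inv e) \<otimes>\<^bsub>P\<^esub> con e = \<one>\<^bsub>P\<^esub>" using eR by (simp flip: con.hom_mult)
    then show ?thesis unfolding Units_def using eR UP.P.m_comm[of "con (inv e)" "con e"] by auto
  qed
  have "coeff P ?k 1 = e" using eR \<beta> by (simp add: UP.monom_mult_is_smult del: UP.coeff_mult)
  moreover have "e \<noteq> \<zero>" using eR one_not_zero by auto
  ultimately have "?k \<noteq> \<zero>\<^bsub>P\<^esub>" by (metis UP.coeff_zero)
  then have kU: "E ?k \<in> Units L" by (rule E_unit[OF kP])
  have "L.ld (E (?T \<ominus>\<^bsub>P\<^esub> con c)) = L.ld (E (con (inv e)) \<otimes>\<^bsub>L\<^esub> E ?k)"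
    unfolding Tc using kP eR by (simp only: E.hom_mult con.hom_closed)
  also have "\<dots> = L.ld (E (con (inv e))) \<otimes>\<^bsub>L.TL\<^esub> L.ld (E ?k)"
    by (rule L.log_deriv_mult[OF E_unit_unit[OF ie] kU])
  also have "L.ld (E ?k) = \<one>\<^bsub>L.TL\<^esub>"
    using C by (intro L.log_deriv_const[OF kU]) (simp only: D_constants_def mem_Collect_eq)
  also have "L.ld (E (con (inv e))) \<otimes>\<^bsub>L.TL\<^esub> \<one>\<^bsub>L.TL\<^esub> = L.ld (E (con (inv e)))"
    using L.log_deriv_unit[OF E_unit_unit[OF ie]] L.TL.Units_closed by simp
  finally show ?thesis using that[OF cR] ie by (auto simp: unit_log_derivs_def)
qed

end

lemma generated_by_trivial:
  assumes "group Q" and "carrier Q = {x}"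
  shows "generated_by Q x"
proof -
  interpret group Q by fact
  have "generate Q {x} = {x}"
    using generate_incl[of "{x}"] generate.incl[of x "{x}" Q] assms(2) by auto
  then have g: "generate Q {x} = carrier Q" by (simp only: assms(2))
  have "subgroup_generated Q {x} = Q\<lparr>carrier := generate Q {x}\<rparr>"
    unfolding subgroup_generated_def assms(2) by simp
  then have "subgroup_generated Q {x} = Q" unfolding g by simp
  then show ?thesis using assms(2) by (simp add: generated_by_def)
qed

lemma quotient_by_carrier:
  assumes "group G"
  shows "group (G Mod carrier G)" and "carrier (G Mod carrier G) = {carrier G}"
    and "x \<in> carrier G \<Longrightarrow> carrier G #>\<^bsub>G\<^esub> x = carrier G"
proof -
  interpret group G by fact
  show "group (G Mod carrier G)" by (rule normal.factorgroup_is_group[OF normal_self])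
  show co: "carrier G #>\<^bsub>G\<^esub> x = carrier G" if "x \<in> carrier G" for x
    by (rule coset_join2[OF that subgroup_self that])
  show "carrier (G Mod carrier G) = {carrier G}"
    using co one_closed by (auto simp: FactGroup_def RCOSETS_def)
qed

lemma (in log_derivative_setting) quotient_trivial:
  assumes G: "G = (units_of L.TL)\<lparr>carrier := integral_log_derivs\<rparr>" and Q: "Q = G Mod unit_log_derivs"
  shows "group Q \<and> finite (carrier Q) \<and> cyclic_group Q \<and>
    (\<forall>x\<in>carrier Q. x [^]\<^bsub>Q\<^esub> (N :: nat) = \<one>\<^bsub>Q\<^esub>) \<and>
    (\<forall>X\<in>integral_log_derivs. generated_by Q (unit_log_derivs #>\<^bsub>G\<^esub> X))"
proof -
  have gG: "group G"
    unfolding G integral_log_derivs_eq by (rule subgroup.subgroup_is_group[OF unit_log_derivs_subgroup L.TL.units_group])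
  have cG: "carrier G = unit_log_derivs" by (simp add: G integral_log_derivs_eq)
  have gQ: "group Q" and cQ: "carrier Q = {unit_log_derivs}"
    using quotient_by_carrier(1,2)[OF gG] by (simp_all add: Q cG)
  interpret Q: group Q by (rule gQ)
  have one: "\<one>\<^bsub>Q\<^esub> = unit_log_derivs" using Q.one_closed by (simp add: cQ)
  have gen: "generated_by Q unit_log_derivs" by (rule generated_by_trivial[OF gQ cQ])
  have "x [^]\<^bsub>Q\<^esub> N = \<one>\<^bsub>Q\<^esub>" if "x \<in> carrier Q" for x
    using that Q.nat_pow_closed[OF that, of N] by (simp add: cQ one)
  moreover have "generated_by Q (unit_log_derivs #>\<^bsub>G\<^esub> X)" if "X \<in> integral_log_derivs" for X
    using quotient_by_carrier(3)[OF gG, of X] that gen by (simp add: cG integral_log_derivs_eq)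
  moreover have "cyclic_group Q" using gen by (auto simp: cyclic_group_def generated_by_def)
  ultimately show ?thesis using gQ cQ by simp
qed

section \<open>Forms of a disc\<close>

lemma (in valued_field) v_pow: "x \<in> carrier R \<Longrightarrow> v (x [^] (i::nat)) = v x ^ i"
  by (induction i) (simp_all add: v_one v_props)

lemma (in valued_field) symb_pow:
  "x \<in> carrier R \<Longrightarrow> x \<noteq> \<zero> \<Longrightarrow> symb R v (v x) x [^]\<^bsub>gr\<^esub> (i::nat) = symb R v (v x ^ i) (x [^] i)"
proof (induction i)
  case 0
  then show ?case by (simp add: symb_one)
next
  case (Suc i)
  then show ?case
    using v_pos[of x] symb_mult[of "v x ^ i" "x [^] i" "v x" x] by (simp add: v_pow mult.commute)
qed

text \<open>Divide by the last power of the uniformizer that is at least as large as \<open>x\<close>. A quotient of value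
  less than one would have at most the value of the uniformizer, which makes the next power large enough.\<close>

lemma (in valued_field) value_uniformizer_power:
  assumes \<pi>: "uniformizer R v \<pi>" and x: "x \<in> carrier R" "x \<noteq> \<zero>" "v x \<le> 1"
  obtains i :: nat where "v x = v \<pi> ^ i"
proof -
  have \<pi>c: "\<pi> \<in> carrier R" "0 < v \<pi>" "v \<pi> < 1" and max: "\<And>y. y \<in> carrier R \<Longrightarrow> v y < 1 \<Longrightarrow> v y \<le> v \<pi>"
    using \<pi> by (auto simp: uniformizer_def)
  have vx: "0 < v x" using x by (intro v_pos)
  define n where "n = (LEAST n. v \<pi> ^ n < v x)"
  have ex: "\<exists>n. v \<pi> ^ n < v x" by (rule real_arch_pow_inv[OF vx \<pi>c(3)])
  have n: "v \<pi> ^ n < v x" unfolding n_def by (rule LeastI_ex[OF ex])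
  have "n \<noteq> 0" using n x(3) by (cases n) auto
  then obtain i where i: "n = Suc i" by (cases n) auto
  have up: "v x \<le> v \<pi> ^ i"
    using not_less_Least[of i "\<lambda>n. v \<pi> ^ n < v x"] i by (simp add: n_def[symmetric] not_less)
  have pi: "\<pi> [^] i \<in> carrier R" "v (\<pi> [^] i) = v \<pi> ^ i" using \<pi>c by (simp_all add: v_pow)
  have pn: "\<pi> [^] i \<noteq> \<zero>" using v_props(2)[OF pi(1)] pi(2) \<pi>c by auto
  have iv: "inv (\<pi> [^] i) \<in> carrier R" "v (inv (\<pi> [^] i)) = 1 / v \<pi> ^ i" using v_inv[OF pi(1) pn] pi by auto
  define b where "b = x \<otimes> inv (\<pi> [^] i)"
  have b: "b \<in> carrier R" "v b = v x / v \<pi> ^ i" using x iv by (simp_all add: b_def v_props)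
  have "\<not> v b < 1"
  proof
    assume "v b < 1"
    then have "v x / v \<pi> ^ i \<le> v \<pi>" using max[OF b(1)] b(2) by simp
    then have "v x \<le> v \<pi> * v \<pi> ^ i" using \<pi>c by (simp add: pos_divide_le_eq)
    then show False using n i by simp
  qed
  then have "v \<pi> ^ i \<le> v x" using b(2) \<pi>c by (simp add: not_less pos_le_divide_eq)
  then show ?thesis using that[of i] up by simp
qed

text \<open>Multiplying by a power of the uniformizer leads to degree one, where all homogeneous elements come
  from \<open>k\<close>.\<close>

lemma (in totally_ramified_extension) uniformizer_decomposition:
  assumes \<pi>: "uniformizer l v \<pi>"
    and h: "0 < \<gamma>" "h \<in> carrier lt" "l.gr_component \<gamma> h = h" "h \<noteq> \<zero>\<^bsub>lt\<^esub>"
  shows "\<exists>i::nat. \<exists>c\<in>carrier kt. h = symb l v (v \<pi>) \<pi> [^]\<^bsub>lt\<^esub> i \<otimes>\<^bsub>lt\<^esub> \<iota> c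
    \<or> h \<otimes>\<^bsub>lt\<^esub> symb l v (v \<pi>) \<pi> [^]\<^bsub>lt\<^esub> i = \<iota> c"
proof -
  have \<pi>c: "\<pi> \<in> carrier l" "0 < v \<pi>" "v \<pi> < 1" using \<pi> by (auto simp: uniformizer_def)
  then have \<pi>n: "\<pi> \<noteq> \<zero>\<^bsub>l\<^esub>" using l.w_zero by auto
  have pp: "\<pi> [^]\<^bsub>l\<^esub> i \<in> carrier l" "v (\<pi> [^]\<^bsub>l\<^esub> i) = v \<pi> ^ i" "0 < v \<pi> ^ i" for i :: nat
    using \<pi>c by (simp_all add: l.v_pow)
  obtain a where a: "a \<in> carrier l" "a \<noteq> \<zero>\<^bsub>l\<^esub>" "v a = \<gamma>" "h = symb l v \<gamma> a"
    using l.homogeneous_symb[OF h(2-4,1)] by blast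
  show ?thesis
  proof (cases "v a \<le> 1")
    case True
    obtain i :: nat where i: "v a = v \<pi> ^ i" using l.value_uniformizer_power[OF \<pi> a(1,2) True] .
    have pn: "\<pi> [^]\<^bsub>l\<^esub> i \<noteq> \<zero>\<^bsub>l\<^esub>"
    proof
      assume "\<pi> [^]\<^bsub>l\<^esub> i = \<zero>\<^bsub>l\<^esub>"
      then have "v (\<pi> [^]\<^bsub>l\<^esub> i) = 0" using l.w_zero by simp
      then show False using pp(3)[of i] unfolding pp(2)[symmetric] by simp
    qed
    have iv: "inv\<^bsub>l\<^esub> (\<pi> [^]\<^bsub>l\<^esub> i) \<in> carrier l" "v (inv\<^bsub>l\<^esub> (\<pi> [^]\<^bsub>l\<^esub> i)) = 1 / v \<pi> ^ i"
      using l.v_inv[OF pp(1) pn] pp[of i] by auto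
    define b where "b = inv\<^bsub>l\<^esub> (\<pi> [^]\<^bsub>l\<^esub> i) \<otimes>\<^bsub>l\<^esub> a"
    have b: "b \<in> carrier l" "v b = 1" using iv a i pp(3)[of i] by (simp_all add: b_def l.v_props)
    have pb: "\<pi> [^]\<^bsub>l\<^esub> i \<otimes>\<^bsub>l\<^esub> b = a"
      using pp(1)[of i] pn a iv by (simp add: b_def l.m_assoc[symmetric] l.field_Units)
    obtain c where c: "c \<in> carrier k" "v c \<le> 1" "symb l v 1 b = \<iota> (symb k v 1 c)"
      using unit_degree_image[OF b] .
    have "h = symb l v (v \<pi> ^ i) (\<pi> [^]\<^bsub>l\<^esub> i) \<otimes>\<^bsub>lt\<^esub> symb l v 1 b"
      using l.symb_mult[of "v \<pi> ^ i" "\<pi> [^]\<^bsub>l\<^esub> i" 1 b] pp[of i] b pb a i by simp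
    then have "h = symb l v (v \<pi>) \<pi> [^]\<^bsub>lt\<^esub> i \<otimes>\<^bsub>lt\<^esub> \<iota> (symb k v 1 c)"
      by (simp add: l.symb_pow[OF \<pi>c(1) \<pi>n] c(3))
    then show ?thesis using k.symb_closed[of 1 c] c by auto
  next
    case False
    have ia: "inv\<^bsub>l\<^esub> a \<in> carrier l" "inv\<^bsub>l\<^esub> a \<noteq> \<zero>\<^bsub>l\<^esub>" "v (inv\<^bsub>l\<^esub> a) = 1 / v a"
      using l.v_inv[OF a(1,2)] by auto
    then have "v (inv\<^bsub>l\<^esub> a) \<le> 1" using False by simp
    then obtain i :: nat where i: "v (inv\<^bsub>l\<^esub> a) = v \<pi> ^ i" using l.value_uniformizer_power[OF \<pi> ia(1,2)] by blast
    define b where "b = a \<otimes>\<^bsub>l\<^esub> \<pi> [^]\<^bsub>l\<^esub> i"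
    have gi: "\<gamma> * v \<pi> ^ i = 1" using i ia a h(1) by (simp flip: i)
    have b: "b \<in> carrier l" "v b = 1" using a pp[of i] gi by (simp_all add: b_def l.v_props)
    obtain c where c: "c \<in> carrier k" "v c \<le> 1" "symb l v 1 b = \<iota> (symb k v 1 c)"
      using unit_degree_image[OF b] .
    have "h \<otimes>\<^bsub>lt\<^esub> symb l v (v \<pi> ^ i) (\<pi> [^]\<^bsub>l\<^esub> i) = symb l v 1 b"
      using l.symb_mult[of \<gamma> a "v \<pi> ^ i" "\<pi> [^]\<^bsub>l\<^esub> i"] pp[of i] a h(1) gi by (simp add: b_def)
    then have "h \<otimes>\<^bsub>lt\<^esub> symb l v (v \<pi>) \<pi> [^]\<^bsub>lt\<^esub> i = \<iota> (symb k v 1 c)"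
      by (simp add: l.symb_pow[OF \<pi>c(1) \<pi>n] c(3))
    then show ?thesis using k.symb_closed[of 1 c] c by auto
  qed
qed

text \<open>Representatives agree up to exponent \<open>m\<close>, so the set in the definition of \<^const>\<open>deg_T\<close> has only one
  element.\<close>

lemma deg_T_bound:
  fixes R :: "('a, 'm) ring_scheme" and S :: "(nat \<Rightarrow> 'a, 'n) ring_scheme"
  assumes S: "cring S" and W: "W \<in> carrier (trunc_poly S m)" and j: "j \<le> m"
  shows "deg R (tcoeff j W) \<le> deg_T R m W"
proof -
  interpret S: cring S by fact
  obtain f where f: "f \<in> carrier (UP S)" "W = trunc_class S m f" using W by (rule S.trunc_polyE)
  let ?d = "\<lambda>f. Max ((\<lambda>j. deg R (f j)) ` {..m})"
  have eq: "?d g = ?d f" if "g \<in> W" for g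
  proof -
    have "g j = f j" if "j \<le> m" for j using \<open>g \<in> W\<close> that f by (simp add: S.trunc_class_eq)
    then have "(\<lambda>j. deg R (g j)) ` {..m} = (\<lambda>j. deg R (f j)) ` {..m}" by (intro image_cong) auto
    then show ?thesis by simp
  qed
  have fW: "f \<in> W" using f by (simp add: S.trunc_class_eq)
  have "?d ` W = (\<lambda>_. ?d f) ` W" by (rule image_cong[OF refl eq])
  also have "\<dots> = {?d f}" by (rule image_constant[OF fW])
  finally have "?d ` W = {?d f}" .
  then have "deg_T R m W = ?d f" by (simp add: deg_T_def)
  moreover have "deg R (f j) \<le> ?d f" using j by (intro Max_ge) auto
  ultimately show ?thesis using f j by (simp add: S.tcoeff_trunc_class)
qed

theorem proposition6p3:
  fixes k l :: "'a ring" and v :: "'a \<Rightarrow> real" and p n :: nat and r :: real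
    and A :: "'b ring" and \<alpha> :: "'a \<Rightarrow> 'b" and N :: "'b \<Rightarrow> real"
    and F :: "'f ring" and gF :: "real \<Rightarrow> 'f set" and \<iota>F :: "(real \<Rightarrow> 'a) set \<Rightarrow> 'f"
  assumes ext: "field_extension k l"
    and abs: "nonarch_abs l v"
    and k_complete: "norm_complete k v"
    and k_discrete: "nontrivial_discrete k v"
    and char: "residue_char k v p"
    and wild: "wildly_ramified k l v p"
    and total: "totally_ramified k l v"
    and r: "r \<in> sqrt_value_group k v"
    and form: "is_form k l v r A \<alpha> N"
    \<comment> \<open>the graded reductions of k, l and A, and the maps between them\<close>
    and kt: "kt = graded_reduction k v"
    and lt: "lt = graded_reduction l v"
    and At: "At = graded_reduction A (spectral_seminorm A N)"
    and ktl: "\<iota>l = gr_map l v (\<lambda>c. c)"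
    and ktA: "\<iota>A = gr_map A (spectral_seminorm A N) \<alpha>"
    and degree: "ring.dimension l (p ^ n) (carrier k) (carrier l)"
    and gr_degree: "graded_degree kt lt (gr_part l v) \<iota>l (p ^ n)"
    and closure: "graded_algebraic_closure kt (gr_part k v) F gF \<iota>F"
    and geom_reduced: "reduced_ring (tensor kt F At \<iota>F \<iota>A)"
    \<comment> \<open>the fixed identification of the tensor product of At and lt with B = lt[T]\<close>
    and B: "B = UP lt"
    and iso: "\<Phi> \<in> ring_iso (tensor kt At lt \<iota>A \<iota>l) B"
    and iso_algebra: "\<forall>y\<in>carrier lt. \<Phi> (tens kt At lt \<iota>A \<iota>l \<one>\<^bsub>At\<^esub> y) = monom B y 0"
    and unif: "uniformizer l v \<pi>"
    and t: "t = symb l v (v \<pi>) \<pi>"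
    and m: "m = p ^ n - 1"
    \<comment> \<open>the fraction fields and the embeddings of K' into K, of K into L and of L' into L\<close>
    and K': "K' = Frac kt" and K: "K = Frac lt" and L': "L' = Frac At" and L: "L = Frac B"
    and \<iota>K'K: "\<iota>K'K = Frac_map lt \<iota>l"
    and \<iota>KL: "\<iota>KL = Frac_map B (\<lambda>y. monom B y 0)"
    and \<iota>L'L: "\<iota>L'L = Frac_map B (\<lambda>a. \<Phi> (tens kt At lt \<iota>A \<iota>l a \<one>\<^bsub>lt\<^esub>))"
    \<comment> \<open>the standard higher derivation of K over K', and its extension to L\<close>
    and d_hom: "d \<in> ring_hom K (trunc_poly K m)"
    and d_const: "\<forall>c\<in>carrier K'. d (\<iota>K'K c) = trunc_const K m (\<iota>K'K c)"
    and d_t: "d (to_Frac lt t) = trunc_const K m (to_Frac lt t) \<oplus>\<^bsub>trunc_poly K m\<^esub> trunc_var K m"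
    and dL_hom: "dL \<in> ring_hom L (trunc_poly L m)"
    and dL_tensor: "\<forall>x\<in>carrier L'. \<forall>y\<in>carrier K.
        dL (\<iota>L'L x \<otimes>\<^bsub>L\<^esub> \<iota>KL y) =
          trunc_const L m (\<iota>L'L x) \<otimes>\<^bsub>trunc_poly L m\<^esub> trunc_map L m \<iota>KL (d y)"
    and T: "T = monom B \<one>\<^bsub>lt\<^esub> 1"
    and deg_one: "\<exists>W\<in>carrier (trunc_poly B m).
        trunc_map L m (to_Frac B) W = dL (to_Frac B T) \<and> deg_T lt m W = 1"
    \<comment> \<open>the subgroups of the unit group of L[S]/(S^(m+1)), and the quotient group Q\<close>
    and LL: "LL = log_deriv L m dL ` Units L"
    and LB: "LB = LL \<inter> trunc_map L m (to_Frac B) ` Units (trunc_poly B m)"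
    and LB': "LB' = (\<lambda>u. log_deriv L m dL (to_Frac B u)) ` Units B"
    and G: "G = (units_of (trunc_poly L m))\<lparr>carrier := LB\<rparr>"
    and Q: "Q = G Mod LB'"
  shows "group Q \<and> finite (carrier Q) \<and> cyclic_group Q \<and>
         (\<forall>x\<in>carrier Q. x [^]\<^bsub>Q\<^esub> (p ^ n) = \<one>\<^bsub>Q\<^esub>) \<and>
         (log_deriv L m dL (to_Frac B T) \<in> LB \<longrightarrow>
            generated_by Q (LB' #>\<^bsub>G\<^esub> log_deriv L m dL (to_Frac B T))) \<and>
         (\<exists>c\<in>carrier lt.
            log_deriv L m dL (to_Frac B (T \<ominus>\<^bsub>B\<^esub> monom B c 0)) \<in> LB \<and>
            generated_by Q (LB' #>\<^bsub>G\<^esub> log_deriv L m dL (to_Frac B (T \<ominus>\<^bsub>B\<^esub> monom B c 0))))"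
proof -
  interpret X: totally_ramified_extension k l v
    by (intro totally_ramified_extension.intro ext abs total)
  have aff: "affinoid_algebra k v A \<alpha> N" using form by (simp add: is_form_def)
  have A: "cring A" "\<alpha> \<in> ring_hom k A" "nonarch_norm A N" using aff by (simp_all add: affinoid_algebra_def)
  have sA: "seminormed_cring A (spectral_seminorm A N)"
    by (rule normed_cring.spectral_seminormed[OF normed_cring.intro[OF A(1) normed_cring_axioms.intro[OF A(3)]]])
  have kt_cring: "cring kt" and lt_cring: "cring lt" and At_cring: "cring At"
    unfolding kt lt At using X.kt.is_cring X.lt.is_cring seminormed_cring.gr_cring[OF sA] by auto
  have \<iota>l_hom: "\<iota>l \<in> ring_hom kt lt" unfolding kt lt ktl by (rule X.iota_hom)
  have \<iota>A_hom: "\<iota>A \<in> ring_hom kt At"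
    unfolding kt At ktA
    using affinoid_spectral_const[OF X.k.valued_field_axioms aff]
    by (intro gr_map_hom[OF X.k.seminormed_cring_axioms sA A(2)]) blast
  interpret TP: tensor_product kt At lt \<iota>A \<iota>l
    by (intro tensor_product.intro ring_hom_cring.intro ring_hom_cring_axioms.intro
        kt_cring lt_cring At_cring \<iota>l_hom \<iota>A_hom)
  let ?TP = "tensor kt At lt \<iota>A \<iota>l" and ?tn = "tens kt At lt \<iota>A \<iota>l"
  define hc where "hc = X.l.gr_component"
  have gf: "graded_field_ring lt hc" unfolding lt hc_def by (rule X.lt.graded_field_ring_axioms)
  interpret R: graded_field_ring lt hc by (rule gf)
  have lt_domain: "domain lt" by (rule R.is_domain)
  interpret UP: UP_domain lt "UP lt"
    using lt_domain by (intro UP_domain.intro) (auto simp: UP_cring_def lt_cring)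
  have B_domain: "domain (UP lt)" by (rule UP.UP_domain)
  have B_cring: "cring (UP lt)" by (rule UP.UP_cring)
  let ?con = "\<lambda>y. monom (UP lt) y 0" and ?E = "to_Frac (UP lt)"
  have con_hom: "?con \<in> ring_hom lt (UP lt)" by (rule UP.const_ring_hom)
  have con_inj: "inj_on ?con (carrier lt)" by (rule UP.monom_inj)
  have E_hom: "?E \<in> ring_hom (UP lt) (Frac (UP lt))" by (rule domain.to_Frac_hom[OF B_domain])
  have L_field: "field (Frac (UP lt))" by (rule domain.Frac_field[OF B_domain])
  have \<Phi>_hom: "\<Phi> \<in> ring_hom ?TP (UP lt)" and \<Phi>_bij: "bij_betw \<Phi> (carrier ?TP) (carrier (UP lt))"
    using iso unfolding B by (auto simp: ring_iso_def)
  interpret \<Phi>: ring_hom_cring ?TP "UP lt" \<Phi>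
    by (intro ring_hom_cring.intro ring_hom_cring_axioms.intro TP.tensor_cring B_cring \<Phi>_hom)
  define g where "g a = \<Phi> (?tn a \<one>\<^bsub>lt\<^esub>)" for a
  have g_hom: "g \<in> ring_hom At (UP lt)"
    unfolding g_def using ring_hom_trans[OF TP.tens_left_hom \<Phi>_hom] by (simp add: o_def)
  have g_inj: "inj_on g (carrier At)"
  proof -
    obtain retr where retr: "\<And>y. y \<in> carrier lt \<Longrightarrow> retr y \<in> carrier kt" "retr \<one>\<^bsub>lt\<^esub> = \<one>\<^bsub>kt\<^esub>"
      "\<And>x y. x \<in> carrier lt \<Longrightarrow> y \<in> carrier lt \<Longrightarrow> retr (x \<oplus>\<^bsub>lt\<^esub> y) = retr x \<oplus>\<^bsub>kt\<^esub> retr y"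
      "\<And>c y. c \<in> carrier kt \<Longrightarrow> y \<in> carrier lt \<Longrightarrow> retr (\<iota>l c \<otimes>\<^bsub>lt\<^esub> y) = c \<otimes>\<^bsub>kt\<^esub> retr y"
      unfolding kt lt ktl by (rule X.linear_retraction) blast
    have 1: "inj_on (\<lambda>x. ?tn x \<one>\<^bsub>lt\<^esub>) (carrier At)"
      by (rule TP.tens_left_inj[of retr]) (use retr in auto)
    have 2: "inj_on \<Phi> ((\<lambda>x. ?tn x \<one>\<^bsub>lt\<^esub>) ` carrier At)"
      by (rule inj_on_subset[OF bij_betw_imp_inj_on[OF \<Phi>_bij]]) (auto intro: TP.tens_closed)
    show ?thesis using comp_inj_on[OF 1 2] by (simp add: g_def[abs_def] o_def)
  qed
  interpret g: ring_hom_cring At "UP lt" g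
    by (intro ring_hom_cring.intro ring_hom_cring_axioms.intro At_cring B_cring g_hom)
  \<comment> \<open>so that \<open>At\<close> has a field of fractions, which embeds into that of \<open>lt[T]\<close>\<close>
  have At_domain: "domain At"
  proof (rule domainI[OF At_cring])
    show "\<one>\<^bsub>At\<^esub> \<noteq> \<zero>\<^bsub>At\<^esub>"
      using g.hom_one g.hom_zero domain.one_not_zero[OF B_domain] by metis
    fix a b assume ab: "a \<otimes>\<^bsub>At\<^esub> b = \<zero>\<^bsub>At\<^esub>" "a \<in> carrier At" "b \<in> carrier At"
    then have "g a \<otimes>\<^bsub>UP lt\<^esub> g b = \<zero>\<^bsub>UP lt\<^esub>" by (simp flip: g.hom_mult)
    then have "g a = g \<zero>\<^bsub>At\<^esub> \<or> g b = g \<zero>\<^bsub>At\<^esub>"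
      using domain.integral[OF B_domain] ab by simp
    then show "a = \<zero>\<^bsub>At\<^esub> \<or> b = \<zero>\<^bsub>At\<^esub>" using inj_onD[OF g_inj] ab by blast
  qed
  have K_cring: "cring K" and L'_cring: "cring L'" and L_cring: "cring L"
    unfolding K L' L B using domain.Frac_field[OF lt_domain] domain.Frac_field[OF At_domain] L_field
    by (auto simp: field_def domain_def)
  interpret K: cring K by (rule K_cring)
  interpret L: cring L by (rule L_cring)
  interpret TL: cring "trunc_poly L m" by (rule L.trunc_poly_cring)
  have \<iota>L'L_E: "\<iota>L'L (to_Frac At a) = ?E (g a)" if "a \<in> carrier At" for a
    unfolding \<iota>L'L B using domain.Frac_map_to_Frac[OF At_domain B_domain g_hom g_inj that]
    by (simp add: g_def[abs_def])
  have \<iota>KL_E: "\<iota>KL (to_Frac lt y) = ?E (?con y)" if "y \<in> carrier lt" for y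
    unfolding \<iota>KL B by (rule domain.Frac_map_to_Frac[OF lt_domain B_domain con_hom con_inj that])
  have \<iota>KL_closed: "\<iota>KL x \<in> carrier L" if "x \<in> carrier K" for x
    unfolding \<iota>KL B L using domain.Frac_map_closed[OF lt_domain B_domain con_hom con_inj] that by (simp add: K)
  have K_one: "\<one>\<^bsub>K\<^esub> = to_Frac lt \<one>\<^bsub>lt\<^esub>" and K_zero: "\<zero>\<^bsub>K\<^esub> = to_Frac lt \<zero>\<^bsub>lt\<^esub>"
    unfolding K by (simp_all add: to_Frac_def Frac_def)
  have L_one: "\<one>\<^bsub>L\<^esub> = ?E \<one>\<^bsub>UP lt\<^esub>" and L_zero: "\<zero>\<^bsub>L\<^esub> = ?E \<zero>\<^bsub>UP lt\<^esub>"
    unfolding L B by (simp_all add: to_Frac_def Frac_def)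
  have \<iota>KL_one: "\<iota>KL \<one>\<^bsub>K\<^esub> = \<one>\<^bsub>L\<^esub>" and \<iota>KL_zero: "\<iota>KL \<zero>\<^bsub>K\<^esub> = \<zero>\<^bsub>L\<^esub>"
    unfolding K_one K_zero L_one L_zero by (simp_all add: \<iota>KL_E)
  have EL: "?E x \<in> carrier L" if "x \<in> carrier (UP lt)" for x
    unfolding L B using ring_hom_closed[OF E_hom that] .
  have tmap: "trunc_map L m \<iota>KL X \<in> carrier (trunc_poly L m)"
    "j \<le> m \<Longrightarrow> tcoeff j (trunc_map L m \<iota>KL X) = \<iota>KL (tcoeff j X)"
    if X: "X \<in> carrier (trunc_poly K m)" for X j
    using tcoeff_trunc_map[where h = \<iota>KL, OF K_cring L_cring _ \<iota>KL_zero X] \<iota>KL_closed by blast+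
  have d_one: "trunc_map L m \<iota>KL (d \<one>\<^bsub>K\<^esub>) = \<one>\<^bsub>trunc_poly L m\<^esub>"
  proof -
    interpret TK: cring "trunc_poly K m" by (rule K.trunc_poly_cring)
    have "d \<one>\<^bsub>K\<^esub> = \<one>\<^bsub>trunc_poly K m\<^esub>" by (rule ring_hom_one[OF d_hom])
    then show ?thesis
      using L.trunc_poly_eqI[OF tmap(1)[OF TK.one_closed] TL.one_closed]
      by (simp add: tmap(2)[OF TK.one_closed] K.tcoeff_one L.tcoeff_one \<iota>KL_one \<iota>KL_zero)
  qed
  have dL_g: "dL (?E (g a)) = trunc_const L m (?E (g a))" if a: "a \<in> carrier At" for a
  proof -
    have aL: "to_Frac At a \<in> carrier L'"
      unfolding L' by (rule ring_hom_closed[OF domain.to_Frac_hom[OF At_domain] a])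
    have "g a \<in> carrier (UP lt)" using a by simp
    then show ?thesis
      using dL_tensor[rule_format, OF aL K.one_closed] EL[of "g a"]
      by (simp add: \<iota>L'L_E[OF a] \<iota>KL_one d_one L.trunc_const_closed)
  qed
  have \<pi>: "\<pi> \<in> carrier l" "0 < v \<pi>" using unif by (auto simp: uniformizer_def)
  have t_carrier: "t \<in> carrier lt" unfolding t lt by (rule X.l.symb_closed) (use \<pi> in auto)
  have t_nonzero: "t \<noteq> \<zero>\<^bsub>lt\<^esub>" unfolding t lt using X.l.symb_eq_zero_iff[of "v \<pi>" \<pi>] \<pi> by simp
  have t_degree: "hc (v \<pi>) t = t" unfolding t hc_def using X.l.gr_component_symb[of "v \<pi>" \<pi>] \<pi> by simp
  have dL_t: "dL (?E (?con t)) = trunc_const L m (?E (?con t)) \<oplus>\<^bsub>trunc_poly L m\<^esub> trunc_var L m"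
  proof -
    have tK: "to_Frac lt t \<in> carrier K"
      unfolding K by (rule ring_hom_closed[OF domain.to_Frac_hom[OF lt_domain] t_carrier])
    have 1: "\<iota>L'L (to_Frac At \<one>\<^bsub>At\<^esub>) = \<one>\<^bsub>L\<^esub>" by (simp add: \<iota>L'L_E L_one)
    have oneL': "to_Frac At \<one>\<^bsub>At\<^esub> \<in> carrier L'"
      unfolding L' by (rule ring_hom_closed[OF domain.to_Frac_hom[OF At_domain]]) simp
    have Et: "?E (?con t) \<in> carrier L" using EL t_carrier by simp
    have dt: "d (to_Frac lt t) \<in> carrier (trunc_poly K m)" by (rule ring_hom_closed[OF d_hom tK])
    have tr: "trunc_map L m \<iota>KL (d (to_Frac lt t)) \<in> carrier (trunc_poly L m)" by (rule tmap(1)[OF dt])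
    have "trunc_map L m \<iota>KL (d (to_Frac lt t)) = trunc_const L m (?E (?con t)) \<oplus>\<^bsub>trunc_poly L m\<^esub> trunc_var L m"
    proof (rule L.trunc_poly_eqI[OF tr])
      show "trunc_const L m (?E (?con t)) \<oplus>\<^bsub>trunc_poly L m\<^esub> trunc_var L m \<in> carrier (trunc_poly L m)"
        using Et by (simp add: L.trunc_const_closed L.trunc_var_closed)
      fix j assume j: "j \<le> m"
      have "tcoeff j (d (to_Frac lt t)) = (if j = 0 then to_Frac lt t else if j = 1 then \<one>\<^bsub>K\<^esub> else \<zero>\<^bsub>K\<^esub>)"
        unfolding d_t using tK j
        by (simp add: K.tcoeff_add K.trunc_const_closed K.trunc_var_closed K.tcoeff_const K.tcoeff_var)
      then show "tcoeff j (trunc_map L m \<iota>KL (d (to_Frac lt t)))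
        = tcoeff j (trunc_const L m (?E (?con t)) \<oplus>\<^bsub>trunc_poly L m\<^esub> trunc_var L m)"
        using Et j
        by (simp add: tmap(2)[OF dt j] \<iota>KL_E[OF t_carrier] \<iota>KL_one \<iota>KL_zero
            L.tcoeff_add L.trunc_const_closed L.trunc_var_closed L.tcoeff_const L.tcoeff_var)
    qed
    moreover have "trunc_const L m \<one>\<^bsub>L\<^esub> = \<one>\<^bsub>trunc_poly L m\<^esub>" by (simp add: L.trunc_one)
    ultimately show ?thesis
      using dL_tensor[rule_format, OF oneL' tK] Et tr by (simp add: 1 \<iota>KL_E[OF t_carrier])
  qed
  \<comment> \<open>elements of the base can be moved across the tensor sign\<close>
  have con_g: "?con (\<iota>l c) \<in> g ` carrier At" if c: "c \<in> carrier kt" for c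
  proof -
    have cA: "\<iota>A c \<in> carrier At" "\<iota>l c \<in> carrier lt" using c ring_hom_closed[OF \<iota>A_hom] ring_hom_closed[OF \<iota>l_hom] by auto
    have "?con (\<iota>l c) = \<Phi> (?tn \<one>\<^bsub>At\<^esub> (\<iota>l c))" using iso_algebra cA B by simp
    also have "?tn \<one>\<^bsub>At\<^esub> (\<iota>l c) = ?tn (\<iota>A c) \<one>\<^bsub>lt\<^esub>"
      using TP.tens_balanced[of "\<one>\<^bsub>At\<^esub>" c "\<one>\<^bsub>lt\<^esub>"] cA c by simp
    finally show ?thesis using cA by (simp add: g_def)
  qed
  have "prime p" using char by (simp add: residue_char_def)
  have kt_char: "[p] \<cdot>\<^bsub>kt\<^esub> \<one>\<^bsub>kt\<^esub> = \<zero>\<^bsub>kt\<^esub>"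
    using char unfolding residue_char_def kt Let_def by (simp add: add_pow_def nat_pow_def)
  have lt_char: "[p] \<cdot>\<^bsub>lt\<^esub> \<one>\<^bsub>lt\<^esub> = \<zero>\<^bsub>lt\<^esub>"
    by (rule hom_nat_multiple_one[OF kt_cring lt_cring \<iota>l_hom kt_char])
  have "0 < p ^ n" using prime_gt_0_nat[OF \<open>prime p\<close>] by simp
  then have Sm: "Suc m = p ^ n" using m by simp
  have Phi_tens: "\<Phi> (?tn a r) = ?con r \<otimes>\<^bsub>UP lt\<^esub> g a" if a: "a \<in> carrier At" and r: "r \<in> carrier lt" for a r
  proof -
    have "?tn a r = ?tn \<one>\<^bsub>At\<^esub> r \<otimes>\<^bsub>?TP\<^esub> ?tn a \<one>\<^bsub>lt\<^esub>" using a r by (simp add: TP.tens_mult)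
    then show ?thesis using a r iso_algebra B by (simp add: TP.tens_closed g_def)
  qed
  interpret S: log_derivative_setting lt hc p n m t "v \<pi>" dL "g ` carrier At"
  proof (intro log_derivative_setting.intro log_derivative_setting_axioms.intro gf)
    show "prime p" "[p] \<cdot>\<^bsub>lt\<^esub> \<one>\<^bsub>lt\<^esub> = \<zero>\<^bsub>lt\<^esub>" "Suc m = p ^ n" by fact+
    show "dL \<in> ring_hom (Frac (UP lt)) (trunc_poly (Frac (UP lt)) m)" using dL_hom unfolding L B .
    show "g ` carrier At \<subseteq> carrier (UP lt)" by auto
    show "dL (?E c) = trunc_const (Frac (UP lt)) m (?E c)" if "c \<in> g ` carrier At" for c
      using that dL_g unfolding L B by auto
    show "t \<in> carrier lt" "t \<noteq> \<zero>\<^bsub>lt\<^esub>" "0 < v \<pi>" "hc (v \<pi>) t = t" by fact+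
    show "dL (?E (?con t)) = trunc_const (Frac (UP lt)) m (?E (?con t))
        \<oplus>\<^bsub>trunc_poly (Frac (UP lt)) m\<^esub> trunc_var (Frac (UP lt)) m"
      using dL_t unfolding L B .
  next
    fix Q :: "(nat \<Rightarrow> (real \<Rightarrow> 'a) set) \<Rightarrow> bool" and x
    assume x: "x \<in> carrier (UP lt)" and zero: "Q \<zero>\<^bsub>UP lt\<^esub>"
      and gen: "\<And>r c. r \<in> carrier lt \<Longrightarrow> c \<in> g ` carrier At \<Longrightarrow> Q (?con r \<otimes>\<^bsub>UP lt\<^esub> c)"
      and add: "\<And>x y. x \<in> carrier (UP lt) \<Longrightarrow> y \<in> carrier (UP lt) \<Longrightarrow> Q x \<Longrightarrow> Q y \<Longrightarrow> Q (x \<oplus>\<^bsub>UP lt\<^esub> y)"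
    have "x \<in> \<Phi> ` carrier ?TP" using x bij_betw_imp_surj_on[OF \<Phi>_bij] by simp
    then obtain Y where Y: "Y \<in> carrier ?TP" "x = \<Phi> Y" by blast
    from Y(1) have "Q (\<Phi> Y)"
    proof (induction Y rule: TP.tensor_induct)
      case zero
      then show ?case using \<open>Q \<zero>\<^bsub>UP lt\<^esub>\<close> by simp
    next
      case (tens a r)
      then show ?case using gen by (simp add: Phi_tens)
    next
      case (add X Y)
      then show ?case using \<open>\<And>x y. _ \<Longrightarrow> _ \<Longrightarrow> Q x \<Longrightarrow> Q y \<Longrightarrow> Q (x \<oplus>\<^bsub>UP lt\<^esub> y)\<close>[of "\<Phi> X" "\<Phi> Y"] by simp
    qed
    then show "Q x" using Y(2) by simp
  next
    fix \<gamma> :: real and h assume h: "0 < \<gamma>" "h \<in> carrier lt" "hc \<gamma> h = h" "h \<noteq> \<zero>\<^bsub>lt\<^esub>"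
    obtain i :: nat and c where c: "c \<in> carrier kt"
      "h = t [^]\<^bsub>lt\<^esub> i \<otimes>\<^bsub>lt\<^esub> \<iota>l c \<or> h \<otimes>\<^bsub>lt\<^esub> t [^]\<^bsub>lt\<^esub> i = \<iota>l c"
      using X.uniformizer_decomposition[OF unif h(1) h(2-4)[unfolded lt hc_def]] unfolding t lt kt ktl by blast
    show "\<exists>i::nat. \<exists>c\<in>carrier lt. ?con c \<in> g ` carrier At \<and>
        (h = t [^]\<^bsub>lt\<^esub> i \<otimes>\<^bsub>lt\<^esub> c \<or> h \<otimes>\<^bsub>lt\<^esub> t [^]\<^bsub>lt\<^esub> i = c)"
      using c con_g[OF c(1)] ring_hom_closed[OF \<iota>l_hom c(1)] by blast
  next
    fix j assume j: "j \<le> m"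
    obtain W where W: "W \<in> carrier (trunc_poly (UP lt) m)"
      "trunc_map L m ?E W = dL (?E (monom (UP lt) \<one>\<^bsub>lt\<^esub> 1))" "deg_T lt m W = 1"
      using deg_one unfolding B T by blast
    have Wj: "tcoeff j W \<in> carrier (UP lt)" by (rule cring.tcoeff_closed[OF B_cring W(1) j])
    have "deg lt (tcoeff j W) \<le> 1" using deg_T_bound[OF B_cring W(1) j, of lt] W(3) by simp
    then have "\<forall>i>1. coeff (UP lt) (tcoeff j W) i = \<zero>\<^bsub>lt\<^esub>"
      using Wj by (intro allI impI UP.deg_aboveD) simp_all
    moreover have "?E (tcoeff j W) = tcoeff j (dL (?E (monom (UP lt) \<one>\<^bsub>lt\<^esub> 1)))"
      unfolding W(2)[symmetric]
      using tcoeff_trunc_map(2)[where h = ?E, OF B_cring L_cring _ L_zero[symmetric] W(1) j] EL by simp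
    ultimately show "\<exists>g\<in>carrier (UP lt). (\<forall>i>1. coeff (UP lt) g i = \<zero>\<^bsub>lt\<^esub>) \<and>
        ?E g = tcoeff j (dL (?E (monom (UP lt) \<one>\<^bsub>lt\<^esub> 1)))"
      using Wj by blast
  qed
  have LB_eq: "LB = S.integral_log_derivs" unfolding LB LL S.integral_log_derivs_def L B ..
  have LB'_eq: "LB' = S.unit_log_derivs" unfolding LB' S.unit_log_derivs_def L B ..
  have "G = (units_of (trunc_poly (Frac (UP lt)) m))\<lparr>carrier := S.integral_log_derivs\<rparr>" "Q = G Mod S.unit_log_derivs"
    using G Q unfolding LB_eq LB'_eq L B by auto
  note triv = S.quotient_trivial[OF this, of "p ^ n"]
  obtain c where c: "c \<in> carrier lt"
    "log_deriv L m dL (?E (monom (UP lt) \<one>\<^bsub>lt\<^esub> 1 \<ominus>\<^bsub>UP lt\<^esub> ?con c)) \<in> S.unit_log_derivs"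
    unfolding L B by (rule S.translated_coordinate) blast
  show ?thesis
    using triv c unfolding LB_eq LB'_eq T B S.integral_log_derivs_eq by blast
qed

end
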